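(* Let $N\ge2$, let $b^-<b^+$ be real constants, let $\Omega=\{x\in\mathbb{R}^N : b^-<x_N<b^+\}$, let $m\in\mathbb{N}$ with $m\ge2$, and let $1<p<\infty$. There exists a constant $c=c(m,N,p)>0$ such that for every $u\in\dot{W}^{m,p}(\Omega)$ the following estimates hold: for every $i,l\in\mathbb{N}_0$ with $0\le i+l\le m-1$, $$\int_{\mathbb{R}^{N-1}}\left|\sum_{k=0}^{m-l-i-1}\frac{(-1)^k}{k!}\Big(\nabla_{\parallel}^i\operatorname{Tr}(\partial_N^{k+l}u)(x',b^+)+(-1)^{k+1}\nabla_{\parallel}^i\operatorname{Tr}(\partial_N^{k+l}u)(x',b^-)\Big)\left(\frac{b^+-b^-}{2}\right)^k\right|^pdx'\le(b^+-b^-)^{(m-i-l)p-1}\int_\Omega|\nabla^mu(x)|^p\,dx,$$ and $$\int_{\mathbb{R}^{N-1}}\int_{B'(0,b^+-b^-)}\frac{|\operatorname{Tr}(\nabla^{m-1}u)(x'+h',b^\pm)-\operatorname{Tr}(\nabla^{m-1}u)(x',b^\pm)|^p}{|h'|^{p+N-2}}\,dh'\,dx'\le c\int_\Omega|\nabla^mu(x)|^p\,dx.$$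
   Context: $\mathbb{N}_0=\{0,1,2,\dots\}$; points are written $x=(x',x_N)\in\mathbb{R}^{N-1}\times\mathbb{R}$; $B'(0,r)$ is the open ball in $\mathbb{R}^{N-1}$. $\dot{W}^{m,p}(\Omega)$ is the space of real-valued $u\in L^1_{\mathrm{loc}}(\Omega)$ all of whose weak derivatives of order $m$ belong to $L^p(\Omega)$. $\nabla^k$ denotes the vector of all partial derivatives $\partial^\alpha$ with $|\alpha|=k$, and $\nabla_{\parallel}^k$ the vector of all partial derivatives $\partial^\alpha$ with $\alpha=(\alpha',0)\in\mathbb{N}_0^{N-1}\times\mathbb{N}_0$, $|\alpha|=k$; $\nabla^0u=\nabla_{\parallel}^0u=u$. $\operatorname{Tr}$ is the usual Sobolev boundary trace, applied componentwise to vectors (derivatives of $u$ of order at most $m-1$ are in $W^{1,p}$ of bounded Lipschitz subdomains of $\Omega$, so have traces in $L^p_{\mathrm{loc}}(\partial\Omega)$). For $0\le j\le m-1$ the functions $\operatorname{Tr}(\partial_N^ju)(\cdot,b^\pm)$ belong to $W^{m-1-j,p}_{\mathrm{loc}}(\mathbb{R}^{N-1})$, and $\nabla_{\parallel}^i\operatorname{Tr}(\partial_N^ju)(\cdot,b^\pm)=\operatorname{Tr}(\nabla_{\parallel}^i\partial_N^ju)(\cdot,b^\pm)$ for $i+j\le m-1$. *)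

theory Defs
  imports "HOL-Analysis.Analysis" "HOL-Library.Multiset"
begin

section \<open>Multi-indices and classical partial derivatives\<close>

text \<open>
  A multi-index on a Euclidean space is a multiset \<open>\<alpha>\<close> of coordinate vectors: \<open>count \<alpha> b\<close> is the
  number of differentiations in direction \<open>b\<close>, and the order is \<open>size \<alpha>\<close>. Every \<open>\<partial>\<^sup>\<alpha>\<close> of the given
  order is thus listed exactly once.
\<close>

definition multi_indices :: "nat \<Rightarrow> ('a::euclidean_space) multiset set" where
  "multi_indices k = {\<alpha>. set_mset \<alpha> \<subseteq> Basis \<and> size \<alpha> = k}"

text \<open>\<open>L2_set\<close> is a genuine Euclidean norm only over finite index sets.\<close>

lemma finite_multi_indices: "finite (multi_indices k :: 'a::euclidean_space multiset set)"
proof -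
  have "multi_indices k \<subseteq> mset ` {xs :: 'a list. set xs \<subseteq> Basis \<and> length xs = k}"
  proof
    fix \<alpha> :: "'a multiset"
    assume a: "\<alpha> \<in> multi_indices k"
    obtain xs where "mset xs = \<alpha>"
      using ex_mset by blast
    with a show "\<alpha> \<in> mset ` {xs. set xs \<subseteq> Basis \<and> length xs = k}"
      by (auto simp: multi_indices_def)
  qed
  moreover have "finite (mset ` {xs :: 'a list. set xs \<subseteq> Basis \<and> length xs = k})"
    by (intro finite_imageI finite_lists_length_eq finite_Basis)
  ultimately show ?thesis
    by (rule finite_subset)
qed

fun iter_partial :: "('a::euclidean_space) list \<Rightarrow> ('a \<Rightarrow> real) \<Rightarrow> 'a \<Rightarrow> real" where
  "iter_partial [] f = f"
| "iter_partial (b # bs) f = (\<lambda>x. frechet_derivative (iter_partial bs f) (at x) b)"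

text \<open>
  If all iterated partial derivatives are differentiable, they are all continuous, so this is
  \<open>C\<^sup>\<infinity>\<close> on the whole space.
\<close>

definition smooth_fun :: "(('a::euclidean_space) \<Rightarrow> real) \<Rightarrow> bool" where
  "smooth_fun f \<longleftrightarrow>
     (\<forall>bs. set bs \<subseteq> Basis \<longrightarrow> (\<forall>x. iter_partial bs f differentiable (at x)))"

text \<open>
  Used for smooth functions only, for which the order of differentiation chosen here is immaterial.
\<close>

definition partial :: "('a::euclidean_space) multiset \<Rightarrow> ('a \<Rightarrow> real) \<Rightarrow> 'a \<Rightarrow> real" where
  "partial \<alpha> f = iter_partial (SOME bs. mset bs = \<alpha>) f"

definition test_functions :: "('a::euclidean_space) set \<Rightarrow> ('a \<Rightarrow> real) set" where
  "test_functions \<Omega> =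
     {\<phi>. smooth_fun \<phi> \<and> compact (closure {x. \<phi> x \<noteq> 0}) \<and> closure {x. \<phi> x \<noteq> 0} \<subseteq> \<Omega>}"


section \<open>Weak derivatives and Sobolev spaces\<close>

text \<open>
  Functions on \<open>\<Omega>\<close> are total functions whose values outside \<open>\<Omega>\<close> are irrelevant; measurability is
  Lebesgue measurability.
\<close>

definition locally_integrable :: "('a::euclidean_space) set \<Rightarrow> ('a \<Rightarrow> real) \<Rightarrow> bool" where
  "locally_integrable \<Omega> u \<longleftrightarrow>
     (\<forall>K. compact K \<and> K \<subseteq> \<Omega> \<longrightarrow> u absolutely_integrable_on K)"

definition in_Lp :: "real \<Rightarrow> ('a::euclidean_space) set \<Rightarrow> ('a \<Rightarrow> real) \<Rightarrow> bool" where
  "in_Lp p \<Omega> u \<longleftrightarrow> u \<in> borel_measurable (lebesgue_on \<Omega>) \<and>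
     (\<integral>\<^sup>+x\<in>\<Omega>. ennreal (\<bar>u x\<bar> powr p) \<partial>lebesgue) < \<infinity>"

definition has_weak_deriv ::
    "('a::euclidean_space) set \<Rightarrow> 'a multiset \<Rightarrow> ('a \<Rightarrow> real) \<Rightarrow> ('a \<Rightarrow> real) \<Rightarrow> bool" where
  "has_weak_deriv \<Omega> \<alpha> u g \<longleftrightarrow>
     locally_integrable \<Omega> u \<and> locally_integrable \<Omega> g \<and>
     (\<forall>\<phi>\<in>test_functions \<Omega>.
        (LINT x:\<Omega>|lebesgue. u x * partial \<alpha> \<phi> x) =
        (- 1) ^ size \<alpha> * (LINT x:\<Omega>|lebesgue. g x * \<phi> x))"

text \<open>
  A representative of the weak derivative, which is unique up to null sets; \<open>weak_deriv \<Omega> {#} u\<close>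
  agrees with \<open>u\<close> almost everywhere in \<open>\<Omega>\<close>.
\<close>

definition weak_deriv ::
    "('a::euclidean_space) set \<Rightarrow> 'a multiset \<Rightarrow> ('a \<Rightarrow> real) \<Rightarrow> 'a \<Rightarrow> real" where
  "weak_deriv \<Omega> \<alpha> u = (SOME g. has_weak_deriv \<Omega> \<alpha> u g)"

definition homogeneous_sobolev ::
    "nat \<Rightarrow> real \<Rightarrow> ('a::euclidean_space) set \<Rightarrow> ('a \<Rightarrow> real) set" where
  "homogeneous_sobolev m p \<Omega> =
     {u. locally_integrable \<Omega> u \<and>
         (\<forall>\<alpha>\<in>multi_indices m. \<exists>g. has_weak_deriv \<Omega> \<alpha> u g \<and> in_Lp p \<Omega> g)}"

definition sobolev1 :: "real \<Rightarrow> ('a::euclidean_space) set \<Rightarrow> ('a \<Rightarrow> real) set" where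
  "sobolev1 p \<Omega> =
     {v. in_Lp p \<Omega> v \<and> (\<forall>e\<in>Basis. \<exists>g. has_weak_deriv \<Omega> {#e#} v g \<and> in_Lp p \<Omega> g)}"

text \<open>The \<open>p\<close>-th power of the usual norm of \<open>W\<^sup>1\<^sup>,\<^sup>p(\<Omega>)\<close>.\<close>

definition sobolev1_norm_powr ::
    "real \<Rightarrow> ('a::euclidean_space) set \<Rightarrow> ('a \<Rightarrow> real) \<Rightarrow> ennreal" where
  "sobolev1_norm_powr p \<Omega> v =
     (\<integral>\<^sup>+x\<in>\<Omega>. ennreal (\<bar>v x\<bar> powr p) \<partial>lebesgue) +
     (\<Sum>e\<in>Basis. \<integral>\<^sup>+x\<in>\<Omega>. ennreal (\<bar>weak_deriv \<Omega> {#e#} v x\<bar> powr p) \<partial>lebesgue)"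


section \<open>The strip and traces on its boundary\<close>

text \<open>
  The space \<open>\<real>\<^sup>N\<close> is \<open>(real ^ 'n) \<times> real\<close>, so \<open>N = CARD('n) + 1\<close>. The trace of \<open>v\<close> on
  \<open>{x\<^sub>N = s}\<close>, with \<open>s\<close> one of \<open>bm\<close>, \<open>bp\<close>, is the continuous extension to \<open>W\<^sup>1\<^sup>,\<^sup>p\<close> of restriction to
  the boundary: on each bounded cylinder \<open>Q\<^sub>R = B'(0,R) \<times> (bm,bp)\<close> it is the \<open>L\<^sup>p\<close> limit of the boundary
  values of functions that are smooth up to the boundary and converge to \<open>v\<close> in \<open>W\<^sup>1\<^sup>,\<^sup>p(Q\<^sub>R)\<close>.
\<close>

definition strip :: "real \<Rightarrow> real \<Rightarrow> ((real ^ 'n) \<times> real) set" where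
  "strip bm bp = UNIV \<times> {bm<..<bp}"

definition cylinder :: "real \<Rightarrow> real \<Rightarrow> real \<Rightarrow> ((real ^ 'n) \<times> real) set" where
  "cylinder bm bp R = ball 0 R \<times> {bm<..<bp}"

definition has_trace ::
    "real \<Rightarrow> real \<Rightarrow> real \<Rightarrow> real \<Rightarrow> ((real ^ 'n) \<times> real \<Rightarrow> real) \<Rightarrow> (real ^ 'n \<Rightarrow> real) \<Rightarrow> bool" where
  "has_trace p bm bp s v g \<longleftrightarrow>
     g \<in> borel_measurable lebesgue \<and>
     (\<forall>R>0. v \<in> sobolev1 p (cylinder bm bp R) \<and>
        (\<exists>w :: nat \<Rightarrow> (real ^ 'n) \<times> real \<Rightarrow> real.
           (\<forall>n. smooth_fun (w n)) \<and>
           (\<lambda>n. sobolev1_norm_powr p (cylinder bm bp R) (\<lambda>x. w n x - v x)) \<longlonglongrightarrow> 0 \<and>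
           (\<lambda>n. \<integral>\<^sup>+x'\<in>ball 0 R. ennreal (\<bar>w n (x', s) - g x'\<bar> powr p) \<partial>lebesgue) \<longlonglongrightarrow> 0))"

definition boundary_trace ::
    "real \<Rightarrow> real \<Rightarrow> real \<Rightarrow> real \<Rightarrow> ((real ^ 'n) \<times> real \<Rightarrow> real) \<Rightarrow> real ^ 'n \<Rightarrow> real" where
  "boundary_trace p bm bp s v = (SOME g. has_trace p bm bp s v g)"

text \<open>\<open>\<partial>\<^sub>N\<^sup>j\<close> as a multi-index.\<close>

definition normal_index :: "nat \<Rightarrow> ((real ^ 'n) \<times> real) multiset" where
  "normal_index j = replicate_mset j (0, 1)"

text \<open>The component \<open>\<partial>\<^sup>\<beta> Tr(\<partial>\<^sub>N\<^sup>j u)(\<cdot>, s)\<close> of \<open>\<nabla>\<^sub>\<parallel>\<^sup>i Tr(\<partial>\<^sub>N\<^sup>j u)(\<cdot>, s)\<close>, \<open>i = size \<beta>\<close>.\<close>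

definition tangential_trace ::
    "real \<Rightarrow> real \<Rightarrow> real \<Rightarrow> real \<Rightarrow> (real ^ 'n) multiset \<Rightarrow> nat \<Rightarrow>
     ((real ^ 'n) \<times> real \<Rightarrow> real) \<Rightarrow> real ^ 'n \<Rightarrow> real" where
  "tangential_trace p bm bp s \<beta> j u =
     weak_deriv UNIV \<beta> (boundary_trace p bm bp s (weak_deriv (strip bm bp) (normal_index j) u))"

text \<open>\<open>\<integral>\<^sub>\<Omega> |\<nabla>\<^sup>m u|\<^sup>p dx\<close>.\<close>

definition gradient_energy ::
    "nat \<Rightarrow> real \<Rightarrow> ('a::euclidean_space) set \<Rightarrow> ('a \<Rightarrow> real) \<Rightarrow> ennreal" where
  "gradient_energy m p \<Omega> u =
     (\<integral>\<^sup>+x\<in>\<Omega>. ennreal (L2_set (\<lambda>\<alpha>. weak_deriv \<Omega> \<alpha> u x) (multi_indices m) powr p) \<partial>lebesgue)"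

end

theory Submission
  imports Defs "HOL-Real_Asymp.Real_Asymp" "HOL-Computational_Algebra.Polynomial"
begin

text \<open>
  Squeezing the strip towards its middle hyperplane and mollifying gives functions \<open>U\<^sub>k\<close>, smooth on the whole
  space, whose derivatives of order \<open>m\<close> converge to those of \<open>u\<close> in \<open>L\<^sup>p\<close> of the strip; by a Poincare inequality
  and a trace inequality on cylinders, the boundary values of their lower derivatives converge to the traces,
  locally in \<open>L\<^sup>p\<close> and, along a subsequence, almost everywhere. By Fatou's lemma both estimates therefore only have
  to be proved for smooth functions.

  There the alternating sum is the difference between the Taylor polynomials at the midpoint of the vertical
  segment, with base points \<open>bp\<close> and \<open>bm\<close>; as a function of the base point \<open>t\<close> the Taylor polynomial of order \<open>k\<close>
  has the derivative \<open>(mid - t)^k / k!\<close> times the derivative of order \<open>k + 1\<close> at \<open>t\<close>, and Jensen's inequality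
  applies. For the difference quotients, one goes from \<open>x'\<close> to the point at distance \<open>norm h'\<close> from the boundary,
  across by \<open>h'\<close> and back again: polar coordinates and Hardy's inequality control the vertical pieces, and the
  horizontal piece is the integral of a tangential derivative.
\<close>

section \<open>Integrals of p-th powers\<close>

text \<open>Only the derivatives of order m are in L^p of the strip; u itself is just locally
  integrable, and nothing is known beyond the boundary. Squeezing makes room for the mollifier: it
  sees only points of the strip. Up to the boundary the lower orders can be controlled only from
  order m downwards. Hence the Poincare inequality uses means against a fixed test function, for
  which local L^1 convergence of \<open>U k\<close> suffices.

  The first estimate has the constant 1, so the passage to the limit must not lose a factor.
  \<open>lpn\<close> is the p-th power of the norm, and its triangle inequality costs 2^p. Errors
  that tend to 0 tolerate this; the energies are compared by a convexity inequality whose main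
  coefficient can be brought close to 1.

  In the second estimate c must not depend on the width d of the strip. With n = N - 1 the kernel
  |h'|^(-p-n+1) and the Jacobian r^(n-1) leave r^(-p), the weight of Hardy's inequality, which holds
  on (0,d) with a constant free of d.\<close>

definition lpn :: "real \<Rightarrow> 'a::euclidean_space set \<Rightarrow> ('a \<Rightarrow> real) \<Rightarrow> ennreal" where
  "lpn p A f = (\<integral>\<^sup>+x\<in>A. ennreal (\<bar>f x\<bar> powr p) \<partial>lebesgue)"

lemma lpn_restrict:
  "A \<in> sets lebesgue \<Longrightarrow> lpn p A f = (\<integral>\<^sup>+x. ennreal (\<bar>f x\<bar> powr p) \<partial>lebesgue_on A)"
  unfolding lpn_def by (subst nn_integral_restrict_space) auto

text \<open>Each summand is at most the largest one, \<open>B\<close>, and \<open>B powr p\<close>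
  occurs among the summands on the right. The constant is not the best one, but it is valid for all
  \<open>0 \<le> p\<close>.\<close>

lemma powr_sum_le:
  fixes a :: "'i \<Rightarrow> real"
  assumes "finite I" "0 \<le> p"
  shows "\<bar>\<Sum>i\<in>I. a i\<bar> powr p \<le> real (card I) powr p * (\<Sum>i\<in>I. \<bar>a i\<bar> powr p)"
proof (cases "I = {}")
  case False
  define B where "B = Max ((\<lambda>i. \<bar>a i\<bar>) ` I)"
  have "B \<in> (\<lambda>i. \<bar>a i\<bar>) ` I"
    unfolding B_def using False assms by (intro Max_in) auto
  then obtain j where j: "j \<in> I" "B = \<bar>a j\<bar>" by auto
  have "\<bar>\<Sum>i\<in>I. a i\<bar> \<le> (\<Sum>i\<in>I. \<bar>a i\<bar>)" by (rule sum_abs)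
  also have "\<dots> \<le> real (card I) * B"
    using assms by (intro sum_bounded_above) (auto simp: B_def)
  finally have "\<bar>\<Sum>i\<in>I. a i\<bar> powr p \<le> (real (card I) * B) powr p"
    using assms by (intro powr_mono2) auto
  also have "\<dots> = real (card I) powr p * \<bar>a j\<bar> powr p"
    using j by (simp add: powr_mult)
  also have "\<dots> \<le> real (card I) powr p * (\<Sum>i\<in>I. \<bar>a i\<bar> powr p)"
    using j assms by (intro mult_left_mono member_le_sum) auto
  finally show ?thesis .
qed auto

lemma powr_add_le:
  fixes a b :: real
  assumes "0 \<le> p"
  shows "\<bar>a + b\<bar> powr p \<le> 2 powr p * (\<bar>a\<bar> powr p + \<bar>b\<bar> powr p)"
  using powr_sum_le[OF _ assms, of "UNIV :: bool set" "\<lambda>i. if i then a else b"]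
  by (simp add: UNIV_bool add.commute)

text \<open>Convexity of x^p at the weighted mean (1 - t) (a / (1 - t)) + t (b / t). In contrast to
  \<open>powr_add_le\<close>, the coefficient of \<open>a powr p\<close> tends to 1 as t tends to 0,
  so that a main term keeps its constant.\<close>

lemma powr_add_le_convex:
  fixes a b :: real
  assumes "1 \<le> p" "0 < t" "t < 1" "0 \<le> a" "0 \<le> b"
  shows "(a + b) powr p \<le> (1 - t) powr (1 - p) * a powr p + t powr (1 - p) * b powr p"
proof -
  have cv: "convex_on {0<..} (\<lambda>x::real. x powr p)"
    using assms by (intro powr_convex) auto
  have *: "(a + b) powr p \<le> (1 - t) powr (1 - p) * a powr p + t powr (1 - p) * b powr p"
    if "0 < a" "0 < b" for a b :: real
  proof -
    have "((1 - t) *\<^sub>R (a / (1 - t)) + t *\<^sub>R (b / t)) powr p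
      \<le> (1 - t) * (a / (1 - t)) powr p + t * (b / t) powr p"
      using assms that by (intro convex_onD[OF cv]) auto
    moreover have "(1 - t) * (a / (1 - t)) powr p = (1 - t) powr (1 - p) * a powr p"
      using assms that by (simp add: powr_divide powr_diff)
    moreover have "t * (b / t) powr p = t powr (1 - p) * b powr p"
      using assms that by (simp add: powr_divide powr_diff)
    ultimately show ?thesis using assms by simp
  qed
  \<comment> \<open>Convexity is available on the positive reals only. If a or b is 0, it is enough
    that both coefficients are at least 1, their exponent \<open>1 - p\<close> being
    nonpositive.\<close>
  have g: "1 \<le> s powr (1 - p)" if "0 < s" "s < 1" for s :: real
    using powr_mono'[of "1 - p" 0 s] that assms by simp
  show ?thesis
  proof (cases "a = 0 \<or> b = 0")
    case True
    then show ?thesis using g[of t] g[of "1 - t"] assms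
      by (auto simp: mult_le_cancel_right1)
  next
    case False
    then show ?thesis using * assms by auto
  qed
qed

lemma lpn_mono_set: "A \<subseteq> B \<Longrightarrow> lpn p A f \<le> lpn p B f"
  unfolding lpn_def by (intro nn_integral_mono) (auto simp: indicator_def)

lemma lpn_cong_AE:
  assumes "A \<in> sets lebesgue" "AE x in lebesgue_on A. f x = g x"
  shows "lpn p A f = lpn p A g"
  unfolding lpn_restrict[OF assms(1)] using assms(2) by (intro nn_integral_cong_AE) auto

lemma lpn_cong: "(\<And>x. x \<in> A \<Longrightarrow> f x = g x) \<Longrightarrow> lpn p A f = lpn p A g"
  unfolding lpn_def by (intro nn_integral_cong) (auto simp: indicator_def)

lemma lpn_mono:
  assumes "0 \<le> p" "\<And>x. x \<in> A \<Longrightarrow> \<bar>f x\<bar> \<le> \<bar>g x\<bar>"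
  shows "lpn p A f \<le> lpn p A g"
  unfolding lpn_def using assms
  by (intro nn_integral_mono) (auto simp: indicator_def intro!: ennreal_leI powr_mono2)

lemma lpn_minus_commute: "lpn p A (\<lambda>x. f x - g x) = lpn p A (\<lambda>x. g x - f x)"
  unfolding lpn_def by (simp add: abs_minus_commute)

lemma lpn_uminus: "lpn p A (\<lambda>x. - f x) = lpn p A f"
  unfolding lpn_def by simp

lemma lpn_sum:
  fixes f :: "'i \<Rightarrow> 'a::euclidean_space \<Rightarrow> real"
  assumes I: "finite I" and p: "0 \<le> p" and A: "A \<in> sets lebesgue"
    and [measurable]: "\<And>i. i \<in> I \<Longrightarrow> f i \<in> borel_measurable (lebesgue_on A)"
  shows "lpn p A (\<lambda>x. \<Sum>i\<in>I. f i x) \<le> ennreal (real (card I) powr p) * (\<Sum>i\<in>I. lpn p A (f i))"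
proof -
  have "lpn p A (\<lambda>x. \<Sum>i\<in>I. f i x)
      \<le> (\<integral>\<^sup>+x. ennreal (real (card I) powr p) * (\<Sum>i\<in>I. ennreal (\<bar>f i x\<bar> powr p)) \<partial>lebesgue_on A)"
    unfolding lpn_restrict[OF A]
  proof (intro nn_integral_mono)
    fix x
    have "ennreal (\<bar>\<Sum>i\<in>I. f i x\<bar> powr p) \<le> ennreal (real (card I) powr p * (\<Sum>i\<in>I. \<bar>f i x\<bar> powr p))"
      by (intro ennreal_leI powr_sum_le I p)
    also have "\<dots> = ennreal (real (card I) powr p) * (\<Sum>i\<in>I. ennreal (\<bar>f i x\<bar> powr p))"
      by (simp add: ennreal_mult sum_nonneg)
    finally show "ennreal (\<bar>\<Sum>i\<in>I. f i x\<bar> powr p)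
      \<le> ennreal (real (card I) powr p) * (\<Sum>i\<in>I. ennreal (\<bar>f i x\<bar> powr p))" .
  qed
  also have "\<dots> = ennreal (real (card I) powr p) * (\<Sum>i\<in>I. lpn p A (f i))"
    unfolding lpn_restrict[OF A]
    by (subst nn_integral_cmult, measurable, subst nn_integral_sum) auto
  finally show ?thesis .
qed

lemma lpn_add:
  assumes p: "0 \<le> p" and A: "A \<in> sets lebesgue"
    and f: "f \<in> borel_measurable (lebesgue_on A)" and g: "g \<in> borel_measurable (lebesgue_on A)"
  shows "lpn p A (\<lambda>x. f x + g x) \<le> ennreal (2 powr p) * (lpn p A f + lpn p A g)"
  using lpn_sum[OF _ p A, of "UNIV :: bool set" "\<lambda>i. if i then f else g"] f g
  by (simp add: UNIV_bool add.commute)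

lemma lpn_diff:
  assumes p: "0 \<le> p" and A: "A \<in> sets lebesgue"
    and f: "f \<in> borel_measurable (lebesgue_on A)" and g: "g \<in> borel_measurable (lebesgue_on A)"
  shows "lpn p A (\<lambda>x. f x - g x) \<le> ennreal (2 powr p) * (lpn p A f + lpn p A g)"
  using lpn_add[OF p A f, of "\<lambda>x. - g x"] g by (simp add: lpn_uminus)

lemma lpn_triangle:
  assumes p: "0 \<le> p" and A: "A \<in> sets lebesgue"
    and f: "f \<in> borel_measurable (lebesgue_on A)" and g: "g \<in> borel_measurable (lebesgue_on A)"
    and h: "h \<in> borel_measurable (lebesgue_on A)"
  shows "lpn p A (\<lambda>x. f x - h x) \<le> ennreal (2 powr p) * (lpn p A (\<lambda>x. f x - g x) + lpn p A (\<lambda>x. g x - h x))"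
  using lpn_add[OF p A, of "\<lambda>x. f x - g x" "\<lambda>x. g x - h x"] f g h by simp

lemma lpn_cmult:
  assumes A: "A \<in> sets lebesgue" and f: "f \<in> borel_measurable (lebesgue_on A)"
  shows "lpn p A (\<lambda>x. c * f x) = ennreal (\<bar>c\<bar> powr p) * lpn p A f"
  unfolding lpn_restrict[OF A] using f
  by (simp add: abs_mult powr_mult ennreal_mult nn_integral_cmult)

text \<open>Jensen's inequality for the measure with density \<open>w\<close>: integrate the tangent line of \<open>t \<mapsto> t\<^sup>p\<close>
  at the mean value of \<open>\<bar>f\<bar>\<close>.\<close>

lemma jensen_powr:
  fixes f w :: "'a \<Rightarrow> real"
  assumes p: "1 < p" and f[measurable]: "f \<in> borel_measurable M" and w[measurable]: "w \<in> borel_measurable M"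
    and w0: "\<And>x. x \<in> space M \<Longrightarrow> 0 \<le> w x" and W: "(\<integral>\<^sup>+x. ennreal (w x) \<partial>M) \<le> ennreal W" and W0: "0 \<le> W"
  shows "ennreal (\<bar>\<integral>x. f x * w x \<partial>M\<bar> powr p) \<le> ennreal (W powr (p - 1)) * (\<integral>\<^sup>+x. ennreal (\<bar>f x\<bar> powr p * w x) \<partial>M)"
\<comment> \<open>If the product is not integrable, its integral is 0 by convention and there is
  nothing to prove. Excluding the value 0 as well guarantees below that the total weight
  \<open>V\<close> is positive.\<close>
proof (cases "integrable M (\<lambda>x. f x * w x) \<and> (\<integral>x. f x * w x \<partial>M) \<noteq> 0")
  case False
  then have "(\<integral>x. f x * w x \<partial>M) = 0" using not_integrable_integral_eq by blast
  then show ?thesis by simp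
next
  case True
  then have int: "integrable M (\<lambda>x. f x * w x)" and nz: "(\<integral>x. f x * w x \<partial>M) \<noteq> 0" by auto
  define J where "J = (\<integral>\<^sup>+x. ennreal (\<bar>f x\<bar> powr p * w x) \<partial>M)"
  define I where "I = (\<integral>x. \<bar>f x\<bar> * w x \<partial>M)"
  have inta: "integrable M (\<lambda>x. \<bar>f x\<bar> * w x)"
    using integrable_abs[OF int] by (rule Bochner_Integration.integrable_cong[THEN iffD1, rotated -1]) (auto simp: abs_mult w0)
  have le: "\<bar>\<integral>x. f x * w x \<partial>M\<bar> \<le> I"
  proof -
    have "\<bar>\<integral>x. f x * w x \<partial>M\<bar> \<le> (\<integral>x. \<bar>f x * w x\<bar> \<partial>M)" by (rule integral_abs_bound)
    also have "\<dots> = I" unfolding I_def by (intro Bochner_Integration.integral_cong) (auto simp: abs_mult w0)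
    finally show ?thesis .
  qed
  then have I0: "0 < I" using nz by linarith
  have wint: "integrable M w"
    using le_less_trans[OF W ennreal_less_top] w0 by (intro integrableI_nonneg) (auto intro!: AE_I2)
  define V where "V = (\<integral>x. w x \<partial>M)"
  have V: "V \<le> W" "0 \<le> V"
  proof -
    have "ennreal V = (\<integral>\<^sup>+x. ennreal (w x) \<partial>M)" unfolding V_def
      by (rule nn_integral_eq_integral[symmetric, OF wint]) (auto intro!: AE_I2 w0)
    then have "ennreal V \<le> ennreal W" using W by simp
    then show "V \<le> W" using W0 by (simp add: ennreal_le_iff)
    show "0 \<le> V" unfolding V_def by (intro Bochner_Integration.integral_nonneg) (auto simp: w0)
  qed
  have V0: "0 < V"
  proof (rule ccontr)
    assume "\<not> 0 < V"
    then have "V = 0" using V by auto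
    then have "AE x in M. w x = 0"
      unfolding V_def using integral_nonneg_eq_0_iff_AE[OF wint] w0 by auto
    then have "I = 0" unfolding I_def by (intro integral_eq_zero_AE) auto
    then show False using I0 by simp
  qed
  define y where "y = I / V"
  have y0: "0 < y" unfolding y_def using I0 V0 by simp
  have tangent: "p * y powr (p - 1) * t \<le> t powr p + (p - 1) * y powr p" if "0 \<le> t" for t
  proof (cases "t = 0")
    case True then show ?thesis using p by simp
  next
    case False
    have cv: "convex_on {0<..} (\<lambda>x::real. x powr p)" using p by (intro powr_convex) auto
    have d: "((\<lambda>x. x powr p) has_real_derivative p * y powr (p - 1)) (at y)"
      using y0 by (auto intro!: derivative_eq_intros)
    have "t powr p - y powr p \<ge> p * y powr (p - 1) * (t - y)"
      using d y0 that False
      by (intro convex_on_imp_above_tangent[OF cv]) (auto intro: has_field_derivative_at_within simp: interior_open)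
    moreover have "y powr (p - 1) * y = y powr p"
      using y0 by (simp add: powr_mult_base mult.commute)
    ultimately show ?thesis by (simp add: algebra_simps)
  qed
  show ?thesis
  \<comment> \<open>An infinite \<open>J\<close> makes the right side infinite because
    \<open>W \<ge> V > 0\<close> keeps the factor \<open>W powr (p - 1)\<close> positive.\<close>
  proof (cases "J = \<infinity>")
    case True
    then show ?thesis using V V0 unfolding J_def by (simp add: ennreal_mult_eq_top_iff ennreal_mult_top)
  next
    case False
    have Jint: "integrable M (\<lambda>x. \<bar>f x\<bar> powr p * w x)"
      using False w0 unfolding J_def by (intro integrableI_nonneg) (auto simp: less_top intro!: AE_I2)
    define J' where "J' = (\<integral>x. \<bar>f x\<bar> powr p * w x \<partial>M)"
    have JJ: "J = ennreal J'" unfolding J_def J'_def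
      by (rule nn_integral_eq_integral[OF Jint]) (auto intro!: AE_I2 simp: w0)
    have "(\<integral>x. p * y powr (p - 1) * (\<bar>f x\<bar> * w x) \<partial>M) \<le> (\<integral>x. \<bar>f x\<bar> powr p * w x + (p - 1) * y powr p * w x \<partial>M)"
    proof (intro integral_mono)
      fix x assume x: "x \<in> space M"
      have "(p * y powr (p - 1) * \<bar>f x\<bar>) * w x \<le> (\<bar>f x\<bar> powr p + (p - 1) * y powr p) * w x"
        by (intro mult_right_mono tangent w0 x) auto
      then show "p * y powr (p - 1) * (\<bar>f x\<bar> * w x) \<le> \<bar>f x\<bar> powr p * w x + (p - 1) * y powr p * w x"
        by (simp add: algebra_simps)
    qed (auto intro!: inta Jint wint)
    then have *: "p * y powr (p - 1) * I \<le> J' + (p - 1) * y powr p * V"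
      unfolding I_def J'_def V_def using Jint wint by simp
    have yp: "y powr (p - 1) * y = y powr p"
      using y0 by (simp add: powr_mult_base mult.commute)
    have "y powr (p - 1) * I = y powr (p - 1) * y * V" using V0 unfolding y_def by simp
    also have "\<dots> = y powr p * V" using yp by simp
    finally have "y powr (p - 1) * I = y powr p * V" .
    with * have "p * (y powr p * V) \<le> J' + (p - 1) * y powr p * V"
      by (metis mult.assoc)
    then have "y powr p * V \<le> J'" by (simp add: algebra_simps)
    moreover have "I powr p = y powr p * V powr p"
      using I0 V0 unfolding y_def by (simp add: powr_divide)
    moreover have "V powr p = V powr (p - 1) * V" using V0 by (simp add: powr_mult_base mult.commute)
    ultimately have "I powr p \<le> V powr (p - 1) * J'"
      using mult_left_mono[of "y powr p * V" J' "V powr (p - 1)"] by (simp add: mult_ac)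
    also have "\<dots> \<le> W powr (p - 1) * J'"
      using V V0 p w0 by (intro mult_right_mono powr_mono2) (auto simp: J'_def intro!: Bochner_Integration.integral_nonneg)
    finally have "\<bar>\<integral>x. f x * w x \<partial>M\<bar> powr p \<le> W powr (p - 1) * J'"
      using le p powr_mono2[of p "\<bar>\<integral>x. f x * w x \<partial>M\<bar>" I] by linarith
    then show ?thesis unfolding J_def[symmetric] JJ
      using w0 by (subst ennreal_mult'[symmetric]) (auto simp: J'_def intro!: Bochner_Integration.integral_nonneg ennreal_leI)
  qed
qed

lemma jensen_set:
  fixes f :: "'a::euclidean_space \<Rightarrow> real"
  assumes p: "1 < p" and A: "A \<in> sets lebesgue" and f: "f \<in> borel_measurable (lebesgue_on A)"
    and W: "emeasure lebesgue A \<le> ennreal W" "0 \<le> W"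
  shows "ennreal (\<bar>LINT x|lebesgue_on A. f x\<bar> powr p) \<le> ennreal (W powr (p - 1)) * lpn p A f"
proof -
  have "(\<integral>\<^sup>+x. ennreal 1 \<partial>lebesgue_on A) \<le> ennreal W"
    using W A by (simp add: emeasure_restrict_space)
  then show ?thesis
    using jensen_powr[OF p f, of "\<lambda>_. 1" W] W A by (simp add: lpn_restrict)
qed

text \<open>For fixed t, \<open>powr_add_le_convex\<close> bounds the p-th power of
  \<open>f k\<close> by nearly that of \<open>g\<close> plus a multiple of the error, which vanishes
  in the limit; afterwards t tends to 0. The inequality \<open>lpn_add\<close> would leave a factor
  2^p, which the first estimate of the theorem cannot absorb.\<close>

lemma lpn_liminf_le:
  fixes f :: "nat \<Rightarrow> 'a::euclidean_space \<Rightarrow> real"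
  assumes p: "1 \<le> p" and A: "A \<in> sets lebesgue"
    and f[measurable]: "\<And>k. f k \<in> borel_measurable (lebesgue_on A)" and g[measurable]: "g \<in> borel_measurable (lebesgue_on A)"
    and lim: "(\<lambda>k. lpn p A (\<lambda>x. f k x - g x)) \<longlonglongrightarrow> 0"
  shows "liminf (\<lambda>k. lpn p A (f k)) \<le> lpn p A g"
proof (cases "lpn p A g = \<infinity>")
  case False
  have *: "liminf (\<lambda>k. lpn p A (f k)) \<le> ennreal ((1 - t) powr (1 - p)) * lpn p A g" if t: "0 < t" "t < 1" for t
  proof -
    have "lpn p A (f k) \<le> ennreal ((1 - t) powr (1 - p)) * lpn p A g
        + ennreal (t powr (1 - p)) * lpn p A (\<lambda>x. f k x - g x)" for k
    proof -
      have "lpn p A (f k) \<le> (\<integral>\<^sup>+x. ennreal ((1 - t) powr (1 - p)) * ennreal (\<bar>g x\<bar> powr p)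
          + ennreal (t powr (1 - p)) * ennreal (\<bar>f k x - g x\<bar> powr p) \<partial>lebesgue_on A)"
        unfolding lpn_restrict[OF A]
      proof (intro nn_integral_mono)
        fix x
        have "\<bar>f k x\<bar> powr p \<le> (\<bar>g x\<bar> + \<bar>f k x - g x\<bar>) powr p"
          using p by (intro powr_mono2) auto
        also have "\<dots> \<le> (1 - t) powr (1 - p) * \<bar>g x\<bar> powr p + t powr (1 - p) * \<bar>f k x - g x\<bar> powr p"
          by (intro powr_add_le_convex p t) auto
        finally have "ennreal (\<bar>f k x\<bar> powr p) \<le> ennreal ((1 - t) powr (1 - p) * \<bar>g x\<bar> powr p + t powr (1 - p) * \<bar>f k x - g x\<bar> powr p)"
          by (rule ennreal_leI)
        then show "ennreal (\<bar>f k x\<bar> powr p) \<le> ennreal ((1 - t) powr (1 - p)) * ennreal (\<bar>g x\<bar> powr p)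
          + ennreal (t powr (1 - p)) * ennreal (\<bar>f k x - g x\<bar> powr p)"
          by (simp add: ennreal_mult)
      qed
      also have "\<dots> = ennreal ((1 - t) powr (1 - p)) * lpn p A g
        + ennreal (t powr (1 - p)) * lpn p A (\<lambda>x. f k x - g x)"
        unfolding lpn_restrict[OF A] by (subst nn_integral_add) (auto simp: nn_integral_cmult)
      finally show ?thesis .
    qed
    then have "liminf (\<lambda>k. lpn p A (f k)) \<le> liminf (\<lambda>k. ennreal ((1 - t) powr (1 - p)) * lpn p A g
        + ennreal (t powr (1 - p)) * lpn p A (\<lambda>x. f k x - g x))"
      by (intro Liminf_mono) auto
    also have "(\<lambda>k. ennreal ((1 - t) powr (1 - p)) * lpn p A g
        + ennreal (t powr (1 - p)) * lpn p A (\<lambda>x. f k x - g x)) \<longlonglongrightarrow> ennreal ((1 - t) powr (1 - p)) * lpn p A g + ennreal (t powr (1 - p)) * 0"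
      by (intro tendsto_add tendsto_const ennreal_tendsto_cmult lim) auto
    then have "liminf (\<lambda>k. ennreal ((1 - t) powr (1 - p)) * lpn p A g
        + ennreal (t powr (1 - p)) * lpn p A (\<lambda>x. f k x - g x)) = ennreal ((1 - t) powr (1 - p)) * lpn p A g + ennreal (t powr (1 - p)) * 0"
      by (intro lim_imp_Liminf) auto
    finally show ?thesis by simp
  qed
  have "(\<lambda>n. (1 - 1 / (real n + 2)) powr (1 - p)) \<longlonglongrightarrow> 1 powr (1 - p)"
  proof (intro tendsto_powr tendsto_const)
    have "(\<lambda>n. 1 / (real n + 2)) \<longlonglongrightarrow> 0"
      by real_asymp
    then show "(\<lambda>n. 1 - 1 / (real n + 2)) \<longlonglongrightarrow> 1" using tendsto_diff[OF tendsto_const[of 1]] by fastforce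
  qed auto
  then have "(\<lambda>n. ennreal ((1 - 1 / (real n + 2)) powr (1 - p)) * lpn p A g) \<longlonglongrightarrow> ennreal 1 * lpn p A g"
    using False by (intro tendsto_mult_ennreal tendsto_ennrealI tendsto_const) (auto simp: less_top)
  moreover have "liminf (\<lambda>k. lpn p A (f k)) \<le> ennreal ((1 - 1 / (real n + 2)) powr (1 - p)) * lpn p A g" for n
    by (intro *) (auto simp: field_simps)
  ultimately have "liminf (\<lambda>k. lpn p A (f k)) \<le> ennreal 1 * lpn p A g"
    by (intro LIMSEQ_le_const) auto
  then show ?thesis by simp
qed auto

text \<open>Along the subsequence the errors are made at most 2^(-j) on \<open>A j\<close>. For
  fixed J the tail from J on is then summable on \<open>A J\<close>, because \<open>A J\<close> is
  contained in the later sets; so the pointwise series is finite almost everywhere and its terms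
  tend to 0. One subsequence thus serves all the sets.\<close>

lemma lpn_AE_subseq:
  fixes h :: "nat \<Rightarrow> 'a::euclidean_space \<Rightarrow> real"
  assumes p: "0 < p" and A: "\<And>j. A j \<in> sets lebesgue" and inc: "incseq A"
    and h: "\<And>k. h k \<in> borel_measurable lebesgue"
    and lim: "\<And>j. (\<lambda>k. lpn p (A j) (h k)) \<longlonglongrightarrow> 0"
  shows "\<exists>r :: nat \<Rightarrow> nat. strict_mono r \<and> (AE x in lebesgue. x \<in> (\<Union>j. A j) \<longrightarrow> (\<lambda>k. h (r k) x) \<longlonglongrightarrow> 0)"
proof -
  have ex: "\<exists>r :: nat \<Rightarrow> nat. \<forall>j. lpn p (A j) (h (r j)) \<le> ennreal ((1/2) ^ j) \<and> r j < r (Suc j)"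
  proof (rule dependent_nat_choice)
    show "\<exists>x. lpn p (A 0) (h x) \<le> ennreal ((1/2) ^ 0)"
    proof -
      have "\<forall>\<^sub>F k in sequentially. lpn p (A 0) (h k) < ennreal 1"
        by (intro order_tendstoD[OF lim]) auto
      then show ?thesis by (auto simp: eventually_sequentially intro: less_imp_le)
    qed
    fix x j
    assume "lpn p (A j) (h x) \<le> ennreal ((1/2) ^ j)"
    have "\<forall>\<^sub>F k in sequentially. lpn p (A (Suc j)) (h k) < ennreal ((1/2) ^ Suc j) \<and> x < k"
      by (intro eventually_conj order_tendstoD[OF lim] eventually_gt_at_top) (auto simp: ennreal_zero_less_divide)
    then obtain k where "lpn p (A (Suc j)) (h k) < ennreal ((1/2) ^ Suc j) \<and> x < k"
      by (auto simp: eventually_sequentially)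
    then show "\<exists>y. lpn p (A (Suc j)) (h y) \<le> ennreal ((1/2) ^ Suc j) \<and> x < y" by (auto intro: less_imp_le)
  qed
  then obtain r where r: "\<And>j. lpn p (A j) (h (r j)) \<le> ennreal ((1/2) ^ j)" "\<And>j. r j < r (Suc j)" by auto
  have sm: "strict_mono r" using r(2) by (simp add: strict_mono_Suc_iff)
  have "AE x in lebesgue. x \<in> A J \<longrightarrow> (\<lambda>k. h (r k) x) \<longlonglongrightarrow> 0" for J
  proof -
    have [measurable]: "h k \<in> borel_measurable (lebesgue_on (A J))" for k
      using h by (rule measurable_restrict_space1)
    have "(\<integral>\<^sup>+x. (\<Sum>j. ennreal (\<bar>h (r (j + J)) x\<bar> powr p)) \<partial>lebesgue_on (A J))
        = (\<Sum>j. lpn p (A J) (h (r (j + J))))"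
      unfolding lpn_restrict[OF A] by (rule nn_integral_suminf) auto
    also have "\<dots> \<le> (\<Sum>j. ennreal ((1/2) ^ j))"
    proof (intro suminf_le allI)
      fix j
      have "lpn p (A J) (h (r (j + J))) \<le> lpn p (A (j + J)) (h (r (j + J)))"
        using inc by (intro lpn_mono_set) (auto simp: incseq_def)
      also have "\<dots> \<le> ennreal ((1/2) ^ (j + J))" by (rule r)
      also have "\<dots> \<le> ennreal ((1/2) ^ j)" by (intro ennreal_leI power_decreasing) auto
      finally show "lpn p (A J) (h (r (j + J))) \<le> ennreal ((1/2) ^ j)" .
    qed auto
    also have "\<dots> = ennreal (\<Sum>j. (1/2) ^ j)"
      by (intro suminf_ennreal2) (auto intro!: summable_geometric)
    also have "\<dots> < \<infinity>" by simp
    finally have "(\<integral>\<^sup>+x. (\<Sum>j. ennreal (\<bar>h (r (j + J)) x\<bar> powr p)) \<partial>lebesgue_on (A J)) \<noteq> \<infinity>" by simp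
    then have "AE x in lebesgue_on (A J). (\<Sum>j. ennreal (\<bar>h (r (j + J)) x\<bar> powr p)) \<noteq> \<infinity>"
      by (intro nn_integral_PInf_AE) auto
    then have "AE x in lebesgue_on (A J). (\<lambda>k. h (r k) x) \<longlonglongrightarrow> 0"
    proof (eventually_elim)
      fix x assume "(\<Sum>j. ennreal (\<bar>h (r (j + J)) x\<bar> powr p)) \<noteq> \<infinity>"
      then have "summable (\<lambda>j. \<bar>h (r (j + J)) x\<bar> powr p)"
        by (intro summable_suminf_not_top) auto
      then have "(\<lambda>j. \<bar>h (r (j + J)) x\<bar> powr p) \<longlonglongrightarrow> 0" by (rule summable_LIMSEQ_zero)
      then have "(\<lambda>j. (\<bar>h (r (j + J)) x\<bar> powr p) powr (1/p)) \<longlonglongrightarrow> 0 powr (1/p)"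
        using p by (intro tendsto_powr' tendsto_const) auto
      then have "(\<lambda>j. h (r (j + J)) x) \<longlonglongrightarrow> 0"
        using p by (simp add: powr_powr tendsto_rabs_zero_iff)
      then show "(\<lambda>k. h (r k) x) \<longlonglongrightarrow> 0" by (rule LIMSEQ_offset)
    qed
    then show ?thesis using A by (simp add: AE_restrict_space_iff)
  qed
  then have "AE x in lebesgue. \<forall>J. x \<in> A J \<longrightarrow> (\<lambda>k. h (r k) x) \<longlonglongrightarrow> 0"
    by (subst AE_all_countable) blast
  then have "AE x in lebesgue. x \<in> (\<Union>j. A j) \<longrightarrow> (\<lambda>k. h (r k) x) \<longlonglongrightarrow> 0"
    by eventually_elim auto
  then show ?thesis using sm by blast
qed

text \<open>The argument of Riesz and Fischer, run diagonally over the increasing sets: the j-th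
  step of the subsequence is controlled on \<open>A j\<close>, so that one function is the limit on
  all of them.\<close>

lemma lpn_complete:
  fixes f :: "nat \<Rightarrow> 'a::euclidean_space \<Rightarrow> real"
  assumes p: "0 < p" and A: "\<And>j. A j \<in> sets lebesgue" and inc: "incseq A"
    and f[measurable]: "\<And>k. f k \<in> borel_measurable lebesgue"
    and lim: "\<And>j. ((\<lambda>(k, l). lpn p (A j) (\<lambda>x. f k x - f l x)) \<longlongrightarrow> 0) (sequentially \<times>\<^sub>F sequentially)"
  shows "\<exists>g\<in>borel_measurable lebesgue. \<forall>j. (\<lambda>k. lpn p (A j) (\<lambda>x. f k x - g x)) \<longlonglongrightarrow> 0"
proof -
  have ev: "\<exists>N. \<forall>k\<ge>N. \<forall>l\<ge>N. lpn p (A j) (\<lambda>x. f k x - f l x) < e" if "0 < e" for j e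
    using order_tendstoD(2)[OF lim that, of j] unfolding eventually_prod_sequentially by simp blast
  \<comment> \<open>The second factor pays for multiplying the j-th difference by 2^j before taking
    the p-th power, the first one makes the resulting series converge. Almost everywhere the
    differences therefore decay geometrically, and the telescoping series converges
    absolutely.\<close>
  define e where "e j = ennreal ((1/2) ^ j * ((1/2) ^ j) powr p)" for j :: nat
  have e0: "0 < e j" for j unfolding e_def by (auto simp: ennreal_less_zero_iff)
  define N where "N j = (SOME N. \<forall>k\<ge>N. \<forall>l\<ge>N. lpn p (A j) (\<lambda>x. f k x - f l x) < e j)" for j
  have N: "lpn p (A j) (\<lambda>x. f k x - f l x) < e j" if "k \<ge> N j" "l \<ge> N j" for k l j
    using someI_ex[OF ev[OF e0, of j j]] that unfolding N_def by blast
  \<comment> \<open>The sum dominates \<open>N j\<close>, and the added j makes \<open>r\<close>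
    strictly increasing.\<close>
  define r where "r j = (\<Sum>i\<le>j. N i) + j" for j
  have rN: "N j \<le> r j" for j unfolding r_def by (intro trans_le_add1 member_le_sum) auto
  have rS: "r j < r (Suc j)" for j unfolding r_def by simp
  have sm: "strict_mono r" using rS by (simp add: strict_mono_Suc_iff)
  have d: "lpn p (A j) (\<lambda>x. f (r (Suc j)) x - f (r j) x) \<le> e j" for j
    by (intro less_imp_le N rN order.trans[OF rN less_imp_le[OF rS]])
  define g where "g x = lim (\<lambda>k. f (r k) x)" for x
  have g[measurable]: "g \<in> borel_measurable lebesgue" unfolding g_def by (rule borel_measurable_lim_metric) auto
  have "AE x in lebesgue_on (A J). (\<lambda>k. f (r k) x) \<longlonglongrightarrow> g x" for J
  proof -
    have [measurable]: "f k \<in> borel_measurable (lebesgue_on (A J))" for k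
      using f by (rule measurable_restrict_space1)
    define D where "D j x = f (r (Suc j)) x - f (r j) x" for j x
    have Dm[measurable]: "D j \<in> borel_measurable (lebesgue_on (A J))" for j unfolding D_def by measurable
    have "(\<integral>\<^sup>+x. (\<Sum>j. ennreal (((2::real) ^ (j + J)) powr p) * ennreal (\<bar>D (j + J) x\<bar> powr p)) \<partial>lebesgue_on (A J))
        = (\<Sum>j. ennreal ((2 ^ (j + J)) powr p) * lpn p (A J) (D (j + J)))"
      unfolding lpn_restrict[OF A] by (subst nn_integral_suminf) (auto simp: nn_integral_cmult)
    also have "\<dots> \<le> (\<Sum>j. ennreal ((1/2) ^ j))"
    proof (intro suminf_le allI)
      fix j
      have "lpn p (A J) (D (j + J)) \<le> lpn p (A (j + J)) (D (j + J))"
        using inc by (intro lpn_mono_set) (auto simp: incseq_def)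
      also have "\<dots> \<le> e (j + J)" unfolding D_def by (rule d)
      finally have "ennreal ((2 ^ (j + J)) powr p) * lpn p (A J) (D (j + J)) \<le> ennreal ((2 ^ (j + J)) powr p) * e (j + J)"
        by (rule mult_left_mono) auto
      also have "\<dots> = ennreal (((2 ^ (j + J)) powr p * ((1/2) ^ (j+J)) powr p) * (1/2) ^ (j + J))"
        unfolding e_def by (simp add: ennreal_mult'[symmetric] mult_ac)
      also have "((2::real) ^ (j + J)) powr p * ((1/2) ^ (j+J)) powr p = 1"
        by (simp flip: powr_mult power_mult_distrib)
      also have "ennreal (1 * (1/2) ^ (j + J)) \<le> ennreal ((1/2) ^ j)" 
        unfolding mult_1 by (intro ennreal_leI power_decreasing) auto
      finally show "ennreal ((2 ^ (j + J)) powr p) * lpn p (A J) (D (j + J)) \<le> ennreal ((1/2) ^ j)" .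
    qed auto
    also have "\<dots> = ennreal (\<Sum>j. (1/2) ^ j)"
      by (intro suminf_ennreal2) (auto intro!: summable_geometric)
    also have "\<dots> < \<infinity>" by simp
    finally have "AE x in lebesgue_on (A J). (\<Sum>j. ennreal (((2::real) ^ (j + J)) powr p) * ennreal (\<bar>D (j + J) x\<bar> powr p)) \<noteq> \<infinity>"
      by (intro nn_integral_PInf_AE) auto
    then show ?thesis
    proof eventually_elim
      fix x assume a: "(\<Sum>j. ennreal (((2::real) ^ (j + J)) powr p) * ennreal (\<bar>D (j + J) x\<bar> powr p)) \<noteq> \<infinity>"
      have "summable (\<lambda>j. (2 ^ (j + J) * \<bar>D (j + J) x\<bar>) powr p)"
        using a by (intro summable_suminf_not_top) (auto simp: powr_mult ennreal_mult)
      then have "(\<lambda>j. (2 ^ (j + J) * \<bar>D (j + J) x\<bar>) powr p) \<longlonglongrightarrow> 0" by (rule summable_LIMSEQ_zero)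
      then have "\<forall>\<^sub>F j in sequentially. (2 ^ (j + J) * \<bar>D (j + J) x\<bar>) powr p < 1"
        by (rule order_tendstoD) auto
      then have "\<forall>\<^sub>F j in sequentially. norm (D (j + J) x) \<le> (1/2) ^ j"
      proof eventually_elim
        case (elim j)
        have "2 ^ (j + J) * \<bar>D (j + J) x\<bar> < 1"
        proof (rule ccontr)
          assume "\<not> 2 ^ (j + J) * \<bar>D (j + J) x\<bar> < 1"
          then have "(1::real) powr p \<le> (2 ^ (j + J) * \<bar>D (j + J) x\<bar>) powr p" using p by (intro powr_mono2) auto
          then show False using elim by simp
        qed
        moreover have "2 ^ j * \<bar>D (j + J) x\<bar> \<le> 2 ^ (j + J) * \<bar>D (j + J) x\<bar>"
          by (intro mult_right_mono power_increasing) auto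
        ultimately have "2 ^ j * \<bar>D (j + J) x\<bar> < 1" by simp
        then show ?case by (simp add: field_simps power_divide)
      qed
      then have "summable (\<lambda>j. D (j + J) x)"
        by (rule summable_comparison_test_ev) (auto intro!: summable_geometric)
      then have "summable (\<lambda>j. D j x)" by (simp only: summable_iff_shift[of "\<lambda>j. D j x" J])
      then have "convergent (\<lambda>n. \<Sum>j<n. D j x)" by (simp add: summable_iff_convergent)
      then have "convergent (\<lambda>n. f (r n) x - f (r 0) x)"
        unfolding D_def sum_lessThan_telescope[of "\<lambda>j. f (r j) x"] .
      then have "convergent (\<lambda>n. f (r n) x)"
        using convergent_diff_const_right_iff[of "\<lambda>n. f (r n) x" "f (r 0) x"] by auto
      then show "(\<lambda>k. f (r k) x) \<longlonglongrightarrow> g x" unfolding g_def by (simp add: convergent_LIMSEQ_iff)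
    qed
  qed note conv = this
  \<comment> \<open>Convergence of the whole sequence and not only of the subsequence: in the Cauchy
    condition one index is sent to infinity along \<open>r\<close>, by Fatou's lemma.\<close>
  have "(\<lambda>k. lpn p (A j) (\<lambda>x. f k x - g x)) \<longlonglongrightarrow> 0" for j
  proof (rule order_tendstoI)
    fix a :: ennreal assume a: "0 < a"
    obtain b where b: "0 < b" "b < a" using a dense by blast
    obtain K where K: "\<And>k l. k \<ge> K \<Longrightarrow> l \<ge> K \<Longrightarrow> lpn p (A j) (\<lambda>x. f k x - f l x) < b" using ev[OF b(1), of j] by blast
    have [measurable]: "f k \<in> borel_measurable (lebesgue_on (A j))" for k
      using f by (rule measurable_restrict_space1)
    have [measurable]: "g \<in> borel_measurable (lebesgue_on (A j))"
      using g by (rule measurable_restrict_space1)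
    have "lpn p (A j) (\<lambda>x. f k x - g x) \<le> b" if k: "k \<ge> K" for k
    proof -
      have "lpn p (A j) (\<lambda>x. f k x - g x) = (\<integral>\<^sup>+x. liminf (\<lambda>l. ennreal (\<bar>f k x - f (r l) x\<bar> powr p)) \<partial>lebesgue_on (A j))"
        unfolding lpn_restrict[OF A]
      proof (rule nn_integral_cong_AE, use conv[of j] in eventually_elim)
        fix x assume "(\<lambda>k. f (r k) x) \<longlonglongrightarrow> g x"
        then have "(\<lambda>l. ennreal (\<bar>f k x - f (r l) x\<bar> powr p)) \<longlonglongrightarrow> ennreal (\<bar>f k x - g x\<bar> powr p)"
          using p by (intro tendsto_ennrealI tendsto_powr' tendsto_intros) auto
        then show "ennreal (\<bar>f k x - g x\<bar> powr p) = liminf (\<lambda>l. ennreal (\<bar>f k x - f (r l) x\<bar> powr p))"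
          by (intro lim_imp_Liminf[symmetric]) auto
      qed
      also have "\<dots> \<le> liminf (\<lambda>l. lpn p (A j) (\<lambda>x. f k x - f (r l) x))"
        unfolding lpn_restrict[OF A] by (rule nn_integral_liminf) auto
      also have "\<dots> \<le> b"
      proof (rule Liminf_le, simp)
        show "\<forall>\<^sub>F n in sequentially. lpn p (A j) (\<lambda>x. f k x - f (r n) x) \<le> b"
          using eventually_ge_at_top[of K]
        proof eventually_elim
          case (elim n)
          have "n \<le> r n" using sm by (rule seq_suble)
          then show ?case using elim k by (intro less_imp_le[OF K]) auto
        qed
      qed
      finally show ?thesis .
    qed
    then show "\<forall>\<^sub>F k in sequentially. lpn p (A j) (\<lambda>x. f k x - g x) < a"
      unfolding eventually_sequentially using le_less_trans[OF _ b(2)] by blast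
  qed auto
  then show ?thesis using g by (intro bexI[of _ g] allI)
qed

lemma tendsto_zero_ennreal_le:
  fixes f g :: "'b \<Rightarrow> ennreal"
  assumes "(g \<longlongrightarrow> 0) F" "\<And>x. f x \<le> g x"
  shows "(f \<longlongrightarrow> 0) F"
  by (rule tendsto_sandwich[OF _ _ tendsto_const assms(1)]) (auto simp: assms(2))

lemma lpn_lim_Cauchy:
  fixes f :: "nat \<Rightarrow> 'a::euclidean_space \<Rightarrow> real"
  assumes p: "0 \<le> p" and A: "A \<in> sets lebesgue"
    and f: "\<And>k. f k \<in> borel_measurable (lebesgue_on A)" and g: "g \<in> borel_measurable (lebesgue_on A)"
    and lim: "(\<lambda>k. lpn p A (\<lambda>x. f k x - g x)) \<longlonglongrightarrow> 0"
  shows "((\<lambda>(k, l). lpn p A (\<lambda>x. f k x - f l x)) \<longlongrightarrow> 0) (sequentially \<times>\<^sub>F sequentially)"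
proof (rule tendsto_zero_ennreal_le)
  have 1: "((\<lambda>x. lpn p A (\<lambda>y. f (fst x) y - g y)) \<longlongrightarrow> 0) (sequentially \<times>\<^sub>F sequentially)"
    by (rule filterlim_compose[OF lim filterlim_fst])
  have 2: "((\<lambda>x. lpn p A (\<lambda>y. f (snd x) y - g y)) \<longlongrightarrow> 0) (sequentially \<times>\<^sub>F sequentially)"
    by (rule filterlim_compose[OF lim filterlim_snd])
  have "((\<lambda>x. ennreal (2 powr p) * (lpn p A (\<lambda>y. f (fst x) y - g y) + lpn p A (\<lambda>y. f (snd x) y - g y))) \<longlongrightarrow> ennreal (2 powr p) * (0 + 0)) (sequentially \<times>\<^sub>F sequentially)"
    by (intro ennreal_tendsto_cmult tendsto_add 1 2) auto
  then show "((\<lambda>x. ennreal (2 powr p) * (lpn p A (\<lambda>y. f (fst x) y - g y) + lpn p A (\<lambda>y. f (snd x) y - g y))) \<longlongrightarrow> 0) (sequentially \<times>\<^sub>F sequentially)"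
    by simp
  fix x :: "nat \<times> nat"
  show "(case x of (k, l) \<Rightarrow> lpn p A (\<lambda>x. f k x - f l x))
    \<le> ennreal (2 powr p) * (lpn p A (\<lambda>y. f (fst x) y - g y) + lpn p A (\<lambda>y. f (snd x) y - g y))"
    using lpn_triangle[OF p A f g f, of "fst x" "snd x"]
    by (cases x) (simp add: lpn_minus_commute[of p A g])
qed

lemma lpn_power_one: "A \<in> sets lebesgue \<Longrightarrow> lpn 1 A f = (\<integral>\<^sup>+x. ennreal \<bar>f x\<bar> \<partial>lebesgue_on A)"
  unfolding lpn_restrict by simp

section \<open>Calculus of smooth functions\<close>

lemma frechet_derivative_Basis:
  fixes f :: "'a::euclidean_space \<Rightarrow> real"
  assumes "f differentiable (at x)"
  shows "frechet_derivative f (at x) h = (\<Sum>b\<in>Basis. (h \<bullet> b) * frechet_derivative f (at x) b)"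
proof -
  interpret linear "frechet_derivative f (at x)"
    using assms by (rule linear_frechet_derivative)
  have "frechet_derivative f (at x) h = frechet_derivative f (at x) (\<Sum>b\<in>Basis. (h \<bullet> b) *\<^sub>R b)"
    by (simp add: euclidean_representation)
  also have "\<dots> = (\<Sum>b\<in>Basis. (h \<bullet> b) * frechet_derivative f (at x) b)"
    by (simp add: sum scale)
  finally show ?thesis .
qed

lemma frechet_derivative_eqI: "(f has_derivative f') (at x) \<Longrightarrow> frechet_derivative f (at x) h = f' h"
  using frechet_derivative_at by metis

lemma frechet_derivative_line:
  fixes f :: "'a::euclidean_space \<Rightarrow> real"
  assumes "f differentiable (at (x + t *\<^sub>R b))"
  shows "((\<lambda>t. f (x + t *\<^sub>R b)) has_real_derivative frechet_derivative f (at (x + t *\<^sub>R b)) b) (at t)"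
proof -
  have 1: "(f has_derivative frechet_derivative f (at (x + t *\<^sub>R b))) (at (x + t *\<^sub>R b))"
    using assms by (simp add: frechet_derivative_works)
  have 2: "((\<lambda>t. x + t *\<^sub>R b) has_derivative (\<lambda>s. s *\<^sub>R b)) (at t)"
    by (auto intro!: derivative_eq_intros)
  have "((\<lambda>t. f (x + t *\<^sub>R b)) has_derivative (\<lambda>s. frechet_derivative f (at (x + t *\<^sub>R b)) (s *\<^sub>R b))) (at t)"
    using has_derivative_compose[OF 2 1] .
  moreover have "(\<lambda>s. frechet_derivative f (at (x + t *\<^sub>R b)) (s *\<^sub>R b)) = (*) (frechet_derivative f (at (x + t *\<^sub>R b)) b)"
    using linear_scale[OF linear_frechet_derivative[OF assms]] by (auto simp: fun_eq_iff)
  ultimately show ?thesis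
    unfolding has_field_derivative_def by argo
qed

lemma smooth_funD: "smooth_fun f \<Longrightarrow> set bs \<subseteq> Basis \<Longrightarrow> iter_partial bs f differentiable (at x)"
  by (simp add: smooth_fun_def)

lemma smooth_fun_differentiable: "smooth_fun f \<Longrightarrow> f differentiable (at x)"
  using smooth_funD[of f "[]"] by simp

lemma iter_partial_append: "iter_partial (cs @ bs) f = iter_partial cs (iter_partial bs f)"
  by (induction cs) auto

lemma smooth_fun_iter_partial: "smooth_fun f \<Longrightarrow> set bs \<subseteq> Basis \<Longrightarrow> smooth_fun (iter_partial bs f)"
  by (auto simp: smooth_fun_def simp flip: iter_partial_append)

lemma smooth_fun_continuous_on: "smooth_fun f \<Longrightarrow> continuous_on S f"
  by (intro differentiable_imp_continuous_on)
    (auto simp: differentiable_on_def intro: differentiable_at_withinI smooth_fun_differentiable)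

lemma smooth_fun_borel: "smooth_fun f \<Longrightarrow> f \<in> borel_measurable borel"
  by (intro borel_measurable_continuous_onI smooth_fun_continuous_on)

lemma smooth_fun_measurable_lebesgue_on: "smooth_fun f \<Longrightarrow> f \<in> borel_measurable (lebesgue_on A)"
  by (intro measurable_restrict_space1 measurable_completion) (simp add: smooth_fun_borel)

lemma iter_partial_diff:
  assumes "smooth_fun f" "smooth_fun g" "set bs \<subseteq> Basis"
  shows "iter_partial bs (\<lambda>x. f x - g x) = (\<lambda>x. iter_partial bs f x - iter_partial bs g x)"
  using assms(3)
proof (induction bs)
  case (Cons b bs)
  then have IH: "iter_partial bs (\<lambda>x. f x - g x) = (\<lambda>x. iter_partial bs f x - iter_partial bs g x)" by auto
  show ?case
  proof
    fix x
    have "((\<lambda>x. iter_partial bs f x - iter_partial bs g x) has_derivative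
      (\<lambda>h. frechet_derivative (iter_partial bs f) (at x) h - frechet_derivative (iter_partial bs g) (at x) h)) (at x)"
      using Cons.prems assms by (intro has_derivative_diff) (auto simp flip: frechet_derivative_works intro: smooth_funD)
    from frechet_derivative_eqI[OF this, of b]
    show "iter_partial (b # bs) (\<lambda>x. f x - g x) x = iter_partial (b # bs) f x - iter_partial (b # bs) g x"
      by (simp add: IH)
  qed
qed simp

lemma smooth_fun_diff:
  assumes "smooth_fun f" "smooth_fun g" shows "smooth_fun (\<lambda>x. f x - g x)"
  unfolding smooth_fun_def
proof (intro allI impI)
  fix bs :: "'a list" and x assume "set bs \<subseteq> Basis"
  then show "iter_partial bs (\<lambda>x. f x - g x) differentiable at x"
    using assms by (simp add: iter_partial_diff smooth_funD)
qed

text \<open>The map sends every coordinate vector to a multiple of a coordinate vector, possibly of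
  another space, so each partial derivative of the composition is a single term. Reflections, the
  squeezing of the strip and the embedding of a horizontal slice are all of this kind.\<close>

lemma iter_partial_compose:
  fixes L :: "'a::euclidean_space \<Rightarrow> 'b::euclidean_space"
  assumes F: "smooth_fun F" and L: "\<And>x. (L has_derivative L') (at x)"
    and b: "\<And>b. b \<in> Basis \<Longrightarrow> L' b = l b *\<^sub>R e b" "\<And>b. b \<in> Basis \<Longrightarrow> e b \<in> Basis"
    and bs: "set bs \<subseteq> Basis"
  shows "iter_partial bs (\<lambda>x. F (L x)) = (\<lambda>x. prod_list (map l bs) * iter_partial (map e bs) F (L x))"
  using bs
proof (induction bs)
  case (Cons c bs)
  then have IH: "iter_partial bs (\<lambda>x. F (L x)) = (\<lambda>x. prod_list (map l bs) * iter_partial (map e bs) F (L x))" by auto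
  have sub: "set (map e bs) \<subseteq> Basis" using Cons.prems b(2) by auto
  show ?case
  proof
    fix x
    let ?D = "frechet_derivative (iter_partial (map e bs) F) (at (L x))"
    have d: "iter_partial (map e bs) F differentiable (at (L x))"
      using sub by (intro smooth_funD F)
    have "((\<lambda>x. iter_partial (map e bs) F (L x)) has_derivative (\<lambda>h. ?D (L' h))) (at x)"
      using d by (intro has_derivative_compose[OF L]) (simp add: frechet_derivative_works)
    then have "((\<lambda>x. prod_list (map l bs) * iter_partial (map e bs) F (L x)) has_derivative (\<lambda>h. prod_list (map l bs) * ?D (L' h))) (at x)"
      by (intro has_derivative_mult_right)
    from frechet_derivative_eqI[OF this, of c]
    have "iter_partial (c # bs) (\<lambda>x. F (L x)) x = prod_list (map l bs) * ?D (L' c)"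
      by (simp add: IH)
    also have "?D (L' c) = l c * ?D (e c)"
      using Cons.prems b(1)[of c] linear_scale[OF linear_frechet_derivative[OF d]] by simp
    finally show "iter_partial (c # bs) (\<lambda>x. F (L x)) x = prod_list (map l (c # bs)) * iter_partial (map e (c # bs)) F (L x)"
      by simp
  qed
qed simp

lemma smooth_fun_compose:
  fixes L :: "'a::euclidean_space \<Rightarrow> 'b::euclidean_space"
  assumes F: "smooth_fun F" and L: "\<And>x. (L has_derivative L') (at x)"
    and b: "\<And>b. b \<in> Basis \<Longrightarrow> L' b = l b *\<^sub>R e b" "\<And>b. b \<in> Basis \<Longrightarrow> e b \<in> Basis"
  shows "smooth_fun (\<lambda>x. F (L x))"
  unfolding smooth_fun_def
proof (intro allI impI)
  fix bs :: "'a list" and x assume bs: "set bs \<subseteq> Basis"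
  then have "set (map e bs) \<subseteq> Basis" using b(2) by auto
  then have "iter_partial (map e bs) F differentiable (at (L x))" by (intro smooth_funD F)
  moreover have "L differentiable (at x)" using L by (auto simp: differentiable_def)
  ultimately have "(\<lambda>x. iter_partial (map e bs) F (L x)) differentiable (at x)"
    using differentiable_chain_at[of L x "iter_partial (map e bs) F"] by (simp add: o_def)
  then show "iter_partial bs (\<lambda>x. F (L x)) differentiable at x"
    by (subst iter_partial_compose[OF F L b bs]) auto
qed

section \<open>Symmetry of the mixed partial derivatives\<close>

lemma second_difference_mvt:
  fixes f :: "'a::euclidean_space \<Rightarrow> real"
  assumes f: "smooth_fun f" and ab: "a \<in> Basis" "b \<in> Basis" and s: "0 < s"
  shows "\<exists>z. norm (z - x) \<le> 2 * s \<and>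
    f (x + s *\<^sub>R a + s *\<^sub>R b) - f (x + s *\<^sub>R a) - f (x + s *\<^sub>R b) + f x = s\<^sup>2 * iter_partial [b, a] f z"
proof -
  define fa where "fa = iter_partial [a] f"
  have fa: "fa y = frechet_derivative f (at y) a" for y by (simp add: fa_def)
  have sfa: "smooth_fun fa" unfolding fa_def using f ab by (intro smooth_fun_iter_partial) auto
  have d1: "((\<lambda>t. f (x + s *\<^sub>R b + t *\<^sub>R a) - f (x + t *\<^sub>R a)) has_real_derivative fa (x + s *\<^sub>R b + t *\<^sub>R a) - fa (x + t *\<^sub>R a)) (at t)" for t
    unfolding fa by (intro DERIV_diff frechet_derivative_line smooth_fun_differentiable f)
  obtain u where u: "0 < u" "u < s"
    "(f (x + s *\<^sub>R b + s *\<^sub>R a) - f (x + s *\<^sub>R a)) - (f (x + s *\<^sub>R b + 0 *\<^sub>R a) - f (x + 0 *\<^sub>R a)) = (s - 0) * (fa (x + s *\<^sub>R b + u *\<^sub>R a) - fa (x + u *\<^sub>R a))"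
    using MVT2[OF s d1] by blast
  have d2: "((\<lambda>t. fa ((x + u *\<^sub>R a) + t *\<^sub>R b)) has_real_derivative frechet_derivative fa (at ((x + u *\<^sub>R a) + t *\<^sub>R b)) b) (at t)" for t
    by (intro frechet_derivative_line smooth_fun_differentiable sfa)
  obtain v where v: "0 < v" "v < s" "fa ((x + u *\<^sub>R a) + s *\<^sub>R b) - fa ((x + u *\<^sub>R a) + 0 *\<^sub>R b) = (s - 0) * frechet_derivative fa (at ((x + u *\<^sub>R a) + v *\<^sub>R b)) b"
    using MVT2[OF s d2] by blast
  show ?thesis
  proof (intro exI conjI)
    show "norm ((x + u *\<^sub>R a + v *\<^sub>R b) - x) \<le> 2 * s"
      using norm_triangle_ineq[of "u *\<^sub>R a" "v *\<^sub>R b"] u v ab by (simp add: add.assoc)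
    show "f (x + s *\<^sub>R a + s *\<^sub>R b) - f (x + s *\<^sub>R a) - f (x + s *\<^sub>R b) + f x = s\<^sup>2 * iter_partial [b, a] f (x + u *\<^sub>R a + v *\<^sub>R b)"
      using u(3) v(3) by (simp add: power2_eq_square fa_def add_ac)
  qed
qed

text \<open>The second difference is symmetric in the two directions, and by
  \<open>second_difference_mvt\<close> it equals s^2 times either mixed derivative at some point
  within distance 2 s of x. Continuity of both mixed derivatives at x excludes different
  values.\<close>

lemma iter_partial_commute2:
  fixes f :: "'a::euclidean_space \<Rightarrow> real"
  assumes f: "smooth_fun f" and ab: "a \<in> Basis" "b \<in> Basis"
  shows "iter_partial [a, b] f = iter_partial [b, a] f"
proof (rule ext, rule ccontr)
  fix x
  assume ne: "iter_partial [a, b] f x \<noteq> iter_partial [b, a] f x"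
  define e where "e = \<bar>iter_partial [a, b] f x - iter_partial [b, a] f x\<bar> / 2"
  have e: "0 < e" using ne by (simp add: e_def)
  have c: "isCont (iter_partial bs f) x" if "set bs \<subseteq> Basis" for bs
    using smooth_funD[OF f that] by (rule differentiable_imp_continuous_within)
  obtain d1 where d1: "0 < d1" "\<And>z. dist z x < d1 \<Longrightarrow> dist (iter_partial [a, b] f z) (iter_partial [a, b] f x) < e"
    using c[of "[a, b]"] ab e unfolding continuous_at_eps_delta by (auto simp: subset_iff)
  obtain d2 where d2: "0 < d2" "\<And>z. dist z x < d2 \<Longrightarrow> dist (iter_partial [b, a] f z) (iter_partial [b, a] f x) < e"
    using c[of "[b, a]"] ab e unfolding continuous_at_eps_delta by (auto simp: subset_iff)
  \<comment> \<open>A third of the smaller radius, so that all points at distance at most 2 s lie in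
    both neighbourhoods.\<close>
  define s where "s = min d1 d2 / 3"
  have s: "0 < s" "2 * s < d1" "2 * s < d2" using d1(1) d2(1) by (auto simp: s_def)
  obtain z1 where z1: "norm (z1 - x) \<le> 2 * s"
    "f (x + s *\<^sub>R b + s *\<^sub>R a) - f (x + s *\<^sub>R b) - f (x + s *\<^sub>R a) + f x = s\<^sup>2 * iter_partial [a, b] f z1"
    using second_difference_mvt[OF f ab(2,1) s(1)] by blast
  obtain z2 where z2: "norm (z2 - x) \<le> 2 * s"
    "f (x + s *\<^sub>R a + s *\<^sub>R b) - f (x + s *\<^sub>R a) - f (x + s *\<^sub>R b) + f x = s\<^sup>2 * iter_partial [b, a] f z2"
    using second_difference_mvt[OF f ab s(1)] by blast
  have "s\<^sup>2 * iter_partial [a, b] f z1 = s\<^sup>2 * iter_partial [b, a] f z2"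
    unfolding z1(2)[symmetric] z2(2)[symmetric] by (simp add: algebra_simps)
  then have "iter_partial [a, b] f z1 = iter_partial [b, a] f z2" using s by simp
  moreover have "dist (iter_partial [a, b] f z1) (iter_partial [a, b] f x) < e"
    using z1 s by (intro d1) (auto simp: dist_norm)
  moreover have "dist (iter_partial [b, a] f z2) (iter_partial [b, a] f x) < e"
    using z2 s by (intro d2) (auto simp: dist_norm)
  moreover have "False" if "u = v" "dist u A < \<bar>A - B\<bar> / 2" "dist v B < \<bar>A - B\<bar> / 2" for u v A B :: real
    using that unfolding dist_real_def by (cases "A \<le> B") (auto simp: abs_if split: if_splits)
  ultimately show False unfolding e_def by metis
qed

lemma iter_partial_move:
  assumes "smooth_fun f" "set xs \<subseteq> Basis" "b \<in> Basis" "set ys \<subseteq> Basis"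
  shows "iter_partial (xs @ b # ys) f = iter_partial (b # xs @ ys) f"
  using assms(2)
proof (induction xs)
  case (Cons a xs)
  define g where "g = iter_partial (xs @ ys) f"
  have g: "smooth_fun g" unfolding g_def using assms Cons.prems by (intro smooth_fun_iter_partial) auto
  have "iter_partial ((a # xs) @ b # ys) f = iter_partial [a] (iter_partial (xs @ b # ys) f)" by simp
  also have "\<dots> = iter_partial [a] (iter_partial (b # xs @ ys) f)" using Cons by (metis insert_subset list.simps(15))
  also have "\<dots> = iter_partial [a, b] g" by (simp add: g_def)
  also have "\<dots> = iter_partial [b, a] g" using g assms Cons.prems by (intro iter_partial_commute2) auto
  also have "\<dots> = iter_partial (b # (a # xs) @ ys) f" by (simp add: g_def)
  finally show ?case .
qed simp

text \<open>\<open>partial\<close> evaluates an arbitrary enumeration of its multi-index; this is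
  what makes the enumeration irrelevant for smooth functions.\<close>

lemma iter_partial_mset_eq:
  assumes "smooth_fun f" "set bs \<subseteq> Basis" "mset bs = mset cs"
  shows "iter_partial bs f = iter_partial cs f"
  using assms(2,3)
proof (induction bs arbitrary: cs)
  case (Cons b bs)
  then have "b \<in> set cs" by (metis list.set_intros(1) mset_eq_setD)
  then obtain xs ys where cs: "cs = xs @ b # ys" by (meson split_list)
  have m: "mset bs = mset (xs @ ys)" using Cons.prems(2) cs by simp
  have sub: "set (xs @ ys) \<subseteq> Basis" using m Cons.prems(1) by (metis mset_eq_setD set_subset_Cons subset_trans)
  have "iter_partial bs f = iter_partial (xs @ ys) f" using Cons.IH[OF _ m] Cons.prems by auto
  then have "iter_partial (b # bs) f = iter_partial (b # xs @ ys) f" by simp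
  also have "\<dots> = iter_partial cs f" unfolding cs using sub Cons.prems assms
    by (intro iter_partial_move[symmetric]) auto
  finally show ?case .
qed simp

lemma partial_mset:
  assumes "smooth_fun f" "set bs \<subseteq> Basis"
  shows "partial (mset bs) f = iter_partial bs f"
proof -
  have "mset (SOME cs. mset cs = mset bs) = mset bs" by (rule someI[of _ bs]) simp
  then show ?thesis unfolding partial_def
    using assms by (intro iter_partial_mset_eq[symmetric]) auto
qed

text \<open>The list is chosen before the function, so that one enumeration serves several smooth
  functions in the same argument.\<close>

lemma partial_eq_iter_partial:
  fixes \<alpha> :: "'a::euclidean_space multiset"
  assumes "set_mset \<alpha> \<subseteq> Basis"
  shows "\<exists>bs. set bs \<subseteq> Basis \<and> mset bs = \<alpha> \<and> (\<forall>f. smooth_fun f \<longrightarrow> partial \<alpha> f = iter_partial bs f)"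
proof -
  obtain bs where bs: "mset bs = \<alpha>" using ex_mset by blast
  then have "set bs \<subseteq> Basis" using assms by (metis set_mset_mset)
  then show ?thesis using bs partial_mset[of _ bs] by (intro exI[of _ bs]) auto
qed

lemma smooth_fun_partial:
  fixes f :: "'a::euclidean_space \<Rightarrow> real"
  assumes "smooth_fun f" "set_mset \<alpha> \<subseteq> Basis"
  shows "smooth_fun (partial \<alpha> f)"
proof -
  obtain bs where "set bs \<subseteq> Basis" "\<forall>f. smooth_fun f \<longrightarrow> partial \<alpha> f = iter_partial bs f"
    using partial_eq_iter_partial[OF assms(2)] by blast
  then show ?thesis using assms by (simp add: smooth_fun_iter_partial)
qed

lemma partial_empty [simp]: "partial {#} f = f"
  by (simp add: partial_def)

lemma partial_union:
  assumes "smooth_fun f" "set_mset \<alpha> \<subseteq> Basis" "set_mset \<beta> \<subseteq> Basis"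
  shows "partial (\<alpha> + \<beta>) f = partial \<alpha> (partial \<beta> f)"
proof -
  obtain as where as: "mset as = \<alpha>" using ex_mset by blast
  obtain bs where bs: "mset bs = \<beta>" using ex_mset by blast
  have sub: "set as \<subseteq> Basis" "set bs \<subseteq> Basis" using as bs assms by (metis set_mset_mset)+
  have "partial (\<alpha> + \<beta>) f = iter_partial (as @ bs) f"
    using partial_mset[of f "as @ bs"] as bs sub assms by simp
  also have "\<dots> = partial \<alpha> (partial \<beta> f)"
    unfolding iter_partial_append as[symmetric] bs[symmetric]
    using sub assms by (simp add: partial_mset smooth_fun_iter_partial)
  finally show ?thesis .
qed

lemma partial_single: "partial {#b#} f = (\<lambda>x. frechet_derivative f (at x) b)"
proof -
  have "(SOME cs. mset cs = {#b#}) = [b]" by simp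
  then show ?thesis unfolding partial_def by (simp only: iter_partial.simps)
qed

lemma partial_diff:
  fixes f g :: "'a::euclidean_space \<Rightarrow> real"
  assumes "smooth_fun f" "smooth_fun g" "set_mset \<alpha> \<subseteq> Basis"
  shows "partial \<alpha> (\<lambda>x. f x - g x) = (\<lambda>x. partial \<alpha> f x - partial \<alpha> g x)"
proof -
  obtain bs where "set bs \<subseteq> Basis" "\<forall>f. smooth_fun f \<longrightarrow> partial \<alpha> f = iter_partial bs f"
    using partial_eq_iter_partial[OF assms(3)] by blast
  then show ?thesis using assms by (simp add: iter_partial_diff smooth_fun_diff)
qed

section \<open>Supports and test functions\<close>

lemma iter_partial_eq_zero:
  assumes "open S" "\<And>x. x \<in> S \<Longrightarrow> f x = 0" "x \<in> S"
  shows "iter_partial bs f x = 0"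
  using assms(3)
proof (induction bs arbitrary: x)
  case (Cons b bs)
  have "((\<lambda>x. 0) has_derivative (\<lambda>h. 0)) (at x)" by simp
  then have "(iter_partial bs f has_derivative (\<lambda>h. 0)) (at x)"
    by (rule has_derivative_transform_within_open[OF _ assms(1) Cons.prems]) (simp add: Cons.IH)
  from frechet_derivative_eqI[OF this] show ?case by simp
qed (simp add: assms(2))

lemma partial_eq_zero:
  assumes "open S" "\<And>x. x \<in> S \<Longrightarrow> f x = 0" "x \<in> S"
  shows "partial \<alpha> f x = 0"
  unfolding partial_def by (rule iter_partial_eq_zero[OF assms])

lemma test_functions_zero: "x \<notin> closure {x. \<phi> x \<noteq> 0} \<Longrightarrow> \<phi> x = 0"
  using subsetD[OF closure_subset, of x "{x. \<phi> x \<noteq> 0}"] by (cases "\<phi> x = 0") simp_all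

lemma closure_support_partial: "closure {x. partial \<alpha> f x \<noteq> 0} \<subseteq> closure {x. f x \<noteq> 0}"
proof (rule closure_minimal)
  show "{x. partial \<alpha> f x \<noteq> 0} \<subseteq> closure {x. f x \<noteq> 0}"
  proof
    fix x assume "x \<in> {x. partial \<alpha> f x \<noteq> 0}"
    then have "partial \<alpha> f x \<noteq> 0" by simp
    moreover have "partial \<alpha> f x = 0" if "x \<notin> closure {x. f x \<noteq> 0}"
    proof (rule partial_eq_zero)
      show "open (- closure {x. f x \<noteq> 0})" by (simp add: open_Compl)
    qed (use that in \<open>auto intro: test_functions_zero\<close>)
    ultimately show "x \<in> closure {x. f x \<noteq> 0}" by blast
  qed
qed auto

lemma test_functions_partial:
  assumes "\<phi> \<in> test_functions \<Omega>" "set_mset \<alpha> \<subseteq> Basis"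
  shows "partial \<alpha> \<phi> \<in> test_functions \<Omega>"
proof -
  have c: "closure {x. partial \<alpha> \<phi> x \<noteq> 0} \<subseteq> closure {x. \<phi> x \<noteq> 0}" by (rule closure_support_partial)
  then have "compact (closure {x. partial \<alpha> \<phi> x \<noteq> 0})"
    using assms(1) compact_Int_closed[of "closure {x. \<phi> x \<noteq> 0}" "closure {x. partial \<alpha> \<phi> x \<noteq> 0}"]
    by (simp add: test_functions_def Int_absorb1)
  then show ?thesis using assms c by (auto simp: test_functions_def smooth_fun_partial)
qed

lemma test_functionsD:
  assumes "\<phi> \<in> test_functions \<Omega>"
  shows "smooth_fun \<phi>" "compact (closure {x. \<phi> x \<noteq> 0})" "closure {x. \<phi> x \<noteq> 0} \<subseteq> \<Omega>"
  using assms by (auto simp: test_functions_def)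

lemma test_functions_mono: "\<Omega> \<subseteq> \<Omega>' \<Longrightarrow> test_functions \<Omega> \<subseteq> test_functions \<Omega>'"
  by (auto simp: test_functions_def)

lemma compact_support_bounded:
  fixes \<phi> :: "'a::euclidean_space \<Rightarrow> real"
  assumes "continuous_on UNIV \<phi>" "compact K" "\<And>x. x \<notin> K \<Longrightarrow> \<phi> x = 0"
  obtains B where "0 < B" "\<And>x. \<bar>\<phi> x\<bar> \<le> B"
proof -
  have "compact (\<phi> ` K)" using assms by (intro compact_continuous_image) (auto intro: continuous_on_subset)
  then have "bounded (\<phi> ` K)" by (rule compact_imp_bounded)
  then obtain B where B: "0 < B" "\<And>y. y \<in> \<phi> ` K \<Longrightarrow> norm y \<le> B"
    by (auto simp: bounded_pos)
  have "\<bar>\<phi> x\<bar> \<le> B" for x using B assms(3)[of x] by (cases "x \<in> K") auto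
  then show ?thesis using B that by blast
qed

lemma test_functions_bounded:
  assumes "\<phi> \<in> test_functions \<Omega>"
  obtains B where "0 < B" "\<And>x. \<bar>\<phi> x\<bar> \<le> B"
  by (rule compact_support_bounded[OF smooth_fun_continuous_on[OF test_functionsD(1)[OF assms]] test_functionsD(2)[OF assms]
    test_functions_zero[of _ \<phi>]]) (assumption | rule that)+

section \<open>Integration by parts\<close>

lemma integrable_compact_support:
  fixes f :: "'a::euclidean_space \<Rightarrow> real"
  assumes "continuous_on UNIV f" "compact K" "\<And>x. x \<notin> K \<Longrightarrow> f x = 0"
  shows "integrable lborel f"
proof -
  have "integrable lborel (\<lambda>x. indicator K x *\<^sub>R f x)"
    using assms by (intro borel_integrable_compact) (auto intro: continuous_on_subset)
  moreover have "(\<lambda>x. indicator K x *\<^sub>R f x) = f" using assms(3) by (auto simp: indicator_def fun_eq_iff)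
  ultimately show ?thesis by simp
qed

lemma lborel_integral_translate:
  fixes f :: "'a::euclidean_space \<Rightarrow> real"
  assumes [measurable]: "f \<in> borel_measurable borel"
  shows "(\<integral>x. f (x + c) \<partial>lborel) = (\<integral>x. f x \<partial>lborel)"
proof -
  have "(\<integral>x. f x \<partial>lborel) = (\<integral>x. f x \<partial>distr lborel borel ((+) c))"
    by (simp add: lborel_distr_plus)
  also have "\<dots> = (\<integral>x. f (x + c) \<partial>lborel)"
    by (subst integral_distr) (auto simp: add.commute)
  finally show ?thesis by simp
qed

lemma lborel_nn_integral_translate:
  fixes f :: "'a::euclidean_space \<Rightarrow> ennreal"
  assumes [measurable]: "f \<in> borel_measurable borel"
  shows "(\<integral>\<^sup>+x. f (x + c) \<partial>lborel) = (\<integral>\<^sup>+x. f x \<partial>lborel)"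
proof -
  have "(\<integral>\<^sup>+x. f x \<partial>lborel) = (\<integral>\<^sup>+x. f x \<partial>distr lborel borel ((+) c))"
    by (simp add: lborel_distr_plus)
  also have "\<dots> = (\<integral>\<^sup>+x. f (x + c) \<partial>lborel)"
    by (subst nn_integral_distr) (auto simp: add.commute)
  finally show ?thesis by simp
qed

text \<open>The integral of a directional derivative is the limit of integrals of difference quotients, which
  vanish by translation invariance.\<close>

lemma integral_frechet_derivative_zero:
  fixes f :: "'a::euclidean_space \<Rightarrow> real"
  assumes d: "\<And>x. f differentiable (at x)" and c: "continuous_on UNIV (\<lambda>x. frechet_derivative f (at x) b)"
    and K: "compact K" "\<And>x. x \<notin> K \<Longrightarrow> f x = 0" and b: "b \<in> Basis"
  shows "(\<integral>x. frechet_derivative f (at x) b \<partial>lborel) = 0"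
proof -
  have cf: "continuous_on UNIV f"
    using d by (simp add: differentiable_imp_continuous_on differentiable_at_imp_differentiable_on)
  have fb[measurable]: "f \<in> borel_measurable borel" using cf by (rule borel_measurable_continuous_onI)
  have db[measurable]: "(\<lambda>x. frechet_derivative f (at x) b) \<in> borel_measurable borel"
    using c by (rule borel_measurable_continuous_onI)
  have zero: "frechet_derivative f (at x) b = 0" if "x \<notin> K" for x
    using iter_partial_eq_zero[of "-K" f x "[b]"] that K by (auto simp: compact_imp_closed open_Compl)
  obtain B where B: "0 < B" "\<And>x. \<bar>frechet_derivative f (at x) b\<bar> \<le> B"
    using compact_support_bounded[OF c K(1) zero] by blast
  obtain r where r: "0 < r" "\<And>x. x \<in> K \<Longrightarrow> norm x \<le> r"
    using compact_imp_bounded[OF K(1)] by (auto simp: bounded_pos)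
  define t where "t n = 1 / (real n + 1)" for n
  have t: "0 < t n" "t n \<le> 1" for n by (auto simp: t_def)
  have tlim: "t \<longlonglongrightarrow> 0" unfolding t_def by real_asymp
  define q where "q n x = (f (x + t n *\<^sub>R b) - f x) / t n" for n x
  have mv: "\<bar>q n x\<bar> \<le> B" for n x
  proof -
    have "\<exists>z. 0 < z \<and> z < t n \<and> f (x + t n *\<^sub>R b) - f (x + 0 *\<^sub>R b) = (t n - 0) * frechet_derivative f (at (x + z *\<^sub>R b)) b"
      using t by (intro MVT2 frechet_derivative_line d) auto
    then obtain z where "f (x + t n *\<^sub>R b) - f x = t n * frechet_derivative f (at (x + z *\<^sub>R b)) b" by auto
    then show ?thesis using B(2)[of "x + z *\<^sub>R b"] t(1)[of n] by (simp add: q_def)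
  qed
  have "(\<lambda>n. \<integral>x. q n x \<partial>lborel) \<longlonglongrightarrow> (\<integral>x. frechet_derivative f (at x) b \<partial>lborel)"
  \<comment> \<open>All shifts \<open>t n\<close> are at most 1, so the quotients vanish outside the
    ball of radius \<open>r + 1\<close>; inside, the mean value theorem bounds them by
    \<open>B\<close>.\<close>
  proof (rule integral_dominated_convergence[where w = "\<lambda>x. indicator (cball 0 (r + 1)) x *\<^sub>R B"])
    show "integrable lborel (\<lambda>x::'a. indicator (cball 0 (r + 1)) x *\<^sub>R B)"
      by (intro borel_integrable_compact) auto
    show "q n \<in> borel_measurable lborel" for n unfolding q_def by measurable
    show "AE x in lborel. (\<lambda>n. q n x) \<longlonglongrightarrow> frechet_derivative f (at x) b"
    proof (intro AE_I2)
      fix x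
      have "((\<lambda>t. f (x + t *\<^sub>R b)) has_real_derivative frechet_derivative f (at (x + 0 *\<^sub>R b)) b) (at 0)"
        by (intro frechet_derivative_line d)
      then have "((\<lambda>h. (f (x + h *\<^sub>R b) - f x) / h) \<longlongrightarrow> frechet_derivative f (at x) b) (at 0)"
        by (simp add: DERIV_def)
      moreover have "filterlim t (at 0) sequentially"
        using tlim t(1) by (simp add: filterlim_at less_imp_neq[symmetric])
      ultimately show "(\<lambda>n. q n x) \<longlonglongrightarrow> frechet_derivative f (at x) b"
        unfolding q_def by (rule filterlim_compose)
    qed
    fix n
    show "AE x in lborel. norm (q n x) \<le> indicator (cball 0 (r + 1)) x *\<^sub>R B"
    proof (intro AE_I2)
      fix x
      show "norm (q n x) \<le> indicator (cball 0 (r + 1)) x *\<^sub>R B"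
      proof (cases "x \<in> cball 0 (r + 1)")
        case False
        then have nx: "norm x > r + 1" by simp
        then have "x \<notin> K" using r by force
        moreover have "norm (x + t n *\<^sub>R b) > r"
          using norm_diff_ineq[of x "t n *\<^sub>R b"] t[of n] b nx by simp
        then have "x + t n *\<^sub>R b \<notin> K" using r by force
        ultimately have "q n x = 0" using K by (simp add: q_def)
        then show ?thesis using B by simp
      qed (use mv in auto)
    qed
  qed auto
  moreover have "(\<integral>x. q n x \<partial>lborel) = 0" for n
  proof -
    have i: "integrable lborel f" using cf K by (rule integrable_compact_support)
    have i2: "integrable lborel (\<lambda>x. f (x + t n *\<^sub>R b))"
    proof (rule integrable_compact_support)
      show "continuous_on UNIV (\<lambda>x. f (x + t n *\<^sub>R b))"
        by (rule continuous_on_compose2[OF cf]) (auto intro!: continuous_intros)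
      show "compact (cball (0::'a) (r + 1))" by simp
      fix x :: 'a assume "x \<notin> cball 0 (r + 1)"
      then have "norm (x + t n *\<^sub>R b) > r"
        using norm_diff_ineq[of x "t n *\<^sub>R b"] t[of n] b by simp
      then show "f (x + t n *\<^sub>R b) = 0" using r K by force
    qed
    show ?thesis unfolding q_def using i i2 by (simp add: lborel_integral_translate)
  qed
  ultimately have "(\<lambda>n::nat. 0) \<longlonglongrightarrow> (\<integral>x. frechet_derivative f (at x) b \<partial>lborel)" by simp
  then show ?thesis using LIMSEQ_unique[OF _ tendsto_const] by metis
qed

lemma integral_by_parts_partial:
  assumes V: "smooth_fun V" and f: "smooth_fun f" and K: "compact K" "\<And>x. x \<notin> K \<Longrightarrow> f x = 0" and b: "b \<in> Basis"
  shows "(\<integral>x. V x * frechet_derivative f (at x) b \<partial>lborel) = - (\<integral>x. frechet_derivative V (at x) b * f x \<partial>lborel)"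
proof -
  have der: "((\<lambda>x. V x * f x) has_derivative (\<lambda>h. V x * frechet_derivative f (at x) h + frechet_derivative V (at x) h * f x)) (at x)" for x
    using V f by (intro has_derivative_mult) (auto simp flip: frechet_derivative_works intro: smooth_fun_differentiable)
  have fr: "frechet_derivative (\<lambda>x. V x * f x) (at x) b = V x * frechet_derivative f (at x) b + frechet_derivative V (at x) b * f x" for x
    by (rule frechet_derivative_eqI[OF der])
  have cV: "continuous_on UNIV (\<lambda>x. frechet_derivative V (at x) b)"
    using smooth_fun_continuous_on[OF smooth_fun_iter_partial[OF V, of "[b]"]] b by simp
  have cf: "continuous_on UNIV (\<lambda>x. frechet_derivative f (at x) b)"
    using smooth_fun_continuous_on[OF smooth_fun_iter_partial[OF f, of "[b]"]] b by simp
  note c = cV cf smooth_fun_continuous_on[OF V] smooth_fun_continuous_on[OF f]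
  have zero: "frechet_derivative f (at x) b = 0" if "x \<notin> K" for x
    using iter_partial_eq_zero[of "-K" f x "[b]"] that K by (auto simp: compact_imp_closed open_Compl)
  have "0 = (\<integral>x. frechet_derivative (\<lambda>x. V x * f x) (at x) b \<partial>lborel)"
  proof (rule integral_frechet_derivative_zero[symmetric, OF _ _ K(1) _ b])
    show "continuous_on UNIV (\<lambda>x. frechet_derivative (\<lambda>x. V x * f x) (at x) b)"
      unfolding fr by (intro continuous_intros c)
  qed (use der K in \<open>auto simp: differentiable_def\<close>)
  also have "\<dots> = (\<integral>x. V x * frechet_derivative f (at x) b \<partial>lborel) + (\<integral>x. frechet_derivative V (at x) b * f x \<partial>lborel)"
    unfolding fr using K zero
    by (intro Bochner_Integration.integral_add integrable_compact_support[OF _ K(1)] continuous_intros c) auto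
  finally show ?thesis by simp
qed

text \<open>The outermost derivative of f is moved first and then sits innermost on V, which
  reverses the list. All products inherit the compact support of f.\<close>

lemma integral_by_parts_iter_partial:
  assumes "smooth_fun V" "smooth_fun f" "compact K" "\<And>x. x \<notin> K \<Longrightarrow> f x = 0" "set bs \<subseteq> Basis"
  shows "(\<integral>x. V x * iter_partial bs f x \<partial>lborel) = (- 1) ^ length bs * (\<integral>x. iter_partial (rev bs) V x * f x \<partial>lborel)"
  using assms(1,5)
proof (induction bs arbitrary: V)
  case (Cons b bs)
  have z: "iter_partial bs f x = 0" if "x \<notin> K" for x
    using that assms by (intro iter_partial_eq_zero[of "-K"]) (auto simp: compact_imp_closed open_Compl)
  have sb: "smooth_fun (iter_partial bs f)" using Cons assms by (intro smooth_fun_iter_partial) auto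
  have "(\<integral>x. V x * iter_partial (b # bs) f x \<partial>lborel) = - (\<integral>x. iter_partial [b] V x * iter_partial bs f x \<partial>lborel)"
    using integral_by_parts_partial[OF Cons.prems(1) sb assms(3) z, of b] Cons.prems by simp
  also have "\<dots> = - ((- 1) ^ length bs * (\<integral>x. iter_partial (rev bs) (iter_partial [b] V) x * f x \<partial>lborel))"
    using Cons.prems by (subst Cons.IH) (auto intro: smooth_fun_iter_partial[of V "[b]", simplified])
  finally show ?case by (simp add: iter_partial_append)
qed simp

lemma integral_by_parts:
  assumes "smooth_fun V" "\<phi> \<in> test_functions \<Omega>" "set_mset \<alpha> \<subseteq> Basis"
  shows "(\<integral>x. V x * partial \<alpha> \<phi> x \<partial>lborel) = (- 1) ^ size \<alpha> * (\<integral>x. partial \<alpha> V x * \<phi> x \<partial>lborel)"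
proof -
  obtain bs where bs: "set bs \<subseteq> Basis" "mset bs = \<alpha>" using partial_eq_iter_partial[OF assms(3)] by blast
  have "partial \<alpha> V = iter_partial (rev bs) V" "partial \<alpha> \<phi> = iter_partial bs \<phi>"
    using partial_mset[of V "rev bs"] partial_mset[of \<phi> bs] bs assms(1) test_functionsD(1)[OF assms(2)] by auto
  moreover have "length bs = size \<alpha>" using bs(2) by auto
  ultimately show ?thesis
    using integral_by_parts_iter_partial[OF assms(1) test_functionsD(1,2)[OF assms(2)] test_functions_zero[of _ \<phi>] bs(1)] by simp
qed

section \<open>Mollifiers\<close>

text \<open>Differentiability n times on the whole line, with the derivative as a witness: sums,
  products and affine substitutions are then handled by induction on n with arbitrary functions.
  Smoothness is \<open>diffn n f\<close> for all n.\<close>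

primrec diffn :: "nat \<Rightarrow> (real \<Rightarrow> real) \<Rightarrow> bool" where
  "diffn 0 f \<longleftrightarrow> True"
| "diffn (Suc n) f \<longleftrightarrow> (\<exists>f'. (\<forall>t. (f has_real_derivative f' t) (at t)) \<and> diffn n f')"

lemma diffn_SucD: "diffn (Suc n) f \<Longrightarrow> diffn n f"
proof (induction n arbitrary: f)
  case (Suc n)
  from Suc.prems obtain f' where "\<forall>t. (f has_real_derivative f' t) (at t)" "diffn (Suc n) f'"
    unfolding diffn.simps(2)[of "Suc n"] by blast
  then show ?case using Suc.IH[of f'] unfolding diffn.simps(2)[of n f] by blast
qed simp

lemma diffn_add: "diffn n f \<Longrightarrow> diffn n g \<Longrightarrow> diffn n (\<lambda>t. f t + g t)"
proof (induction n arbitrary: f g)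
  case (Suc n)
  then obtain f' g' where "\<And>t. (f has_real_derivative f' t) (at t)" "diffn n f'"
    "\<And>t. (g has_real_derivative g' t) (at t)" "diffn n g'" by auto
  then show ?case using Suc.IH[of f' g'] by (auto intro!: exI[of _ "\<lambda>t. f' t + g' t"] DERIV_add)
qed simp

lemma diffn_mult: "diffn n f \<Longrightarrow> diffn n g \<Longrightarrow> diffn n (\<lambda>t. f t * g t)"
proof (induction n arbitrary: f g)
  case (Suc n)
  then obtain f' g' where fg: "\<And>t. (f has_real_derivative f' t) (at t)" "diffn n f'"
    "\<And>t. (g has_real_derivative g' t) (at t)" "diffn n g'" by auto
  have "diffn n (\<lambda>t. f' t * g t + g' t * f t)"
    by (rule diffn_add[OF Suc.IH[OF fg(2) diffn_SucD[OF Suc.prems(2)]] Suc.IH[OF fg(4) diffn_SucD[OF Suc.prems(1)]]])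
  then show ?case using fg by (auto intro!: exI[of _ "\<lambda>t. f' t * g t + g' t * f t"] DERIV_mult)
qed simp

lemma diffn_const: "diffn n (\<lambda>t. c)"
  by (induction n arbitrary: c) (auto intro!: exI[of _ "\<lambda>t. 0"])

lemma diffn_affine: "diffn n f \<Longrightarrow> diffn n (\<lambda>t. f (c * t + d))"
proof (induction n arbitrary: f)
  case (Suc n)
  then obtain f' where f: "\<And>t. (f has_real_derivative f' t) (at t)" "diffn n f'" by auto
  have "diffn n (\<lambda>t. c * f' (c * t + d))" using f by (intro diffn_mult diffn_const Suc.IH)
  moreover have "((\<lambda>t. f (c * t + d)) has_real_derivative c * f' (c * t + d)) (at t)" for t
  proof -
    have "((\<lambda>t. c * t + d) has_real_derivative c) (at t)" by (auto intro!: derivative_eq_intros)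
    from DERIV_chain2[OF f(1) this] show ?thesis by (simp add: mult.commute)
  qed
  ultimately show ?case unfolding diffn.simps(2) by (intro exI[of _ "\<lambda>t. c * f' (c * t + d)"] conjI allI)
qed simp

text \<open>By uniqueness of derivatives the witnesses obtained for the various n all coincide with
  \<open>deriv f\<close>.\<close>

lemma diffn_deriv:
  assumes "\<And>n. diffn n f"
  shows "(f has_real_derivative deriv f t) (at t)" "diffn n (deriv f)"
proof -
  have *: "\<exists>f'. (\<forall>t. (f has_real_derivative f' t) (at t)) \<and> diffn n f'" for n
    using assms[of "Suc n"] unfolding diffn.simps .
  have d: "deriv f = f'" if "\<forall>t. (f has_real_derivative f' t) (at t)" for f'
    by (rule ext) (rule DERIV_imp_deriv[OF that[rule_format]])
  obtain f' where "\<forall>t. (f has_real_derivative f' t) (at t)" "diffn n f'" using *[of n] by blast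
  then show "(f has_real_derivative deriv f t) (at t)" "diffn n (deriv f)"
    using d[of f'] by simp_all
qed

lemma diffn_funpow_deriv: "(\<And>n. diffn n f) \<Longrightarrow> diffn n ((deriv ^^ k) f)"
  by (induction k arbitrary: n) (auto intro: diffn_deriv(2))

text \<open>The classical flat function exp(-1/t) for positive t, with a polynomial in 1/t as a
  factor. This family is closed under differentiation: the derivative belongs to the polynomial X^2
  (P - P').\<close>

definition flat :: "real poly \<Rightarrow> real \<Rightarrow> real" where
  "flat P t = (if t \<le> 0 then 0 else poly P (1 / t) * exp (- (1 / t)))"

lemma poly_exp_tendsto_0: "((\<lambda>s. poly P s * exp (- s)) \<longlongrightarrow> 0) (at_top :: real filter)"
proof -
  have "((\<lambda>s. \<Sum>i\<le>degree P. coeff P i * (s ^ i / exp s)) \<longlongrightarrow> (\<Sum>i\<le>degree P. coeff P i * 0)) (at_top :: real filter)"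
    by (intro tendsto_sum tendsto_mult tendsto_const tendsto_power_div_exp_0)
  moreover have "poly P s * exp (- s) = (\<Sum>i\<le>degree P. coeff P i * (s ^ i / exp s))" for s
    by (simp add: poly_altdef exp_minus sum_distrib_right divide_inverse mult.assoc)
  ultimately show ?thesis by simp
qed

lemma flat_has_derivative:
  "(flat P has_real_derivative flat ([:0, 0, 1:] * (P - pderiv P)) t) (at t)"
proof -
  consider "t < 0" | "t = 0" | "0 < t" by linarith
  then show ?thesis
  proof cases
    case 1
    have "((\<lambda>t. 0) has_real_derivative 0) (at t)" by simp
    then have "(flat P has_real_derivative 0) (at t)"
      by (rule has_field_derivative_transform_within_open[where S = "{..<0}"]) (use 1 in \<open>auto simp: flat_def\<close>)
    then show ?thesis using 1 by (simp add: flat_def)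
  next
    case 3
    have "((\<lambda>t. poly P (1 / t) * exp (- (1 / t))) has_real_derivative
      (poly (pderiv P) (1 / t) * (- (1 / t\<^sup>2))) * exp (- (1 / t)) + exp (- (1 / t)) * (1 / t\<^sup>2) * poly P (1 / t)) (at t)"
      using 3 by (auto intro!: derivative_eq_intros DERIV_chain2[OF poly_DERIV] simp: power2_eq_square field_simps)
    also have "(poly (pderiv P) (1 / t) * (- (1 / t\<^sup>2))) * exp (- (1 / t)) + exp (- (1 / t)) * (1 / t\<^sup>2) * poly P (1 / t)
       = flat ([:0, 0, 1:] * (P - pderiv P)) t"
      using 3 by (simp add: flat_def power2_eq_square field_simps)
    finally show ?thesis
      by (rule has_field_derivative_transform_within_open[where S = "{0<..}"]) (use 3 in \<open>auto simp: flat_def\<close>)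
  next
    \<comment> \<open>At 0 the difference quotient from the right is s P(s) exp(-s) with s = 1/h,
      and s tends to infinity.\<close>
    case 2
    have "((\<lambda>h. flat P h / h) \<longlongrightarrow> 0) (at 0)"
    proof (rule filterlim_split_at)
      show "((\<lambda>h. flat P h / h) \<longlongrightarrow> 0) (at_left 0)"
        by (rule tendsto_eventually) (auto simp: eventually_at_left_real flat_def intro!: eventually_at_leftI[of "-1"])
      have "((\<lambda>h. poly ([:0, 1:] * P) (inverse h) * exp (- inverse h)) \<longlongrightarrow> 0) (at_right 0)"
        by (rule filterlim_compose[OF poly_exp_tendsto_0 filterlim_inverse_at_top_right])
      then show "((\<lambda>h. flat P h / h) \<longlongrightarrow> 0) (at_right 0)"
        by (rule Lim_transform_eventually) (auto simp: flat_def field_simps intro!: eventually_at_rightI[of 0 1])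
    qed
    then show ?thesis using 2 by (simp add: DERIV_def flat_def)
  qed
qed

lemma diffn_flat: "diffn n (flat P)"
  by (induction n arbitrary: P) (use flat_has_derivative in auto)

text \<open>Equal to exp(-1/(a+t)) exp(-1/(a-t)) for |t| < a and 0 elsewhere. The factors 1 and -1
  give the arguments the form required by \<open>diffn_affine\<close>.\<close>

definition bump :: "real \<Rightarrow> real \<Rightarrow> real" where
  "bump a t = flat 1 (1 * t + a) * flat 1 (- 1 * t + a)"

lemma diffn_bump: "diffn n (bump a)"
  unfolding bump_def by (intro diffn_mult diffn_affine diffn_flat)

lemma bump_nonneg: "0 \<le> bump a t"
  by (simp add: bump_def flat_def)

lemma bump_zero: "a \<le> \<bar>t\<bar> \<Longrightarrow> bump a t = 0"
  by (auto simp: bump_def flat_def abs_if split: if_splits)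

lemma bump_pos: "0 < a \<Longrightarrow> 0 < bump a 0"
  by (simp add: bump_def flat_def)

text \<open>Each differentiation acts on a single factor, so that the result is again a product of
  functions of one coordinate each. For this reason the mollifier is built from a product supported
  in a cube and not from a function of the norm.\<close>

lemma iter_partial_prod:
  fixes f :: "real \<Rightarrow> real"
  assumes f: "\<And>n. diffn n f" and bs: "set bs \<subseteq> (Basis :: 'a::euclidean_space set)"
  shows "iter_partial bs (\<lambda>x. c * (\<Prod>b\<in>Basis. f (x \<bullet> b))) = (\<lambda>x. c * (\<Prod>b\<in>Basis. (deriv ^^ count (mset bs) b) f (x \<bullet> b)))"
    and "iter_partial bs (\<lambda>x. c * (\<Prod>b\<in>Basis. f (x \<bullet> b))) differentiable (at (x :: 'a))"
proof -
  have F: "((deriv ^^ k) f has_real_derivative (deriv ^^ Suc k) f t) (at t)" for k t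
    using diffn_deriv(1)[OF diffn_funpow_deriv[OF f]] by simp
  have D: "((\<lambda>x. c * (\<Prod>b\<in>Basis. (deriv ^^ k b) f (x \<bullet> b))) has_derivative
      (\<lambda>y. c * (\<Sum>i\<in>Basis. ((deriv ^^ Suc (k i)) f (x \<bullet> i) * (y \<bullet> i)) * (\<Prod>j\<in>Basis - {i}. (deriv ^^ k j) f (x \<bullet> j))))) (at x)"
    for k and x :: 'a
  proof (intro has_derivative_mult_right has_derivative_prod)
    fix i :: 'a
    show "((\<lambda>x. (deriv ^^ k i) f (x \<bullet> i)) has_derivative (\<lambda>y. (deriv ^^ Suc (k i)) f (x \<bullet> i) * (y \<bullet> i))) (at x)"
      using F[of "k i" "x \<bullet> i"] unfolding has_field_derivative_def
      by (rule has_derivative_compose[rotated]) (auto intro!: derivative_eq_intros)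
  qed
  show *: "iter_partial bs (\<lambda>x. c * (\<Prod>b\<in>Basis. f (x \<bullet> b))) = (\<lambda>x. c * (\<Prod>b\<in>Basis. (deriv ^^ count (mset bs) b) f (x \<bullet> b)))"
    using bs
  proof (induction bs)
    case (Cons e bs)
    then have IH: "iter_partial bs (\<lambda>x. c * (\<Prod>b\<in>Basis. f (x \<bullet> b))) = (\<lambda>x. c * (\<Prod>b\<in>Basis. (deriv ^^ count (mset bs) b) f (x \<bullet> b)))"
      and e: "e \<in> Basis" by auto
    show ?case
    proof
      fix x
      have "iter_partial (e # bs) (\<lambda>x. c * (\<Prod>b\<in>Basis. f (x \<bullet> b))) x
        = c * (\<Sum>i\<in>Basis. ((deriv ^^ Suc (count (mset bs) i)) f (x \<bullet> i) * (e \<bullet> i)) * (\<Prod>j\<in>Basis - {i}. (deriv ^^ count (mset bs) j) f (x \<bullet> j)))"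
        unfolding iter_partial.simps IH by (rule frechet_derivative_eqI[OF D])
      also have "\<dots> = c * (\<Sum>i\<in>Basis. if i = e then (deriv ^^ Suc (count (mset bs) i)) f (x \<bullet> i) * (\<Prod>j\<in>Basis - {i}. (deriv ^^ count (mset bs) j) f (x \<bullet> j)) else 0)"
        using e by (intro arg_cong[of _ _ "(*) c"] sum.cong) (auto simp: inner_Basis)
      also have "\<dots> = c * ((deriv ^^ Suc (count (mset bs) e)) f (x \<bullet> e) * (\<Prod>j\<in>Basis - {e}. (deriv ^^ count (mset bs) j) f (x \<bullet> j)))"
        using e by simp
      also have "(\<Prod>j\<in>Basis - {e}. (deriv ^^ count (mset bs) j) f (x \<bullet> j)) = (\<Prod>j\<in>Basis - {e}. (deriv ^^ count (mset (e # bs)) j) f (x \<bullet> j))"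
        by (intro prod.cong) auto
      also have "(deriv ^^ Suc (count (mset bs) e)) f (x \<bullet> e) * \<dots> = (\<Prod>b\<in>Basis. (deriv ^^ count (mset (e # bs)) b) f (x \<bullet> b))"
        using prod.remove[OF finite_Basis e, of "\<lambda>b. (deriv ^^ count (mset (e # bs)) b) f (x \<bullet> b)"] by simp
      finally show "iter_partial (e # bs) (\<lambda>x. c * (\<Prod>b\<in>Basis. f (x \<bullet> b))) x = c * (\<Prod>b\<in>Basis. (deriv ^^ count (mset (e # bs)) b) f (x \<bullet> b))" .
    qed
  qed simp
  show "iter_partial bs (\<lambda>x. c * (\<Prod>b\<in>Basis. f (x \<bullet> b))) differentiable (at x)"
    unfolding * using D differentiable_def by blast
qed

definition mollifier :: "real \<Rightarrow> ('a::euclidean_space \<Rightarrow> real) \<Rightarrow> bool" where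
  "mollifier e \<eta> \<longleftrightarrow> smooth_fun \<eta> \<and> (\<forall>x. 0 \<le> \<eta> x) \<and> (\<forall>x. e < norm x \<longrightarrow> \<eta> x = 0) \<and> integrable lborel \<eta> \<and> (\<integral>x. \<eta> x \<partial>lborel) = 1"

lemma mollifierD:
  assumes "mollifier e \<eta>"
  shows "smooth_fun \<eta>" "0 \<le> \<eta> x" "e < norm x \<Longrightarrow> \<eta> x = 0" "integrable lborel \<eta>" "(\<integral>x. \<eta> x \<partial>lborel) = 1"
  using assms by (auto simp: mollifier_def)

lemma mollifier_nn_integral:
  assumes "mollifier e \<eta>" shows "(\<integral>\<^sup>+x. ennreal (\<eta> x) \<partial>lborel) = 1"
  using nn_integral_eq_integral[OF mollifierD(4)[OF assms]] mollifierD(2,5)[OF assms] by simp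

lemma mollifier_exists:
  assumes e: "0 < e"
  shows "\<exists>\<eta> :: 'a::euclidean_space \<Rightarrow> real. mollifier e \<eta>"
proof -
  \<comment> \<open>All points of the cube of half side \<open>a\<close> have l^1 norm at most e, so
    the cube lies in the ball of radius e.\<close>
  define a where "a = e / DIM('a)"
  have a: "0 < a" using e by (simp add: a_def)
  define g where "g c x = c * (\<Prod>b\<in>Basis. bump a (x \<bullet> b))" for c and x :: 'a
  have sg: "smooth_fun (g c)" for c
    unfolding smooth_fun_def g_def using iter_partial_prod(2)[OF diffn_bump] by blast
  have g0: "0 \<le> g 1 x" for x by (simp add: g_def bump_nonneg prod_nonneg)
  have z: "g c x = 0" if "e < norm x" for c x
  proof -
    have "\<exists>b\<in>Basis. a \<le> \<bar>x \<bullet> b\<bar>"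
    proof (rule ccontr)
      assume "\<not> ?thesis"
      then have "(\<Sum>b\<in>Basis. \<bar>x \<bullet> b\<bar>) \<le> (\<Sum>b\<in>(Basis :: 'a set). a)"
        by (intro sum_mono) (auto simp: not_le intro: less_imp_le)
      also have "\<dots> = e" by (simp add: a_def)
      finally show False using norm_le_l1[of x] that by simp
    qed
    then have "\<exists>b\<in>Basis. bump a (x \<bullet> b) = 0" using bump_zero by blast
    then have "(\<Prod>b\<in>Basis. bump a (x \<bullet> b)) = 0" by (intro prod_zero) auto
    then show ?thesis unfolding g_def by simp
  qed
  have int: "integrable lborel (g c)" for c
    by (rule integrable_compact_support[OF smooth_fun_continuous_on[OF sg], of "cball 0 e"]) (auto simp: z)
  define I where "I = (\<integral>x. g 1 x \<partial>lborel)"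
  \<comment> \<open>A vanishing integral of the nonnegative function would make its zero set, which
    is closed, a set of full measure and hence the whole space; but this set misses 0.\<close>
  have "I \<noteq> 0"
  proof
    assume "I = 0"
    then have "AE x in lborel. g 1 x = 0"
      unfolding I_def using integral_nonneg_eq_0_iff_AE[OF int[of 1]] g0 by auto
    then have "AE x in lebesgue. x \<in> {x. g 1 x = 0}" by (simp add: AE_completion)
    moreover have "closed {x. g 1 x = 0}"
      by (intro closed_Collect_eq smooth_fun_continuous_on sg continuous_on_const)
    ultimately have "0 \<in> {x. g 1 x = 0}" by (rule mem_closed_if_AE_lebesgue[rotated])
    then show False using bump_pos[OF a] by (simp add: g_def)
  qed
  moreover have "0 \<le> I" unfolding I_def using g0 by (intro Bochner_Integration.integral_nonneg) auto
  ultimately have I: "0 < I" by simp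
  have gI: "g (1 / I) x = g 1 x / I" for x by (simp add: g_def)
  have "mollifier e (g (1 / I))"
    unfolding mollifier_def
  proof (intro conjI allI impI sg int z)
    show "0 \<le> g (1 / I) x" for x using g0[of x] I by (simp add: gI)
    have "(\<integral>x. g (1 / I) x \<partial>lborel) = (\<integral>x. g 1 x / I \<partial>lborel)" by (simp only: gI)
    then show "(\<integral>x. g (1 / I) x \<partial>lborel) = 1" using I by (simp add: I_def[symmetric])
  qed
  then show ?thesis by blast
qed

section \<open>Approximation by mollification\<close>

lemma lpn_lborel:
  assumes [measurable]: "f \<in> borel_measurable borel" "A \<in> sets borel"
  shows "lpn p A f = (\<integral>\<^sup>+x\<in>A. ennreal (\<bar>f x\<bar> powr p) \<partial>lborel)"
  unfolding lpn_def by (simp add: nn_integral_completion)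

lemma borel_imp_lebesgue_on: "f \<in> borel_measurable borel \<Longrightarrow> f \<in> borel_measurable (lebesgue_on A)"
  by (intro measurable_restrict_space1 measurable_completion) simp

lemma borel_imp_lebesgue: "f \<in> borel_measurable borel \<Longrightarrow> f \<in> borel_measurable lebesgue"
  by (intro measurable_completion) simp

lemma Lp_truncation:
  fixes f :: "'a::euclidean_space \<Rightarrow> real"
  assumes p: "0 < p" and f[measurable]: "f \<in> borel_measurable borel" and fin: "lpn p UNIV f < \<infinity>"
  shows "(\<lambda>M. lpn p UNIV (\<lambda>x. f x - (if norm x \<le> real M then max (- real M) (min (real M) (f x)) else 0))) \<longlonglongrightarrow> 0"
proof -
  have "(\<lambda>M. \<integral>\<^sup>+x. ennreal (\<bar>f x - (if norm x \<le> real M then max (- real M) (min (real M) (f x)) else 0)\<bar> powr p) \<partial>lborel)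
      \<longlonglongrightarrow> (\<integral>\<^sup>+x. 0 \<partial>(lborel :: 'a measure))"
  proof (rule nn_integral_dominated_convergence[where w = "\<lambda>x. ennreal (\<bar>f x\<bar> powr p)"])
    show "(\<integral>\<^sup>+x. ennreal (\<bar>f x\<bar> powr p) \<partial>lborel) < \<infinity>"
      using fin by (simp add: lpn_lborel)
    show "AE x in lborel. (\<lambda>M. ennreal (\<bar>f x - (if norm x \<le> real M then max (- real M) (min (real M) (f x)) else 0)\<bar> powr p)) \<longlonglongrightarrow> 0"
    proof (intro AE_I2 tendsto_eventually)
      fix x
      obtain K where K: "norm x \<le> real K" "\<bar>f x\<bar> \<le> real K"
        using real_arch_simple[of "max (norm x) \<bar>f x\<bar>"] by auto
      show "\<forall>\<^sub>F M in sequentially. ennreal (\<bar>f x - (if norm x \<le> real M then max (- real M) (min (real M) (f x)) else 0)\<bar> powr p) = 0"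
        using eventually_ge_at_top[of K]
      proof eventually_elim
        case (elim M)
        then have "real K \<le> real M" by simp
        then show ?case using K p by (simp add: abs_if max_def min_def split: if_splits)
      qed
    qed
    show "AE x in lborel. ennreal (\<bar>f x - (if norm x \<le> real M then max (- real M) (min (real M) (f x)) else 0)\<bar> powr p) \<le> ennreal (\<bar>f x\<bar> powr p)" for M
      using p by (intro AE_I2 ennreal_leI powr_mono2) (auto simp: max_def min_def abs_if split: if_splits)
  qed (measurable)
  then show ?thesis by (simp add: lpn_lborel)
qed

text \<open>After truncation f is bounded with bounded support. A measurable function is the limit
  almost everywhere of continuous ones; cut off in height, and in space by \<open>chi\<close>, these
  obey a common bound, and dominated convergence applies.\<close>

lemma continuous_dense_Lp:
  fixes f :: "'a::euclidean_space \<Rightarrow> real"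
  assumes p: "0 < p" and f[measurable]: "f \<in> borel_measurable borel" and fin: "lpn p UNIV f < \<infinity>" and d: "0 < d"
  obtains h r where "continuous_on UNIV h" "0 < r" "\<And>x. r < norm x \<Longrightarrow> h x = 0" "lpn p UNIV (\<lambda>x. f x - h x) < d"
proof -
  define g where "g M x = (if norm x \<le> real M then max (- real M) (min (real M) (f x)) else 0)" for M x
  have gm[measurable]: "g M \<in> borel_measurable borel" for M unfolding g_def by measurable
  \<comment> \<open>Two errors below \<open>d1\<close> stay below d after the factor 2^p of the
    triangle inequality; an infinite d is treated apart.\<close>
  obtain d1 where d1: "0 < d1" "ennreal (2 powr p) * (d1 + d1) < d"
  proof (cases "d = \<infinity>")
    case True
    then show ?thesis by (intro that[of 1]) (auto simp: ennreal_mult_less_top)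
  next
    case False
    then obtain c where c: "d = ennreal c" "0 < c" using d by (cases d) auto
    have "ennreal (2 powr p) * (ennreal (c / (4 * 2 powr p)) + ennreal (c / (4 * 2 powr p))) = ennreal (c / 2)"
      using c by (simp flip: ennreal_plus ennreal_mult)
    also have "\<dots> < d" using c by (simp add: ennreal_lessI)
    finally show ?thesis using c by (intro that[of "ennreal (c / (4 * 2 powr p))"]) auto
  qed
  obtain M where M: "lpn p UNIV (\<lambda>x. f x - g M x) < d1" "0 < M"
  proof -
    have "\<forall>\<^sub>F M in sequentially. lpn p UNIV (\<lambda>x. f x - g M x) < d1 \<and> 0 < M"
      using Lp_truncation[OF p f fin] d1(1) unfolding g_def
      by (intro eventually_conj order_tendstoD eventually_gt_at_top)
    then show ?thesis using that by (auto simp: eventually_sequentially)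
  qed
  have "g M measurable_on UNIV"
    by (intro lebesgue_measurable_imp_measurable_on borel_imp_lebesgue) auto
  then obtain N G where N: "negligible N" and G: "\<And>n. continuous_on UNIV (G n)" "\<And>x. x \<notin> N \<Longrightarrow> (\<lambda>n. G n x) \<longlonglongrightarrow> g M x"
    unfolding measurable_on_def by auto
  define chi where "chi x = max 0 (min 1 (real M + 1 - norm x))" for x :: 'a
  define H where "H n x = max (- real M) (min (real M) (G n x)) * chi x" for n x
  have Hc: "continuous_on UNIV (H n)" for n unfolding H_def chi_def using G(1) by (intro continuous_intros) auto
  have Hm[measurable]: "H n \<in> borel_measurable borel" for n using Hc by (rule borel_measurable_continuous_onI)
  have Hz: "H n x = 0" if "real M + 1 < norm x" for n x using that by (simp add: H_def chi_def)
  have Hb: "\<bar>H n x\<bar> \<le> real M" for n x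
  proof -
    have "\<bar>H n x\<bar> \<le> real M * 1" unfolding H_def abs_mult by (intro mult_mono) (auto simp: chi_def)
    then show ?thesis by simp
  qed
  have "(\<lambda>n. \<integral>\<^sup>+x. ennreal (\<bar>g M x - H n x\<bar> powr p) \<partial>lebesgue) \<longlonglongrightarrow> (\<integral>\<^sup>+x. 0 \<partial>(lebesgue :: 'a measure))"
  proof (rule nn_integral_dominated_convergence[where w = "\<lambda>x. ennreal ((2 * real M) powr p) * indicator (cball 0 (real M + 1)) x"])
    show "(\<integral>\<^sup>+x. ennreal ((2 * real M) powr p) * indicator (cball 0 (real M + 1)) x \<partial>(lebesgue :: 'a measure)) < \<infinity>"
      by (subst nn_integral_cmult_indicator) (auto simp: ennreal_mult_less_top emeasure_cball)
    show "AE x in lebesgue. (\<lambda>n. ennreal (\<bar>g M x - H n x\<bar> powr p)) \<longlonglongrightarrow> 0"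
    proof -
      have "AE x in lebesgue. x \<notin> N" using N by (simp add: negligible_iff_null_sets AE_not_in)
      then show ?thesis
      proof eventually_elim
        fix x assume "x \<notin> N"
        then have "(\<lambda>n. H n x) \<longlonglongrightarrow> max (- real M) (min (real M) (g M x)) * chi x"
          unfolding H_def by (intro tendsto_intros G)
        moreover have "max (- real M) (min (real M) (g M x)) * chi x = g M x"
          by (auto simp: g_def chi_def)
        ultimately have "(\<lambda>n. H n x) \<longlonglongrightarrow> g M x" by simp
        then have "(\<lambda>n. ennreal (\<bar>g M x - H n x\<bar> powr p)) \<longlonglongrightarrow> ennreal (\<bar>g M x - g M x\<bar> powr p)"
          using p by (intro tendsto_ennrealI tendsto_powr' tendsto_intros) auto
        then show "(\<lambda>n. ennreal (\<bar>g M x - H n x\<bar> powr p)) \<longlonglongrightarrow> 0" using p by simp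
      qed
    qed
    show "AE x in lebesgue. ennreal (\<bar>g M x - H n x\<bar> powr p) \<le> ennreal ((2 * real M) powr p) * indicator (cball 0 (real M + 1)) x" for n
    proof (intro AE_I2)
      fix x
      show "ennreal (\<bar>g M x - H n x\<bar> powr p) \<le> ennreal ((2 * real M) powr p) * indicator (cball 0 (real M + 1)) x"
      proof (cases "x \<in> cball 0 (real M + 1)")
        case True
        have "\<bar>g M x\<bar> \<le> real M" by (auto simp: g_def)
        then have "\<bar>g M x - H n x\<bar> \<le> 2 * real M" using Hb[of n x] by linarith
        then show ?thesis using True p by (auto intro!: ennreal_leI powr_mono2)
      next
        case False
        then have "g M x = 0" "H n x = 0" using Hz[of x n] by (auto simp: g_def)
        then show ?thesis using p by simp
      qed
    qed
    show "(\<lambda>x. ennreal (\<bar>g M x - H n x\<bar> powr p)) \<in> borel_measurable lebesgue" for n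
      by (rule measurable_completion) measurable
    show "(\<lambda>x. ennreal ((2 * real M) powr p) * indicator (cball (0 :: 'a) (real M + 1)) x) \<in> borel_measurable lebesgue"
      by (intro borel_measurable_times_ennreal borel_measurable_const borel_measurable_indicator) simp
  qed simp_all
  then have "(\<lambda>n. lpn p UNIV (\<lambda>x. g M x - H n x)) \<longlonglongrightarrow> 0" by (simp add: lpn_def)
  from order_tendstoD(2)[OF this d1(1)] obtain n where n: "lpn p UNIV (\<lambda>x. g M x - H n x) < d1"
    by (auto simp: eventually_sequentially)
  have "lpn p UNIV (\<lambda>x. f x - H n x) \<le> ennreal (2 powr p) * (lpn p UNIV (\<lambda>x. f x - g M x) + lpn p UNIV (\<lambda>x. g M x - H n x))"
    using p by (intro lpn_triangle borel_imp_lebesgue_on) auto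
  also have "\<dots> \<le> ennreal (2 powr p) * (d1 + d1)"
    using M n by (intro mult_left_mono add_mono) auto
  also have "\<dots> < d" by (rule d1)
  finally show ?thesis using Hc Hz M(2) by (intro that[of "H n" "real M + 1"]) auto
qed

text \<open>Mollifications are evaluated at displaced points \<open>L k x\<close>, and
  \<open>L_integral\<close> takes over the role of translation invariance. The displacement may grow
  like 1 + |x|, as it does for the squeezing of the strip; \<open>e k\<close> is the radius of the
  k-th mollifier.\<close>

locale near_identity =
  fixes L :: "nat \<Rightarrow> 'a::euclidean_space \<Rightarrow> 'a" and e :: "nat \<Rightarrow> real" and d :: "nat \<Rightarrow> real" and C :: real
  assumes L_measurable[measurable]: "\<And>k. L k \<in> borel_measurable borel"
    and L_integral: "\<And>k z (g :: 'a \<Rightarrow> ennreal). g \<in> borel_measurable borel \<Longrightarrow>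
      (\<integral>\<^sup>+x. g (L k x - z) \<partial>lborel) \<le> ennreal C * (\<integral>\<^sup>+x. g x \<partial>lborel)"
    and L_dist: "\<And>k x. norm (L k x - x) \<le> d k * (1 + norm x)"
    and d_lim: "d \<longlonglongrightarrow> 0" and e_lim: "e \<longlonglongrightarrow> 0"
begin

lemma translation_continuous_compact_support:
  assumes p: "0 < p" and h: "continuous_on UNIV h" and r: "0 < r" "\<And>x. r < norm x \<Longrightarrow> h x = 0" and a: "0 < a"
  shows "\<forall>\<^sub>F k in sequentially. \<forall>z. norm z \<le> e k \<longrightarrow> lpn p UNIV (\<lambda>x. h (L k x - z) - h x) \<le> ennreal a"
proof -
  have hm[measurable]: "h \<in> borel_measurable borel" using h by (rule borel_measurable_continuous_onI)
  \<comment> \<open>For large k the displacement is at most (1 + |x|) / 4 and |z| is at most 1, so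
    that |x| > R gives |L k x - z| \<ge> 3 |x| / 4 - 5 / 4 > r: both values of h vanish outside this
    ball.\<close>
  define R where "R = 2 * r + 4"
  define V where "V = measure lborel (cball (0 :: 'a) R)"
  have V: "0 \<le> V" "emeasure lborel (cball (0 :: 'a) R) = ennreal V"
    unfolding V_def using emeasure_eq_ennreal_measure[of lborel "cball (0 :: 'a) R"] emeasure_lborel_cball_finite[of "0 :: 'a" R]
    by (auto simp: less_top)
  \<comment> \<open>If the values of h differ by less than b on the ball, the integral is at most
    \<open>b powr p * V\<close>; the summand 1 avoids a division by 0.\<close>
  define b where "b = (a / (V + 1)) powr (1 / p)"
  have b: "0 < b" "b powr p * V \<le> a"
  proof -
    show "0 < b" using a V by (simp add: b_def)
    have "b powr p = a / (V + 1)" using a V p by (simp add: b_def powr_powr)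
    then have "b powr p * V + b powr p = a" using V by (simp add: field_simps)
    then show "b powr p * V \<le> a" using powr_ge_zero[of b p] by linarith
  qed
  have "uniformly_continuous_on (cball 0 (R + 2)) h"
    using h by (intro compact_uniformly_continuous) (auto intro: continuous_on_subset)
  then obtain s where s: "0 < s" "\<And>x y. x \<in> cball 0 (R + 2) \<Longrightarrow> y \<in> cball 0 (R + 2) \<Longrightarrow> dist y x < s \<Longrightarrow> dist (h y) (h x) < b"
    unfolding uniformly_continuous_on_def using b(1) by metis
  have lim: "(\<lambda>k. d k * (1 + R) + e k) \<longlonglongrightarrow> 0 * (1 + R) + 0"
    by (intro tendsto_intros d_lim e_lim)
  have "\<forall>\<^sub>F k in sequentially. d k < 1 / 4 \<and> e k < 1 \<and> d k * (1 + R) + e k < min s 2"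
    using s(1) lim by (intro eventually_conj order_tendstoD[OF d_lim] order_tendstoD[OF e_lim] order_tendstoD[OF lim]) auto
  then show ?thesis
  proof eventually_elim
    case (elim k)
    show ?case
    proof (intro allI impI)
      fix z :: 'a assume z: "norm z \<le> e k"
      have "lpn p UNIV (\<lambda>x. h (L k x - z) - h x) \<le> (\<integral>\<^sup>+x. ennreal (b powr p) * indicator (cball (0 :: 'a) R) x \<partial>lborel)"
      proof -
        have "lpn p UNIV (\<lambda>x. h (L k x - z) - h x) = (\<integral>\<^sup>+x. ennreal (\<bar>h (L k x - z) - h x\<bar> powr p) \<partial>lborel)"
          by (simp add: lpn_lborel)
        also have "\<dots> \<le> (\<integral>\<^sup>+x. ennreal (b powr p) * indicator (cball (0 :: 'a) R) x \<partial>lborel)"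
      proof (intro nn_integral_mono)
        fix x :: 'a
        show "ennreal (\<bar>h (L k x - z) - h x\<bar> powr p) \<le> ennreal (b powr p) * indicator (cball 0 R) x"
        proof (cases "x \<in> cball 0 R")
          case False
          then have nx: "R < norm x" by simp
          have "norm x \<le> norm (L k x - z) + norm (L k x - x) + norm z"
            using norm_triangle_ineq4[of "L k x - z" "L k x - x - z"] norm_triangle_ineq4[of "L k x - x" z] by (simp add: algebra_simps)
          also have "\<dots> \<le> norm (L k x - z) + 1 / 4 * (1 + norm x) + 1"
            using L_dist[of k x] z elim mult_right_mono[of "d k" "1/4" "1 + norm x"] by (intro add_mono) auto
          finally have "r < norm (L k x - z)" using nx r unfolding R_def by argo
          then have "h (L k x - z) = 0" by (rule r)
          moreover have "h x = 0" using nx r by (intro r) (simp add: R_def)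
          ultimately show ?thesis using p by simp
        next
          case True
          have "dist (L k x - z) x \<le> norm (L k x - x) + norm z"
            using norm_triangle_ineq4[of "L k x - x" z] by (simp add: dist_norm algebra_simps)
          also have "\<dots> \<le> d k * (1 + norm x) + e k"
            using L_dist[of k x] z by (intro add_mono) auto
          also have "\<dots> \<le> d k * (1 + R) + e k"
          proof -
            have "0 \<le> d k * (1 + norm (0::'a))" using L_dist[of k 0] norm_ge_zero order_trans by blast
            then show ?thesis using True by (intro add_mono mult_left_mono) auto
          qed
          finally have dd: "dist (L k x - z) x < min s 2" using elim by simp
          have "norm (L k x - z) \<le> norm x + dist (L k x - z) x"
            using norm_triangle_ineq[of x "L k x - z - x"] by (simp add: dist_norm)
          then have "dist (h (L k x - z)) (h x) < b" using True dd by (intro s) auto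
          then have "\<bar>h (L k x - z) - h x\<bar> powr p \<le> b powr p"
            using p by (intro powr_mono2) (auto simp: dist_real_def)
          then show ?thesis using True by (simp add: ennreal_leI)
        qed
      qed
      finally show ?thesis .
      qed
      also have "\<dots> = ennreal (b powr p) * ennreal V"
        using V by (subst nn_integral_cmult_indicator) auto
      also have "\<dots> \<le> ennreal a" using b V by (simp add: ennreal_leI flip: ennreal_mult)
      finally show "lpn p UNIV (\<lambda>x. h (L k x - z) - h x) \<le> ennreal a" .
    qed
  qed
qed

text \<open>Replace f by a continuous h of compact support. By \<open>L_integral\<close> the error f
  - h at the displaced points is at most C times the original one, uniformly in z; the rest is the
  uniform continuity of h.\<close>

lemma translation_continuous:
  assumes p: "0 < p" and f[measurable]: "f \<in> borel_measurable borel" and fin: "lpn p UNIV f < \<infinity>" and a: "0 < a"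
  shows "\<forall>\<^sub>F k in sequentially. \<forall>z. norm z \<le> e k \<longrightarrow> lpn p UNIV (\<lambda>x. f (L k x - z) - f x) \<le> ennreal a"
proof -
  \<comment> \<open>Collects the factors of the two triangle inequalities below: 2^p on the outside;
    inside, |C| for f - h at the displaced points and 2^p times 2 for the remaining two
    errors.\<close>
  define D where "D = 2 powr p * (\<bar>C\<bar> + 2 powr p * 2)"
  have D: "0 < D" by (simp add: D_def add_nonneg_pos)
  define b where "b = a / D"
  have b: "0 < b" using a D by (simp add: b_def)
  obtain h r where h: "continuous_on UNIV h" and r: "0 < r" "\<And>x. r < norm x \<Longrightarrow> h x = 0"
    and fh: "lpn p UNIV (\<lambda>x. f x - h x) < ennreal b"
    using continuous_dense_Lp[OF p f fin, of "ennreal b"] b by auto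
  have hm[measurable]: "h \<in> borel_measurable borel" using h by (rule borel_measurable_continuous_onI)
  have "\<forall>\<^sub>F k in sequentially. \<forall>z. norm z \<le> e k \<longrightarrow> lpn p UNIV (\<lambda>x. h (L k x - z) - h x) \<le> ennreal b"
    by (rule translation_continuous_compact_support[OF p h r b])
  then show ?thesis
  proof eventually_elim
    case (elim k)
    show ?case
    proof (intro allI impI)
      fix z :: 'a assume z: "norm z \<le> e k"
      have m[measurable]: "(\<lambda>x. f (L k x - z)) \<in> borel_measurable borel" "(\<lambda>x. h (L k x - z)) \<in> borel_measurable borel" by measurable
      have 1: "lpn p UNIV (\<lambda>x. f (L k x - z) - h (L k x - z)) \<le> ennreal \<bar>C\<bar> * ennreal b"
      proof -
        have "lpn p UNIV (\<lambda>x. f (L k x - z) - h (L k x - z)) = (\<integral>\<^sup>+x. (\<lambda>y. ennreal (\<bar>f y - h y\<bar> powr p)) (L k x - z) \<partial>lborel)"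
          by (simp add: lpn_lborel)
        also have "\<dots> \<le> ennreal C * (\<integral>\<^sup>+y. ennreal (\<bar>f y - h y\<bar> powr p) \<partial>lborel)"
          by (rule L_integral) measurable
        also have "\<dots> = ennreal C * lpn p UNIV (\<lambda>x. f x - h x)" by (simp add: lpn_lborel)
        also have "\<dots> \<le> ennreal \<bar>C\<bar> * ennreal b" using fh by (intro mult_mono ennreal_leI) auto
        finally show ?thesis .
      qed
      have 2: "lpn p UNIV (\<lambda>x. h (L k x - z) - f x) \<le> ennreal (2 powr p) * ennreal (2 * b)"
      proof -
        have "lpn p UNIV (\<lambda>x. h (L k x - z) - f x) \<le> ennreal (2 powr p) * (lpn p UNIV (\<lambda>x. h (L k x - z) - h x) + lpn p UNIV (\<lambda>x. h x - f x))"
          using p by (intro lpn_triangle borel_imp_lebesgue_on) auto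
        also have "\<dots> \<le> ennreal (2 powr p) * ennreal (2 * b)"
        proof (intro mult_left_mono)
          have "lpn p UNIV (\<lambda>x. h (L k x - z) - h x) + lpn p UNIV (\<lambda>x. h x - f x) \<le> ennreal b + ennreal b"
            using elim z fh by (intro add_mono) (auto simp: lpn_minus_commute[of p UNIV h])
          also have "\<dots> = ennreal (2 * b)" using b by (simp flip: ennreal_plus)
          finally show "lpn p UNIV (\<lambda>x. h (L k x - z) - h x) + lpn p UNIV (\<lambda>x. h x - f x) \<le> ennreal (2 * b)" .
        qed simp
        finally show ?thesis .
      qed
      have "lpn p UNIV (\<lambda>x. f (L k x - z) - f x) \<le> ennreal (2 powr p) * (lpn p UNIV (\<lambda>x. f (L k x - z) - h (L k x - z)) + lpn p UNIV (\<lambda>x. h (L k x - z) - f x))"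
        using p by (intro lpn_triangle borel_imp_lebesgue_on) auto
      also have "\<dots> \<le> ennreal (2 powr p) * (ennreal \<bar>C\<bar> * ennreal b + ennreal (2 powr p) * ennreal (2 * b))"
        by (intro mult_left_mono add_mono 1 2) auto
      also have "\<dots> = ennreal (2 powr p * (\<bar>C\<bar> * b + 2 powr p * (2 * b)))"
        using b by (simp add: ennreal_mult'[symmetric] ennreal_plus[symmetric] del: ennreal_plus)
      also have "2 powr p * (\<bar>C\<bar> * b + 2 powr p * (2 * b)) = D * b" by (simp add: D_def algebra_simps)
      also have "D * b = a" using D by (simp add: b_def)
      finally show "lpn p UNIV (\<lambda>x. f (L k x - z) - f x) \<le> ennreal a" .
    qed
  qed
qed

end

section \<open>Convolution with smooth kernels of compact support\<close>

definition conv :: "('a::euclidean_space \<Rightarrow> real) \<Rightarrow> ('a \<Rightarrow> real) \<Rightarrow> 'a \<Rightarrow> real" where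
  "conv \<phi> f x = (\<integral>y. \<phi> (x - y) * f y \<partial>lborel)"

text \<open>Local integrability on the whole space for a Borel function. A Borel representative
  keeps convolutions within \<open>lborel\<close>, where substitution and Fubini's theorem
  apply.\<close>

definition lint :: "('a::euclidean_space \<Rightarrow> real) \<Rightarrow> bool" where
  "lint f \<longleftrightarrow> f \<in> borel_measurable borel \<and> (\<forall>r. integrable lborel (\<lambda>y. indicator (cball 0 r) y * f y))"

lemma Lp_imp_lint:
  fixes f :: "'a::euclidean_space \<Rightarrow> real"
  assumes p: "1 \<le> p" and f[measurable]: "f \<in> borel_measurable borel" and fin: "lpn p UNIV f < \<infinity>"
  shows "lint f"
  unfolding lint_def
proof (intro conjI allI f)
  fix r
  have [measurable]: "cball (0 :: 'a) r \<in> sets borel" by simp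
  have "integrable lborel (\<lambda>y. indicator (cball 0 r) y *\<^sub>R (1 :: real) + \<bar>f y\<bar> powr p)"
  proof (intro Bochner_Integration.integrable_add)
    show "integrable lborel (\<lambda>y :: 'a. indicator (cball 0 r) y *\<^sub>R (1 :: real))"
      by (rule borel_integrable_compact) auto
    show "integrable lborel (\<lambda>y. \<bar>f y\<bar> powr p)"
      using fin by (intro integrableI_nonneg) (auto simp: lpn_lborel)
  qed
  then show "integrable lborel (\<lambda>y. indicator (cball 0 r) y * f y)"
  proof (rule Bochner_Integration.integrable_bound)
    have "\<bar>t\<bar> \<le> 1 + \<bar>t\<bar> powr p" for t :: real
    proof (cases "\<bar>t\<bar> \<le> 1")
      case False
      then have "\<bar>t\<bar> powr 1 \<le> \<bar>t\<bar> powr p" using p by (intro powr_mono) auto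
      then show ?thesis using False by simp
    qed (simp add: add_increasing2)
    then show "AE x in lborel. norm (indicator (cball 0 r) x * f x) \<le> norm (indicator (cball 0 r) x *\<^sub>R (1 :: real) + \<bar>f x\<bar> powr p)"
      by (intro AE_I2) (auto simp: indicator_def)
  qed measurable
qed

lemma conv_integrable:
  fixes f :: "'a::euclidean_space \<Rightarrow> real"
  assumes phi: "continuous_on UNIV \<phi>" "\<And>x. r < norm x \<Longrightarrow> \<phi> x = 0" and f: "lint f"
  shows "integrable lborel (\<lambda>y. \<phi> (x - y) * f y)"
proof -
  have [measurable]: "f \<in> borel_measurable borel" "\<phi> \<in> borel_measurable borel"
    using f phi by (auto simp: lint_def intro: borel_measurable_continuous_onI)
  have [measurable]: "cball (0 :: 'a) (norm x + r) \<in> sets borel" by simp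
  obtain B where B: "0 < B" "\<And>x. \<bar>\<phi> x\<bar> \<le> B"
    by (rule compact_support_bounded[OF phi(1), of "cball 0 r"]) (use phi(2) in auto)
  have "integrable lborel (\<lambda>y. B * (indicator (cball 0 (norm x + r)) y * f y))"
    using f by (intro integrable_mult_right) (auto simp: lint_def)
  then show ?thesis
  proof (rule Bochner_Integration.integrable_bound)
    show "AE y in lborel. norm (\<phi> (x - y) * f y) \<le> norm (B * (indicator (cball 0 (norm x + r)) y * f y))"
    proof (intro AE_I2)
      fix y
      show "norm (\<phi> (x - y) * f y) \<le> norm (B * (indicator (cball 0 (norm x + r)) y * f y))"
      proof (cases "y \<in> cball 0 (norm x + r)")
        case True
        then show ?thesis using B by (auto simp: abs_mult intro!: mult_right_mono)
      next
        case False
        then have "r < norm (x - y)" using norm_triangle_ineq2[of y x] by (simp add: norm_minus_commute)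
        then show ?thesis by (simp add: phi)
      qed
    qed
  qed measurable
qed

lemma frechet_derivative_bound:
  fixes f :: "'a::euclidean_space \<Rightarrow> real" and B :: real
  assumes "f differentiable (at x)" "\<And>b. b \<in> Basis \<Longrightarrow> \<bar>frechet_derivative f (at x) b\<bar> \<le> B"
  shows "\<bar>frechet_derivative f (at x) h\<bar> \<le> real DIM('a) * B * norm h"
proof -
  have "\<bar>frechet_derivative f (at x) h\<bar> \<le> (\<Sum>b\<in>Basis. \<bar>(h \<bullet> b) * frechet_derivative f (at x) b\<bar>)"
    unfolding frechet_derivative_Basis[OF assms(1), of h] by (rule sum_abs)
  also have "\<dots> \<le> (\<Sum>b\<in>(Basis :: 'a set). norm h * B)"
    using assms(2) by (intro sum_mono) (auto simp: abs_mult Basis_le_norm intro!: mult_mono)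
  finally show ?thesis by (simp add: mult_ac)
qed

text \<open>Differentiation under the integral sign by dominated convergence, which is why the limit
  is taken along sequences \<open>X\<close>. The quotients are at most 2 \<open>Li\<close>, since
  the kernel and its linear part both have the Lipschitz constant \<open>Li\<close>, and they vanish
  outside one ball because the sequence is bounded.\<close>

lemma conv_has_derivative:
  fixes f :: "'a::euclidean_space \<Rightarrow> real"
  assumes phi: "smooth_fun \<phi>" "\<And>x. r < norm x \<Longrightarrow> \<phi> x = 0" and f: "lint f"
  shows "(conv \<phi> f has_derivative (\<lambda>h. \<Sum>b\<in>Basis. (h \<bullet> b) * conv (iter_partial [b] \<phi>) f x)) (at x)"
proof -
  let ?D = "\<lambda>z h. frechet_derivative \<phi> (at z) h"
  have d: "\<phi> differentiable (at z)" for z using phi(1) by (rule smooth_fun_differentiable)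
  have fm[measurable]: "f \<in> borel_measurable borel" using f by (auto simp: lint_def)
  have pm[measurable]: "\<phi> \<in> borel_measurable borel" using phi by (auto intro: smooth_fun_borel)
  have bz: "iter_partial [b] \<phi> z = 0" if "r < norm z" for b z
    by (rule iter_partial_eq_zero[of "- cball 0 r"]) (use that phi(2) in \<open>auto simp: open_Compl\<close>)
  have bc: "continuous_on UNIV (iter_partial [b] \<phi>)" if "b \<in> Basis" for b
    using that phi by (intro smooth_fun_continuous_on smooth_fun_iter_partial) auto
  note pc = smooth_fun_continuous_on[OF phi(1)]
  have "\<exists>B. \<forall>z. \<bar>iter_partial [b] \<phi> z\<bar> \<le> B" if "b \<in> Basis" for b
    by (rule compact_support_bounded[OF bc[OF that], of "cball 0 r"]) (use bz in auto)
  then obtain B' where B': "\<And>b z. b \<in> Basis \<Longrightarrow> \<bar>iter_partial [b] \<phi> z\<bar> \<le> B' b" by metis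
  define B where "B = (\<Sum>b\<in>(Basis :: 'a set). \<bar>B' b\<bar>)"
  have B: "\<bar>?D z b\<bar> \<le> B" if "b \<in> Basis" for b z
  proof -
    have "\<bar>?D z b\<bar> \<le> \<bar>B' b\<bar>" using B'[OF that, of z] by simp
    also have "\<dots> \<le> B" unfolding B_def using that by (intro member_le_sum) auto
    finally show ?thesis .
  qed
  define Li where "Li = real DIM('a) * B"
  have Li: "\<bar>?D z h\<bar> \<le> Li * norm h" for z h
    unfolding Li_def by (rule frechet_derivative_bound[OF d B])
  have lip: "\<bar>\<phi> u - \<phi> v\<bar> \<le> Li * norm (u - v)" for u v
  proof -
    have "norm (\<phi> u - \<phi> v) \<le> Li * norm (u - v)"
    proof (rule differentiable_bound[where f' = "\<lambda>z. ?D z" and S = UNIV])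
      show "onorm (?D z) \<le> Li" for z using Li[of z] by (intro onorm_le) auto
    qed (use d in \<open>auto simp: frechet_derivative_works\<close>)
    then show ?thesis by simp
  qed
  let ?T = "\<lambda>h. \<Sum>b\<in>Basis. (h \<bullet> b) * conv (iter_partial [b] \<phi>) f x"
  have cT: "?T h = (\<integral>y. ?D (x - y) h * f y \<partial>lborel)" "integrable lborel (\<lambda>y. ?D (x - y) h * f y)" for h
  proof -
    have i: "integrable lborel (\<lambda>y. (h \<bullet> b) * (iter_partial [b] \<phi> (x - y) * f y))" if "b \<in> Basis" for b
      using conv_integrable[OF bc[OF that] bz f] by (intro integrable_mult_right) auto
    have eq: "?D (x - y) h * f y = (\<Sum>b\<in>Basis. (h \<bullet> b) * (iter_partial [b] \<phi> (x - y) * f y))" for y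
      by (subst frechet_derivative_Basis[OF d]) (simp add: sum_distrib_right mult.assoc)
    show "integrable lborel (\<lambda>y. ?D (x - y) h * f y)" unfolding eq using i by (intro Bochner_Integration.integrable_sum)
    show "?T h = (\<integral>y. ?D (x - y) h * f y \<partial>lborel)" unfolding eq conv_def using i
      by (subst Bochner_Integration.integral_sum) auto
  qed
  show ?thesis
    unfolding has_derivative_iff_norm
  proof (intro conjI)
    show "bounded_linear ?T"
      by (intro bounded_linear_sum bounded_linear_compose[OF bounded_linear_mult_left] bounded_linear_inner_left)
    show "((\<lambda>y. norm (conv \<phi> f y - conv \<phi> f x - ?T (y - x)) / norm (y - x)) \<longlongrightarrow> 0) (at x)"
      unfolding tendsto_at_iff_sequentially
    proof (intro allI impI)
      fix X :: "nat \<Rightarrow> 'a" assume X: "\<forall>i. X i \<in> UNIV - {x}" "X \<longlonglongrightarrow> x"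
      obtain S where S: "0 < S" "\<And>i. norm (X i) \<le> S"
        using convergent_imp_Bseq[OF convergentI[OF X(2)]] by (auto simp: Bseq_def)
      define q where "q i y = (\<phi> (X i - y) - \<phi> (x - y) - ?D (x - y) (X i - x)) / norm (X i - x) * f y" for i y
      have i1: "integrable lborel (\<lambda>y. \<phi> (z - y) * f y)" for z by (rule conv_integrable[OF pc phi(2) f])
      have qi: "(conv \<phi> f (X i) - conv \<phi> f x - ?T (X i - x)) / norm (X i - x) = (\<integral>y. q i y \<partial>lborel)" for i
      proof -
        have "q i y = (\<phi> (X i - y) * f y - \<phi> (x - y) * f y - ?D (x - y) (X i - x) * f y) / norm (X i - x)" for y
          unfolding q_def by (simp add: algebra_simps diff_divide_distrib)
        then show ?thesis using i1 cT by (simp add: conv_def)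
      qed
      have "(\<lambda>i. \<integral>y. q i y \<partial>lborel) \<longlonglongrightarrow> (\<integral>y. 0 \<partial>(lborel :: 'a measure))"
      proof (rule integral_dominated_convergence[where w = "\<lambda>y. 2 * Li * \<bar>indicator (cball 0 (S + norm x + r)) y * f y\<bar>"])
        show "q i \<in> borel_measurable lborel" for i
        proof -
          have "(\<lambda>y. q i y) = (\<lambda>y. (\<phi> (X i - y) * f y - \<phi> (x - y) * f y - ?D (x - y) (X i - x) * f y) / norm (X i - x))"
            unfolding q_def by (simp add: algebra_simps diff_divide_distrib)
          then show ?thesis using i1 cT(2)
            by (simp add: borel_measurable_diff borel_measurable_divide borel_measurable_integrable)
        qed
        show "integrable lborel (\<lambda>y. 2 * Li * \<bar>indicator (cball 0 (S + norm x + r)) y * f y\<bar>)"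
          using f by (intro integrable_mult_right integrable_abs) (auto simp: lint_def)
        show "AE y in lborel. (\<lambda>i. q i y) \<longlonglongrightarrow> 0"
        proof (intro AE_I2)
          fix y
          have "(\<phi> has_derivative ?D (x - y)) (at (x - y))" using d by (simp add: frechet_derivative_works)
          then have l: "((\<lambda>u. norm (\<phi> u - \<phi> (x - y) - ?D (x - y) (u - (x - y))) / norm (u - (x - y))) \<longlongrightarrow> 0) (at (x - y))"
            unfolding has_derivative_iff_norm by blast
          have "filterlim (\<lambda>i. X i - y) (at (x - y)) sequentially"
            using X by (auto simp: filterlim_at intro!: tendsto_intros)
          from filterlim_compose[OF l this]
          have "(\<lambda>i. \<bar>(\<phi> (X i - y) - \<phi> (x - y) - ?D (x - y) (X i - x)) / norm (X i - x)\<bar>) \<longlonglongrightarrow> 0"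
            by (simp add: abs_divide)
          then have "(\<lambda>i. (\<phi> (X i - y) - \<phi> (x - y) - ?D (x - y) (X i - x)) / norm (X i - x)) \<longlonglongrightarrow> 0"
            by (rule tendsto_rabs_zero_cancel)
          then show "(\<lambda>i. q i y) \<longlonglongrightarrow> 0" unfolding q_def by (rule tendsto_mult_left_zero)
        qed
        fix i
        show "AE y in lborel. norm (q i y) \<le> 2 * Li * \<bar>indicator (cball 0 (S + norm x + r)) y * f y\<bar>"
        proof (intro AE_I2)
          fix y
          have ne: "0 < norm (X i - x)" using X by simp
          show "norm (q i y) \<le> 2 * Li * \<bar>indicator (cball 0 (S + norm x + r)) y * f y\<bar>"
          proof (cases "y \<in> cball 0 (S + norm x + r)")
            case True
            have "\<bar>\<phi> (X i - y) - \<phi> (x - y) - ?D (x - y) (X i - x)\<bar> \<le> 2 * Li * norm (X i - x)"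
              using lip[of "X i - y" "x - y"] Li[of "x - y" "X i - x"] by simp
            then have "\<bar>(\<phi> (X i - y) - \<phi> (x - y) - ?D (x - y) (X i - x)) / norm (X i - x)\<bar> \<le> 2 * Li"
              using ne by (simp add: abs_divide field_simps)
            then have "norm (q i y) \<le> 2 * Li * \<bar>f y\<bar>"
              unfolding q_def real_norm_def abs_mult[of _ "f y"] by (rule mult_right_mono) simp
            then show ?thesis using True by simp
          next
            case False
            then have y: "S + norm x + r < norm y" by simp
            have "r < norm (X i - y)" using norm_triangle_ineq2[of y "X i"] S(2)[of i] y norm_ge_zero[of x]
              unfolding norm_minus_commute[of "X i" y] by linarith
            moreover have xy: "r < norm (x - y)" using norm_triangle_ineq2[of y x] S(1) y unfolding norm_minus_commute[of x y] by linarith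
            moreover have "?D (x - y) h = 0" for h
              by (subst frechet_derivative_Basis[OF d]) (use bz[OF xy] in simp)
            ultimately have "q i y = 0" unfolding q_def by (simp add: phi)
            then show ?thesis using False by simp
          qed
        qed
      qed auto
      then have "(\<lambda>i. norm ((conv \<phi> f (X i) - conv \<phi> f x - ?T (X i - x)) / norm (X i - x))) \<longlonglongrightarrow> 0"
        unfolding qi by (intro tendsto_norm_zero) simp
      then show "((\<lambda>y. norm (conv \<phi> f y - conv \<phi> f x - ?T (y - x)) / norm (y - x)) \<circ> X) \<longlonglongrightarrow> 0"
        by (simp add: o_def)
    qed
  qed
qed

lemma iter_partial_conv:
  fixes f :: "'a::euclidean_space \<Rightarrow> real"
  assumes phi: "smooth_fun \<phi>" "\<And>x. r < norm x \<Longrightarrow> \<phi> x = 0" and f: "lint f" and bs: "set bs \<subseteq> Basis"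
  shows "iter_partial bs (conv \<phi> f) = conv (iter_partial bs \<phi>) f" "iter_partial bs (conv \<phi> f) differentiable (at x)"
proof -
  have z: "iter_partial cs \<phi> x = 0" if "r < norm x" for cs x
    by (rule iter_partial_eq_zero[of "- cball 0 r"]) (use that phi(2) in \<open>auto simp: open_Compl\<close>)
  have D: "(conv (iter_partial cs \<phi>) f has_derivative (\<lambda>h. \<Sum>b\<in>Basis. (h \<bullet> b) * conv (iter_partial (b # cs) \<phi>) f x)) (at x)"
    if "set cs \<subseteq> Basis" for cs x
    using conv_has_derivative[OF smooth_fun_iter_partial[OF phi(1) that] z f] by simp
  show eq: "iter_partial bs (conv \<phi> f) = conv (iter_partial bs \<phi>) f"
    using bs
  proof (induction bs)
    case (Cons b bs)
    then have "iter_partial (b # bs) (conv \<phi> f) x = (\<Sum>c\<in>Basis. (b \<bullet> c) * conv (iter_partial (c # bs) \<phi>) f x)" for x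
      by (simp add: frechet_derivative_eqI[OF D])
    also have "(\<Sum>c\<in>Basis. (b \<bullet> c) * conv (iter_partial (c # bs) \<phi>) f x) = (\<Sum>c\<in>Basis. if c = b then conv (iter_partial (c # bs) \<phi>) f x else 0)" for x
      using Cons.prems by (intro sum.cong) (auto simp: inner_Basis)
    finally show ?case using Cons.prems by (auto simp del: iter_partial.simps)
  qed simp
  show "iter_partial bs (conv \<phi> f) differentiable (at x)"
    unfolding eq using D[OF bs] by (auto simp: differentiable_def)
qed

lemma smooth_fun_conv:
  assumes "smooth_fun \<phi>" "\<And>x. r < norm x \<Longrightarrow> \<phi> x = 0" "lint f"
  shows "smooth_fun (conv \<phi> f)"
  unfolding smooth_fun_def using iter_partial_conv(2)[OF assms] by blast

lemma conv_reflect: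
  fixes f :: "'a::euclidean_space \<Rightarrow> real"
  assumes [measurable]: "f \<in> borel_measurable borel" "\<phi> \<in> borel_measurable borel"
  shows "conv \<phi> f x = (\<integral>z. \<phi> z * f (x - z) \<partial>lborel)"
proof -
  have "lborel = density (distr lborel borel (\<lambda>z. x + (- 1) *\<^sub>R z)) (\<lambda>_. \<bar>- 1 :: real\<bar> ^ DIM('a))"
    by (rule lborel_affine) simp
  then have eq: "(lborel :: 'a measure) = distr lborel borel (\<lambda>z. x - z)" by (simp add: density_1)
  have "conv \<phi> f x = (\<integral>y. \<phi> (x - y) * f y \<partial>distr lborel borel (\<lambda>z. x - z))"
    unfolding conv_def eq[symmetric] ..
  also have "\<dots> = (\<integral>z. \<phi> z * f (x - z) \<partial>lborel)"
    by (subst integral_distr) auto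
  finally show ?thesis .
qed

text \<open>\<open>jensen_powr\<close> requires p > 1. The case p = 1 has to be included because u
  itself is approximated in L^1.\<close>

lemma jensen_mollifier:
  assumes p: "1 \<le> p" and \<eta>: "mollifier e \<eta>" and [measurable]: "f \<in> borel_measurable borel"
  shows "ennreal (\<bar>\<integral>z. f z * \<eta> z \<partial>lborel\<bar> powr p) \<le> (\<integral>\<^sup>+z. ennreal (\<bar>f z\<bar> powr p * \<eta> z) \<partial>lborel)"
proof (cases "p = 1")
  case False
  then show ?thesis
    using jensen_powr[of p f lborel \<eta> 1] mollifier_nn_integral[OF \<eta>] mollifierD(1,2)[OF \<eta>] p smooth_fun_borel[of \<eta>] by simp
next
  case True
  show ?thesis
  proof (cases "integrable lborel (\<lambda>z. f z * \<eta> z)")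
    case int: True
    have "ennreal (norm (\<integral>z. f z * \<eta> z \<partial>lborel)) \<le> (\<integral>\<^sup>+z. ennreal (norm (f z * \<eta> z)) \<partial>lborel)"
      by (rule integral_norm_bound_ennreal[OF int])
    then show ?thesis using True mollifierD(2)[OF \<eta>] by (simp add: abs_mult)
  qed (simp add: not_integrable_integral_eq)
qed

context near_identity
begin

text \<open>As the mollifier has mass 1, the difference is the mean of
  \<open>f (L k x - z) - f x\<close> over z. Jensen's inequality and Fubini's theorem reduce it to
  these differences for fixed z, which \<open>translation_continuous\<close> makes small uniformly
  for |z| \<le> \<open>e k\<close>.\<close>

lemma conv_tendsto:
  assumes p: "1 \<le> p" and f[measurable]: "f \<in> borel_measurable borel" and fin: "lpn p UNIV f < \<infinity>"
    and \<eta>: "\<And>k. mollifier (e k) (\<eta> k)"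
  shows "(\<lambda>k. lpn p UNIV (\<lambda>x. conv (\<eta> k) f (L k x) - f x)) \<longlonglongrightarrow> 0"
proof (rule order_tendstoI)
  fix a :: ennreal assume "0 < a"
  obtain c where c: "0 < c" "ennreal c < a"
  proof -
    obtain b where b: "0 < b" "b < a" using \<open>0 < a\<close> dense by blast
    then show ?thesis using that[of "enn2real b"] by (cases b) (auto simp: ennreal_less_zero_iff top_unique)
  qed
  have \<eta>m[measurable]: "\<eta> k \<in> borel_measurable borel" for k using mollifierD(1)[OF \<eta>] by (rule smooth_fun_borel)
  have cm[measurable]: "conv (\<eta> k) f \<in> borel_measurable borel" for k
    using smooth_fun_conv[OF mollifierD(1,3)[OF \<eta>] Lp_imp_lint[OF p f fin]] by (rule smooth_fun_borel)
  have "\<forall>\<^sub>F k in sequentially. \<forall>z. norm z \<le> e k \<longrightarrow> lpn p UNIV (\<lambda>x. f (L k x - z) - f x) \<le> ennreal c"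
    using p by (intro translation_continuous f fin c) auto
  then show "\<forall>\<^sub>F k in sequentially. lpn p UNIV (\<lambda>x. conv (\<eta> k) f (L k x) - f x) < a"
  proof eventually_elim
    case (elim k)
    have eq: "conv (\<eta> k) f (L k x) - f x = (\<integral>z. (f (L k x - z) - f x) * \<eta> k z \<partial>lborel)" for x
    proof -
      have c1: "conv (\<eta> k) f (L k x) = (\<integral>z. \<eta> k z * f (L k x - z) \<partial>lborel)" by (rule conv_reflect) auto
      have c2: "integrable lborel (\<lambda>z. \<eta> k z * f (L k x - z))"
      proof -
        have "integrable lborel (\<lambda>y. \<eta> k (L k x - y) * f y)"
          by (rule conv_integrable[OF smooth_fun_continuous_on[OF mollifierD(1)[OF \<eta>]] mollifierD(3)[OF \<eta>] Lp_imp_lint[OF p f fin]])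
        moreover have "(lborel :: 'a measure) = distr lborel borel (\<lambda>z. L k x - z)"
          using lborel_affine[of "-1 :: real" "L k x"] by (simp add: density_1)
        ultimately have "integrable (distr lborel borel (\<lambda>z. L k x - z)) (\<lambda>y. \<eta> k (L k x - y) * f y)" by simp
        then show ?thesis by (subst (asm) integrable_distr_eq) auto
      qed
      have c3: "integrable lborel (\<lambda>z. f x * \<eta> k z)" using mollifierD(4)[OF \<eta>] by (rule integrable_mult_right)
      have c4: "(\<integral>z. f x * \<eta> k z \<partial>lborel) = f x" using mollifierD(5)[OF \<eta>, of k] by simp
      have c5: "(\<lambda>z. (f (L k x - z) - f x) * \<eta> k z) = (\<lambda>z. \<eta> k z * f (L k x - z) - f x * \<eta> k z)"
        by (simp add: fun_eq_iff algebra_simps)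
      show ?thesis unfolding c5 Bochner_Integration.integral_diff[OF c2 c3] c1 c4 ..
    qed
    have "lpn p UNIV (\<lambda>x. conv (\<eta> k) f (L k x) - f x)
      = (\<integral>\<^sup>+x. ennreal (\<bar>conv (\<eta> k) f (L k x) - f x\<bar> powr p) \<partial>lborel)"
      by (subst lpn_lborel) auto
    also have "\<dots> \<le> (\<integral>\<^sup>+x. (\<integral>\<^sup>+z. ennreal (\<bar>f (L k x - z) - f x\<bar> powr p * \<eta> k z) \<partial>lborel) \<partial>lborel)"
      unfolding eq by (intro nn_integral_mono jensen_mollifier[OF p \<eta>]) measurable
    also have "\<dots> = (\<integral>\<^sup>+z. (\<integral>\<^sup>+x. ennreal (\<bar>f (L k x - z) - f x\<bar> powr p * \<eta> k z) \<partial>lborel) \<partial>lborel)"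
      by (rule lborel_pair.Fubini'[symmetric]) measurable
    also have "\<dots> \<le> (\<integral>\<^sup>+z. ennreal c * ennreal (\<eta> k z) \<partial>lborel)"
    proof (intro nn_integral_mono)
      fix z
      have "(\<integral>\<^sup>+x. ennreal (\<bar>f (L k x - z) - f x\<bar> powr p * \<eta> k z) \<partial>lborel)
        = lpn p UNIV (\<lambda>x. f (L k x - z) - f x) * ennreal (\<eta> k z)"
        using mollifierD(2)[OF \<eta>] by (simp add: ennreal_mult nn_integral_multc lpn_lborel)
      also have "\<dots> \<le> ennreal c * ennreal (\<eta> k z)"
      proof (cases "norm z \<le> e k")
        case True
        then show ?thesis using elim by (intro mult_right_mono) auto
      next
        case False
        then show ?thesis using mollifierD(3)[OF \<eta>, of k z] by simp
      qed
      finally show "(\<integral>\<^sup>+x. ennreal (\<bar>f (L k x - z) - f x\<bar> powr p * \<eta> k z) \<partial>lborel) \<le> ennreal c * ennreal (\<eta> k z)" .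
    qed
    also have "\<dots> = ennreal c" using mollifier_nn_integral[OF \<eta>] by (simp add: nn_integral_cmult)
    also have "\<dots> < a" by (rule c)
    finally show ?case .
  qed
qed auto

end

section \<open>Weak derivatives\<close>

text \<open>Lebesgue measure is complete, so f and g are either both measurable or both not; in the
  latter case both integrals are 0 by convention.\<close>

lemma lebesgue_integral_cong_AE:
  fixes f g :: "'a::euclidean_space \<Rightarrow> real"
  assumes ae: "AE x in lebesgue. f x = g x"
  shows "(\<integral>x. f x \<partial>lebesgue) = (\<integral>x. g x \<partial>lebesgue)"
proof (cases "f \<in> borel_measurable lebesgue")
  case True
  then have "g \<in> borel_measurable lebesgue" by (rule borel_measurable_AE[OF _ ae])
  with True show ?thesis using ae by (rule integral_cong_AE)
next
  case False
  have ae': "AE x in lebesgue. g x = f x" using ae by eventually_elim simp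
  have "g \<notin> borel_measurable lebesgue" using borel_measurable_AE[OF _ ae'] False by blast
  then have "\<not> integrable lebesgue f" "\<not> integrable lebesgue g" using False by (auto dest: borel_measurable_integrable)
  then show ?thesis by (simp add: not_integrable_integral_eq)
qed

lemma compact_sets_lebesgue:
  fixes K :: "'a::euclidean_space set"
  assumes "compact K"
  shows "K \<in> sets lebesgue" "emeasure lebesgue K < \<infinity>"
proof -
  show "K \<in> sets lebesgue" by (rule fmeasurableD[OF lmeasurable_compact[OF assms]])
  show "emeasure lebesgue K < \<infinity>"
    using fmeasurableD2[OF lmeasurable_compact[OF assms]] by (simp only: infinity_ennreal_def less_top)
qed

lemma locally_integrableD:
  assumes "locally_integrable \<Omega> u" "compact K" "K \<subseteq> \<Omega>"
  shows "integrable lebesgue (\<lambda>x. indicator K x * u x)"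
  using assms unfolding locally_integrable_def set_integrable_def by simp

lemma locally_integrableI:
  assumes "\<And>K. compact K \<Longrightarrow> K \<subseteq> \<Omega> \<Longrightarrow> integrable lebesgue (\<lambda>x. indicator K x * u x)"
  shows "locally_integrable \<Omega> u"
  using assms unfolding locally_integrable_def set_integrable_def by simp

lemma locally_integrable_subset: "locally_integrable \<Omega> u \<Longrightarrow> \<Omega>' \<subseteq> \<Omega> \<Longrightarrow> locally_integrable \<Omega>' u"
  unfolding locally_integrable_def by blast

lemma locally_integrable_diff:
  assumes "locally_integrable \<Omega> u" "locally_integrable \<Omega> v"
  shows "locally_integrable \<Omega> (\<lambda>x. u x - v x)"
proof (rule locally_integrableI)
  fix K assume K: "compact K" "K \<subseteq> \<Omega>"
  have "integrable lebesgue (\<lambda>x. indicator K x * u x - indicator K x * v x)"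
    by (intro Bochner_Integration.integrable_diff locally_integrableD[OF _ K] assms)
  then show "integrable lebesgue (\<lambda>x. indicator K x * (u x - v x))" by (simp add: right_diff_distrib)
qed

text \<open>An exhaustion by compact sets writes the function, extended by 0, as a pointwise limit
  of integrable functions.\<close>

lemma locally_integrable_measurable:
  fixes u :: "'a::euclidean_space \<Rightarrow> real"
  assumes "open \<Omega>" "locally_integrable \<Omega> u"
  shows "u \<in> borel_measurable (lebesgue_on \<Omega>)"
proof -
  obtain C where C: "\<And>n. compact (C n)" "\<And>n. C n \<subseteq> \<Omega>" "\<And>n. C n \<subseteq> interior (C (Suc n))" "\<Union>(range C) = \<Omega>"
    using open_Union_compact_subsets[OF assms(1)] by metis
  have inc: "C m \<subseteq> C n" if "m \<le> n" for m n
    using that by (rule lift_Suc_mono_le[rotated]) (use C(3) interior_subset in blast)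
  have "(\<lambda>x. indicator \<Omega> x * u x) \<in> borel_measurable lebesgue"
  proof (rule borel_measurable_LIMSEQ_real)
    show "(\<lambda>x. indicator (C n) x * u x) \<in> borel_measurable lebesgue" for n
      using locally_integrableD[OF assms(2) C(1,2)] by (rule borel_measurable_integrable)
    fix x
    show "(\<lambda>n. indicator (C n) x * u x) \<longlonglongrightarrow> indicator \<Omega> x * u x"
    proof (cases "x \<in> \<Omega>")
      case True
      then obtain m where "x \<in> C m" using C(4) by blast
      then have "\<forall>\<^sub>F n in sequentially. indicator (C n) x * u x = indicator \<Omega> x * u x"
        using inc True by (auto simp: eventually_sequentially indicator_def intro!: exI[of _ m])
      then show ?thesis by (rule tendsto_eventually)
    next
      case False
      then have "x \<notin> C n" for n using C(2) by blast
      then show ?thesis using False by simp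
    qed
  qed
  then show ?thesis using assms(1) by (subst borel_measurable_restrict_space_iff) auto
qed

lemma locally_integrable_cong_AE:
  fixes u v :: "'a::euclidean_space \<Rightarrow> real"
  assumes \<Omega>: "\<Omega> \<in> sets lebesgue" and u: "locally_integrable \<Omega> u" and eq: "AE x in lebesgue_on \<Omega>. u x = v x"
  shows "locally_integrable \<Omega> v"
proof (rule locally_integrableI)
  fix K assume K: "compact K" "K \<subseteq> \<Omega>"
  have i: "integrable lebesgue (\<lambda>x. indicator K x * u x)" using u K by (rule locally_integrableD)
  have "AE x in lebesgue. x \<in> \<Omega> \<longrightarrow> u x = v x"
    using eq by (simp add: AE_restrict_space_iff \<Omega>)
  then have ae: "AE x in lebesgue. indicator K x * u x = indicator K x * v x"
    by eventually_elim (use K(2) in \<open>auto simp: indicator_def\<close>)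
  have m: "(\<lambda>x. indicator K x * v x) \<in> borel_measurable lebesgue"
    using borel_measurable_integrable[OF i] ae by (rule borel_measurable_AE)
  show "integrable lebesgue (\<lambda>x. indicator K x * v x)"
    using integrable_cong_AE[OF borel_measurable_integrable[OF i] m ae] i by blast
qed

lemma test_functions_support:
  assumes "\<phi> \<in> test_functions \<Omega>"
  shows "\<exists>K. compact K \<and> K \<subseteq> \<Omega> \<and> (\<forall>x. x \<notin> K \<longrightarrow> \<phi> x = 0)"
proof (intro exI conjI allI impI)
  show "\<phi> x = 0" if "x \<notin> closure {x. \<phi> x \<noteq> 0}" for x using that by (rule test_functions_zero)
qed (rule test_functionsD[OF assms])+

lemma test_integral:
  assumes \<Omega>: "open \<Omega>" and u: "locally_integrable \<Omega> u" and \<phi>: "\<phi> \<in> test_functions \<Omega>"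
  shows "integrable lebesgue (\<lambda>x. u x * \<phi> x)"
    and "(LINT x:\<Omega>|lebesgue. u x * \<phi> x) = (\<integral>x. u x * \<phi> x \<partial>lebesgue)"
proof -
  obtain K where K: "compact K" "K \<subseteq> \<Omega>" "\<And>x. x \<notin> K \<Longrightarrow> \<phi> x = 0"
    using test_functions_support[OF \<phi>] by blast
  obtain B where B: "0 < B" "\<And>x. \<bar>\<phi> x\<bar> \<le> B" using test_functions_bounded[OF \<phi>] by blast
  have i: "integrable lebesgue (\<lambda>x. indicator K x * u x)" using u K by (intro locally_integrableD)
  have eq: "u x * \<phi> x = (indicator K x * u x) * \<phi> x" for x using K(3)[of x] by (cases "x \<in> K") auto
  have m: "(\<lambda>x. u x * \<phi> x) \<in> borel_measurable lebesgue"
    unfolding eq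
    by (intro borel_measurable_times borel_measurable_integrable[OF i] borel_imp_lebesgue smooth_fun_borel test_functionsD[OF \<phi>])
  show "integrable lebesgue (\<lambda>x. u x * \<phi> x)"
  proof (rule Bochner_Integration.integrable_bound[OF integrable_mult_right[OF i, of B]])
    show "AE x in lebesgue. norm (u x * \<phi> x) \<le> norm (B * (indicator K x * u x))"
    proof (intro AE_I2)
      fix x
      have "\<bar>indicator K x * u x\<bar> * \<bar>\<phi> x\<bar> \<le> \<bar>indicator K x * u x\<bar> * B" using B by (intro mult_left_mono) auto
      then show "norm (u x * \<phi> x) \<le> norm (B * (indicator K x * u x))"
        unfolding eq[of x] using B(1) by (simp add: abs_mult mult_ac)
    qed
  qed (rule m)
  show "(LINT x:\<Omega>|lebesgue. u x * \<phi> x) = (\<integral>x. u x * \<phi> x \<partial>lebesgue)"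
    unfolding set_lebesgue_integral_def
  proof (rule Bochner_Integration.integral_cong[OF refl])
    fix x
    show "indicator \<Omega> x *\<^sub>R (u x * \<phi> x) = u x * \<phi> x" using K(2) K(3)[of x] by (cases "x \<in> \<Omega>") auto
  qed
qed

lemma has_weak_deriv_iff:
  assumes \<Omega>: "open \<Omega>" and \<alpha>: "set_mset \<alpha> \<subseteq> Basis"
  shows "has_weak_deriv \<Omega> \<alpha> u g \<longleftrightarrow> locally_integrable \<Omega> u \<and> locally_integrable \<Omega> g \<and>
    (\<forall>\<phi>\<in>test_functions \<Omega>. (\<integral>x. u x * partial \<alpha> \<phi> x \<partial>lebesgue) = (- 1) ^ size \<alpha> * (\<integral>x. g x * \<phi> x \<partial>lebesgue))"
  unfolding has_weak_deriv_def
  by (intro conj_cong refl ball_cong) (simp add: test_integral(2)[OF \<Omega>] test_functions_partial[OF _ \<alpha>])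

lemma has_weak_derivD:
  assumes "has_weak_deriv \<Omega> \<alpha> u g"
  shows "locally_integrable \<Omega> u" "locally_integrable \<Omega> g"
  using assms by (auto simp: has_weak_deriv_def)

lemma has_weak_deriv_cong_AE:
  assumes \<Omega>: "\<Omega> \<in> sets lebesgue" and w: "has_weak_deriv \<Omega> \<alpha> u g"
    and u: "AE x in lebesgue_on \<Omega>. u x = u' x" and g: "AE x in lebesgue_on \<Omega>. g x = g' x"
  shows "has_weak_deriv \<Omega> \<alpha> u' g'"
  unfolding has_weak_deriv_def
proof (intro conjI ballI)
  show lu: "locally_integrable \<Omega> u'" "locally_integrable \<Omega> g'"
    using locally_integrable_cong_AE[OF \<Omega> _ u] locally_integrable_cong_AE[OF \<Omega> _ g] has_weak_derivD[OF w] by auto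
  fix \<phi> assume \<phi>: "\<phi> \<in> test_functions \<Omega>"
  have *: "(LINT x:\<Omega>|lebesgue. f' x * \<psi> x) = (LINT x:\<Omega>|lebesgue. f x * \<psi> x)"
    if ae: "AE x in lebesgue_on \<Omega>. f x = f' x" for f f' \<psi> :: "'a \<Rightarrow> real"
  proof -
    have ae': "AE x in lebesgue. x \<in> \<Omega> \<longrightarrow> f x = f' x" using ae by (simp add: AE_restrict_space_iff \<Omega>)
    then have "AE x in lebesgue. indicator \<Omega> x *\<^sub>R (f x * \<psi> x) = indicator \<Omega> x *\<^sub>R (f' x * \<psi> x)"
      by eventually_elim (auto simp: indicator_def)
    then show ?thesis unfolding set_lebesgue_integral_def by (rule lebesgue_integral_cong_AE[symmetric])
  qed
  show "(LINT x:\<Omega>|lebesgue. u' x * partial \<alpha> \<phi> x) = (- 1) ^ size \<alpha> * (LINT x:\<Omega>|lebesgue. g' x * \<phi> x)"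
    unfolding *[OF u] *[OF g] using w \<phi> by (simp add: has_weak_deriv_def)
qed

lemma has_weak_deriv_diff:
  assumes \<Omega>: "open \<Omega>" and \<alpha>: "set_mset \<alpha> \<subseteq> Basis" and 1: "has_weak_deriv \<Omega> \<alpha> u g" and 2: "has_weak_deriv \<Omega> \<alpha> v h"
  shows "has_weak_deriv \<Omega> \<alpha> (\<lambda>x. u x - v x) (\<lambda>x. g x - h x)"
  unfolding has_weak_deriv_iff[OF \<Omega> \<alpha>]
proof (intro conjI ballI locally_integrable_diff)
  fix \<phi> assume \<phi>: "\<phi> \<in> test_functions \<Omega>"
  note l = has_weak_derivD[OF 1] has_weak_derivD[OF 2]
  note p = test_functions_partial[OF \<phi> \<alpha>]
  have "(\<integral>x. (u x - v x) * partial \<alpha> \<phi> x \<partial>lebesgue) = (\<integral>x. u x * partial \<alpha> \<phi> x \<partial>lebesgue) - (\<integral>x. v x * partial \<alpha> \<phi> x \<partial>lebesgue)"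
    unfolding left_diff_distrib by (intro Bochner_Integration.integral_diff test_integral[OF \<Omega>] l p)
  also have "\<dots> = (- 1) ^ size \<alpha> * ((\<integral>x. g x * \<phi> x \<partial>lebesgue) - (\<integral>x. h x * \<phi> x \<partial>lebesgue))"
    using 1 2 \<phi> by (simp add: has_weak_deriv_iff[OF \<Omega> \<alpha>] right_diff_distrib)
  also have "(\<integral>x. g x * \<phi> x \<partial>lebesgue) - (\<integral>x. h x * \<phi> x \<partial>lebesgue) = (\<integral>x. (g x - h x) * \<phi> x \<partial>lebesgue)"
    unfolding left_diff_distrib by (intro Bochner_Integration.integral_diff[symmetric] test_integral[OF \<Omega>] l \<phi>)
  finally show "(\<integral>x. (u x - v x) * partial \<alpha> \<phi> x \<partial>lebesgue) = (- 1) ^ size \<alpha> * (\<integral>x. (g x - h x) * \<phi> x \<partial>lebesgue)" .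
qed (use has_weak_derivD[OF 1] has_weak_derivD[OF 2] in auto)

lemma continuous_locally_integrable:
  fixes V :: "'a::euclidean_space \<Rightarrow> real"
  assumes "continuous_on UNIV V"
  shows "locally_integrable \<Omega> V"
proof (rule locally_integrableI)
  fix K :: "'a set" assume K: "compact K"
  have i: "integrable lborel (\<lambda>x. indicator K x *\<^sub>R V x)"
    using assms by (intro borel_integrable_compact K) (auto intro: continuous_on_subset)
  have "(\<lambda>x. indicator K x *\<^sub>R V x) \<in> borel_measurable lborel"
    using i by (rule borel_measurable_integrable)
  then show "integrable lebesgue (\<lambda>x. indicator K x * V x)"
    using integrable_completion[of "\<lambda>x. indicator K x *\<^sub>R V x" lborel] i by simp
qed

lemma smooth_has_weak_deriv:
  fixes V :: "'a::euclidean_space \<Rightarrow> real"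
  assumes V: "smooth_fun V" and \<Omega>: "open \<Omega>" and \<alpha>: "set_mset \<alpha> \<subseteq> Basis"
  shows "has_weak_deriv \<Omega> \<alpha> V (partial \<alpha> V)"
  unfolding has_weak_deriv_iff[OF \<Omega> \<alpha>]
proof (intro conjI ballI continuous_locally_integrable smooth_fun_continuous_on V smooth_fun_partial \<alpha>)
  fix \<phi> assume \<phi>: "\<phi> \<in> test_functions \<Omega>"
  have [measurable]: "V \<in> borel_measurable borel" "\<phi> \<in> borel_measurable borel" "partial \<alpha> V \<in> borel_measurable borel" "partial \<alpha> \<phi> \<in> borel_measurable borel"
    by (intro smooth_fun_borel smooth_fun_partial V \<alpha> test_functionsD[OF \<phi>])+
  show "(\<integral>x. V x * partial \<alpha> \<phi> x \<partial>lebesgue) = (- 1) ^ size \<alpha> * (\<integral>x. partial \<alpha> V x * \<phi> x \<partial>lebesgue)"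
    using integral_by_parts[OF V \<phi> \<alpha>] by (simp add: integral_completion)
qed

section \<open>Reflected mollifiers as test functions\<close>

lemma reflect_translate_derivative:
  "((\<lambda>y::'a::euclidean_space. x - y) has_derivative (\<lambda>h. - h)) (at y)"
  by (auto intro!: derivative_eq_intros)

lemma smooth_fun_reflect:
  fixes \<eta> :: "'a::euclidean_space \<Rightarrow> real"
  assumes "smooth_fun \<eta>"
  shows "smooth_fun (\<lambda>y. \<eta> (x - y))"
  by (rule smooth_fun_compose[OF assms reflect_translate_derivative, of "\<lambda>_. -1" "\<lambda>b. b"]) auto

lemma partial_reflect:
  fixes \<eta> :: "'a::euclidean_space \<Rightarrow> real"
  assumes \<eta>: "smooth_fun \<eta>" and \<alpha>: "set_mset \<alpha> \<subseteq> Basis"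
  shows "partial \<alpha> (\<lambda>y. \<eta> (x - y)) = (\<lambda>y. (- 1) ^ size \<alpha> * partial \<alpha> \<eta> (x - y))"
proof -
  obtain bs where bs: "set bs \<subseteq> Basis" "mset bs = \<alpha>" "\<forall>f :: 'a \<Rightarrow> real. smooth_fun f \<longrightarrow> partial \<alpha> f = iter_partial bs f"
    using partial_eq_iter_partial[OF \<alpha>] by blast
  have len: "length bs = size \<alpha>" using bs(2) by auto
  have pl: "prod_list (map (\<lambda>_. -1 :: real) bs) = (- 1) ^ length bs" by (induction bs) auto
  have "partial \<alpha> (\<lambda>y. \<eta> (x - y)) = iter_partial bs (\<lambda>y. \<eta> (x - y))"
    using bs(3) smooth_fun_reflect[OF \<eta>] by blast
  also have "\<dots> = (\<lambda>y. prod_list (map (\<lambda>_. -1) bs) * iter_partial (map (\<lambda>b. b) bs) \<eta> (x - y))"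
    by (rule iter_partial_compose[OF \<eta> reflect_translate_derivative]) (use bs in auto)
  also have "\<dots> = (\<lambda>y. (- 1) ^ size \<alpha> * partial \<alpha> \<eta> (x - y))"
    using bs(3) \<eta> by (simp add: pl len)
  finally show ?thesis .
qed

lemma reflect_test_function:
  fixes \<eta> :: "'a::euclidean_space \<Rightarrow> real"
  assumes \<eta>: "smooth_fun \<eta>" "\<And>z. e < norm z \<Longrightarrow> \<eta> z = 0" and sub: "cball x e \<subseteq> \<Omega>"
  shows "(\<lambda>y. \<eta> (x - y)) \<in> test_functions \<Omega>"
proof -
  have "{y. \<eta> (x - y) \<noteq> 0} \<subseteq> cball x e"
  proof
    fix y assume "y \<in> {y. \<eta> (x - y) \<noteq> 0}"
    then have "\<not> e < norm (x - y)" using \<eta>(2)[of "x - y"] by auto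
    then show "y \<in> cball x e" by (simp add: dist_norm)
  qed
  then have c: "closure {y. \<eta> (x - y) \<noteq> 0} \<subseteq> cball x e" by (simp add: closure_minimal)
  then have "compact (closure {y. \<eta> (x - y) \<noteq> 0})"
    using compact_Int_closed[OF compact_cball closed_closure, of x e "{y. \<eta> (x - y) \<noteq> 0}"] by (simp add: Int_absorb1)
  then show ?thesis unfolding test_functions_def using c sub smooth_fun_reflect[OF \<eta>(1)] by auto
qed

text \<open>The test function is the kernel reflected at x, and the ball condition keeps its support
  in the open set. The sign that the reflection gives to its derivative cancels the one in the
  definition of weak derivatives.\<close>

lemma has_weak_deriv_mollifier:
  fixes \<eta> u :: "'a::euclidean_space \<Rightarrow> real"
  assumes \<Omega>: "open \<Omega>" and \<alpha>: "set_mset \<alpha> \<subseteq> Basis" and w: "has_weak_deriv \<Omega> \<alpha> u g"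
    and \<eta>: "smooth_fun \<eta>" "\<And>z. e < norm z \<Longrightarrow> \<eta> z = 0" and sub: "cball x e \<subseteq> \<Omega>"
  shows "(\<integral>y. u y * partial \<alpha> \<eta> (x - y) \<partial>lebesgue) = (\<integral>y. g y * \<eta> (x - y) \<partial>lebesgue)"
proof -
  have "(\<integral>y. u y * partial \<alpha> (\<lambda>y. \<eta> (x - y)) y \<partial>lebesgue) = (- 1) ^ size \<alpha> * (\<integral>y. g y * \<eta> (x - y) \<partial>lebesgue)"
    using w reflect_test_function[OF \<eta> sub] unfolding has_weak_deriv_iff[OF \<Omega> \<alpha>] by blast
  moreover have "(\<integral>y. u y * partial \<alpha> (\<lambda>y. \<eta> (x - y)) y \<partial>lebesgue) = (- 1) ^ size \<alpha> * (\<integral>y. u y * partial \<alpha> \<eta> (x - y) \<partial>lebesgue)"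
    unfolding partial_reflect[OF \<eta>(1) \<alpha>] mult.left_commute[of "u _"] by simp
  ultimately show ?thesis by (simp add: minus_one_power_iff split: if_splits)
qed

lemma near_identity_id: "near_identity (\<lambda>_ x. x :: 'a::euclidean_space) (\<lambda>k. 1 / (real k + 1)) (\<lambda>_. 0) 1"
proof
  show "(\<lambda>k. 1 / (real k + 1)) \<longlonglongrightarrow> 0" by real_asymp
  fix z :: 'a and g :: "'a \<Rightarrow> ennreal" assume "g \<in> borel_measurable borel"
  then show "(\<integral>\<^sup>+x. g (x - z) \<partial>lborel) \<le> ennreal 1 * (\<integral>\<^sup>+x. g x \<partial>lborel)"
    using lborel_nn_integral_translate[of g "- z"] by simp
qed auto

lemma borel_representative:
  fixes g :: "'a::euclidean_space \<Rightarrow> real"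
  assumes "integrable lebesgue g"
  obtains f where "f \<in> borel_measurable borel" "AE x in lebesgue. f x = g x" "lpn 1 UNIV f < \<infinity>"
proof -
  obtain f where f: "f \<in> borel_measurable lborel" "AE x in lborel. g x = f x"
    using completion_ex_borel_measurable_real[OF borel_measurable_integrable[OF assms]] by blast
  have fb: "f \<in> borel_measurable borel" using f(1) by simp
  have ae: "AE x in lebesgue. f x = g x" using AE_completion[OF f(2)] by eventually_elim simp
  have "lpn 1 UNIV f = lpn 1 UNIV g" by (rule lpn_cong_AE) (use ae in \<open>simp_all add: AE_restrict_space_iff\<close>)
  also have "\<dots> = (\<integral>\<^sup>+x. ennreal (norm (g x)) \<partial>lebesgue)" by (simp add: lpn_def)
  also have "\<dots> < \<infinity>" using assms by (simp add: integrable_iff_bounded)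
  finally show ?thesis using fb ae by (intro that)
qed

text \<open>Only points y with a nonzero kernel value contribute, and these all lie in K. So neither
  the cut-off to K nor the choice of the Borel representative f affects the mollification at
  x.\<close>

lemma integrable_indicator_compact_absorb:
  fixes u :: "'a::euclidean_space \<Rightarrow> real"
  assumes "\<And>y. \<eta> (x - y) \<noteq> 0 \<Longrightarrow> y \<in> K" "AE y in lebesgue. f y = indicator K y * u y" "f \<in> borel_measurable borel" "\<eta> \<in> borel_measurable borel"
  shows "conv \<eta> f x = (\<integral>y. u y * \<eta> (x - y) \<partial>lebesgue)"
proof -
  note [measurable] = assms(3,4)
  have "conv \<eta> f x = (\<integral>y. \<eta> (x - y) * f y \<partial>lebesgue)"
    unfolding conv_def by (intro integral_completion[symmetric]) measurable
  also have "\<dots> = (\<integral>y. u y * \<eta> (x - y) \<partial>lebesgue)"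
  proof (rule lebesgue_integral_cong_AE)
    show "AE y in lebesgue. \<eta> (x - y) * f y = u y * \<eta> (x - y)"
      using assms(2)
    proof eventually_elim
      case (elim y)
      then show ?case using assms(1)[of y] by (cases "\<eta> (x - y) = 0") auto
    qed
  qed
  finally show ?thesis .
qed

text \<open>Mollify \<open>g\<close> cut off to a slightly larger compact set: the mollifications vanish on the smaller
  compact set and converge to \<open>g\<close> there.\<close>

lemma weak_zero_AE:
  fixes g :: "'a::euclidean_space \<Rightarrow> real"
  assumes \<Omega>: "open \<Omega>" and g: "locally_integrable \<Omega> g"
    and zero: "\<And>\<phi>. \<phi> \<in> test_functions \<Omega> \<Longrightarrow> (\<integral>x. g x * \<phi> x \<partial>lebesgue) = 0"
  shows "AE x in lebesgue_on \<Omega>. g x = 0"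
proof -
  obtain C where C: "\<And>n. compact (C n)" "\<And>n. C n \<subseteq> \<Omega>" "\<And>n. C n \<subseteq> interior (C (Suc n))" "\<Union>(range C) = \<Omega>"
    using open_Union_compact_subsets[OF \<Omega>] by metis
  have "AE x in lebesgue. x \<in> C n \<longrightarrow> g x = 0" for n
  proof -
    \<comment> \<open>From points of \<open>C n\<close>, a mollifier of radius below d sees only
      \<open>C (Suc n)\<close>, where the cut-off function is g itself.\<close>
    obtain d where d: "0 < d" "(\<Union>x\<in>C n. cball x d) \<subseteq> interior (C (Suc n))"
      using compact_subset_open_imp_cball_epsilon_subset[OF C(1) open_interior C(3), of n] by blast
    obtain f where f: "f \<in> borel_measurable borel" "AE x in lebesgue. f x = indicator (C (Suc n)) x * g x" "lpn 1 UNIV f < \<infinity>"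
      using borel_representative[OF locally_integrableD[OF g C(1)[of "Suc n"] C(2)[of "Suc n"]]] by blast
    interpret near_identity "\<lambda>_ x. x :: 'a" "\<lambda>k. 1 / (real k + 1)" "\<lambda>_. 0" 1 by (rule near_identity_id)
    have "\<forall>k. \<exists>\<eta> :: 'a \<Rightarrow> real. mollifier (1 / (real k + 1)) \<eta>" by (intro allI mollifier_exists) auto
    then obtain \<eta> where \<eta>: "\<And>k. mollifier (1 / (real k + 1)) (\<eta> k :: 'a \<Rightarrow> real)" by metis
    have lim: "(\<lambda>k. lpn 1 UNIV (\<lambda>x. conv (\<eta> k) f x - f x)) \<longlonglongrightarrow> 0"
      by (rule conv_tendsto[OF _ f(1,3) \<eta>]) simp
    have "\<forall>\<^sub>F k in sequentially. 1 / (real k + 1) < d"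
      using e_lim d(1) by (rule order_tendstoD)
    then have ev: "\<forall>\<^sub>F k in sequentially. lpn 1 (C n) f \<le> lpn 1 UNIV (\<lambda>x. conv (\<eta> k) f x - f x)"
    proof eventually_elim
      case (elim k)
      have z: "conv (\<eta> k) f x = 0" if x: "x \<in> C n" for x
      proof -
        have sub: "cball x (1 / (real k + 1)) \<subseteq> C (Suc n)"
          using d(2) x elim interior_subset[of "C (Suc n)"] subset_cball[of "1 / (real k + 1)" d x] by fastforce
        have "conv (\<eta> k) f x = (\<integral>y. g y * \<eta> k (x - y) \<partial>lebesgue)"
        proof (rule integrable_indicator_compact_absorb[OF _ f(2,1)])
          fix y assume "\<eta> k (x - y) \<noteq> 0"
          then have "\<not> 1 / (real k + 1) < norm (x - y)" using mollifierD(3)[OF \<eta>] by blast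
          then show "y \<in> C (Suc n)" using sub by (auto simp: dist_norm subset_iff)
        qed (rule smooth_fun_borel[OF mollifierD(1)[OF \<eta>]])
        also have "\<dots> = 0"
          using sub C(2)[of "Suc n"] by (intro zero reflect_test_function[OF mollifierD(1,3)[OF \<eta>]]) auto
        finally show ?thesis .
      qed
      have "lpn 1 (C n) f = lpn 1 (C n) (\<lambda>x. conv (\<eta> k) f x - f x)"
        unfolding lpn_minus_commute[of _ _ "conv (\<eta> k) f"] by (rule lpn_cong) (simp add: z)
      then show ?case by (simp add: lpn_mono_set)
    qed
    have "lpn 1 (C n) f \<le> 0"
      by (rule tendsto_lowerbound[OF lim ev]) simp
    then have l0: "(\<integral>\<^sup>+x. ennreal (\<bar>f x\<bar> powr 1) * indicator (C n) x \<partial>lebesgue) = 0" by (simp add: lpn_def)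
    have "(\<lambda>x. ennreal (\<bar>f x\<bar> powr 1) * indicator (C n) x) \<in> borel_measurable lebesgue"
    proof (intro borel_measurable_times_ennreal borel_measurable_indicator compact_sets_lebesgue(1) C(1))
      have [measurable]: "f \<in> borel_measurable lebesgue" by (rule borel_imp_lebesgue[OF f(1)])
      show "(\<lambda>x. ennreal (\<bar>f x\<bar> powr 1)) \<in> borel_measurable lebesgue" by measurable
    qed
    from l0[unfolded nn_integral_0_iff_AE[OF this]]
    have "AE x in lebesgue. ennreal (\<bar>f x\<bar> powr 1) * indicator (C n) x = 0" .
    then show ?thesis using f(2)
    proof eventually_elim
      case (elim x)
      have "x \<in> C (Suc n)" if "x \<in> C n" using that C(3)[of n] interior_subset[of "C (Suc n)"] by blast
      then show ?case using elim by (auto simp: indicator_def)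
    qed
  qed
  then have "AE x in lebesgue. \<forall>n. x \<in> C n \<longrightarrow> g x = 0" by (subst AE_all_countable) blast
  then have "AE x in lebesgue. x \<in> \<Omega> \<longrightarrow> g x = 0"
  proof eventually_elim
    case (elim x)
    then show ?case using C(4) by blast
  qed
  then show ?thesis using \<Omega> by (simp add: AE_restrict_space_iff)
qed

lemma has_weak_deriv_unique:
  assumes \<Omega>: "open \<Omega>" and \<alpha>: "set_mset \<alpha> \<subseteq> Basis" and 1: "has_weak_deriv \<Omega> \<alpha> u g" and 2: "has_weak_deriv \<Omega> \<alpha> u h"
  shows "AE x in lebesgue_on \<Omega>. g x = h x"
proof -
  have "AE x in lebesgue_on \<Omega>. g x - h x = 0"
  proof (rule weak_zero_AE[OF \<Omega>])
    show "locally_integrable \<Omega> (\<lambda>x. g x - h x)" using has_weak_derivD[OF 1] has_weak_derivD[OF 2] by (intro locally_integrable_diff)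
    fix \<phi> assume \<phi>: "\<phi> \<in> test_functions \<Omega>"
    have "(\<integral>x. g x * \<phi> x \<partial>lebesgue) = (\<integral>x. h x * \<phi> x \<partial>lebesgue)"
      using 1 2 \<phi> unfolding has_weak_deriv_iff[OF \<Omega> \<alpha>] by simp
    then show "(\<integral>x. (g x - h x) * \<phi> x \<partial>lebesgue) = 0"
      using test_integral(1)[OF \<Omega> has_weak_derivD(2)[OF 1] \<phi>] test_integral(1)[OF \<Omega> has_weak_derivD(2)[OF 2] \<phi>]
      by (simp add: left_diff_distrib)
  qed
  then show ?thesis by simp
qed

lemma weak_deriv_has_weak_deriv: "has_weak_deriv \<Omega> \<alpha> u g \<Longrightarrow> has_weak_deriv \<Omega> \<alpha> u (weak_deriv \<Omega> \<alpha> u)"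
  unfolding weak_deriv_def by (rule someI[of "has_weak_deriv \<Omega> \<alpha> u"])

text \<open>This removes the choice in \<open>weak_deriv\<close>: any weak derivative at hand may
  replace the chosen one inside integrals.\<close>

lemma weak_deriv_AE_eq:
  assumes \<Omega>: "open \<Omega>" and \<alpha>: "set_mset \<alpha> \<subseteq> Basis" and 1: "has_weak_deriv \<Omega> \<alpha> u g"
  shows "AE x in lebesgue_on \<Omega>. weak_deriv \<Omega> \<alpha> u x = g x"
  by (rule has_weak_deriv_unique[OF \<Omega> \<alpha> weak_deriv_has_weak_deriv[OF 1] 1])

text \<open>Where |f| exceeds d, the quotient |f| / d is at most its p-th power; elsewhere |f| is at
  most d. The free parameter d makes the first term small on sets of finite measure before the
  second one is sent to 0.\<close>

lemma lpn_one_le: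
  assumes p: "1 \<le> p" and A: "A \<in> sets lebesgue" and d: "0 < d" and f[measurable]: "f \<in> borel_measurable (lebesgue_on A)"
  shows "lpn 1 A f \<le> ennreal d * emeasure lebesgue A + ennreal (d powr (1 - p)) * lpn p A f"
proof -
  have le: "t \<le> d + d powr (1 - p) * t powr p" if "0 \<le> t" for t
  proof (cases "t \<le> d")
    case False
    then have "d powr (1 - p) * t powr p = d * (t / d) powr p" using d that by (simp add: powr_divide powr_diff)
    moreover have "(t / d) powr 1 \<le> (t / d) powr p" using False d p by (intro powr_mono) auto
    then have "d * (t / d) \<le> d * (t / d) powr p" using d False by (intro mult_left_mono) auto
    ultimately show ?thesis using d by simp
  qed (simp add: add_increasing2)
  have "lpn 1 A f \<le> (\<integral>\<^sup>+x. ennreal d + ennreal (d powr (1 - p)) * ennreal (\<bar>f x\<bar> powr p) \<partial>lebesgue_on A)"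
    unfolding lpn_power_one[OF A]
  proof (intro nn_integral_mono)
    fix x
    have "ennreal \<bar>f x\<bar> \<le> ennreal (d + d powr (1 - p) * \<bar>f x\<bar> powr p)" by (intro ennreal_leI le) simp
    then show "ennreal \<bar>f x\<bar> \<le> ennreal d + ennreal (d powr (1 - p)) * ennreal (\<bar>f x\<bar> powr p)"
      using d by (simp add: ennreal_mult ennreal_plus)
  qed
  also have "\<dots> = ennreal d * emeasure lebesgue A + ennreal (d powr (1 - p)) * lpn p A f"
    unfolding lpn_restrict[OF A] using A
    by (subst nn_integral_add) (auto simp: nn_integral_cmult emeasure_restrict_space)
  finally show ?thesis .
qed

lemma lpn_one_tendsto:
  assumes p: "1 \<le> p" and A: "A \<in> sets lebesgue" "emeasure lebesgue A < \<infinity>"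
    and f: "\<And>k. f k \<in> borel_measurable (lebesgue_on A)"
    and lim: "((\<lambda>k. lpn p A (f k)) \<longlongrightarrow> 0) F"
  shows "((\<lambda>k. lpn 1 A (f k)) \<longlongrightarrow> 0) F"
proof (rule order_tendstoI)
  fix a :: ennreal assume "0 < a"
  then obtain b where b: "0 < b" "b < a" using dense by blast
  obtain c where c: "0 < c" "ennreal c = b"
    using b by (cases b) (auto simp: top_unique)
  obtain W where W: "0 \<le> W" "emeasure lebesgue A = ennreal W"
    using A(2) by (cases "emeasure lebesgue A") auto
  \<comment> \<open>First d is fixed so that the measure term is at most c / 2, then s so that the
    other term equals c / 2; W + 1 avoids a division by 0.\<close>
  define d where "d = c / (2 * (W + 1))"
  have d: "0 < d" using c W by (simp add: d_def)
  have dW: "d * W \<le> c / 2" using c W by (simp add: d_def field_simps)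
  define s where "s = c / (2 * d powr (1 - p))"
  have dn: "d \<noteq> 0" by (rule less_imp_neq[OF d, THEN not_sym])
  have s: "0 < s" using c dn by (simp add: s_def)
  have ss: "d powr (1 - p) * s = c / 2" using dn by (simp add: s_def)
  have "\<forall>\<^sub>F k in F. lpn p A (f k) < ennreal s" using lim s by (intro order_tendstoD(2)) auto
  then show "\<forall>\<^sub>F k in F. lpn 1 A (f k) < a"
  proof eventually_elim
    case (elim k)
    have "lpn 1 A (f k) \<le> ennreal d * ennreal W + ennreal (d powr (1 - p)) * ennreal s"
      by (rule order.trans[OF lpn_one_le[OF p A(1) d f, of k]])
        (unfold W(2), rule add_left_mono[OF mult_left_mono[OF less_imp_le[OF elim] zero_le]])
    also have "\<dots> = ennreal (d * W + d powr (1 - p) * s)"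
      using d W s by (simp add: ennreal_mult ennreal_plus)
    also have "\<dots> \<le> ennreal c" unfolding ss using dW by (intro ennreal_leI) simp
    also have "\<dots> < a" using c b by simp
    finally show ?case .
  qed
qed auto

lemma test_integral_tendsto:
  fixes f :: "nat \<Rightarrow> 'a::euclidean_space \<Rightarrow> real"
  assumes \<Omega>: "open \<Omega>" and f: "\<And>k. locally_integrable \<Omega> (f k)" and g: "locally_integrable \<Omega> g" and \<phi>: "\<phi> \<in> test_functions \<Omega>"
    and lim: "\<And>K. compact K \<Longrightarrow> K \<subseteq> \<Omega> \<Longrightarrow> (\<lambda>k. lpn 1 K (\<lambda>x. f k x - g x)) \<longlonglongrightarrow> 0"
  shows "(\<lambda>k. \<integral>x. f k x * \<phi> x \<partial>lebesgue) \<longlonglongrightarrow> (\<integral>x. g x * \<phi> x \<partial>lebesgue)"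
proof -
  obtain K where K: "compact K" "K \<subseteq> \<Omega>" "\<And>x. x \<notin> K \<Longrightarrow> \<phi> x = 0"
    using test_functions_support[OF \<phi>] by blast
  obtain B where B: "0 < B" "\<And>x. \<bar>\<phi> x\<bar> \<le> B" using test_functions_bounded[OF \<phi>] by blast
  have bound: "ennreal \<bar>(\<integral>x. f k x * \<phi> x \<partial>lebesgue) - (\<integral>x. g x * \<phi> x \<partial>lebesgue)\<bar> \<le> ennreal B * lpn 1 K (\<lambda>x. f k x - g x)" for k
  proof -
    have m: "(\<lambda>x. (f k x - g x)) \<in> borel_measurable (lebesgue_on \<Omega>)"
      using \<Omega> f g by (intro locally_integrable_measurable locally_integrable_diff)
    have eq: "(\<integral>x. f k x * \<phi> x \<partial>lebesgue) - (\<integral>x. g x * \<phi> x \<partial>lebesgue) = (\<integral>x. (f k x - g x) * \<phi> x \<partial>lebesgue)"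
      unfolding left_diff_distrib by (intro Bochner_Integration.integral_diff[symmetric] test_integral[OF \<Omega>] f g \<phi>)
    have int: "integrable lebesgue (\<lambda>x. (f k x - g x) * \<phi> x)"
      by (intro test_integral[OF \<Omega>] locally_integrable_diff f g \<phi>)
    have "ennreal (norm (\<integral>x. (f k x - g x) * \<phi> x \<partial>lebesgue)) \<le> (\<integral>\<^sup>+x. ennreal (norm ((f k x - g x) * \<phi> x)) \<partial>lebesgue)"
      by (rule integral_norm_bound_ennreal[OF int])
    also have "\<dots> \<le> (\<integral>\<^sup>+x. ennreal B * (ennreal (\<bar>f k x - g x\<bar> powr 1) * indicator K x) \<partial>lebesgue)"
    proof (intro nn_integral_mono)
      fix x
      show "ennreal (norm ((f k x - g x) * \<phi> x)) \<le> ennreal B * (ennreal (\<bar>f k x - g x\<bar> powr 1) * indicator K x)"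
      proof (cases "x \<in> K")
        case True
        have "norm ((f k x - g x) * \<phi> x) \<le> B * \<bar>f k x - g x\<bar>"
          using B by (auto simp: abs_mult mult.commute intro!: mult_right_mono)
        then have "ennreal (norm ((f k x - g x) * \<phi> x)) \<le> ennreal (B * \<bar>f k x - g x\<bar>)" by (rule ennreal_leI)
        then show ?thesis using True B by (simp add: ennreal_mult)
      qed (simp add: K(3))
    qed
    also have "\<dots> = ennreal B * lpn 1 K (\<lambda>x. f k x - g x)"
      unfolding lpn_def
    proof (rule nn_integral_cmult)
      have "(\<lambda>x. ennreal (\<bar>f k x - g x\<bar> powr 1)) \<in> borel_measurable (lebesgue_on K)"
      proof -
        have "(\<lambda>x. f k x - g x) \<in> borel_measurable (lebesgue_on K)"
          by (rule measurable_restrict_mono[OF m K(2)])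
        then show ?thesis by measurable
      qed
      then show "(\<lambda>x. ennreal (\<bar>f k x - g x\<bar> powr 1) * indicator K x) \<in> borel_measurable lebesgue"
        using compact_sets_lebesgue(1)[OF K(1)] by (subst (asm) borel_measurable_restrict_space_iff_ennreal) simp_all
    qed
    finally show ?thesis unfolding eq by simp
  qed
  have "(\<lambda>k. ennreal B * lpn 1 K (\<lambda>x. f k x - g x)) \<longlonglongrightarrow> ennreal B * 0"
    using lim[OF K(1,2)] by (intro ennreal_tendsto_cmult) auto
  then have z: "(\<lambda>k. ennreal B * lpn 1 K (\<lambda>x. f k x - g x)) \<longlonglongrightarrow> 0" by simp
  have "(\<lambda>k. ennreal \<bar>(\<integral>x. f k x * \<phi> x \<partial>lebesgue) - (\<integral>x. g x * \<phi> x \<partial>lebesgue)\<bar>) \<longlonglongrightarrow> ennreal 0"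
    unfolding ennreal_0 by (rule tendsto_zero_ennreal_le[OF z bound])
  then have "(\<lambda>k. \<bar>(\<integral>x. f k x * \<phi> x \<partial>lebesgue) - (\<integral>x. g x * \<phi> x \<partial>lebesgue)\<bar>) \<longlonglongrightarrow> 0"
    by (rule tendsto_ennrealD) simp_all
  then show ?thesis by (simp only: tendsto_rabs_zero_iff LIM_zero_iff)
qed

text \<open>Convergence in L^1 on compact sets suffices, as test functions are bounded with compact
  support. It is applied in the strip, in the cylinders and, for the tangential derivatives of
  traces, in the boundary hyperplane.\<close>

lemma has_weak_deriv_limit:
  fixes U :: "nat \<Rightarrow> 'a::euclidean_space \<Rightarrow> real"
  assumes \<Omega>: "open \<Omega>" and \<alpha>: "set_mset \<alpha> \<subseteq> Basis" and U: "\<And>k. has_weak_deriv \<Omega> \<alpha> (U k) (V k)"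
    and u: "locally_integrable \<Omega> u" and g: "locally_integrable \<Omega> g"
    and limu: "\<And>K. compact K \<Longrightarrow> K \<subseteq> \<Omega> \<Longrightarrow> (\<lambda>k. lpn 1 K (\<lambda>x. U k x - u x)) \<longlonglongrightarrow> 0"
    and limg: "\<And>K. compact K \<Longrightarrow> K \<subseteq> \<Omega> \<Longrightarrow> (\<lambda>k. lpn 1 K (\<lambda>x. V k x - g x)) \<longlonglongrightarrow> 0"
  shows "has_weak_deriv \<Omega> \<alpha> u g"
  unfolding has_weak_deriv_iff[OF \<Omega> \<alpha>]
proof (intro conjI ballI u g)
  fix \<phi> assume \<phi>: "\<phi> \<in> test_functions \<Omega>"
  have 1: "(\<lambda>k. \<integral>x. U k x * partial \<alpha> \<phi> x \<partial>lebesgue) \<longlonglongrightarrow> (\<integral>x. u x * partial \<alpha> \<phi> x \<partial>lebesgue)"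
    by (intro test_integral_tendsto[OF \<Omega> has_weak_derivD(1)[OF U] u test_functions_partial[OF \<phi> \<alpha>] limu])
  have 2: "(\<lambda>k. (- 1) ^ size \<alpha> * (\<integral>x. V k x * \<phi> x \<partial>lebesgue)) \<longlonglongrightarrow> (- 1) ^ size \<alpha> * (\<integral>x. g x * \<phi> x \<partial>lebesgue)"
    by (intro tendsto_mult_left test_integral_tendsto[OF \<Omega> has_weak_derivD(2)[OF U] g \<phi> limg])
  have "(\<integral>x. U k x * partial \<alpha> \<phi> x \<partial>lebesgue) = (- 1) ^ size \<alpha> * (\<integral>x. V k x * \<phi> x \<partial>lebesgue)" for k
    using U[of k] \<phi> unfolding has_weak_deriv_iff[OF \<Omega> \<alpha>] by blast
  then show "(\<integral>x. u x * partial \<alpha> \<phi> x \<partial>lebesgue) = (- 1) ^ size \<alpha> * (\<integral>x. g x * \<phi> x \<partial>lebesgue)"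
    using LIMSEQ_unique[OF 1] 2 by simp
qed

lemma lpn_finite_locally_integrable:
  fixes g :: "'a::euclidean_space \<Rightarrow> real"
  assumes p: "1 \<le> p" and g: "g \<in> borel_measurable (lebesgue_on \<Omega>)" and \<Omega>: "\<Omega> \<in> sets lebesgue"
    and fin: "\<And>K. compact K \<Longrightarrow> K \<subseteq> \<Omega> \<Longrightarrow> lpn p K g < \<infinity>"
  shows "locally_integrable \<Omega> g"
proof (rule locally_integrableI)
  fix K assume K: "compact K" "K \<subseteq> \<Omega>"
  have Ks: "K \<in> sets lebesgue" "emeasure lebesgue K < \<infinity>"
    by (rule compact_sets_lebesgue[OF K(1)])+
  have gK: "g \<in> borel_measurable (lebesgue_on K)" by (rule measurable_restrict_mono[OF g K(2)])
  have "lpn 1 K g \<le> ennreal 1 * emeasure lebesgue K + ennreal (1 powr (1 - p)) * lpn p K g"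
    by (rule lpn_one_le[OF p Ks(1) _ gK]) simp
  also have "\<dots> < \<infinity>" using Ks(2) fin[OF K] by simp
  finally have f: "lpn 1 K g < \<infinity>" .
  have "integrable (lebesgue_on K) g"
    using f gK unfolding lpn_power_one[OF Ks(1)] by (simp add: integrable_iff_bounded)
  then show "integrable lebesgue (\<lambda>x. indicator K x * g x)"
    using Ks(1) by (subst (asm) integrable_restrict_space) auto
qed

section \<open>A Poincare inequality\<close>

lemma ftc_jensen:
  fixes F f :: "real \<Rightarrow> real"
  assumes p: "1 < p" and ab: "a \<le> b" and d: "\<And>x. (F has_real_derivative f x) (at x)" and c: "continuous_on UNIV f"
  shows "ennreal (\<bar>F b - F a\<bar> powr p) \<le> ennreal ((b - a) powr (p - 1)) * (\<integral>\<^sup>+t\<in>{a..b}. ennreal (\<bar>f t\<bar> powr p) \<partial>lborel)"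
proof -
  have [measurable]: "f \<in> borel_measurable borel" using c by (rule borel_measurable_continuous_onI)
  have eq: "(\<integral>x. f x * indicator {a..b} x \<partial>lborel) = F b - F a"
    by (rule integral_FTC_Icc_real[OF ab]) (use d c in \<open>auto simp: continuous_on_eq_continuous_at\<close>)
  have "(\<integral>\<^sup>+x. ennreal (indicator {a..b} x) \<partial>lborel) \<le> ennreal (b - a)"
    using ab by (simp add: ennreal_indicator)
  from jensen_powr[OF p _ _ _ this, of f] ab
  have "ennreal (\<bar>F b - F a\<bar> powr p) \<le> ennreal ((b - a) powr (p - 1)) * (\<integral>\<^sup>+x. ennreal (\<bar>f x\<bar> powr p * indicator {a..b} x) \<partial>lborel)"
    unfolding eq[symmetric] by simp
  also have "(\<integral>\<^sup>+x. ennreal (\<bar>f x\<bar> powr p * indicator {a..b} x) \<partial>lborel) = (\<integral>\<^sup>+t\<in>{a..b}. ennreal (\<bar>f t\<bar> powr p) \<partial>lborel)"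
    by (intro nn_integral_cong) (auto simp: indicator_def)
  finally show ?thesis .
qed

lemma nn_integral_affine:
  fixes h :: "'a::euclidean_space \<Rightarrow> ennreal"
  assumes [measurable]: "h \<in> borel_measurable borel" and t: "t \<noteq> 0"
  shows "(\<integral>\<^sup>+x. h (c + t *\<^sub>R x) \<partial>lborel) = ennreal (1 / \<bar>t\<bar> ^ DIM('a)) * (\<integral>\<^sup>+x. h x \<partial>lborel)"
proof -
  have "(\<integral>\<^sup>+x. h x \<partial>lborel) = (\<integral>\<^sup>+x. h x \<partial>density (distr lborel borel (\<lambda>x. c + t *\<^sub>R x)) (\<lambda>_. \<bar>t\<bar> ^ DIM('a)))"
    by (subst lborel_affine[OF t, of c]) (rule refl)
  also have "\<dots> = ennreal (\<bar>t\<bar> ^ DIM('a)) * (\<integral>\<^sup>+x. h (c + t *\<^sub>R x) \<partial>lborel)"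
    by (simp add: nn_integral_density nn_integral_distr nn_integral_cmult)
  finally have eq: "(\<integral>\<^sup>+x. h x \<partial>lborel) = ennreal (\<bar>t\<bar> ^ DIM('a)) * (\<integral>\<^sup>+x. h (c + t *\<^sub>R x) \<partial>lborel)" .
  have "ennreal (1 / \<bar>t\<bar> ^ DIM('a)) * ennreal (\<bar>t\<bar> ^ DIM('a)) = 1"
    using t by (simp flip: ennreal_mult')
  then show ?thesis unfolding eq by (simp add: mult.assoc[symmetric])
qed

lemma nn_integral_affine_le:
  fixes h :: "'a::euclidean_space \<Rightarrow> ennreal"
  assumes [measurable]: "h \<in> borel_measurable borel" and t: "1 / 2 \<le> t"
  shows "(\<integral>\<^sup>+x. h (c + t *\<^sub>R x) \<partial>lborel) \<le> ennreal (2 ^ DIM('a)) * (\<integral>\<^sup>+x. h x \<partial>lborel)"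
proof -
  have "(1 / 2) ^ DIM('a) \<le> t ^ DIM('a)" using t by (intro power_mono) auto
  then have "1 / \<bar>t\<bar> ^ DIM('a) \<le> 2 ^ DIM('a)" using t by (simp add: field_simps power_divide)
  then show ?thesis using t by (subst nn_integral_affine) (auto intro!: mult_right_mono ennreal_leI)
qed

lemma smooth_partial_borel: "smooth_fun V \<Longrightarrow> set_mset \<alpha> \<subseteq> Basis \<Longrightarrow> partial \<alpha> V \<in> borel_measurable borel"
  by (intro smooth_fun_borel smooth_fun_partial)

lemma segment_bound:
  fixes V :: "'a::euclidean_space \<Rightarrow> real"
  assumes p: "1 < p" and V: "smooth_fun V"
  shows "ennreal (\<bar>V x - V y\<bar> powr p) \<le> ennreal (norm (x - y) powr p) *
    (\<integral>\<^sup>+t\<in>{0..1::real}. ennreal ((\<Sum>b\<in>Basis. \<bar>partial {#b#} V (y + t *\<^sub>R (x - y))\<bar>) powr p) \<partial>lborel)"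
proof -
  define H where "H z = (\<Sum>b\<in>Basis. \<bar>partial {#b#} V z\<bar>)" for z
  have [measurable]: "partial {#b#} V \<in> borel_measurable borel" if "b \<in> Basis" for b
    using V that by (intro smooth_partial_borel) auto
  have [measurable]: "H \<in> borel_measurable borel" unfolding H_def by measurable
  define f where "f t = frechet_derivative V (at (y + t *\<^sub>R (x - y))) (x - y)" for t :: real
  have fb: "\<bar>f t\<bar> \<le> norm (x - y) * H (y + t *\<^sub>R (x - y))" for t
  proof -
    have "f t = (\<Sum>b\<in>Basis. ((x - y) \<bullet> b) * partial {#b#} V (y + t *\<^sub>R (x - y)))"
      unfolding f_def partial_single by (rule frechet_derivative_Basis[OF smooth_fun_differentiable[OF V]])
    also have "\<bar>\<dots>\<bar> \<le> (\<Sum>b\<in>Basis. \<bar>((x - y) \<bullet> b) * partial {#b#} V (y + t *\<^sub>R (x - y))\<bar>)" by (rule sum_abs)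
    also have "\<dots> \<le> (\<Sum>b\<in>Basis. norm (x - y) * \<bar>partial {#b#} V (y + t *\<^sub>R (x - y))\<bar>)"
      unfolding abs_mult by (intro sum_mono mult_right_mono Basis_le_norm) auto
    finally show ?thesis by (simp add: H_def sum_distrib_left)
  qed
  have fc: "continuous_on UNIV f"
  proof -
    have feq: "f = (\<lambda>t. \<Sum>b\<in>Basis. ((x - y) \<bullet> b) * partial {#b#} V (y + t *\<^sub>R (x - y)))"
      unfolding f_def partial_single by (rule ext) (rule frechet_derivative_Basis[OF smooth_fun_differentiable[OF V]])
    show ?thesis unfolding feq
      using V by (intro continuous_intros continuous_on_compose2[OF smooth_fun_continuous_on[OF smooth_fun_partial[OF V]]]) auto
  qed
  have fd: "((\<lambda>t. V (y + t *\<^sub>R (x - y))) has_real_derivative f t) (at t)" for t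
    unfolding f_def by (rule frechet_derivative_line[OF smooth_fun_differentiable[OF V]])
  have "ennreal (\<bar>V (y + 1 *\<^sub>R (x - y)) - V (y + 0 *\<^sub>R (x - y))\<bar> powr p)
      \<le> ennreal ((1 - 0) powr (p - 1)) * (\<integral>\<^sup>+t\<in>{0..1}. ennreal (\<bar>f t\<bar> powr p) \<partial>lborel)"
    by (rule ftc_jensen[OF p _ fd fc]) simp
  also have "\<dots> \<le> (\<integral>\<^sup>+t\<in>{0..1}. ennreal (norm (x - y) powr p) * ennreal (H (y + t *\<^sub>R (x - y)) powr p) \<partial>lborel)"
  proof -
    have "ennreal (\<bar>f t\<bar> powr p) \<le> ennreal (norm (x - y) powr p) * ennreal (H (y + t *\<^sub>R (x - y)) powr p)" for t
    proof -
      have "\<bar>f t\<bar> powr p \<le> (norm (x - y) * H (y + t *\<^sub>R (x - y))) powr p"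
        using p fb by (intro powr_mono2) auto
      also have "\<dots> = norm (x - y) powr p * H (y + t *\<^sub>R (x - y)) powr p"
        by (rule powr_mult) 
      finally have "ennreal (\<bar>f t\<bar> powr p) \<le> ennreal (norm (x - y) powr p * H (y + t *\<^sub>R (x - y)) powr p)" by (rule ennreal_leI)
      then show ?thesis by (simp add: ennreal_mult)
    qed
    then show ?thesis by (simp add: nn_integral_mono mult_right_mono)
  qed
  also have "\<dots> = ennreal (norm (x - y) powr p) * (\<integral>\<^sup>+t\<in>{0..1}. ennreal (H (y + t *\<^sub>R (x - y)) powr p) \<partial>lborel)"
    unfolding mult.assoc by (rule nn_integral_cmult) measurable
  finally show ?thesis unfolding H_def by simp
qed

text \<open>For fixed t the point y + t (x - y) is taken as the new variable in place of x if t
  \<ge> 1/2, and in place of y otherwise; the inverse Jacobian is then at most 2 to the power of the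
  dimension. Substituting for the same variable throughout would give a factor that is unbounded
  near t = 0 or near t = 1.\<close>

lemma nn_integral_convex_pairs:
  fixes Q :: "'a::euclidean_space set" and h :: "'a \<Rightarrow> ennreal"
  assumes h[measurable]: "h \<in> borel_measurable borel" and Q[measurable]: "Q \<in> sets borel" and cv: "convex Q"
  shows "(\<integral>\<^sup>+x\<in>Q. (\<integral>\<^sup>+y\<in>Q. (\<integral>\<^sup>+t\<in>{0..1::real}. h (y + t *\<^sub>R (x - y)) \<partial>lborel) \<partial>lborel) \<partial>lborel)
    \<le> ennreal (2 ^ DIM('a)) * emeasure lborel Q * (\<integral>\<^sup>+x\<in>Q. h x \<partial>lborel)"
proof -
  \<comment> \<open>Extension by 0 outside Q: convexity keeps the intermediate point in Q, so after
    the substitution the integral may run over the whole space.\<close>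
  define G where "G z = h z * indicator Q z" for z
  have [measurable]: "G \<in> borel_measurable borel" unfolding G_def by measurable
  define F where "F t x y = indicator {0..1::real} t * indicator Q x * indicator Q y * G (y + t *\<^sub>R (x - y))" for t :: real and x y :: 'a
  have [measurable]: "(\<lambda>(t, x, y). F t x y) \<in> borel_measurable (lborel \<Otimes>\<^sub>M lborel \<Otimes>\<^sub>M lborel)"
    unfolding F_def by measurable
  have eqF: "h (y + t *\<^sub>R (x - y)) * indicator {0..1} t * indicator Q y * indicator Q x = F t x y" for t x y
  proof (cases "t \<in> {0..1} \<and> x \<in> Q \<and> y \<in> Q")
    case True
    then have "(1 - t) *\<^sub>R y + t *\<^sub>R x \<in> Q" by (intro convexD[OF cv]) auto
    moreover have "(1 - t) *\<^sub>R y + t *\<^sub>R x = y + t *\<^sub>R (x - y)" by (simp add: algebra_simps)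
    ultimately show ?thesis using True by (simp add: F_def G_def)
  qed (auto simp: F_def)
  have m2: "(\<lambda>(x, t). F t x y) \<in> borel_measurable (lborel \<Otimes>\<^sub>M lborel)" for y unfolding F_def by measurable
  have m3: "(\<lambda>(y, t). F t x y) \<in> borel_measurable (lborel \<Otimes>\<^sub>M lborel)" for x unfolding F_def by measurable
  have m4: "(\<lambda>(x, t). \<integral>\<^sup>+y. F t x y \<partial>lborel) \<in> borel_measurable (lborel \<Otimes>\<^sub>M lborel)" unfolding F_def by measurable
  have m5: "(\<lambda>(x, y). F t x y) \<in> borel_measurable (lborel \<Otimes>\<^sub>M lborel)" for t unfolding F_def by measurable
  have inner: "(\<integral>\<^sup>+x. \<integral>\<^sup>+y. F t x y \<partial>lborel \<partial>lborel) \<le> indicator {0..1} t * (ennreal (2 ^ DIM('a)) * emeasure lborel Q * (\<integral>\<^sup>+x. G x \<partial>lborel))" for t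
  proof (cases "t \<in> {0..1}")
    case False
    then show ?thesis by (simp add: F_def)
  next
    case t: True
    show ?thesis
    proof (cases "1 / 2 \<le> t")
      case True
      have "(\<integral>\<^sup>+x. \<integral>\<^sup>+y. F t x y \<partial>lborel \<partial>lborel) = (\<integral>\<^sup>+y. \<integral>\<^sup>+x. F t x y \<partial>lborel \<partial>lborel)"
        by (rule lborel_pair.Fubini'[OF m5, symmetric])
      also have "\<dots> \<le> (\<integral>\<^sup>+y. indicator Q y * (ennreal (2 ^ DIM('a)) * (\<integral>\<^sup>+x. G x \<partial>lborel)) \<partial>lborel)"
      proof (intro nn_integral_mono)
        fix y :: 'a
        have "(\<integral>\<^sup>+x. F t x y \<partial>lborel) \<le> (\<integral>\<^sup>+x. indicator Q y * G ((1 - t) *\<^sub>R y + t *\<^sub>R x) \<partial>lborel)"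
          using t by (intro nn_integral_mono) (auto simp: F_def indicator_def algebra_simps)
        also have "\<dots> = indicator Q y * (\<integral>\<^sup>+x. G ((1 - t) *\<^sub>R y + t *\<^sub>R x) \<partial>lborel)"
          by (rule nn_integral_cmult) measurable
        also have "\<dots> \<le> indicator Q y * (ennreal (2 ^ DIM('a)) * (\<integral>\<^sup>+x. G x \<partial>lborel))"
          by (intro mult_left_mono nn_integral_affine_le True) auto
        finally show "(\<integral>\<^sup>+x. F t x y \<partial>lborel) \<le> indicator Q y * (ennreal (2 ^ DIM('a)) * (\<integral>\<^sup>+x. G x \<partial>lborel))" .
      qed
      also have "\<dots> = emeasure lborel Q * (ennreal (2 ^ DIM('a)) * (\<integral>\<^sup>+x. G x \<partial>lborel))"
        by (subst nn_integral_multc) auto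
      finally show ?thesis using t by (simp add: mult_ac)
    next
      case False
      have "(\<integral>\<^sup>+x. \<integral>\<^sup>+y. F t x y \<partial>lborel \<partial>lborel) \<le> (\<integral>\<^sup>+x. indicator Q x * (ennreal (2 ^ DIM('a)) * (\<integral>\<^sup>+y. G y \<partial>lborel)) \<partial>lborel)"
      proof (intro nn_integral_mono)
        fix x :: 'a
        have "(\<integral>\<^sup>+y. F t x y \<partial>lborel) \<le> (\<integral>\<^sup>+y. indicator Q x * G (t *\<^sub>R x + (1 - t) *\<^sub>R y) \<partial>lborel)"
          using t by (intro nn_integral_mono) (auto simp: F_def indicator_def algebra_simps)
        also have "\<dots> = indicator Q x * (\<integral>\<^sup>+y. G (t *\<^sub>R x + (1 - t) *\<^sub>R y) \<partial>lborel)"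
          by (rule nn_integral_cmult) measurable
        also have "\<dots> \<le> indicator Q x * (ennreal (2 ^ DIM('a)) * (\<integral>\<^sup>+y. G y \<partial>lborel))"
          using False by (intro mult_left_mono nn_integral_affine_le) auto
        finally show "(\<integral>\<^sup>+y. F t x y \<partial>lborel) \<le> indicator Q x * (ennreal (2 ^ DIM('a)) * (\<integral>\<^sup>+y. G y \<partial>lborel))" .
      qed
      also have "\<dots> = emeasure lborel Q * (ennreal (2 ^ DIM('a)) * (\<integral>\<^sup>+x. G x \<partial>lborel))"
        by (subst nn_integral_multc) auto
      finally show ?thesis using t by (simp add: mult_ac)
    qed
  qed
  have "(\<integral>\<^sup>+x\<in>Q. (\<integral>\<^sup>+y\<in>Q. (\<integral>\<^sup>+t\<in>{0..1::real}. h (y + t *\<^sub>R (x - y)) \<partial>lborel) \<partial>lborel) \<partial>lborel)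
      = (\<integral>\<^sup>+x. \<integral>\<^sup>+y. \<integral>\<^sup>+t. F t x y \<partial>lborel \<partial>lborel \<partial>lborel)"
    unfolding eqF[symmetric] by (simp add: nn_integral_multc)
  also have "\<dots> = (\<integral>\<^sup>+x. \<integral>\<^sup>+t. \<integral>\<^sup>+y. F t x y \<partial>lborel \<partial>lborel \<partial>lborel)"
    by (intro nn_integral_cong lborel_pair.Fubini'[OF m3, symmetric])
  also have "\<dots> = (\<integral>\<^sup>+t. \<integral>\<^sup>+x. \<integral>\<^sup>+y. F t x y \<partial>lborel \<partial>lborel \<partial>lborel)"
    by (rule lborel_pair.Fubini'[OF m4, symmetric])
  also have "\<dots> \<le> (\<integral>\<^sup>+t. indicator {0..1::real} t * (ennreal (2 ^ DIM('a)) * emeasure lborel Q * (\<integral>\<^sup>+x. G x \<partial>lborel)) \<partial>lborel)"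
    by (intro nn_integral_mono inner)
  also have "\<dots> = ennreal (2 ^ DIM('a)) * emeasure lborel Q * (\<integral>\<^sup>+x. G x \<partial>lborel)"
    by (subst nn_integral_multc) auto
  finally show ?thesis unfolding G_def .
qed

text \<open>The mean is taken against a fixed test function and not over Q, since such means of
  derivatives can be moved onto \<open>\<psi>\<close> by parts. As \<open>\<psi>\<close> has
  integral 1, V x minus the mean is the integral of (V x - V y) \<open>\<psi> y\<close>, which
  Jensen's inequality, \<open>segment_bound\<close> and \<open>nn_integral_convex_pairs\<close>
  estimate by the gradient.\<close>

lemma poincare:
  fixes Q :: "'a::euclidean_space set"
  assumes p: "1 < p" and Q: "open Q" "convex Q" "bounded Q"
    and \<psi>: "\<psi> \<in> test_functions Q" "(\<integral>x. \<psi> x \<partial>lborel) = 1"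
  shows "\<exists>C\<ge>0. \<forall>V. smooth_fun V \<longrightarrow>
    lpn p Q (\<lambda>x. V x - (\<integral>y. V y * \<psi> y \<partial>lborel)) \<le> ennreal C * (\<Sum>b\<in>Basis. lpn p Q (partial {#b#} V))"
proof -
  obtain D where D: "0 < D" "\<And>x y. x \<in> Q \<Longrightarrow> y \<in> Q \<Longrightarrow> norm (x - y) \<le> D"
  proof -
    obtain R where R: "0 < R" "\<And>x. x \<in> Q \<Longrightarrow> norm x \<le> R" using Q(3) unfolding bounded_pos by blast
    show ?thesis
    proof (rule that[of "2 * R"])
      fix x y assume "x \<in> Q" "y \<in> Q"
      then show "norm (x - y) \<le> 2 * R" using R(2)[of x] R(2)[of y] norm_triangle_ineq4[of x y] by linarith
    qed (use R in simp)
  qed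
  obtain B where B: "0 < B" "\<And>x. \<bar>\<psi> x\<bar> \<le> B" using test_functions_bounded[OF \<psi>(1)] by blast
  have Qm[measurable]: "Q \<in> sets borel" using Q(1) by simp
  have Qfin: "emeasure lborel Q < \<infinity>" by (rule emeasure_bounded_finite[OF Q(3)])
  define W where "W = measure lborel Q"
  have W: "emeasure lborel Q = ennreal W" "0 \<le> W"
    using Qfin by (simp_all add: W_def emeasure_eq_ennreal_measure less_top)
  define N where "N = real (card (Basis :: 'a set))"
  \<comment> \<open>W^(p-1) comes from Jensen's inequality on Q, B^p from the bound of
    \<open>\<psi>\<close>, D^p from the length of the segments, the factor in parentheses from
    \<open>nn_integral_convex_pairs\<close>, and N^p from separating the sum of the partial
    derivatives.\<close>
  define C where "C = W powr (p - 1) * B powr p * D powr p * (2 ^ DIM('a) * W) * N powr p"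
  have C0: "0 \<le> C" using W by (simp add: C_def)
  have \<psi>m[measurable]: "\<psi> \<in> borel_measurable borel" by (rule smooth_fun_borel[OF test_functionsD(1)[OF \<psi>(1)]])
  obtain K where K: "compact K" "K \<subseteq> Q" "\<And>x. x \<notin> K \<Longrightarrow> \<psi> x = 0"
    using test_functions_support[OF \<psi>(1)] by blast
  have \<psi>c: "continuous_on UNIV \<psi>" by (rule smooth_fun_continuous_on[OF test_functionsD(1)[OF \<psi>(1)]])
  show ?thesis
  proof (intro exI[of _ C] conjI C0 allI impI)
    fix V :: "'a \<Rightarrow> real" assume V: "smooth_fun V"
    have Vm[measurable]: "V \<in> borel_measurable borel" using V by (rule smooth_fun_borel)
    have Vc: "continuous_on UNIV V" using V by (rule smooth_fun_continuous_on)
    have dm[measurable]: "partial {#b#} V \<in> borel_measurable borel" if "b \<in> Basis" for b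
      using V that by (intro smooth_partial_borel) auto
    define H where "H z = (\<Sum>b\<in>Basis. \<bar>partial {#b#} V z\<bar>)" for z
    have Hm[measurable]: "H \<in> borel_measurable borel" unfolding H_def by measurable
    define A where "A = (\<integral>y. V y * \<psi> y \<partial>lborel)"
    have pt: "ennreal (\<bar>V x - A\<bar> powr p) \<le> ennreal (W powr (p - 1) * B powr p * D powr p) *
        (\<integral>\<^sup>+y\<in>Q. (\<integral>\<^sup>+t\<in>{0..1::real}. ennreal (H (y + t *\<^sub>R (x - y)) powr p) \<partial>lborel) \<partial>lborel)" if x: "x \<in> Q" for x
    proof -
      have "V x - A = (\<integral>y. V x * \<psi> y \<partial>lborel) - (\<integral>y. V y * \<psi> y \<partial>lborel)"
        using \<psi>(2) by (simp add: A_def)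
      also have "\<dots> = (\<integral>y. V x * \<psi> y - V y * \<psi> y \<partial>lborel)"
        using K by (intro Bochner_Integration.integral_diff[symmetric] integrable_compact_support[OF _ K(1)] continuous_intros Vc \<psi>c) auto
      also have "\<dots> = (\<integral>y. ((V x - V y) * \<psi> y) * indicator Q y \<partial>lborel)"
      proof (intro Bochner_Integration.integral_cong refl)
        fix y show "V x * \<psi> y - V y * \<psi> y = ((V x - V y) * \<psi> y) * indicator Q y"
          using K(2) K(3)[of y] by (cases "y \<in> Q") (auto simp: algebra_simps)
      qed
      finally have eq: "V x - A = (\<integral>y. ((V x - V y) * \<psi> y) * indicator Q y \<partial>lborel)" .
      have "(\<integral>\<^sup>+y. ennreal (indicator Q y) \<partial>lborel) \<le> ennreal W" using W by (simp add: ennreal_indicator)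
      from jensen_powr[OF p _ _ _ this W(2), of "\<lambda>y. (V x - V y) * \<psi> y"]
      have "ennreal (\<bar>V x - A\<bar> powr p) \<le> ennreal (W powr (p - 1)) * (\<integral>\<^sup>+y. ennreal (\<bar>(V x - V y) * \<psi> y\<bar> powr p * indicator Q y) \<partial>lborel)"
        unfolding eq by simp
      also have "(\<integral>\<^sup>+y. ennreal (\<bar>(V x - V y) * \<psi> y\<bar> powr p * indicator Q y) \<partial>lborel)
        \<le> (\<integral>\<^sup>+y. ennreal (B powr p * D powr p) * ((\<integral>\<^sup>+t\<in>{0..1::real}. ennreal (H (y + t *\<^sub>R (x - y)) powr p) \<partial>lborel) * indicator Q y) \<partial>lborel)"
      proof (intro nn_integral_mono)
        fix y
        show "ennreal (\<bar>(V x - V y) * \<psi> y\<bar> powr p * indicator Q y) \<le> ennreal (B powr p * D powr p) * ((\<integral>\<^sup>+t\<in>{0..1::real}. ennreal (H (y + t *\<^sub>R (x - y)) powr p) \<partial>lborel) * indicator Q y)"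
        proof (cases "y \<in> Q")
          case True
          have "\<bar>(V x - V y) * \<psi> y\<bar> powr p = \<bar>\<psi> y\<bar> powr p * \<bar>V x - V y\<bar> powr p" by (simp add: abs_mult powr_mult)
          also have "\<dots> \<le> B powr p * \<bar>V x - V y\<bar> powr p" using B p by (intro mult_right_mono powr_mono2) auto
          finally have "ennreal (\<bar>(V x - V y) * \<psi> y\<bar> powr p) \<le> ennreal (B powr p) * ennreal (\<bar>V x - V y\<bar> powr p)"
            by (simp add: ennreal_leI flip: ennreal_mult)
          also have "ennreal (\<bar>V x - V y\<bar> powr p) \<le> ennreal (norm (x - y) powr p) * (\<integral>\<^sup>+t\<in>{0..1::real}. ennreal (H (y + t *\<^sub>R (x - y)) powr p) \<partial>lborel)"
            unfolding H_def by (rule segment_bound[OF p V])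
          also have "\<dots> \<le> ennreal (D powr p) * (\<integral>\<^sup>+t\<in>{0..1::real}. ennreal (H (y + t *\<^sub>R (x - y)) powr p) \<partial>lborel)"
            using D(2)[OF x True] p by (intro mult_right_mono ennreal_leI powr_mono2) auto
          finally show ?thesis using True by (simp add: mult_left_mono ennreal_mult mult.assoc)
        qed simp
      qed
      also have "\<dots> = ennreal (B powr p * D powr p) * (\<integral>\<^sup>+y\<in>Q. (\<integral>\<^sup>+t\<in>{0..1::real}. ennreal (H (y + t *\<^sub>R (x - y)) powr p) \<partial>lborel) \<partial>lborel)"
        by (rule nn_integral_cmult) measurable
      finally show ?thesis by (simp add: mult_left_mono ennreal_mult mult.assoc)
    qed
    have "lpn p Q (\<lambda>x. V x - A) = (\<integral>\<^sup>+x\<in>Q. ennreal (\<bar>V x - A\<bar> powr p) \<partial>lborel)"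
      by (rule lpn_lborel) measurable
    also have "\<dots> \<le> (\<integral>\<^sup>+x. ennreal (W powr (p - 1) * B powr p * D powr p) *
        ((\<integral>\<^sup>+y\<in>Q. (\<integral>\<^sup>+t\<in>{0..1::real}. ennreal (H (y + t *\<^sub>R (x - y)) powr p) \<partial>lborel) \<partial>lborel) * indicator Q x) \<partial>lborel)"
    proof (intro nn_integral_mono)
      fix x
      show "ennreal (\<bar>V x - A\<bar> powr p) * indicator Q x \<le> ennreal (W powr (p - 1) * B powr p * D powr p) *
        ((\<integral>\<^sup>+y\<in>Q. (\<integral>\<^sup>+t\<in>{0..1::real}. ennreal (H (y + t *\<^sub>R (x - y)) powr p) \<partial>lborel) \<partial>lborel) * indicator Q x)"
        using pt[of x] by (cases "x \<in> Q") auto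
    qed
    also have "\<dots> = ennreal (W powr (p - 1) * B powr p * D powr p) *
        (\<integral>\<^sup>+x\<in>Q. (\<integral>\<^sup>+y\<in>Q. (\<integral>\<^sup>+t\<in>{0..1::real}. ennreal (H (y + t *\<^sub>R (x - y)) powr p) \<partial>lborel) \<partial>lborel) \<partial>lborel)"
      by (rule nn_integral_cmult) measurable
    also have "\<dots> \<le> ennreal (W powr (p - 1) * B powr p * D powr p) * (ennreal (2 ^ DIM('a)) * ennreal W * (\<integral>\<^sup>+x\<in>Q. ennreal (H x powr p) \<partial>lborel))"
      unfolding W(1)[symmetric]
      by (intro mult_left_mono nn_integral_convex_pairs[where h = "\<lambda>z. ennreal (H z powr p)"] Q(2) Qm) measurable
    also have "(\<integral>\<^sup>+x\<in>Q. ennreal (H x powr p) \<partial>lborel) = lpn p Q H"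
      by (subst lpn_lborel) (auto simp: H_def sum_nonneg)
    also have "lpn p Q H \<le> ennreal (N powr p) * (\<Sum>b\<in>Basis. lpn p Q (\<lambda>x. \<bar>partial {#b#} V x\<bar>))"
      unfolding H_def N_def using p by (intro lpn_sum borel_imp_lebesgue_on) auto
    also have "(\<Sum>b\<in>Basis. lpn p Q (\<lambda>x. \<bar>partial {#b#} V x\<bar>)) = (\<Sum>b\<in>Basis. lpn p Q (partial {#b#} V))"
      by (simp add: lpn_def)
    finally show "lpn p Q (\<lambda>x. V x - (\<integral>y. V y * \<psi> y \<partial>lborel)) \<le> ennreal C * (\<Sum>b\<in>Basis. lpn p Q (partial {#b#} V))"
      using W(2) by (simp add: A_def C_def ennreal_mult mult_ac mult_left_mono mult_right_mono)
  qed
qed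

lemma ball_test_function:
  fixes x :: "'a::euclidean_space"
  assumes "open Q" "x \<in> Q"
  shows "\<exists>\<psi>\<in>test_functions Q. (\<integral>x. \<psi> x \<partial>lborel) = 1"
proof -
  obtain e where e: "0 < e" "cball x e \<subseteq> Q" using assms open_contains_cball by blast
  obtain \<eta> :: "'a \<Rightarrow> real" where \<eta>: "mollifier e \<eta>" using mollifier_exists[OF e(1)] by blast
  have [measurable]: "\<eta> \<in> borel_measurable borel" by (rule smooth_fun_borel[OF mollifierD(1)[OF \<eta>]])
  have "(\<integral>y. \<eta> (x - y) \<partial>lborel) = conv \<eta> (\<lambda>_. 1) x" by (simp add: conv_def)
  also have "\<dots> = 1" using mollifierD(5)[OF \<eta>] by (subst conv_reflect) auto
  finally have "(\<integral>y. \<eta> (x - y) \<partial>lborel) = 1" .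
  moreover have "(\<lambda>y. \<eta> (x - y)) \<in> test_functions Q"
    by (rule reflect_test_function[OF mollifierD(1,3)[OF \<eta>] e(2)])
  ultimately show ?thesis by blast
qed

text \<open>The Poincare inequality for a derivative of V, with its mean moved onto the test
  function by parts. The last term sees V only through an integral against a test function, so
  convergence in the sense of distributions controls it.\<close>

lemma poincare_partial:
  fixes Q :: "'a::euclidean_space set"
  assumes p: "1 < p" and Q: "open Q" "convex Q" "bounded Q" and \<psi>: "\<psi> \<in> test_functions Q" "(\<integral>x. \<psi> x \<partial>lborel) = 1"
    and \<alpha>: "set_mset \<alpha> \<subseteq> Basis"
  shows "\<exists>C. \<forall>V. smooth_fun V \<longrightarrow> lpn p Q (partial \<alpha> V) \<le>
    ennreal C * ((\<Sum>b\<in>Basis. lpn p Q (partial (add_mset b \<alpha>) V)) + ennreal (\<bar>\<integral>y. V y * partial \<alpha> \<psi> y \<partial>lborel\<bar> powr p))"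
proof -
  obtain C where C: "0 \<le> C" "\<And>V. smooth_fun V \<Longrightarrow> lpn p Q (\<lambda>x. V x - (\<integral>y. V y * \<psi> y \<partial>lborel)) \<le> ennreal C * (\<Sum>b\<in>Basis. lpn p Q (partial {#b#} V))"
    using poincare[OF p Q \<psi>] by blast
  have Qfin: "emeasure lborel Q < \<infinity>" by (rule emeasure_bounded_finite[OF Q(3)])
  define W where "W = measure lborel Q"
  have W: "emeasure lborel Q = ennreal W" "0 \<le> W"
    using Qfin by (simp_all add: W_def emeasure_eq_ennreal_measure less_top)
  have Qs: "Q \<in> sets lebesgue" "Q \<in> sets borel" using Q(1) by auto
  show ?thesis
  proof (intro exI[of _ "2 powr p * (C + W)"] allI impI)
    fix V :: "'a \<Rightarrow> real" assume V: "smooth_fun V"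
    define A where "A = (\<integral>y. partial \<alpha> V y * \<psi> y \<partial>lborel)"
    define S where "S = (\<Sum>b\<in>Basis. lpn p Q (partial (add_mset b \<alpha>) V))"
    have sV: "smooth_fun (partial \<alpha> V)" by (rule smooth_fun_partial[OF V \<alpha>])
    have A: "\<bar>A\<bar> = \<bar>\<integral>y. V y * partial \<alpha> \<psi> y \<partial>lborel\<bar>"
      using integral_by_parts[OF V \<psi>(1) \<alpha>] by (simp add: A_def abs_mult power_abs)
    have add: "partial {#b#} (partial \<alpha> V) = partial (add_mset b \<alpha>) V" if "b \<in> Basis" for b
      using partial_union[OF V, of "{#b#}" \<alpha>] that \<alpha> by simp
    have "lpn p Q (partial \<alpha> V) = lpn p Q (\<lambda>x. (partial \<alpha> V x - A) + A)" by simp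
    also have "\<dots> \<le> ennreal (2 powr p) * (lpn p Q (\<lambda>x. partial \<alpha> V x - A) + lpn p Q (\<lambda>x. A))"
      using p Qs smooth_fun_measurable_lebesgue_on[OF sV] by (intro lpn_add borel_measurable_diff) auto
    also have "lpn p Q (\<lambda>x. A) = ennreal W * ennreal (\<bar>A\<bar> powr p)"
      using Qs W by (simp add: lpn_lborel nn_integral_cmult_indicator mult.commute[of "ennreal W"])
    also have "lpn p Q (\<lambda>x. partial \<alpha> V x - A) \<le> ennreal C * S"
      using C(2)[OF sV] by (simp add: A_def S_def add)
    also have "ennreal C * S + ennreal W * ennreal (\<bar>A\<bar> powr p) \<le> ennreal (C + W) * (S + ennreal (\<bar>A\<bar> powr p))"
      using C(1) W(2) by (simp add: distrib_left ennreal_plus distrib_right add_increasing2 add_mono add_increasing)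
    finally have "lpn p Q (partial \<alpha> V) \<le> ennreal (2 powr p) * (ennreal (C + W) * (S + ennreal (\<bar>A\<bar> powr p)))"
      by (simp add: mult_left_mono add_right_mono)
    then show "lpn p Q (partial \<alpha> V) \<le> ennreal (2 powr p * (C + W)) * ((\<Sum>b\<in>Basis. lpn p Q (partial (add_mset b \<alpha>) V)) + ennreal (\<bar>\<integral>y. V y * partial \<alpha> \<psi> y \<partial>lborel\<bar> powr p))"
      using C(1) W(2) by (simp add: S_def A ennreal_mult mult.assoc)
  qed
qed

text \<open>\<open>poincare_partial\<close> bounds the differences of one order by those of the next
  higher order and by integrals against test functions, which converge by assumption. Writing the
  order as \<open>m - j\<close> turns the descent from m into an ordinary induction on j.\<close>

lemma partials_Cauchy:
  fixes Q :: "'a::euclidean_space set" and U :: "nat \<Rightarrow> 'a \<Rightarrow> real"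
  assumes p: "1 < p" and Q: "open Q" "convex Q" "bounded Q" "Q \<noteq> {}" and U: "\<And>k. smooth_fun (U k)"
    and conv: "\<And>\<phi>. \<phi> \<in> test_functions Q \<Longrightarrow> convergent (\<lambda>k. \<integral>x. U k x * \<phi> x \<partial>lborel)"
    and top: "\<And>\<alpha>. \<alpha> \<in> multi_indices m \<Longrightarrow>
      ((\<lambda>(k, l). lpn p Q (\<lambda>x. partial \<alpha> (U k) x - partial \<alpha> (U l) x)) \<longlongrightarrow> 0) (sequentially \<times>\<^sub>F sequentially)"
    and j: "j \<le> m" and \<alpha>: "\<alpha> \<in> multi_indices (m - j)"
  shows "((\<lambda>(k, l). lpn p Q (\<lambda>x. partial \<alpha> (U k) x - partial \<alpha> (U l) x)) \<longlongrightarrow> 0) (sequentially \<times>\<^sub>F sequentially)"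
proof -
  obtain \<psi> where \<psi>: "\<psi> \<in> test_functions Q" "(\<integral>x. \<psi> x \<partial>lborel) = 1" using ball_test_function[OF Q(1)] Q(4) by blast
  let ?F = "sequentially \<times>\<^sub>F sequentially :: (nat \<times> nat) filter"
  show ?thesis
    using j \<alpha>
  proof (induction j arbitrary: \<alpha>)
    case 0
    then show ?case using top by simp
  next
    case (Suc j)
    have \<alpha>: "set_mset \<alpha> \<subseteq> Basis" using Suc.prems by (simp add: multi_indices_def)
    obtain C where C: "\<And>V. smooth_fun V \<Longrightarrow> lpn p Q (partial \<alpha> V) \<le>
        ennreal C * ((\<Sum>b\<in>Basis. lpn p Q (partial (add_mset b \<alpha>) V)) + ennreal (\<bar>\<integral>y. V y * partial \<alpha> \<psi> y \<partial>lborel\<bar> powr p))"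
      using poincare_partial[OF p Q(1-3) \<psi> \<alpha>] by blast
    have IH: "((\<lambda>(k, l). lpn p Q (\<lambda>x. partial (add_mset b \<alpha>) (U k) x - partial (add_mset b \<alpha>) (U l) x)) \<longlongrightarrow> 0) ?F" if "b \<in> Basis" for b
      using Suc.prems that by (intro Suc.IH) (auto simp: multi_indices_def)
    have \<psi>': "partial \<alpha> \<psi> \<in> test_functions Q" by (rule test_functions_partial[OF \<psi>(1) \<alpha>])
    define I where "I k = (\<integral>y. U k y * partial \<alpha> \<psi> y \<partial>lborel)" for k
    obtain l where l: "I \<longlonglongrightarrow> l" using conv[OF \<psi>'] unfolding convergent_def I_def by blast
    have "((\<lambda>x. \<bar>I (fst x) - I (snd x)\<bar> powr p) \<longlongrightarrow> \<bar>l - l\<bar> powr p) ?F"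
      using p by (intro tendsto_powr' tendsto_intros filterlim_compose[OF l filterlim_fst] filterlim_compose[OF l filterlim_snd]) auto
    then have I0: "((\<lambda>x. ennreal (\<bar>I (fst x) - I (snd x)\<bar> powr p)) \<longlongrightarrow> 0) ?F"
      using p tendsto_ennrealI by fastforce
    have Idiff: "(\<integral>y. (U k y - U l y) * partial \<alpha> \<psi> y \<partial>lborel) = I k - I l" for k l
    proof -
      obtain K where K: "compact K" "\<And>x. x \<notin> K \<Longrightarrow> partial \<alpha> \<psi> x = 0" using test_functions_support[OF \<psi>'] by blast
      have i: "integrable lborel (\<lambda>y. U k y * partial \<alpha> \<psi> y)" for k
        using K by (intro integrable_compact_support[OF _ K(1)] continuous_intros smooth_fun_continuous_on U test_functionsD(1)[OF \<psi>']) auto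
      show ?thesis unfolding I_def left_diff_distrib by (rule Bochner_Integration.integral_diff[OF i i])
    qed
    have "((\<lambda>x. ennreal C * ((\<Sum>b\<in>Basis. lpn p Q (\<lambda>y. partial (add_mset b \<alpha>) (U (fst x)) y - partial (add_mset b \<alpha>) (U (snd x)) y))
        + ennreal (\<bar>I (fst x) - I (snd x)\<bar> powr p))) \<longlongrightarrow> ennreal C * ((\<Sum>b\<in>(Basis :: 'a set). 0) + 0)) ?F"
      using IH by (intro ennreal_tendsto_cmult tendsto_add tendsto_sum I0) (auto simp: case_prod_unfold)
    then have lim: "((\<lambda>x. ennreal C * ((\<Sum>b\<in>Basis. lpn p Q (\<lambda>y. partial (add_mset b \<alpha>) (U (fst x)) y - partial (add_mset b \<alpha>) (U (snd x)) y))
        + ennreal (\<bar>I (fst x) - I (snd x)\<bar> powr p))) \<longlongrightarrow> 0) ?F" by simp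
    show ?case
    proof (rule tendsto_zero_ennreal_le[OF lim])
      fix x :: "nat \<times> nat"
      obtain k l where x: "x = (k, l)" by (cases x)
      have eqb: "lpn p Q (partial (add_mset b \<alpha>) (\<lambda>y. U k y - U l y)) = lpn p Q (\<lambda>y. partial (add_mset b \<alpha>) (U k) y - partial (add_mset b \<alpha>) (U l) y)" if "b \<in> Basis" for b
        using that \<alpha> by (subst partial_diff[OF U U]) auto
      have "lpn p Q (\<lambda>x. partial \<alpha> (U k) x - partial \<alpha> (U l) x) = lpn p Q (partial \<alpha> (\<lambda>y. U k y - U l y))"
        by (simp add: partial_diff[OF U U \<alpha>])
      also have "\<dots> \<le> ennreal C * ((\<Sum>b\<in>Basis. lpn p Q (partial (add_mset b \<alpha>) (\<lambda>y. U k y - U l y))) + ennreal (\<bar>I k - I l\<bar> powr p))"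
        using C[OF smooth_fun_diff[OF U U], of k l] unfolding Idiff .
      also have "(\<Sum>b\<in>Basis. lpn p Q (partial (add_mset b \<alpha>) (\<lambda>y. U k y - U l y))) = (\<Sum>b\<in>Basis. lpn p Q (\<lambda>y. partial (add_mset b \<alpha>) (U k) y - partial (add_mset b \<alpha>) (U l) y))"
        by (intro sum.cong refl eqb)
      finally show "(case x of (k, l) \<Rightarrow> lpn p Q (\<lambda>x. partial \<alpha> (U k) x - partial \<alpha> (U l) x)) \<le> ennreal C * ((\<Sum>b\<in>Basis. lpn p Q (\<lambda>y. partial (add_mset b \<alpha>) (U (fst x)) y - partial (add_mset b \<alpha>) (U (snd x)) y))
        + ennreal (\<bar>I (fst x) - I (snd x)\<bar> powr p))"
        by (simp add: x)
    qed
  qed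
qed

section \<open>Smooth approximation in the strip\<close>

lemma nn_integral_lborel_Pair:
  fixes g :: "'a::euclidean_space \<times> 'b::euclidean_space \<Rightarrow> ennreal"
  assumes "g \<in> borel_measurable borel"
  shows "(\<integral>\<^sup>+z. g z \<partial>lborel) = (\<integral>\<^sup>+x. \<integral>\<^sup>+y. g (x, y) \<partial>lborel \<partial>lborel)"
proof -
  have "g \<in> borel_measurable (lborel \<Otimes>\<^sub>M lborel)" unfolding lborel_prod using assms by simp
  from lborel.nn_integral_fst[OF this] show ?thesis unfolding lborel_prod by simp
qed

lemma Basis_Pair_cases:
  assumes "b \<in> (Basis :: ('a::euclidean_space \<times> real) set)"
  obtains b' where "b' \<in> Basis" "b = (b', 0)" | "b = (0, 1)"
  using assms by (auto simp: Basis_prod_def)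

lemma normal_in_Basis: "(0, 1) \<in> (Basis :: ('a::euclidean_space \<times> real) set)"
  by (auto simp: Basis_prod_def)

lemma tangential_in_Basis: "b \<in> Basis \<Longrightarrow> (b, 0) \<in> (Basis :: ('a::euclidean_space \<times> real) set)"
  by (auto simp: Basis_prod_def)

definition squeeze :: "real \<Rightarrow> real \<Rightarrow> nat \<Rightarrow> ('a::euclidean_space \<times> real) \<Rightarrow> ('a \<times> real)" where
  "squeeze c lam k x = (fst x, c + lam * (snd x - c))"

lemma squeeze_derivative:
  "((squeeze c lam k :: 'a::euclidean_space \<times> real \<Rightarrow> _) has_derivative (\<lambda>h. (fst h, lam * snd h))) (at x)"
  unfolding squeeze_def by (auto intro!: derivative_eq_intros)

lemma squeeze_Basis:
  assumes "b \<in> (Basis :: ('a::euclidean_space \<times> real) set)"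
  shows "(fst b, lam * snd b) = (if b = (0, 1) then lam else 1) *\<^sub>R b"
  using assms by (cases rule: Basis_Pair_cases) (auto simp: zero_prod_def[symmetric])

lemma smooth_fun_squeeze:
  fixes F :: "'a::euclidean_space \<times> real \<Rightarrow> real"
  assumes "smooth_fun F"
  shows "smooth_fun (\<lambda>x. F (squeeze c lam k x))"
  by (rule smooth_fun_compose[OF assms squeeze_derivative squeeze_Basis])

lemma partial_squeeze:
  fixes F :: "'a::euclidean_space \<times> real \<Rightarrow> real"
  assumes F: "smooth_fun F" and \<alpha>: "set_mset \<alpha> \<subseteq> Basis"
  shows "partial \<alpha> (\<lambda>x. F (squeeze c lam k x)) = (\<lambda>x. lam ^ count \<alpha> (0, 1) * partial \<alpha> F (squeeze c lam k x))"
proof -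
  obtain bs where bs: "set bs \<subseteq> Basis" "mset bs = \<alpha>" "\<forall>f :: 'a \<times> real \<Rightarrow> real. smooth_fun f \<longrightarrow> partial \<alpha> f = iter_partial bs f"
    using partial_eq_iter_partial[OF \<alpha>] by blast
  have pl: "prod_list (map (\<lambda>b. if b = (0, 1) then lam else 1) bs) = lam ^ count (mset bs) (0, 1)"
    by (induction bs) auto
  have "partial \<alpha> (\<lambda>x. F (squeeze c lam k x)) = iter_partial bs (\<lambda>x. F (squeeze c lam k x))"
    using bs(3) smooth_fun_squeeze[OF F] by blast
  also have "\<dots> = (\<lambda>x. prod_list (map (\<lambda>b. if b = (0, 1) then lam else 1) bs) * iter_partial (map (\<lambda>b. b) bs) F (squeeze c lam k x))"
    by (rule iter_partial_compose[OF F squeeze_derivative squeeze_Basis _ bs(1)])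
  also have "\<dots> = (\<lambda>x. lam ^ count \<alpha> (0, 1) * partial \<alpha> F (squeeze c lam k x))"
    using bs(3) F unfolding pl bs(2) by simp
  finally show ?thesis .
qed

text \<open>Only the last coordinate is scaled, by a factor of at least 1/2, whence the constant 2.
  The point moves by |c - x_N| / (k + 2), and |c - x_N| is at most (|c| + 1) (1 + |x|).\<close>

lemma squeeze_near_identity:
  fixes c d :: real
  assumes d: "0 < d"
  shows "near_identity (\<lambda>k. squeeze c (1 - 1 / (real k + 2)) k :: ('a::euclidean_space \<times> real) \<Rightarrow> _)
    (\<lambda>k. d / (4 * (real k + 2))) (\<lambda>k. (\<bar>c\<bar> + 1) / (real k + 2)) 2"
proof
  show "(\<lambda>k. d / (4 * (real k + 2))) \<longlonglongrightarrow> 0" by real_asymp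
  show "(\<lambda>k. (\<bar>c\<bar> + 1) / (real k + 2)) \<longlonglongrightarrow> 0" by real_asymp
  show "squeeze c (1 - 1 / (real k + 2)) k \<in> borel_measurable (borel :: ('a \<times> real) measure)" for k
    unfolding squeeze_def by (intro borel_measurable_continuous_onI continuous_intros)
  fix k :: nat
  define lam where "lam = 1 - 1 / (real k + 2)"
  have lam: "1 / 2 \<le> lam" by (simp add: lam_def field_simps)
  show "norm (squeeze c (1 - 1 / (real k + 2)) k x - x) \<le> (\<bar>c\<bar> + 1) / (real k + 2) * (1 + norm x)" for x :: "'a \<times> real"
  proof -
    have "squeeze c (1 - 1 / (real k + 2)) k x - x = (0, (c - snd x) / (real k + 2))"
      by (simp add: squeeze_def prod_eq_iff field_simps)
    then have "norm (squeeze c (1 - 1 / (real k + 2)) k x - x) = \<bar>c - snd x\<bar> / (real k + 2)"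
      by (simp add: norm_Pair abs_divide)
    also have "\<dots> \<le> ((\<bar>c\<bar> + 1) * (1 + norm x)) / (real k + 2)"
    proof (intro divide_right_mono)
      have "\<bar>c - snd x\<bar> \<le> \<bar>c\<bar> + norm x" using norm_snd_le[of "snd x" "fst x"] by simp
      also have "\<dots> \<le> (\<bar>c\<bar> + 1) * (1 + norm x)" by (simp add: algebra_simps)
      finally show "\<bar>c - snd x\<bar> \<le> (\<bar>c\<bar> + 1) * (1 + norm x)" .
    qed simp
    finally show ?thesis by simp
  qed
  fix z :: "'a \<times> real" and g :: "'a \<times> real \<Rightarrow> ennreal"
  assume g[measurable]: "g \<in> borel_measurable borel"
  have [measurable]: "(\<lambda>x. g (squeeze c lam k x - z)) \<in> borel_measurable borel"
    by (rule measurable_compose[OF _ g]) (auto simp: squeeze_def intro!: borel_measurable_continuous_onI continuous_intros)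
  have gp[measurable]: "(\<lambda>(x, s). g (x, s)) \<in> borel_measurable (borel \<Otimes>\<^sub>M borel)"
    unfolding borel_prod by simp
  define G where "G x = (\<integral>\<^sup>+s. g (x, s) \<partial>lborel)" for x
  have Gm[measurable]: "G \<in> borel_measurable borel" unfolding G_def by measurable
  have "(\<integral>\<^sup>+x. g (squeeze c lam k x - z) \<partial>lborel) = (\<integral>\<^sup>+x. \<integral>\<^sup>+t. g (squeeze c lam k (x, t) - z) \<partial>lborel \<partial>lborel)"
    by (rule nn_integral_lborel_Pair) measurable
  also have "\<dots> \<le> (\<integral>\<^sup>+x. ennreal 2 * G (x - fst z) \<partial>lborel)"
  proof (intro nn_integral_mono)
    fix x :: 'a
    have [measurable]: "(\<lambda>s. g (x - fst z, s)) \<in> borel_measurable borel"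
      by (rule measurable_compose[OF _ g]) (auto intro!: borel_measurable_continuous_onI continuous_intros)
    have "(\<integral>\<^sup>+t. g (squeeze c lam k (x, t) - z) \<partial>lborel) = (\<integral>\<^sup>+t. (\<lambda>s. g (x - fst z, s)) ((c - lam * c - snd z) + lam *\<^sub>R t) \<partial>lborel)"
      by (intro nn_integral_cong arg_cong[of _ _ g]) (simp add: squeeze_def prod_eq_iff algebra_simps)
    also have "\<dots> \<le> ennreal (2 ^ DIM(real)) * (\<integral>\<^sup>+s. g (x - fst z, s) \<partial>lborel)"
      by (rule nn_integral_affine_le[OF _ lam]) measurable
    finally show "(\<integral>\<^sup>+t. g (squeeze c lam k (x, t) - z) \<partial>lborel) \<le> ennreal 2 * G (x - fst z)" by (simp add: G_def)
  qed
  also have "\<dots> = ennreal 2 * (\<integral>\<^sup>+x. G (x - fst z) \<partial>lborel)" by (rule nn_integral_cmult) measurable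
  also have "(\<integral>\<^sup>+x. G (x - fst z) \<partial>lborel) = (\<integral>\<^sup>+x. G x \<partial>lborel)"
    using lborel_nn_integral_translate[OF Gm, of "- fst z"] by simp
  also have "\<dots> = (\<integral>\<^sup>+x. g x \<partial>lborel)" unfolding G_def by (rule nn_integral_lborel_Pair[OF g, symmetric])
  finally show "(\<integral>\<^sup>+x. g (squeeze c (1 - 1 / (real k + 2)) k x - z) \<partial>lborel) \<le> ennreal 2 * (\<integral>\<^sup>+x. g x \<partial>lborel)"
    unfolding lam_def .
qed

lemma AE_lebesgue_on_iff:
  "A \<in> sets lebesgue \<Longrightarrow> (AE x in lebesgue_on A. P x) \<longleftrightarrow> (AE x in lebesgue. x \<in> A \<longrightarrow> P x)"
  by (simp add: AE_restrict_space_iff)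

lemma open_strip: "open (strip bm bp)"
  unfolding strip_def by (intro open_Times) auto

lemma strip_sets: "strip bm bp \<in> sets borel" "strip bm bp \<in> sets lebesgue"
proof -
  show "strip bm bp \<in> sets borel" by (rule borel_open[OF open_strip])
  show "strip bm bp \<in> sets lebesgue" by (rule sets_completionI_sets) (simp add: borel_open[OF open_strip])
qed

lemma cylinder_facts:
  fixes bm bp R :: real
  shows "open (cylinder bm bp R)" "convex (cylinder bm bp R)" "bounded (cylinder bm bp R)" "cylinder bm bp R \<subseteq> strip bm bp"
  unfolding cylinder_def strip_def by (auto intro!: open_Times convex_Times bounded_Times)

lemma cylinder_sets: "cylinder bm bp R \<in> sets borel" "cylinder bm bp R \<in> sets lebesgue"
proof -
  show "cylinder bm bp R \<in> sets borel" by (rule borel_open[OF cylinder_facts(1)])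
  show "cylinder bm bp R \<in> sets lebesgue" by (rule sets_completionI_sets) (simp add: borel_open[OF cylinder_facts(1)])
qed

lemma lpn_continuous_bounded_finite:
  fixes V :: "'a::euclidean_space \<Rightarrow> real"
  assumes V: "continuous_on UNIV V" and A: "bounded A" "A \<in> sets lebesgue" and p: "0 \<le> p"
  shows "lpn p A V < \<infinity>"
proof -
  obtain r where "\<forall>x\<in>A. norm x \<le> r" using A(1) unfolding bounded_iff by blast
  then have r: "A \<subseteq> cball 0 r" by auto
  have "compact (V ` cball 0 r)" using V by (intro compact_continuous_image) (auto intro: continuous_on_subset)
  from compact_imp_bounded[OF this] obtain B where "\<forall>y\<in>V ` cball 0 r. norm y \<le> B"
    unfolding bounded_iff by blast
  then have B: "\<And>x. x \<in> cball 0 r \<Longrightarrow> \<bar>V x\<bar> \<le> B" by simp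
  have "lpn p A V \<le> (\<integral>\<^sup>+x. ennreal (B powr p) * indicator (cball 0 r) x \<partial>(lebesgue :: 'a measure))"
    unfolding lpn_def
  proof (intro nn_integral_mono)
    fix x
    show "ennreal (\<bar>V x\<bar> powr p) * indicator A x \<le> ennreal (B powr p) * indicator (cball 0 r) x"
    proof (cases "x \<in> A")
      case True
      then have "\<bar>V x\<bar> powr p \<le> B powr p" using B[of x] r p by (intro powr_mono2) auto
      then show ?thesis using True r by (auto simp: indicator_def intro: ennreal_leI)
    qed simp
  qed
  also have "\<dots> = ennreal (B powr p) * emeasure lebesgue (cball (0 :: 'a) r)"
    by (rule nn_integral_cmult_indicator) simp
  also have "\<dots> < \<infinity>" using compact_sets_lebesgue(2)[of "cball (0 :: 'a) r"] by (simp add: ennreal_mult_less_top)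
  finally show ?thesis .
qed

text \<open>Here \<open>u0\<close> is a Borel representative of u extended by 0. It need not be
  integrable up to the boundary of the strip.\<close>

locale strip_mollification =
  fixes bm bp :: real and u :: "(real ^ 'n) \<times> real \<Rightarrow> real" and \<eta> :: "nat \<Rightarrow> (real ^ 'n) \<times> real \<Rightarrow> real" and u0 :: "(real ^ 'n) \<times> real \<Rightarrow> real"
  assumes b: "bm < bp" and u: "locally_integrable (strip bm bp) u"
    and \<eta>: "\<And>k. mollifier ((bp - bm) / (4 * (real k + 2))) (\<eta> k)"
    and u0: "u0 \<in> borel_measurable borel" "AE x in lebesgue. u0 x = indicator (strip bm bp) x * u x"
begin

abbreviation "\<Omega> \<equiv> strip bm bp :: ((real ^ 'n) \<times> real) set"
text \<open>The radius is matched to the squeezing: the squeezed strip keeps the distance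
  \<open>2 * ee k\<close> from the boundary, so a mollifier at its points reaches only
  \<open>inner_strip k\<close>, which still keeps the distance \<open>ee k\<close>.\<close>

definition "ee k = (bp - bm) / (4 * (real k + 2))"
definition "lam k = 1 - 1 / (real k + 2)"
definition "mid = (bm + bp) / 2"
definition LL :: "nat \<Rightarrow> (real ^ 'n) \<times> real \<Rightarrow> (real ^ 'n) \<times> real" where "LL k = squeeze mid (lam k) k"
definition inner_strip :: "nat \<Rightarrow> ((real ^ 'n) \<times> real) set" where "inner_strip k = {y. \<bar>snd y - mid\<bar> \<le> (bp - bm) / 2 - ee k}"
text \<open>Without the cut-off the function may fail to be integrable on balls that meet the
  boundary of the strip, and its convolution would not be available. Mollifications at squeezed
  points do not see the cut-off.\<close>

definition "cutoff k y = indicator (inner_strip k) y * u0 y"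
definition "U k x = conv (\<eta> k) (cutoff k) (LL k x)"

lemma ee_pos: "0 < ee k"
  unfolding ee_def using b by simp

sublocale ni: near_identity LL ee "\<lambda>k. (\<bar>mid\<bar> + 1) / (real k + 2)" 2
  using squeeze_near_identity[of "bp - bm" mid] b unfolding LL_def lam_def ee_def by simp

lemmas \<eta>' = \<eta>[folded ee_def]

lemma u0m[measurable]: "u0 \<in> borel_measurable borel" by (rule u0(1))
lemma \<eta>m[measurable]: "\<eta> k \<in> borel_measurable borel" by (rule smooth_fun_borel[OF mollifierD(1)[OF \<eta>]])

lemma strip_iff: "x \<in> \<Omega> \<longleftrightarrow> \<bar>snd x - mid\<bar> < (bp - bm) / 2"
  unfolding strip_def mid_def by (cases x) (auto simp: abs_less_iff field_simps)

lemma inner_strip_subset: "inner_strip k \<subseteq> \<Omega>"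
proof
  fix y assume "y \<in> inner_strip k"
  then have "\<bar>snd y - mid\<bar> \<le> (bp - bm) / 2 - ee k" by (simp add: inner_strip_def)
  then have "\<bar>snd y - mid\<bar> < (bp - bm) / 2" using ee_pos[of k] by linarith
  then show "y \<in> \<Omega>" by (simp only: strip_iff)
qed

lemma closed_inner_strip: "closed (inner_strip k)"
  unfolding inner_strip_def by (intro closed_Collect_le continuous_intros)

lemma inner_strip_borel[measurable]: "inner_strip k \<in> sets borel"
  using closed_inner_strip by simp

lemma LL_snd: "snd (LL k x) - mid = lam k * (snd x - mid)"
  by (simp add: LL_def squeeze_def)

lemma lam_bounds: "0 \<le> lam k" "lam k \<le> 1" "lam k * ((bp - bm) / 2) = (bp - bm) / 2 - 2 * ee k"
  by (auto simp: lam_def ee_def field_simps)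

lemma near_LL_inner:
  assumes x: "x \<in> \<Omega>" and y: "dist (LL k x) y \<le> ee k"
  shows "y \<in> inner_strip k"
proof -
  have "\<bar>snd (LL k x) - snd y\<bar> \<le> ee k" using y dist_snd_le[of "LL k x" y] by (simp add: dist_real_def)
  moreover have "\<bar>snd (LL k x) - mid\<bar> \<le> lam k * ((bp - bm) / 2)"
    unfolding LL_snd abs_mult abs_of_nonneg[OF lam_bounds(1)]
    by (rule mult_left_mono[OF less_imp_le[OF x[unfolded strip_iff]] lam_bounds(1)])
  ultimately have "\<bar>snd y - mid\<bar> \<le> (bp - bm) / 2 - ee k" using lam_bounds(3)[of k] by linarith
  then show ?thesis by (simp add: inner_strip_def)
qed

lemma cutoff_measurable[measurable]: "cutoff k \<in> borel_measurable borel"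
  unfolding cutoff_def by measurable

lemma cutoff_AE: "AE y in lebesgue. cutoff k y = indicator (inner_strip k) y * u y"
  using u0(2)
proof eventually_elim
  case (elim y)
  then show ?case using inner_strip_subset[of k] by (auto simp: cutoff_def indicator_def)
qed

lemma restrict_integrable:
  assumes K: "compact K" "K \<subseteq> \<Omega>"
  shows "integrable lborel (\<lambda>y. indicator K y * u0 y)"
proof -
  have ae: "AE y in lebesgue. indicator K y * u y = indicator K y * u0 y"
    using u0(2)
  proof eventually_elim
    case (elim y)
    then show ?case using K(2) by (auto simp: indicator_def)
  qed
  have i: "integrable lebesgue (\<lambda>y. indicator K y * u y)" using u K by (rule locally_integrableD)
  have "K \<in> sets borel" using K(1) by (simp add: borel_compact)
  then have m: "(\<lambda>y. indicator K y * u0 y) \<in> borel_measurable lborel" by simp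
  have "integrable lebesgue (\<lambda>y. indicator K y * u0 y)"
    using integrable_cong_AE[OF borel_measurable_integrable[OF i] measurable_completion[OF m] ae] i by blast
  then show ?thesis using integrable_completion[OF m] by blast
qed

lemma lint_cutoff: "lint (cutoff k)"
  unfolding lint_def
proof (intro conjI allI cutoff_measurable)
  fix r
  have c: "compact (cball 0 r \<inter> inner_strip k)" using closed_inner_strip by (intro compact_Int_closed) auto
  have "integrable lborel (\<lambda>y. indicator (cball 0 r \<inter> inner_strip k) y * u0 y)"
    using inner_strip_subset by (intro restrict_integrable c) auto
  then show "integrable lborel (\<lambda>y. indicator (cball 0 r) y * cutoff k y)"
    by (simp add: cutoff_def indicator_inter_arith mult.assoc)
qed

lemma smooth_conv: "smooth_fun (conv (\<eta> k) (cutoff k))"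
  by (rule smooth_fun_conv[OF mollifierD(1,3)[OF \<eta>'] lint_cutoff])

lemma smooth_U: "smooth_fun (U k)"
  unfolding U_def LL_def by (rule smooth_fun_squeeze[OF smooth_conv])

lemma partial_U:
  assumes \<alpha>: "set_mset \<alpha> \<subseteq> Basis"
  shows "partial \<alpha> (U k) x = lam k ^ count \<alpha> (0, 1) * conv (partial \<alpha> (\<eta> k)) (cutoff k) (LL k x)"
proof -
  obtain bs where bs: "set bs \<subseteq> Basis" "mset bs = \<alpha>" "\<forall>f :: (real ^ 'n) \<times> real \<Rightarrow> real. smooth_fun f \<longrightarrow> partial \<alpha> f = iter_partial bs f"
    using partial_eq_iter_partial[OF \<alpha>] by blast
  have "partial \<alpha> (U k) x = lam k ^ count \<alpha> (0, 1) * partial \<alpha> (conv (\<eta> k) (cutoff k)) (LL k x)"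
    unfolding U_def LL_def by (subst partial_squeeze[OF smooth_conv \<alpha>]) simp
  also have "partial \<alpha> (conv (\<eta> k) (cutoff k)) = iter_partial bs (conv (\<eta> k) (cutoff k))"
    using bs(3) smooth_conv by blast
  also have "\<dots> = conv (iter_partial bs (\<eta> k)) (cutoff k)"
    by (rule iter_partial_conv(1)[OF mollifierD(1,3)[OF \<eta>'] lint_cutoff bs(1)])
  also have "iter_partial bs (\<eta> k) = partial \<alpha> (\<eta> k)" using bs(3) mollifierD(1)[OF \<eta>] by simp
  finally show ?thesis .
qed

lemma partial_\<eta>_zero: "ee k < norm z \<Longrightarrow> partial \<alpha> (\<eta> k) z = 0"
  by (rule partial_eq_zero[of "- cball 0 (ee k)"]) (auto simp: open_Compl mollifierD(3)[OF \<eta>'])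

text \<open>At squeezed points the mollifier stays inside the strip, so the derivative passes from
  the kernel to u and produces a mollification of g. The power of \<open>lam k\<close> is the chain
  rule, one factor for each normal derivative. Here g is extended by 0 instead of being cut off; the
  kernel does not see the difference.\<close>

lemma partial_U_eq:
  assumes \<alpha>: "set_mset \<alpha> \<subseteq> Basis" and w: "has_weak_deriv \<Omega> \<alpha> u g" and x: "x \<in> \<Omega>"
    and g0: "g0 \<in> borel_measurable borel" "AE y in lebesgue. g0 y = indicator \<Omega> y * g y"
  shows "partial \<alpha> (U k) x = lam k ^ count \<alpha> (0, 1) * conv (\<eta> k) g0 (LL k x)"
proof -
  have near: "y \<in> inner_strip k" if "f (LL k x - y) \<noteq> 0" "\<And>z. ee k < norm z \<Longrightarrow> f z = 0" for y and f :: "(real ^ 'n) \<times> real \<Rightarrow> real"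
  proof -
    have "\<not> ee k < norm (LL k x - y)" using that by blast
    then show ?thesis by (intro near_LL_inner[OF x]) (simp add: dist_norm)
  qed
  have sub: "cball (LL k x) (ee k) \<subseteq> \<Omega>"
    using near_LL_inner[OF x, of k] inner_strip_subset[of k] by (auto simp: subset_iff)
  have "conv (partial \<alpha> (\<eta> k)) (cutoff k) (LL k x) = (\<integral>y. u y * partial \<alpha> (\<eta> k) (LL k x - y) \<partial>lebesgue)"
  proof (rule integrable_indicator_compact_absorb[OF _ cutoff_AE cutoff_measurable])
    show "y \<in> inner_strip k" if "partial \<alpha> (\<eta> k) (LL k x - y) \<noteq> 0" for y
      using near[of "partial \<alpha> (\<eta> k)", OF that partial_\<eta>_zero] .
    show "partial \<alpha> (\<eta> k) \<in> borel_measurable borel" by (rule smooth_partial_borel[OF mollifierD(1)[OF \<eta>] \<alpha>])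
  qed
  also have "\<dots> = (\<integral>y. g y * \<eta> k (LL k x - y) \<partial>lebesgue)"
    by (rule has_weak_deriv_mollifier[OF open_strip \<alpha> w mollifierD(1,3)[OF \<eta>'] sub])
  also have "\<dots> = conv (\<eta> k) g0 (LL k x)"
  proof (rule integrable_indicator_compact_absorb[OF _ g0(2,1) \<eta>m, symmetric])
    show "y \<in> \<Omega>" if "\<eta> k (LL k x - y) \<noteq> 0" for y
      using near[of "\<eta> k", OF that mollifierD(3)[OF \<eta>']] inner_strip_subset[of k] by blast
  qed
  finally show ?thesis unfolding partial_U[OF \<alpha>] by simp
qed

text \<open>Since g is in L^p of the whole strip, its extension by 0 is in L^p of the whole space
  and \<open>conv_tendsto\<close> applies. The factor from the chain rule costs a further error,
  which vanishes as \<open>lam k\<close> tends to 1.\<close>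

lemma top_order_tendsto:
  assumes p: "1 \<le> p" and \<alpha>: "set_mset \<alpha> \<subseteq> Basis" and w: "has_weak_deriv \<Omega> \<alpha> u g" and g: "in_Lp p \<Omega> g"
  shows "(\<lambda>k. lpn p \<Omega> (\<lambda>x. partial \<alpha> (U k) x - g x)) \<longlonglongrightarrow> 0"
proof -
  have gm: "(\<lambda>x. indicator \<Omega> x * g x) \<in> borel_measurable lebesgue"
    using g strip_sets(2)[of bm bp] borel_measurable_restrict_space_iff[of \<Omega> lebesgue g] by (simp add: in_Lp_def)
  obtain g0 where g0: "g0 \<in> borel_measurable borel" "AE y in lebesgue. g0 y = indicator \<Omega> y * g y"
  proof -
    obtain g0 where "g0 \<in> borel_measurable lborel" "AE y in lborel. indicator \<Omega> y * g y = g0 y"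
      using completion_ex_borel_measurable_real[OF gm] by blast
    then show ?thesis by (intro that[of g0]) (auto dest!: AE_completion elim!: eventually_mono)
  qed
  have g0m[measurable]: "g0 \<in> borel_measurable borel" by (rule g0(1))
  have fin: "lpn p UNIV g0 < \<infinity>"
  proof -
    have "lpn p UNIV g0 = lpn p UNIV (\<lambda>y. indicator \<Omega> y * g y)"
      by (rule lpn_cong_AE) (use g0(2) in \<open>simp_all add: AE_restrict_space_iff\<close>)
    also have "\<dots> = lpn p \<Omega> g" unfolding lpn_def
      by (intro nn_integral_cong) (use p in \<open>auto simp: indicator_def\<close>)
    also have "\<dots> < \<infinity>" using g by (simp add: in_Lp_def lpn_def)
    finally show ?thesis .
  qed
  define n where "n = count \<alpha> (0, 1)"
  define S where "S k x = conv (\<eta> k) g0 (LL k x)" for k x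
  have sm: "smooth_fun (conv (\<eta> k) g0)" for k
    by (rule smooth_fun_conv[OF mollifierD(1,3)[OF \<eta>'] Lp_imp_lint[OF p g0(1) fin]])
  have Sm[measurable]: "S k \<in> borel_measurable borel" for k
    unfolding S_def by (rule measurable_compose[OF ni.L_measurable smooth_fun_borel[OF sm]])
  have lim: "(\<lambda>k. lpn p UNIV (\<lambda>x. S k x - g0 x)) \<longlonglongrightarrow> 0"
    unfolding S_def by (rule ni.conv_tendsto[OF p g0(1) fin \<eta>'])
  have laml: "lam \<longlonglongrightarrow> 1" unfolding lam_def by real_asymp
  have bound: "lpn p \<Omega> (\<lambda>x. partial \<alpha> (U k) x - g x) \<le> ennreal (2 powr p) *
      (lpn p UNIV (\<lambda>x. S k x - g0 x) + ennreal (\<bar>lam k ^ n - 1\<bar> powr p) * lpn p UNIV g0)" for k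
  proof -
    have "lpn p \<Omega> (\<lambda>x. partial \<alpha> (U k) x - g x) = lpn p \<Omega> (\<lambda>x. lam k ^ n * S k x - g0 x)"
    proof (rule lpn_cong_AE[OF strip_sets(2)])
      have "AE x in lebesgue. x \<in> \<Omega> \<longrightarrow> partial \<alpha> (U k) x - g x = lam k ^ n * S k x - g0 x"
        using g0(2)
      proof eventually_elim
        case (elim x)
        then show ?case using partial_U_eq[OF \<alpha> w _ g0, of x k] by (auto simp: S_def n_def)
      qed
      then show "AE x in lebesgue_on \<Omega>. partial \<alpha> (U k) x - g x = lam k ^ n * S k x - g0 x"
        by (simp only: AE_lebesgue_on_iff[OF strip_sets(2)])
    qed
    also have "\<dots> \<le> lpn p UNIV (\<lambda>x. lam k ^ n * S k x - g0 x)" by (rule lpn_mono_set) simp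
    also have "\<dots> = lpn p UNIV (\<lambda>x. lam k ^ n * (S k x - g0 x) + (lam k ^ n - 1) * g0 x)"
      by (simp add: algebra_simps)
    also have "\<dots> \<le> ennreal (2 powr p) * (lpn p UNIV (\<lambda>x. lam k ^ n * (S k x - g0 x)) + lpn p UNIV (\<lambda>x. (lam k ^ n - 1) * g0 x))"
      using p by (intro lpn_add borel_imp_lebesgue_on) auto
    also have "\<dots> \<le> ennreal (2 powr p) * (lpn p UNIV (\<lambda>x. S k x - g0 x) + ennreal (\<bar>lam k ^ n - 1\<bar> powr p) * lpn p UNIV g0)"
    proof (intro mult_left_mono add_mono)
      show "lpn p UNIV (\<lambda>x. lam k ^ n * (S k x - g0 x)) \<le> lpn p UNIV (\<lambda>x. S k x - g0 x)"
        using p lam_bounds(1,2)[of k] by (intro lpn_mono) (auto simp: abs_mult power_le_one intro!: mult_left_le_one_le)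
      show "lpn p UNIV (\<lambda>x. (lam k ^ n - 1) * g0 x) \<le> ennreal (\<bar>lam k ^ n - 1\<bar> powr p) * lpn p UNIV g0"
        by (subst lpn_cmult) (auto intro: borel_imp_lebesgue_on)
    qed auto
    finally show ?thesis .
  qed
  have "(\<lambda>k. \<bar>lam k ^ n - 1\<bar> powr p) \<longlonglongrightarrow> \<bar>1 ^ n - 1\<bar> powr p"
    using p by (intro tendsto_powr' tendsto_intros laml) auto
  then have "(\<lambda>k. ennreal (\<bar>lam k ^ n - 1\<bar> powr p)) \<longlonglongrightarrow> ennreal (\<bar>1 ^ n - 1 :: real\<bar> powr p)"
    by (rule tendsto_ennrealI)
  then have "(\<lambda>k. ennreal (\<bar>lam k ^ n - 1\<bar> powr p) * lpn p UNIV g0) \<longlonglongrightarrow> 0 * lpn p UNIV g0"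
    using fin p by (intro tendsto_mult_ennreal tendsto_const) (auto simp: less_top)
  then have "(\<lambda>k. ennreal (2 powr p) * (lpn p UNIV (\<lambda>x. S k x - g0 x) + ennreal (\<bar>lam k ^ n - 1\<bar> powr p) * lpn p UNIV g0))
     \<longlonglongrightarrow> ennreal (2 powr p) * (0 + 0)"
    using lim by (intro ennreal_tendsto_cmult tendsto_add) auto
  then have "(\<lambda>k. ennreal (2 powr p) * (lpn p UNIV (\<lambda>x. S k x - g0 x) + ennreal (\<bar>lam k ^ n - 1\<bar> powr p) * lpn p UNIV g0)) \<longlonglongrightarrow> 0"
    by simp
  then show ?thesis by (rule tendsto_zero_ennreal_le[OF _ bound])
qed

lemma compact_in_inner:
  assumes K: "compact K" "K \<subseteq> \<Omega>"
  obtains s where "0 < s" "\<And>x. x \<in> K \<Longrightarrow> \<bar>snd x - mid\<bar> \<le> (bp - bm) / 2 - s"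
proof (cases "K = {}")
  case True
  then show ?thesis using that[of 1] by simp
next
  case False
  have "continuous_on K (\<lambda>x. \<bar>snd x - mid\<bar>)" by (intro continuous_intros)
  then obtain z where z: "z \<in> K" "\<And>x. x \<in> K \<Longrightarrow> \<bar>snd x - mid\<bar> \<le> \<bar>snd z - mid\<bar>"
    using continuous_attains_sup[OF K(1) False] by blast
  have "\<bar>snd z - mid\<bar> < (bp - bm) / 2" using z(1) K(2) strip_iff by blast
  then show ?thesis using z(2) by (intro that[of "(bp - bm) / 2 - \<bar>snd z - mid\<bar>"]) auto
qed

text \<open>For u itself only local integrability is known, hence L^1 and compact sets. Near K the
  function is cut off to a larger compact set \<open>K'\<close>, which for large k contains every
  point reached from K by squeezing and mollifying.\<close>

lemma zero_order_tendsto: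
  assumes K: "compact K" "K \<subseteq> \<Omega>"
  shows "(\<lambda>k. lpn 1 K (\<lambda>x. U k x - u x)) \<longlonglongrightarrow> 0"
proof -
  obtain s where s: "0 < s" "\<And>x. x \<in> K \<Longrightarrow> \<bar>snd x - mid\<bar> \<le> (bp - bm) / 2 - s"
    by (rule compact_in_inner[OF K]) blast
  obtain r where r: "0 < r" "\<And>x. x \<in> K \<Longrightarrow> norm x \<le> r" using compact_imp_bounded[OF K(1)] by (auto simp: bounded_pos)
  \<comment> \<open>Bounds the norm of the points reached: |x| \<le> r, the squeezing moves x by at
    most (|mid| + 1) (1 + r), and the mollifier adds at most bp - bm.\<close>
  define r' where "r' = r + (\<bar>mid\<bar> + 1) * (1 + r) + (bp - bm)"
  define K' where "K' = cball (0 :: (real ^ 'n) \<times> real) r' \<inter> {y. \<bar>snd y - mid\<bar> \<le> (bp - bm) / 2 - s / 2}"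
  have K': "compact K'" "K' \<subseteq> \<Omega>"
  proof -
    have "closed {y :: (real ^ 'n) \<times> real. \<bar>snd y - mid\<bar> \<le> (bp - bm) / 2 - s / 2}"
      by (intro closed_Collect_le continuous_intros)
    then show "compact K'" unfolding K'_def by (intro compact_Int_closed) auto
    show "K' \<subseteq> \<Omega>"
    proof
      fix y assume "y \<in> K'"
      then have "\<bar>snd y - mid\<bar> \<le> (bp - bm) / 2 - s / 2" by (simp add: K'_def)
      then have "\<bar>snd y - mid\<bar> < (bp - bm) / 2" using s(1) by linarith
      then show "y \<in> \<Omega>" by (simp only: strip_iff)
    qed
  qed
  have K'b[measurable]: "K' \<in> sets borel" using K'(1) by (simp add: borel_compact)
  define f where "f y = indicator K' y * u0 y" for y
  have fm[measurable]: "f \<in> borel_measurable borel" unfolding f_def by measurable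
  have fAE: "AE y in lebesgue. f y = indicator K' y * u y"
    using u0(2)
  proof eventually_elim
    case (elim y)
    then show ?case using K'(2) by (auto simp: f_def indicator_def)
  qed
  have fin: "lpn 1 UNIV f < \<infinity>"
    using restrict_integrable[OF K'] unfolding f_def[symmetric] by (simp add: lpn_lborel integrable_iff_bounded)
  have lim: "(\<lambda>k. lpn 1 UNIV (\<lambda>x. conv (\<eta> k) f (LL k x) - f x)) \<longlonglongrightarrow> 0"
    by (rule ni.conv_tendsto[OF _ fm fin \<eta>']) simp
  \<comment> \<open>Half of the gap s is reserved for the mollifier; squeezing towards the middle
    does not increase the distance from it.\<close>
  have "\<forall>\<^sub>F k in sequentially. ee k < s / 2"
    using ni.e_lim s(1) by (intro order_tendstoD) auto
  then have ev: "\<forall>\<^sub>F k in sequentially. lpn 1 K (\<lambda>x. U k x - u x) \<le> lpn 1 UNIV (\<lambda>x. conv (\<eta> k) f (LL k x) - f x)"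
  proof eventually_elim
    case (elim k)
    have eq: "U k x = conv (\<eta> k) f (LL k x)" if x: "x \<in> K" for x
    proof -
      have near: "y \<in> inner_strip k" "y \<in> K'" if nz: "\<eta> k (LL k x - y) \<noteq> 0" for y
      proof -
        have d: "norm (LL k x - y) \<le> ee k" using nz mollifierD(3)[OF \<eta>', of k "LL k x - y"] by (meson not_le)
        show "y \<in> inner_strip k" using x K(2) d by (intro near_LL_inner[of x]) (auto simp: dist_norm)
        have "\<bar>snd (LL k x) - snd y\<bar> \<le> ee k" using d dist_snd_le[of "LL k x" y] by (simp add: dist_real_def dist_norm)
        moreover have "\<bar>snd (LL k x) - mid\<bar> \<le> 1 * ((bp - bm) / 2 - s)"
          unfolding LL_snd abs_mult using lam_bounds(1,2)[of k] s(2)[OF x] by (intro mult_mono) auto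
        ultimately have 1: "\<bar>snd y - mid\<bar> \<le> (bp - bm) / 2 - s / 2" using elim by simp
        have "norm y \<le> norm x + norm (LL k x - x) + norm (LL k x - y)"
          using norm_triangle_ineq4[of "LL k x" "LL k x - y"] norm_triangle_ineq[of x "LL k x - x"] by simp
        also have "\<dots> \<le> r + (\<bar>mid\<bar> + 1) * (1 + r) + (bp - bm)"
        proof (intro add_mono r x)
          have "norm (LL k x - x) \<le> (\<bar>mid\<bar> + 1) / (real k + 2) * (1 + norm x)" by (rule ni.L_dist)
          also have "\<dots> \<le> (\<bar>mid\<bar> + 1) * (1 + r)"
            using r(2)[OF x] by (intro mult_mono) (auto simp: field_simps)
          finally show "norm (LL k x - x) \<le> (\<bar>mid\<bar> + 1) * (1 + r)" .
          have "ee k \<le> (bp - bm) / 1" unfolding ee_def using b by (intro divide_left_mono) auto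
          then show "norm (LL k x - y) \<le> bp - bm" using d by simp
        qed
        finally show "y \<in> K'" using 1 by (simp add: K'_def r'_def)
      qed
      have "U k x = (\<integral>y. u y * \<eta> k (LL k x - y) \<partial>lebesgue)"
        unfolding U_def by (rule integrable_indicator_compact_absorb[OF near(1) cutoff_AE cutoff_measurable \<eta>m])
      also have "\<dots> = conv (\<eta> k) f (LL k x)"
        by (rule integrable_indicator_compact_absorb[OF near(2) fAE fm \<eta>m, symmetric])
      finally show ?thesis .
    qed
    have KK': "x \<in> K'" if "x \<in> K" for x
    proof -
      have "\<bar>snd x - mid\<bar> \<le> (bp - bm) / 2 - s / 2" using s(2)[OF that] s(1) by simp
      moreover have "0 \<le> (\<bar>mid\<bar> + 1) * (1 + r)" using r(1) by simp
      then have "norm x \<le> r'" using r(2)[OF that] b by (simp add: r'_def)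
      ultimately show ?thesis by (simp add: K'_def)
    qed
    have "lpn 1 K (\<lambda>x. U k x - u x) = lpn 1 K (\<lambda>x. conv (\<eta> k) f (LL k x) - f x)"
    proof (rule lpn_cong_AE[OF compact_sets_lebesgue(1)[OF K(1)]])
      have "AE x in lebesgue. x \<in> K \<longrightarrow> U k x - u x = conv (\<eta> k) f (LL k x) - f x"
        using fAE
      proof eventually_elim
        case (elim x)
        then show ?case using eq[of x] KK'[of x] by auto
      qed
      then show "AE x in lebesgue_on K. U k x - u x = conv (\<eta> k) f (LL k x) - f x"
        by (simp only: AE_lebesgue_on_iff[OF compact_sets_lebesgue(1)[OF K(1)]])
    qed
    also have "\<dots> \<le> lpn 1 UNIV (\<lambda>x. conv (\<eta> k) f (LL k x) - f x)" by (rule lpn_mono_set) simp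
    finally show ?case .
  qed
  show ?thesis
    by (rule tendsto_sandwich[OF _ ev tendsto_const lim]) simp
qed

end

lemma compact_subset_cylinder:
  assumes "compact K" "K \<subseteq> strip bm bp"
  obtains j :: nat where "K \<subseteq> cylinder bm bp (real j + 1)"
proof -
  obtain r where r: "\<And>x. x \<in> K \<Longrightarrow> norm x \<le> r" using compact_imp_bounded[OF assms(1)] by (auto simp: bounded_iff)
  obtain j where j: "r \<le> real j" using real_arch_simple by blast
  have "x \<in> cylinder bm bp (real j + 1)" if "x \<in> K" for x
  proof -
    have "norm (fst x) \<le> real j" using r[OF that] j norm_fst_le[of "fst x" "snd x"] by simp
    then show ?thesis using that assms(2) by (cases x) (auto simp: cylinder_def strip_def)
  qed
  then show ?thesis by (intro that[of j]) blast
qed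

text \<open>The definition of the homogeneous space provides weak derivatives of order m; those of
  the orders between 0 and m are constructed here. On each cylinder the partial derivatives of
  \<open>U k\<close> are Cauchy in L^p, by the convergence in order m and the local L^1 convergence
  of \<open>U k\<close>, and their limit is a weak derivative of u by
  \<open>has_weak_deriv_limit\<close>.\<close>

lemma strip_approximation:
  fixes u :: "(real ^ 'n) \<times> real \<Rightarrow> real"
  assumes b: "bm < bp" and p: "1 < p" and usob: "u \<in> homogeneous_sobolev m p (strip bm bp)"
  shows "\<exists>U. (\<forall>k. smooth_fun (U k)) \<and>
    (\<forall>\<alpha>\<in>multi_indices m. (\<lambda>k. lpn p (strip bm bp) (\<lambda>x. partial \<alpha> (U k) x - weak_deriv (strip bm bp) \<alpha> u x)) \<longlonglongrightarrow> 0) \<and>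
    (\<forall>j\<le>m. \<forall>\<alpha>\<in>multi_indices j. has_weak_deriv (strip bm bp) \<alpha> u (weak_deriv (strip bm bp) \<alpha> u) \<and>
      (\<forall>R. (\<lambda>k. lpn p (cylinder bm bp R) (\<lambda>x. partial \<alpha> (U k) x - weak_deriv (strip bm bp) \<alpha> u x)) \<longlonglongrightarrow> 0))"
proof -
  let ?O = "strip bm bp :: ((real ^ 'n) \<times> real) set"
  have ul: "locally_integrable ?O u" using usob by (simp add: homogeneous_sobolev_def)
  have "\<forall>k. \<exists>\<eta> :: (real ^ 'n) \<times> real \<Rightarrow> real. mollifier ((bp - bm) / (4 * (real k + 2))) \<eta>"
    using b by (intro allI mollifier_exists) simp
  then obtain \<eta> where \<eta>: "\<And>k. mollifier ((bp - bm) / (4 * (real k + 2))) (\<eta> k :: (real ^ 'n) \<times> real \<Rightarrow> real)" by metis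
  have um: "(\<lambda>x. indicator ?O x * u x) \<in> borel_measurable lebesgue"
    using locally_integrable_measurable[OF open_strip ul] strip_sets(2)[of bm bp] borel_measurable_restrict_space_iff[of ?O lebesgue u] by simp
  obtain u0 where u0: "u0 \<in> borel_measurable borel" "AE y in lebesgue. u0 y = indicator ?O y * u y"
  proof -
    obtain u0 where "u0 \<in> borel_measurable lborel" "AE y in lborel. indicator ?O y * u y = u0 y"
      using completion_ex_borel_measurable_real[OF um] by blast
    then show ?thesis by (intro that[of u0]) (auto dest!: AE_completion elim!: eventually_mono)
  qed
  interpret strip_mollification bm bp u \<eta> u0
    by unfold_locales (use b ul \<eta> u0 in auto)
  have top: "\<exists>g. has_weak_deriv ?O \<alpha> u g \<and> (\<lambda>k. lpn p ?O (\<lambda>x. partial \<alpha> (U k) x - g x)) \<longlonglongrightarrow> 0" if \<alpha>: "\<alpha> \<in> multi_indices m" for \<alpha>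
  proof -
    obtain g where g: "has_weak_deriv ?O \<alpha> u g" "in_Lp p ?O g" using usob \<alpha> unfolding homogeneous_sobolev_def by blast
    have "(\<lambda>k. lpn p ?O (\<lambda>x. partial \<alpha> (U k) x - g x)) \<longlonglongrightarrow> 0"
      using p \<alpha> g by (intro top_order_tendsto) (auto simp: multi_indices_def)
    then show ?thesis using g by blast
  qed
  have testconv: "convergent (\<lambda>k. \<integral>x. U k x * \<phi> x \<partial>lborel)" if \<phi>: "\<phi> \<in> test_functions ?O" for \<phi>
  proof -
    have [measurable]: "U k \<in> borel_measurable borel" "\<phi> \<in> borel_measurable borel" for k
      by (rule smooth_fun_borel[OF smooth_U]) (rule smooth_fun_borel[OF test_functionsD(1)[OF \<phi>]])
    have "(\<lambda>k. \<integral>x. U k x * \<phi> x \<partial>lebesgue) \<longlonglongrightarrow> (\<integral>x. u x * \<phi> x \<partial>lebesgue)"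
      by (rule test_integral_tendsto[OF open_strip continuous_locally_integrable[OF smooth_fun_continuous_on[OF smooth_U]] ul \<phi> zero_order_tendsto])
    then show ?thesis unfolding convergent_def by (auto simp: integral_completion)
  qed
  have sp: "smooth_fun (partial \<alpha> (U k))" if "set_mset \<alpha> \<subseteq> Basis" for \<alpha> k
    by (rule smooth_fun_partial[OF smooth_U that])
  have Cauchy: "((\<lambda>(k, l). lpn p (cylinder bm bp R) (\<lambda>x. partial \<alpha> (U k) x - partial \<alpha> (U l) x)) \<longlongrightarrow> 0) (sequentially \<times>\<^sub>F sequentially)"
    if j: "j \<le> m" and \<alpha>: "\<alpha> \<in> multi_indices j" and R: "0 < R" for j \<alpha> R
  \<comment> \<open>The order j is reached as \<open>m - (m - j)\<close>.\<close>
  proof (rule partials_Cauchy[OF p cylinder_facts(1-3) _ smooth_U _ _ diff_le_self[of m j]])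
    have "(0, (bm + bp) / 2) \<in> (cylinder bm bp R :: ((real ^ 'n) \<times> real) set)" using b R by (simp add: cylinder_def)
    then show "(cylinder bm bp R :: ((real ^ 'n) \<times> real) set) \<noteq> {}" by blast
    show "\<alpha> \<in> multi_indices (m - (m - j))" using \<alpha> j by simp
    fix \<phi> :: "(real ^ 'n) \<times> real \<Rightarrow> real" assume "\<phi> \<in> test_functions (cylinder bm bp R)"
    then show "convergent (\<lambda>k. \<integral>x. U k x * \<phi> x \<partial>lborel)"
      using test_functions_mono[OF cylinder_facts(4)] by (intro testconv) blast
  next
    fix \<alpha> :: "((real ^ 'n) \<times> real) multiset" assume \<alpha>: "\<alpha> \<in> multi_indices m"
    then have \<alpha>B: "set_mset \<alpha> \<subseteq> Basis" by (simp add: multi_indices_def)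
    obtain g where g: "has_weak_deriv ?O \<alpha> u g" "(\<lambda>k. lpn p ?O (\<lambda>x. partial \<alpha> (U k) x - g x)) \<longlonglongrightarrow> 0" using top[OF \<alpha>] by blast
    have gm: "g \<in> borel_measurable (lebesgue_on (cylinder bm bp R))"
      by (rule measurable_restrict_mono[OF locally_integrable_measurable[OF open_strip has_weak_derivD(2)[OF g(1)]] cylinder_facts(4)])
    show "((\<lambda>(k, l). lpn p (cylinder bm bp R) (\<lambda>x. partial \<alpha> (U k) x - partial \<alpha> (U l) x)) \<longlongrightarrow> 0) (sequentially \<times>\<^sub>F sequentially)"
    proof (rule lpn_lim_Cauchy[OF _ cylinder_sets(2) smooth_fun_measurable_lebesgue_on[OF sp[OF \<alpha>B]] gm])
      show "(\<lambda>k. lpn p (cylinder bm bp R) (\<lambda>x. partial \<alpha> (U k) x - g x)) \<longlonglongrightarrow> 0"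
        by (rule tendsto_zero_ennreal_le[OF g(2) lpn_mono_set[OF cylinder_facts(4)]])
    qed (use p in simp)
  qed
  have lower: "\<exists>g. has_weak_deriv ?O \<alpha> u g \<and> (\<forall>R. (\<lambda>k. lpn p (cylinder bm bp R) (\<lambda>x. partial \<alpha> (U k) x - g x)) \<longlonglongrightarrow> 0)"
    if j: "j \<le> m" and \<alpha>: "\<alpha> \<in> multi_indices j" for j \<alpha>
  proof -
    have \<alpha>B: "set_mset \<alpha> \<subseteq> Basis" using \<alpha> by (simp add: multi_indices_def)
    let ?A = "\<lambda>j::nat. cylinder bm bp (real j + 1) :: ((real ^ 'n) \<times> real) set"
    have mono: "cylinder bm bp R \<subseteq> (cylinder bm bp R' :: ((real ^ 'n) \<times> real) set)" if "R \<le> R'" for R R'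
      using that by (auto simp: cylinder_def)
    \<comment> \<open>The cylinders of radius i + 1 exhaust the strip, so a single limit function
      serves all radii.\<close>
    have "\<exists>g\<in>borel_measurable lebesgue. \<forall>j. (\<lambda>k. lpn p (?A j) (\<lambda>x. partial \<alpha> (U k) x - g x)) \<longlonglongrightarrow> 0"
    proof (rule lpn_complete)
      show "incseq ?A" by (intro incseq_SucI mono) simp
      show "partial \<alpha> (U k) \<in> borel_measurable lebesgue" for k
        by (rule borel_imp_lebesgue[OF smooth_fun_borel[OF sp[OF \<alpha>B]]])
      show "((\<lambda>(k, l). lpn p (?A i) (\<lambda>x. partial \<alpha> (U k) x - partial \<alpha> (U l) x)) \<longlongrightarrow> 0) (sequentially \<times>\<^sub>F sequentially)" for i
        by (rule Cauchy[OF j \<alpha>]) simp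
    qed (use p cylinder_sets in auto)
    then obtain g where g: "g \<in> borel_measurable lebesgue" "\<And>j. (\<lambda>k. lpn p (?A j) (\<lambda>x. partial \<alpha> (U k) x - g x)) \<longlonglongrightarrow> 0" by blast
    have gA: "g \<in> borel_measurable (lebesgue_on A)" for A using g(1) by (rule measurable_restrict_space1)
    have gR: "(\<lambda>k. lpn p (cylinder bm bp R) (\<lambda>x. partial \<alpha> (U k) x - g x)) \<longlonglongrightarrow> 0" for R
    proof -
      obtain i :: nat where "R \<le> real i" using real_arch_simple by blast
      then have "R \<le> real i + 1" by simp
      from tendsto_zero_ennreal_le[OF g(2) lpn_mono_set[OF mono[OF this]]] show ?thesis .
    qed
    have gK: "(\<lambda>k. lpn p K (\<lambda>x. partial \<alpha> (U k) x - g x)) \<longlonglongrightarrow> 0" if K: "compact K" "K \<subseteq> ?O" for K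
    proof -
      obtain i where i: "K \<subseteq> ?A i" by (rule compact_subset_cylinder[OF K])
      from tendsto_zero_ennreal_le[OF g(2) lpn_mono_set[OF i]] show ?thesis .
    qed
    \<comment> \<open>On a compact set g differs by a finite \<open>lpn\<close> from one of the
      smooth functions, which is bounded there.\<close>
    have gl: "locally_integrable ?O g"
    proof (rule lpn_finite_locally_integrable[OF _ gA strip_sets(2)])
      fix K assume K: "compact K" "K \<subseteq> ?O"
      have Ks: "K \<in> sets lebesgue" by (rule compact_sets_lebesgue(1)[OF K(1)])
      have "\<forall>\<^sub>F k in sequentially. lpn p K (\<lambda>x. partial \<alpha> (U k) x - g x) < 1"
        by (rule order_tendstoD(2)[OF gK[OF K]]) simp
      then obtain k where k: "lpn p K (\<lambda>x. partial \<alpha> (U k) x - g x) < 1" by (auto simp: eventually_sequentially)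
      have "lpn p K g = lpn p K (\<lambda>x. partial \<alpha> (U k) x - (partial \<alpha> (U k) x - g x))" by simp
      also have "\<dots> \<le> ennreal (2 powr p) * (lpn p K (partial \<alpha> (U k)) + lpn p K (\<lambda>x. partial \<alpha> (U k) x - g x))"
        using p Ks gA smooth_fun_measurable_lebesgue_on[OF sp[OF \<alpha>B]] by (intro lpn_diff borel_measurable_diff) auto
      also have "\<dots> < \<infinity>"
        using k p lpn_continuous_bounded_finite[OF smooth_fun_continuous_on[OF sp[OF \<alpha>B]] compact_imp_bounded[OF K(1)] Ks, of p]
        by (auto simp: ennreal_mult_less_top intro: less_trans)
      finally show "lpn p K g < \<infinity>" .
    qed (use p in simp)
    have "has_weak_deriv ?O \<alpha> u g"
    proof (rule has_weak_deriv_limit[OF open_strip \<alpha>B smooth_has_weak_deriv[OF smooth_U open_strip \<alpha>B] ul gl zero_order_tendsto])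
      fix K assume K: "compact K" "K \<subseteq> ?O"
      show "(\<lambda>k. lpn 1 K (\<lambda>x. partial \<alpha> (U k) x - g x)) \<longlonglongrightarrow> 0"
        using p by (intro lpn_one_tendsto[OF _ compact_sets_lebesgue[OF K(1)] _ gK[OF K]] borel_measurable_diff
          smooth_fun_measurable_lebesgue_on[OF sp[OF \<alpha>B]] gA) simp
    qed
    then show ?thesis using gR by blast
  qed
  show ?thesis
  proof (intro exI[of _ U] conjI allI ballI impI smooth_U)
    fix \<alpha> :: "((real ^ 'n) \<times> real) multiset" assume \<alpha>: "\<alpha> \<in> multi_indices m"
    then have \<alpha>B: "set_mset \<alpha> \<subseteq> Basis" by (simp add: multi_indices_def)
    obtain g where g: "has_weak_deriv ?O \<alpha> u g" "(\<lambda>k. lpn p ?O (\<lambda>x. partial \<alpha> (U k) x - g x)) \<longlonglongrightarrow> 0" using top[OF \<alpha>] by blast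
    have "AE x in lebesgue_on ?O. partial \<alpha> (U k) x - weak_deriv ?O \<alpha> u x = partial \<alpha> (U k) x - g x" for k
      using weak_deriv_AE_eq[OF open_strip \<alpha>B g(1)] by eventually_elim simp
    then have "(\<lambda>k. lpn p ?O (\<lambda>x. partial \<alpha> (U k) x - weak_deriv ?O \<alpha> u x)) = (\<lambda>k. lpn p ?O (\<lambda>x. partial \<alpha> (U k) x - g x))"
      by (intro ext lpn_cong_AE[OF strip_sets(2)])
    then show "(\<lambda>k. lpn p ?O (\<lambda>x. partial \<alpha> (U k) x - weak_deriv ?O \<alpha> u x)) \<longlonglongrightarrow> 0"
      using g(2) by (simp only:)
  next
    fix j and \<alpha> :: "((real ^ 'n) \<times> real) multiset" assume j: "j \<le> m" and \<alpha>: "\<alpha> \<in> multi_indices j"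
    then have \<alpha>B: "set_mset \<alpha> \<subseteq> Basis" by (simp add: multi_indices_def)
    obtain g where g: "has_weak_deriv ?O \<alpha> u g" "\<And>R. (\<lambda>k. lpn p (cylinder bm bp R) (\<lambda>x. partial \<alpha> (U k) x - g x)) \<longlonglongrightarrow> 0"
      using lower[OF j \<alpha>] by blast
    show "has_weak_deriv ?O \<alpha> u (weak_deriv ?O \<alpha> u)" by (rule weak_deriv_has_weak_deriv[OF g(1)])
    fix R
    have "AE x in lebesgue. x \<in> ?O \<longrightarrow> weak_deriv ?O \<alpha> u x = g x"
      using weak_deriv_AE_eq[OF open_strip \<alpha>B g(1)] by (simp only: AE_lebesgue_on_iff[OF strip_sets(2)])
    then have "AE x in lebesgue. x \<in> cylinder bm bp R \<longrightarrow> partial \<alpha> (U k) x - weak_deriv ?O \<alpha> u x = partial \<alpha> (U k) x - g x" for k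
      using cylinder_facts(4)[of bm bp R] by (auto elim!: eventually_mono)
    then have "AE x in lebesgue_on (cylinder bm bp R). partial \<alpha> (U k) x - weak_deriv ?O \<alpha> u x = partial \<alpha> (U k) x - g x" for k
      by (simp only: AE_lebesgue_on_iff[OF cylinder_sets(2)])
    then have "(\<lambda>k. lpn p (cylinder bm bp R) (\<lambda>x. partial \<alpha> (U k) x - weak_deriv ?O \<alpha> u x)) = (\<lambda>k. lpn p (cylinder bm bp R) (\<lambda>x. partial \<alpha> (U k) x - g x))"
      by (intro ext lpn_cong_AE[OF cylinder_sets(2)])
    then show "(\<lambda>k. lpn p (cylinder bm bp R) (\<lambda>x. partial \<alpha> (U k) x - weak_deriv ?O \<alpha> u x)) \<longlonglongrightarrow> 0"
      using g(2)[of R] by (simp only:)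
  qed
qed

section \<open>Traces\<close>

lemma nn_integral_Icc_Ioo:
  fixes f :: "real \<Rightarrow> ennreal"
  shows "(\<integral>\<^sup>+t\<in>{a..b}. f t \<partial>lborel) = (\<integral>\<^sup>+t\<in>{a<..<b}. f t \<partial>lborel)"
proof (rule nn_integral_cong_AE)
  have "AE t in lborel. t \<noteq> a" "AE t in lborel. t \<noteq> b" by (rule AE_lborel_singleton)+
  then show "AE t in lborel. f t * indicator {a..b} t = f t * indicator {a<..<b} t"
    by eventually_elim (auto simp: indicator_def)
qed

lemma lpn_Times:
  fixes V :: "'a::euclidean_space \<times> real \<Rightarrow> real"
  assumes V: "V \<in> borel_measurable borel" and A: "A \<in> sets borel"
  shows "lpn p (A \<times> {a<..<b}) V = (\<integral>\<^sup>+x\<in>A. (\<integral>\<^sup>+t\<in>{a<..<b}. ennreal (\<bar>V (x, t)\<bar> powr p) \<partial>lborel) \<partial>lborel)"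
proof -
  note [measurable] = V
  have AB[measurable]: "A \<times> {a<..<b} \<in> sets borel" using A by (intro borel_Times) auto
  have "lpn p (A \<times> {a<..<b}) V = (\<integral>\<^sup>+z. ennreal (\<bar>V z\<bar> powr p) * indicator (A \<times> {a<..<b}) z \<partial>lborel)"
    by (rule lpn_lborel[OF V AB])
  also have "\<dots> = (\<integral>\<^sup>+x. \<integral>\<^sup>+t. ennreal (\<bar>V (x, t)\<bar> powr p) * indicator (A \<times> {a<..<b}) (x, t) \<partial>lborel \<partial>lborel)"
    by (rule nn_integral_lborel_Pair) measurable
  also have "\<dots> = (\<integral>\<^sup>+x\<in>A. (\<integral>\<^sup>+t\<in>{a<..<b}. ennreal (\<bar>V (x, t)\<bar> powr p) \<partial>lborel) \<partial>lborel)"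
  proof (intro nn_integral_cong)
    fix x
    show "(\<integral>\<^sup>+t. ennreal (\<bar>V (x, t)\<bar> powr p) * indicator (A \<times> {a<..<b}) (x, t) \<partial>lborel)
      = (\<integral>\<^sup>+t\<in>{a<..<b}. ennreal (\<bar>V (x, t)\<bar> powr p) \<partial>lborel) * indicator A x"
      by (cases "x \<in> A") (simp_all add: indicator_times)
  qed
  finally show ?thesis .
qed

lemma vertical_derivative:
  fixes V :: "'a::euclidean_space \<times> real \<Rightarrow> real"
  assumes "smooth_fun V"
  shows "((\<lambda>t. V (x, t)) has_real_derivative partial {#(0, 1)#} V (x, t)) (at t)"
  using frechet_derivative_line[of V "(x, 0)" t "(0, 1)"] smooth_fun_differentiable[OF assms] by (simp add: partial_single)

lemma vertical_continuous:
  fixes V :: "'a::euclidean_space \<times> real \<Rightarrow> real"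
  assumes "smooth_fun V"
  shows "continuous_on S (\<lambda>t. V (x, t))" "continuous_on T (\<lambda>x. V (x, t))"
  by (rule continuous_on_compose2[OF smooth_fun_continuous_on[OF assms, of UNIV]]; auto intro!: continuous_intros)+

lemma vertical_difference:
  fixes V :: "'a::euclidean_space \<times> real \<Rightarrow> real"
  assumes p: "1 < p" and V: "smooth_fun V" and s: "a \<le> s" "s \<le> b" and t: "a \<le> t" "t \<le> b"
  shows "ennreal (\<bar>V (x, s) - V (x, t)\<bar> powr p) \<le> ennreal ((b - a) powr (p - 1)) * (\<integral>\<^sup>+\<tau>\<in>{a<..<b}. ennreal (\<bar>partial {#(0, 1)#} V (x, \<tau>)\<bar> powr p) \<partial>lborel)"
proof -
  have c: "continuous_on UNIV (\<lambda>\<tau>. partial {#(0, 1)#} V (x, \<tau>))"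
    by (intro vertical_continuous smooth_fun_partial V) (simp add: normal_in_Basis)
  have *: "ennreal (\<bar>V (x, s) - V (x, t)\<bar> powr p) \<le> ennreal ((b - a) powr (p - 1)) * (\<integral>\<^sup>+\<tau>\<in>{a<..<b}. ennreal (\<bar>partial {#(0, 1)#} V (x, \<tau>)\<bar> powr p) \<partial>lborel)"
    if "a \<le> t" "t \<le> s" "s \<le> b" for s t
  proof -
    have "ennreal (\<bar>V (x, s) - V (x, t)\<bar> powr p) \<le> ennreal ((s - t) powr (p - 1)) * (\<integral>\<^sup>+\<tau>\<in>{t..s}. ennreal (\<bar>partial {#(0, 1)#} V (x, \<tau>)\<bar> powr p) \<partial>lborel)"
      by (rule ftc_jensen[OF p that(2) vertical_derivative[OF V] c])
    also have "\<dots> \<le> ennreal ((b - a) powr (p - 1)) * (\<integral>\<^sup>+\<tau>\<in>{a..b}. ennreal (\<bar>partial {#(0, 1)#} V (x, \<tau>)\<bar> powr p) \<partial>lborel)"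
      using that p by (intro mult_mono ennreal_leI powr_mono2 nn_integral_mono) (auto simp: indicator_def)
    finally show ?thesis unfolding nn_integral_Icc_Ioo .
  qed
  show ?thesis
  proof (cases "t \<le> s")
    case True
    then show ?thesis using * s t by blast
  next
    case False
    then have "s \<le> t" by simp
    from *[OF s(1) this t(2)] show ?thesis by (simp only: abs_minus_commute)
  qed
qed

text \<open>|V(x,s)|^p is compared with |V(x,t)|^p and the p-th power of the vertical difference,
  and the inequality is averaged over t in (bm,bp). No radius enters, so one constant serves all
  cylinders.\<close>

lemma trace_inequality:
  assumes b: "bm < bp" and p: "1 < p" and s: "bm \<le> s" "s \<le> bp"
  shows "\<exists>C. \<forall>V R. smooth_fun V \<longrightarrow> lpn p (ball 0 R) (\<lambda>x'::real ^ 'n. V (x', s)) \<le>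
    ennreal C * (lpn p (cylinder bm bp R) V + lpn p (cylinder bm bp R) (partial {#(0, 1)#} V))"
proof -
  define d where "d = bp - bm"
  have d: "0 < d" using b by (simp add: d_def)
  \<comment> \<open>Dominates both the factor 2^p / d of V and the factor 2^p d^(p-1) of its normal
    derivative.\<close>
  define C where "C = 2 powr p / d * (1 + d * d powr (p - 1))"
  have C1: "2 powr p / d \<le> C" "2 powr p * d powr (p - 1) \<le> C" using d by (auto simp: C_def field_simps)
  show ?thesis
  proof (intro exI[of _ C] allI impI)
    fix V :: "(real ^ 'n) \<times> real \<Rightarrow> real" and R :: real
    assume V: "smooth_fun V"
    have Vm[measurable]: "V \<in> borel_measurable borel" by (rule smooth_fun_borel[OF V])
    define D where "D = partial {#(0, 1)#} V"
    have Ds: "smooth_fun D" unfolding D_def by (intro smooth_fun_partial V) (simp add: normal_in_Basis)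
    have Dm[measurable]: "D \<in> borel_measurable borel" by (rule smooth_fun_borel[OF Ds])
    have Vx[measurable]: "(\<lambda>t. V (x, t)) \<in> borel_measurable borel" for x
      by (rule borel_measurable_continuous_onI[OF vertical_continuous(1)[OF V]])
    have Dx[measurable]: "(\<lambda>t. D (x, t)) \<in> borel_measurable borel" for x
      by (rule borel_measurable_continuous_onI[OF vertical_continuous(1)[OF Ds]])
    have Vp[measurable]: "(\<lambda>(x, t). V (x, t)) \<in> borel_measurable (borel \<Otimes>\<^sub>M borel)"
      and Dp[measurable]: "(\<lambda>(x, t). D (x, t)) \<in> borel_measurable (borel \<Otimes>\<^sub>M borel)"
      unfolding borel_prod by simp_all
    have Vs[measurable]: "(\<lambda>x. V (x, s)) \<in> borel_measurable borel"
      by (rule borel_measurable_continuous_onI[OF vertical_continuous(2)[OF V]])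
    define I1 where "I1 x = (\<integral>\<^sup>+t\<in>{bm<..<bp}. ennreal (\<bar>V (x, t)\<bar> powr p) \<partial>lborel)" for x
    define I2 where "I2 x = (\<integral>\<^sup>+t\<in>{bm<..<bp}. ennreal (\<bar>D (x, t)\<bar> powr p) \<partial>lborel)" for x
    have I1m[measurable]: "I1 \<in> borel_measurable borel" unfolding I1_def by measurable
    have I2m[measurable]: "I2 \<in> borel_measurable borel" unfolding I2_def by measurable
    have pt: "ennreal (\<bar>V (x, s)\<bar> powr p) \<le> ennreal C * (I1 x + I2 x)" for x
    proof -
      have "ennreal (\<bar>V (x, s)\<bar> powr p) * ennreal d = (\<integral>\<^sup>+t\<in>{bm<..<bp}. ennreal (\<bar>V (x, s)\<bar> powr p) \<partial>lborel)"
        using b by (simp add: nn_integral_cmult_indicator d_def)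
      also have "\<dots> \<le> (\<integral>\<^sup>+t. ennreal (2 powr p) * (ennreal (\<bar>V (x, t)\<bar> powr p) * indicator {bm<..<bp} t
          + ennreal (d powr (p - 1)) * I2 x * indicator {bm<..<bp} t) \<partial>lborel)"
      proof (intro nn_integral_mono)
        fix t
        show "ennreal (\<bar>V (x, s)\<bar> powr p) * indicator {bm<..<bp} t \<le> ennreal (2 powr p) * (ennreal (\<bar>V (x, t)\<bar> powr p) * indicator {bm<..<bp} t
          + ennreal (d powr (p - 1)) * I2 x * indicator {bm<..<bp} t)"
        proof (cases "t \<in> {bm<..<bp}")
          case True
          have "\<bar>V (x, t) + (V (x, s) - V (x, t))\<bar> powr p \<le> 2 powr p * (\<bar>V (x, t)\<bar> powr p + \<bar>V (x, s) - V (x, t)\<bar> powr p)"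
            using p by (intro powr_add_le) simp
          then have "ennreal (\<bar>V (x, s)\<bar> powr p) \<le> ennreal (2 powr p * (\<bar>V (x, t)\<bar> powr p + \<bar>V (x, s) - V (x, t)\<bar> powr p))"
            by (intro ennreal_leI) simp
          also have "\<dots> = ennreal (2 powr p) * (ennreal (\<bar>V (x, t)\<bar> powr p) + ennreal (\<bar>V (x, s) - V (x, t)\<bar> powr p))"
            by (simp add: ennreal_mult ennreal_plus)
          also have "\<dots> \<le> ennreal (2 powr p) * (ennreal (\<bar>V (x, t)\<bar> powr p) + ennreal (d powr (p - 1)) * I2 x)"
            unfolding I2_def D_def d_def using True s by (intro mult_left_mono add_left_mono vertical_difference[OF p V]) auto
          finally show ?thesis using True by simp
        qed simp
      qed
      also have "\<dots> = ennreal (2 powr p) * (I1 x + ennreal (d powr (p - 1)) * I2 x * ennreal d)"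
        unfolding I1_def using b
        by (subst nn_integral_cmult, measurable, subst nn_integral_add) (auto simp: nn_integral_cmult_indicator d_def)
      finally have le: "ennreal (\<bar>V (x, s)\<bar> powr p) * ennreal d \<le> ennreal (2 powr p) * (I1 x + ennreal (d powr (p - 1)) * I2 x * ennreal d)" .
      have "ennreal (\<bar>V (x, s)\<bar> powr p) = ennreal (\<bar>V (x, s)\<bar> powr p) * ennreal d * ennreal (1 / d)"
        using d by (simp add: mult.assoc flip: ennreal_mult')
      also have "\<dots> \<le> ennreal (2 powr p) * (I1 x + ennreal (d powr (p - 1)) * I2 x * ennreal d) * ennreal (1 / d)"
        by (intro mult_right_mono le) simp
      also have "\<dots> = ennreal (2 powr p * (1 / d)) * I1 x + ennreal (2 powr p * d powr (p - 1) * d * (1 / d)) * I2 x"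
      proof -
        have 4: "ennreal (w * x * y * z) = ennreal w * ennreal x * ennreal y * ennreal z" if "0 \<le> w" "0 \<le> x" "0 \<le> y" "0 \<le> z" for w x y z
          using that by (simp add: ennreal_mult)
        have e2: "ennreal (2 powr p * d powr (p - 1) * d * (1 / d)) = ennreal (2 powr p) * ennreal (d powr (p - 1)) * ennreal d * ennreal (1 / d)"
          using d by (intro 4) auto
        have e1: "ennreal (2 powr p * (1 / d)) = ennreal (2 powr p) * ennreal (1 / d)"
          using d by (intro ennreal_mult) auto
        show ?thesis unfolding e1 e2 by (simp only: distrib_left distrib_right mult_ac)
      qed
      also have "\<dots> \<le> ennreal C * I1 x + ennreal C * I2 x"
        using C1 d by (intro add_mono mult_right_mono ennreal_leI) auto
      finally show ?thesis by (simp add: distrib_left)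
    qed
    have bs[measurable]: "ball (0 :: real ^ 'n) R \<in> sets borel" by simp
    have "lpn p (ball 0 R) (\<lambda>x'. V (x', s)) = (\<integral>\<^sup>+x\<in>ball 0 R. ennreal (\<bar>V (x, s)\<bar> powr p) \<partial>lborel)"
      by (rule lpn_lborel[OF Vs bs])
    also have "\<dots> \<le> (\<integral>\<^sup>+x. ennreal C * (I1 x * indicator (ball 0 R) x + I2 x * indicator (ball 0 R) x) \<partial>lborel)"
    proof (intro nn_integral_mono)
      fix x :: "real ^ 'n"
      show "ennreal (\<bar>V (x, s)\<bar> powr p) * indicator (ball 0 R) x \<le> ennreal C * (I1 x * indicator (ball 0 R) x + I2 x * indicator (ball 0 R) x)"
        using pt[of x] by (cases "x \<in> ball 0 R") auto
    qed
    also have "\<dots> = ennreal C * (lpn p (cylinder bm bp R) V + lpn p (cylinder bm bp R) D)"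
      unfolding cylinder_def lpn_Times[OF Vm bs] lpn_Times[OF Dm bs] I1_def[symmetric] I2_def[symmetric]
      by (subst nn_integral_cmult, measurable, subst nn_integral_add) auto
    finally show "lpn p (ball 0 R) (\<lambda>x'. V (x', s)) \<le> ennreal C * (lpn p (cylinder bm bp R) V + lpn p (cylinder bm bp R) (partial {#(0, 1)#} V))"
      unfolding D_def .
  qed
qed

lemma lpn_zero_AE:
  assumes p: "0 < p" and A: "A \<in> sets lebesgue" and f[measurable]: "f \<in> borel_measurable (lebesgue_on A)" and z: "lpn p A f = 0"
  shows "AE x in lebesgue_on A. f x = 0"
proof -
  have "AE x in lebesgue_on A. ennreal (\<bar>f x\<bar> powr p) = 0"
    using z unfolding lpn_restrict[OF A] by (subst (asm) nn_integral_0_iff_AE) auto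
  then show ?thesis by eventually_elim auto
qed

lemma in_Lp_iff: "in_Lp p A v \<longleftrightarrow> v \<in> borel_measurable (lebesgue_on A) \<and> lpn p A v < \<infinity>"
  by (simp add: in_Lp_def lpn_def)

text \<open>\<open>sobolev1_norm_powr\<close> evaluates chosen weak derivatives of the difference;
  by uniqueness they may be computed from any weak derivatives \<open>g e\<close> of v.\<close>

lemma sobolev1_norm_powr_smooth_diff:
  assumes \<Omega>: "open \<Omega>" "\<Omega> \<in> sets lebesgue" and w: "smooth_fun w"
    and v: "\<And>e. e \<in> Basis \<Longrightarrow> has_weak_deriv \<Omega> {#e#} v (g e)"
  shows "sobolev1_norm_powr p \<Omega> (\<lambda>x. w x - v x) = lpn p \<Omega> (\<lambda>x. w x - v x) + (\<Sum>e\<in>Basis. lpn p \<Omega> (\<lambda>x. partial {#e#} w x - g e x))"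
proof -
  have "lpn p \<Omega> (weak_deriv \<Omega> {#e#} (\<lambda>x. w x - v x)) = lpn p \<Omega> (\<lambda>x. partial {#e#} w x - g e x)" if e: "e \<in> Basis" for e
  proof (rule lpn_cong_AE[OF \<Omega>(2)])
    have B: "set_mset {#e#} \<subseteq> Basis" using e by simp
    show "AE x in lebesgue_on \<Omega>. weak_deriv \<Omega> {#e#} (\<lambda>x. w x - v x) x = partial {#e#} w x - g e x"
      by (rule weak_deriv_AE_eq[OF \<Omega>(1) B has_weak_deriv_diff[OF \<Omega>(1) B smooth_has_weak_deriv[OF w \<Omega>(1) B] v[OF e]]])
  qed
  then show ?thesis unfolding sobolev1_norm_powr_def lpn_def[symmetric] by simp
qed

lemma sobolev1_weak_derivs:
  assumes "v \<in> sobolev1 p \<Omega>"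
  shows "v \<in> borel_measurable (lebesgue_on \<Omega>)" "\<exists>g. \<forall>e\<in>Basis. has_weak_deriv \<Omega> {#e#} v (g e) \<and> in_Lp p \<Omega> (g e)"
  using assms unfolding sobolev1_def in_Lp_def mem_Collect_eq by (auto intro: bchoice)

text \<open>The two approximating sequences converge to the same v in W^(1,p) of the cylinder, so by
  \<open>trace_inequality\<close> the boundary values of their differences tend to 0. This makes the
  choice in \<open>boundary_trace\<close> harmless.\<close>

lemma has_trace_unique:
  fixes g g' :: "real ^ 'n \<Rightarrow> real"
  assumes b: "bm < bp" and p: "1 < p" and s: "s \<in> {bm, bp}"
    and 1: "has_trace p bm bp s v g" and 2: "has_trace p bm bp s v g'"
  shows "AE x in lebesgue. g x = g' x"
proof -
  have s': "bm \<le> s" "s \<le> bp" using s b by auto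
  have gm: "g \<in> borel_measurable lebesgue" "g' \<in> borel_measurable lebesgue" using 1 2 by (auto simp: has_trace_def)
  obtain C where C: "\<And>V R. smooth_fun V \<Longrightarrow> lpn p (ball 0 R) (\<lambda>x'::real ^ 'n. V (x', s)) \<le>
    ennreal C * (lpn p (cylinder bm bp R) V + lpn p (cylinder bm bp R) (partial {#(0, 1)#} V))"
    using trace_inequality[OF b p s'] by blast
  have z: "lpn p (ball 0 R) (\<lambda>x. g x - g' x) = 0" if R: "0 < R" for R
  proof -
    let ?Q = "cylinder bm bp R :: ((real ^ 'n) \<times> real) set"
    let ?B = "ball (0 :: real ^ 'n) R"
    have Bs: "?B \<in> sets lebesgue" by simp
    obtain w where w: "\<And>n. smooth_fun (w n)" "(\<lambda>n. sobolev1_norm_powr p ?Q (\<lambda>x. w n x - v x)) \<longlonglongrightarrow> 0"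
      "(\<lambda>n. lpn p ?B (\<lambda>x'. w n (x', s) - g x')) \<longlonglongrightarrow> 0" and vs: "v \<in> sobolev1 p ?Q"
      using 1 R unfolding has_trace_def lpn_def by blast
    obtain w' where w': "\<And>n. smooth_fun (w' n)" "(\<lambda>n. sobolev1_norm_powr p ?Q (\<lambda>x. w' n x - v x)) \<longlonglongrightarrow> 0"
      "(\<lambda>n. lpn p ?B (\<lambda>x'. w' n (x', s) - g' x')) \<longlonglongrightarrow> 0"
      using 2 R unfolding has_trace_def lpn_def by blast
    obtain h where h: "\<And>e. e \<in> Basis \<Longrightarrow> has_weak_deriv ?Q {#e#} v (h e)" using sobolev1_weak_derivs(2)[OF vs] by blast
    have vm: "v \<in> borel_measurable (lebesgue_on ?Q)" by (rule sobolev1_weak_derivs(1)[OF vs])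
    have hm: "h (0, 1) \<in> borel_measurable (lebesgue_on ?Q)"
      by (rule locally_integrable_measurable[OF cylinder_facts(1) has_weak_derivD(2)[OF h[OF normal_in_Basis]]])
    have le: "lpn p ?Q (\<lambda>x. W x - v x) \<le> sobolev1_norm_powr p ?Q (\<lambda>x. W x - v x)"
        "lpn p ?Q (\<lambda>x. partial {#(0, 1)#} W x - h (0, 1) x) \<le> sobolev1_norm_powr p ?Q (\<lambda>x. W x - v x)" if W: "smooth_fun W" for W
    proof -
      have eq: "sobolev1_norm_powr p ?Q (\<lambda>x. W x - v x) = lpn p ?Q (\<lambda>x. W x - v x) + (\<Sum>e\<in>Basis. lpn p ?Q (\<lambda>x. partial {#e#} W x - h e x))"
        by (rule sobolev1_norm_powr_smooth_diff[OF cylinder_facts(1) cylinder_sets(2) W h])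
      show "lpn p ?Q (\<lambda>x. W x - v x) \<le> sobolev1_norm_powr p ?Q (\<lambda>x. W x - v x)" unfolding eq by simp
      have "lpn p ?Q (\<lambda>x. partial {#(0, 1)#} W x - h (0, 1) x) \<le> (\<Sum>e\<in>Basis. lpn p ?Q (\<lambda>x. partial {#e#} W x - h e x))"
        by (rule member_le_sum[OF normal_in_Basis]) auto
      then show "lpn p ?Q (\<lambda>x. partial {#(0, 1)#} W x - h (0, 1) x) \<le> sobolev1_norm_powr p ?Q (\<lambda>x. W x - v x)"
        unfolding eq by (rule order.trans) simp
    qed
    have NB: "set_mset {#(0, 1)#} \<subseteq> (Basis :: ((real ^ 'n) \<times> real) set)" by (simp add: normal_in_Basis)
    let ?S = "\<lambda>n. sobolev1_norm_powr p ?Q (\<lambda>x. w n x - v x) + sobolev1_norm_powr p ?Q (\<lambda>x. w' n x - v x)"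
    have mid: "lpn p ?B (\<lambda>x'. w n (x', s) - w' n (x', s)) \<le> ennreal C * (ennreal (2 powr p) * ?S n + ennreal (2 powr p) * ?S n)" for n
    proof -
      have "lpn p ?B (\<lambda>x'. w n (x', s) - w' n (x', s)) \<le> ennreal C * (lpn p ?Q (\<lambda>x. w n x - w' n x) + lpn p ?Q (partial {#(0, 1)#} (\<lambda>x. w n x - w' n x)))"
        by (rule C[OF smooth_fun_diff[OF w(1) w'(1)]])
      also have "\<dots> \<le> ennreal C * (ennreal (2 powr p) * ?S n + ennreal (2 powr p) * ?S n)"
      proof (intro mult_left_mono add_mono)
        have "lpn p ?Q (\<lambda>x. w n x - w' n x) \<le> ennreal (2 powr p) * (lpn p ?Q (\<lambda>x. w n x - v x) + lpn p ?Q (\<lambda>x. v x - w' n x))"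
          using p by (intro lpn_triangle cylinder_sets smooth_fun_measurable_lebesgue_on w(1) w'(1) vm) simp
        also have "\<dots> \<le> ennreal (2 powr p) * ?S n"
          unfolding lpn_minus_commute[of p ?Q v] by (intro mult_left_mono add_mono le w(1) w'(1)) simp
        finally show "lpn p ?Q (\<lambda>x. w n x - w' n x) \<le> ennreal (2 powr p) * ?S n" .
        have "lpn p ?Q (partial {#(0, 1)#} (\<lambda>x. w n x - w' n x)) = lpn p ?Q (\<lambda>x. partial {#(0, 1)#} (w n) x - partial {#(0, 1)#} (w' n) x)"
          by (simp only: partial_diff[OF w(1) w'(1) NB])
        also have "\<dots> \<le> ennreal (2 powr p) * (lpn p ?Q (\<lambda>x. partial {#(0, 1)#} (w n) x - h (0, 1) x) + lpn p ?Q (\<lambda>x. h (0, 1) x - partial {#(0, 1)#} (w' n) x))"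
          using p by (intro lpn_triangle cylinder_sets smooth_fun_measurable_lebesgue_on smooth_fun_partial w(1) w'(1) hm NB) simp
        also have "\<dots> \<le> ennreal (2 powr p) * ?S n"
          unfolding lpn_minus_commute[of p ?Q "h (0, 1)"] by (intro mult_left_mono add_mono le w(1) w'(1)) simp
        finally show "lpn p ?Q (partial {#(0, 1)#} (\<lambda>x. w n x - w' n x)) \<le> ennreal (2 powr p) * ?S n" .
      qed simp
      finally show ?thesis .
    qed
    have bm1: "(\<lambda>x'. W (x', s)) \<in> borel_measurable (lebesgue_on ?B)" if "smooth_fun W" for W
      by (rule borel_imp_lebesgue_on[OF borel_measurable_continuous_onI[OF vertical_continuous(2)[OF that]]])
    have gB: "g \<in> borel_measurable (lebesgue_on ?B)" "g' \<in> borel_measurable (lebesgue_on ?B)"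
      using gm by (auto intro: measurable_restrict_space1)
    let ?T = "\<lambda>n. ennreal (2 powr p) * (lpn p ?B (\<lambda>x'. w n (x', s) - g x') + ennreal (2 powr p) * (ennreal C * (ennreal (2 powr p) * ?S n + ennreal (2 powr p) * ?S n) + lpn p ?B (\<lambda>x'. w' n (x', s) - g' x')))"
    have bound: "lpn p ?B (\<lambda>x. g x - g' x) \<le> ?T n" for n
    proof -
      have "lpn p ?B (\<lambda>x. g x - g' x) \<le> ennreal (2 powr p) * (lpn p ?B (\<lambda>x. g x - w n (x, s)) + lpn p ?B (\<lambda>x. w n (x, s) - g' x))"
        using p by (intro lpn_triangle Bs gB bm1 w(1)) simp
      also have "\<dots> \<le> ?T n"
        unfolding lpn_minus_commute[of p ?B g]
      proof (intro mult_left_mono add_left_mono)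
        have "lpn p ?B (\<lambda>x. w n (x, s) - g' x) \<le> ennreal (2 powr p) * (lpn p ?B (\<lambda>x. w n (x, s) - w' n (x, s)) + lpn p ?B (\<lambda>x. w' n (x, s) - g' x))"
          using p by (intro lpn_triangle Bs gB bm1 w(1) w'(1)) simp
        also have "\<dots> \<le> ennreal (2 powr p) * (ennreal C * (ennreal (2 powr p) * ?S n + ennreal (2 powr p) * ?S n) + lpn p ?B (\<lambda>x'. w' n (x', s) - g' x'))"
          by (intro mult_left_mono add_right_mono mid) simp
        finally show "lpn p ?B (\<lambda>x. w n (x, s) - g' x) \<le> ennreal (2 powr p) * (ennreal C * (ennreal (2 powr p) * ?S n + ennreal (2 powr p) * ?S n) + lpn p ?B (\<lambda>x'. w' n (x', s) - g' x'))" .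
      qed simp
      finally show ?thesis .
    qed
    have "?T \<longlonglongrightarrow> ennreal (2 powr p) * (0 + ennreal (2 powr p) * (ennreal C * (ennreal (2 powr p) * (0 + 0) + ennreal (2 powr p) * (0 + 0)) + 0))"
      by (intro ennreal_tendsto_cmult tendsto_add w(2,3) w'(2,3)) auto
    then have "?T \<longlonglongrightarrow> 0" by simp
    from LIMSEQ_le_const[OF this] have "lpn p ?B (\<lambda>x. g x - g' x) \<le> 0" using bound by blast
    then show ?thesis by simp
  qed
  have "AE x in lebesgue. x \<in> ball 0 (real n + 1) \<longrightarrow> g x = g' x" for n
  proof -
    have "AE x in lebesgue_on (ball 0 (real n + 1)). g x - g' x = 0"
      using p gm by (intro lpn_zero_AE[OF _ _ _ z]) (auto intro: measurable_restrict_space1)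
    then have "AE x in lebesgue_on (ball 0 (real n + 1)). g x = g' x" by eventually_elim simp
    then show ?thesis by (simp add: AE_lebesgue_on_iff)
  qed
  then have "AE x in lebesgue. \<forall>n. x \<in> ball 0 (real n + 1) \<longrightarrow> g x = g' x" by (subst AE_all_countable) blast
  then show ?thesis
  proof eventually_elim
    case (elim x)
    obtain n where "norm x \<le> real n" using real_arch_simple by blast
    then have "x \<in> ball 0 (real n + 1)" by simp
    then show ?case using elim by blast
  qed
qed

section \<open>Horizontal slices and the derivatives of traces\<close>

lemma slice_derivative:
  fixes s :: real
  shows "((\<lambda>x'::'a::euclidean_space. (x', s)) has_derivative (\<lambda>h. (h, 0))) (at x)"
  by (auto intro!: derivative_eq_intros)

lemma smooth_fun_slice:
  fixes W :: "'a::euclidean_space \<times> real \<Rightarrow> real"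
  assumes "smooth_fun W"
  shows "smooth_fun (\<lambda>x'. W (x', s))"
  by (rule smooth_fun_compose[OF assms slice_derivative, of "\<lambda>_. 1" "\<lambda>b. (b, 0)"]) (auto simp: tangential_in_Basis)

lemma partial_slice:
  fixes W :: "'a::euclidean_space \<times> real \<Rightarrow> real"
  assumes W: "smooth_fun W" and \<beta>: "set_mset \<beta> \<subseteq> Basis"
  shows "partial \<beta> (\<lambda>x'. W (x', s)) = (\<lambda>x'. partial (image_mset (\<lambda>b. (b, 0)) \<beta>) W (x', s))"
proof -
  obtain bs where bs: "set bs \<subseteq> Basis" "mset bs = \<beta>" using partial_eq_iter_partial[OF \<beta>] by blast
  have sub: "set (map (\<lambda>b. (b, 0 :: real)) bs) \<subseteq> Basis" using bs(1) by (auto intro: tangential_in_Basis)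
  have pl: "prod_list (map (\<lambda>_. 1 :: real) bs) = 1" by (induction bs) auto
  have "partial \<beta> (\<lambda>x'. W (x', s)) = iter_partial bs (\<lambda>x'. W (x', s))"
    using partial_mset[OF smooth_fun_slice[OF W] bs(1)] unfolding bs(2) .
  also have "\<dots> = (\<lambda>x'. prod_list (map (\<lambda>_. 1) bs) * iter_partial (map (\<lambda>b. (b, 0)) bs) W (x', s))"
    by (rule iter_partial_compose[OF W slice_derivative _ _ bs(1)]) (auto simp: tangential_in_Basis)
  also have "\<dots> = (\<lambda>x'. partial (image_mset (\<lambda>b. (b, 0)) \<beta>) W (x', s))"
    using partial_mset[OF W sub] unfolding pl bs(2)[symmetric] by simp
  finally show ?thesis .
qed

text \<open>The index that expresses how traces commute with tangential derivatives: the weak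
  derivative \<open>\<beta>\<close> of the trace of the j-th normal derivative is the trace of the
  derivative with this index.\<close>

definition full_index :: "'a::euclidean_space multiset \<Rightarrow> nat \<Rightarrow> ('a \<times> real) multiset" where
  "full_index \<beta> j = image_mset (\<lambda>b. (b, 0)) \<beta> + replicate_mset j (0, 1)"

lemma full_index_multi_indices: "\<beta> \<in> multi_indices i \<Longrightarrow> full_index \<beta> j \<in> multi_indices (i + j)"
  by (auto simp: multi_indices_def full_index_def normal_in_Basis intro: tangential_in_Basis dest!: in_replicate_mset[THEN iffD1])

lemma normal_index_multi_indices: "normal_index j \<in> multi_indices j"
  by (auto simp: multi_indices_def normal_index_def normal_in_Basis)

text \<open>By the trace inequality the boundary values of the derivatives of \<open>U k\<close> are
  Cauchy in L^p of balls. Their limit satisfies \<open>has_trace\<close>, so by uniqueness it agrees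
  almost everywhere with the chosen trace. One further derivative is consumed, whence the orders up
  to m - 1. The clause on tangential derivatives comes from the closedness of weak derivatives,
  applied in the boundary hyperplane.\<close>

lemma trace_approximation:
  fixes u :: "(real ^ 'n) \<times> real \<Rightarrow> real"
  assumes b: "bm < bp" and p: "1 < p" and usob: "u \<in> homogeneous_sobolev m p (strip bm bp)" and m: "1 \<le> m"
  shows "\<exists>U. (\<forall>k. smooth_fun (U k)) \<and>
    (\<forall>\<alpha>\<in>multi_indices m. weak_deriv (strip bm bp) \<alpha> u \<in> borel_measurable (lebesgue_on (strip bm bp)) \<and>
       (\<lambda>k. lpn p (strip bm bp) (\<lambda>x. partial \<alpha> (U k) x - weak_deriv (strip bm bp) \<alpha> u x)) \<longlonglongrightarrow> 0) \<and>
    (\<forall>s\<in>{bm, bp}. \<forall>j\<le>m - 1. \<forall>\<alpha>\<in>multi_indices j.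
       boundary_trace p bm bp s (weak_deriv (strip bm bp) \<alpha> u) \<in> borel_measurable lebesgue \<and>
       (\<forall>R>0. (\<lambda>k. lpn p (ball 0 R) (\<lambda>x'. partial \<alpha> (U k) (x', s) - boundary_trace p bm bp s (weak_deriv (strip bm bp) \<alpha> u) x')) \<longlonglongrightarrow> 0)) \<and>
    (\<forall>s\<in>{bm, bp}. \<forall>i j. i + j \<le> m - 1 \<longrightarrow> (\<forall>\<beta>\<in>multi_indices i.
       AE x' in lebesgue. tangential_trace p bm bp s \<beta> j u x' = boundary_trace p bm bp s (weak_deriv (strip bm bp) (full_index \<beta> j) u) x'))"
proof -
  let ?O = "strip bm bp :: ((real ^ 'n) \<times> real) set"
  let ?D = "\<lambda>\<alpha>. weak_deriv ?O \<alpha> u"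
  obtain U where U: "\<And>k. smooth_fun (U k)"
    and top: "\<And>\<alpha>. \<alpha> \<in> multi_indices m \<Longrightarrow> (\<lambda>k. lpn p ?O (\<lambda>x. partial \<alpha> (U k) x - ?D \<alpha> x)) \<longlonglongrightarrow> 0"
    and wd: "\<And>j \<alpha>. j \<le> m \<Longrightarrow> \<alpha> \<in> multi_indices j \<Longrightarrow> has_weak_deriv ?O \<alpha> u (?D \<alpha>)"
    and cyl: "\<And>j \<alpha> R. j \<le> m \<Longrightarrow> \<alpha> \<in> multi_indices j \<Longrightarrow> (\<lambda>k. lpn p (cylinder bm bp R) (\<lambda>x. partial \<alpha> (U k) x - ?D \<alpha> x)) \<longlonglongrightarrow> 0"
    using strip_approximation[OF b p usob] by blast
  have p0: "0 \<le> p" "0 < p" "1 \<le> p" using p by auto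
  have MB: "set_mset \<alpha> \<subseteq> Basis" if "\<alpha> \<in> multi_indices j" for \<alpha> :: "((real ^ 'n) \<times> real) multiset" and j
    using that by (simp add: multi_indices_def)
  have sp: "smooth_fun (partial \<alpha> (U k))" if "\<alpha> \<in> multi_indices j" for \<alpha> k j
    by (rule smooth_fun_partial[OF U MB[OF that]])
  have Dm: "?D \<alpha> \<in> borel_measurable (lebesgue_on A)" if "j \<le> m" "\<alpha> \<in> multi_indices j" "A \<subseteq> ?O" for j \<alpha> A
    by (rule measurable_restrict_mono[OF locally_integrable_measurable[OF open_strip has_weak_derivD(2)[OF wd[OF that(1,2)]]] that(3)])
  have Dfin: "lpn p (cylinder bm bp R) (?D \<alpha>) < \<infinity>" if j: "j \<le> m" and \<alpha>: "\<alpha> \<in> multi_indices j" for j \<alpha> R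
  proof -
    let ?Q = "cylinder bm bp R :: ((real ^ 'n) \<times> real) set"
    have "\<forall>\<^sub>F k in sequentially. lpn p ?Q (\<lambda>x. partial \<alpha> (U k) x - ?D \<alpha> x) < 1"
      by (rule order_tendstoD(2)[OF cyl[OF j \<alpha>]]) simp
    then obtain k where k: "lpn p ?Q (\<lambda>x. partial \<alpha> (U k) x - ?D \<alpha> x) < 1" by (auto simp: eventually_sequentially)
    have "lpn p ?Q (?D \<alpha>) = lpn p ?Q (\<lambda>x. partial \<alpha> (U k) x - (partial \<alpha> (U k) x - ?D \<alpha> x))" by simp
    also have "\<dots> \<le> ennreal (2 powr p) * (lpn p ?Q (partial \<alpha> (U k)) + lpn p ?Q (\<lambda>x. partial \<alpha> (U k) x - ?D \<alpha> x))"
      by (intro lpn_diff p0 cylinder_sets borel_measurable_diff smooth_fun_measurable_lebesgue_on[OF sp[OF \<alpha>]] Dm[OF j \<alpha>] cylinder_facts)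
    also have "\<dots> < \<infinity>"
    proof -
      have "lpn p ?Q (partial \<alpha> (U k)) < \<infinity>"
        by (rule lpn_continuous_bounded_finite[OF smooth_fun_continuous_on[OF sp[OF \<alpha>]] cylinder_facts(3) cylinder_sets(2) p0(1)])
      then show ?thesis using k by (auto simp: ennreal_mult_less_top intro: less_trans)
    qed
    finally show ?thesis .
  qed
  \<comment> \<open>For the smooth \<open>U k\<close> a further derivative just enlarges the
    multi-index. In the limit, a weak derivative of u of order j + 1 becomes a first-order weak
    derivative of one of order j, which is what \<open>sobolev1\<close> asks for.\<close>
  have wdc: "has_weak_deriv (cylinder bm bp R) {#e#} (?D \<alpha>) (?D (add_mset e \<alpha>))"
    if j: "j \<le> m - 1" and \<alpha>: "\<alpha> \<in> multi_indices j" and e: "e \<in> Basis" for j \<alpha> e R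
  proof -
    have j': "j \<le> m" "Suc j \<le> m" using j m by auto
    have a: "add_mset e \<alpha> \<in> multi_indices (Suc j)" using \<alpha> e by (simp add: multi_indices_def)
    have eB: "set_mset {#e#} \<subseteq> Basis" using e by simp
    let ?Q = "cylinder bm bp R :: ((real ^ 'n) \<times> real) set"
    have lim: "(\<lambda>k. lpn 1 K (\<lambda>x. partial \<gamma> (U k) x - ?D \<gamma> x)) \<longlonglongrightarrow> 0"
      if "i \<le> m" "\<gamma> \<in> multi_indices i" "compact K" "K \<subseteq> ?Q" for i \<gamma> K
    proof (rule lpn_one_tendsto[OF p0(3) compact_sets_lebesgue[OF that(3)]])
      have KO: "K \<subseteq> ?O" using that(4) cylinder_facts(4) by blast
      show "(\<lambda>x. partial \<gamma> (U k) x - ?D \<gamma> x) \<in> borel_measurable (lebesgue_on K)" for k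
        by (intro borel_measurable_diff smooth_fun_measurable_lebesgue_on[OF sp[OF that(2)]] Dm[OF that(1,2) KO])
      show "(\<lambda>k. lpn p K (\<lambda>x. partial \<gamma> (U k) x - ?D \<gamma> x)) \<longlonglongrightarrow> 0"
        by (rule tendsto_zero_ennreal_le[OF cyl[OF that(1,2)] lpn_mono_set[OF that(4)]])
    qed
    have eq: "partial {#e#} (partial \<alpha> (U k)) = partial (add_mset e \<alpha>) (U k)" for k
      using partial_union[OF U eB MB[OF \<alpha>], of k] by simp
    show ?thesis
    proof (rule has_weak_deriv_limit[OF cylinder_facts(1) eB])
      show "has_weak_deriv ?Q {#e#} (partial \<alpha> (U k)) (partial (add_mset e \<alpha>) (U k))" for k
        by (rule smooth_has_weak_deriv[OF sp[OF \<alpha>] cylinder_facts(1) eB, unfolded eq])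
      show "locally_integrable ?Q (?D \<alpha>)" "locally_integrable ?Q (?D (add_mset e \<alpha>))"
        by (rule locally_integrable_subset[OF has_weak_derivD(2)[OF wd] cylinder_facts(4)]; (rule j' \<alpha> a))+
    qed (rule lim[OF j'(1) \<alpha>] lim[OF j'(2) a]; assumption)+
  qed
  have sob: "?D \<alpha> \<in> sobolev1 p (cylinder bm bp R)" if j: "j \<le> m - 1" and \<alpha>: "\<alpha> \<in> multi_indices j" for j \<alpha> R
  proof -
    have j': "j \<le> m" "Suc j \<le> m" using j m by auto
    have L: "in_Lp p (cylinder bm bp R) (?D \<gamma>)" if "i \<le> m" "\<gamma> \<in> multi_indices i" for i \<gamma>
      unfolding in_Lp_iff using Dm[OF that cylinder_facts(4)] Dfin[OF that] by blast
    have "\<exists>g. has_weak_deriv (cylinder bm bp R) {#e#} (?D \<alpha>) g \<and> in_Lp p (cylinder bm bp R) g" if e: "e \<in> Basis" for e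
    proof -
      have a: "add_mset e \<alpha> \<in> multi_indices (Suc j)" using \<alpha> e by (simp add: multi_indices_def)
      show ?thesis using wdc[OF j \<alpha> e] L[OF j'(2) a] by blast
    qed
    then show ?thesis unfolding sobolev1_def using L[OF j'(1) \<alpha>] by blast
  qed
  have tr: "\<exists>t\<in>borel_measurable lebesgue. (\<forall>R. (\<lambda>k. lpn p (ball 0 R) (\<lambda>x'. partial \<alpha> (U k) (x', s) - t x')) \<longlonglongrightarrow> 0) \<and> has_trace p bm bp s (?D \<alpha>) t"
    if s: "s \<in> {bm, bp}" and j: "j \<le> m - 1" and \<alpha>: "\<alpha> \<in> multi_indices j" for s j \<alpha>
  proof -
    have j': "j \<le> m" "Suc j \<le> m" using j m by auto
    have s': "bm \<le> s" "s \<le> bp" using s b by auto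
    have a: "add_mset (0, 1) \<alpha> \<in> multi_indices (Suc j)" using \<alpha> normal_in_Basis by (auto simp: multi_indices_def)
    obtain C where C: "\<And>V R. smooth_fun V \<Longrightarrow> lpn p (ball 0 R) (\<lambda>x'::real ^ 'n. V (x', s)) \<le>
      ennreal C * (lpn p (cylinder bm bp R) V + lpn p (cylinder bm bp R) (partial {#(0, 1)#} V))"
      using trace_inequality[OF b p s'] by blast
    have NB: "set_mset {#(0, 1)#} \<subseteq> (Basis :: ((real ^ 'n) \<times> real) set)" by (simp add: normal_in_Basis)
    let ?F = "sequentially \<times>\<^sub>F sequentially :: (nat \<times> nat) filter"
    have eq: "partial {#(0, 1)#} (\<lambda>x. partial \<alpha> (U k) x - partial \<alpha> (U l) x) = (\<lambda>x. partial (add_mset (0, 1) \<alpha>) (U k) x - partial (add_mset (0, 1) \<alpha>) (U l) x)" for k l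
      using partial_diff[OF sp[OF \<alpha>] sp[OF \<alpha>] NB, of k l] partial_union[OF U NB MB[OF \<alpha>]] by simp
    have Cauchy: "((\<lambda>(k, l). lpn p (ball 0 R) (\<lambda>x'. partial \<alpha> (U k) (x', s) - partial \<alpha> (U l) (x', s))) \<longlongrightarrow> 0) ?F" for R
    proof (rule tendsto_zero_ennreal_le)
      have 1: "((\<lambda>(k, l). lpn p (cylinder bm bp R) (\<lambda>x. partial \<gamma> (U k) x - partial \<gamma> (U l) x)) \<longlongrightarrow> 0) ?F"
        if "i \<le> m" "\<gamma> \<in> multi_indices i" for i \<gamma>
        by (rule lpn_lim_Cauchy[OF p0(1) cylinder_sets(2) smooth_fun_measurable_lebesgue_on[OF sp[OF that(2)]] Dm[OF that cylinder_facts(4)] cyl[OF that]])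
      have "((\<lambda>x. ennreal C * ((case x of (k, l) \<Rightarrow> lpn p (cylinder bm bp R) (\<lambda>x. partial \<alpha> (U k) x - partial \<alpha> (U l) x))
        + (case x of (k, l) \<Rightarrow> lpn p (cylinder bm bp R) (\<lambda>x. partial (add_mset (0, 1) \<alpha>) (U k) x - partial (add_mset (0, 1) \<alpha>) (U l) x)))) \<longlongrightarrow> ennreal C * (0 + 0)) ?F"
        by (intro ennreal_tendsto_cmult tendsto_add 1[OF j'(1) \<alpha>] 1[OF j'(2) a]) simp
      then show "((\<lambda>x. ennreal C * ((case x of (k, l) \<Rightarrow> lpn p (cylinder bm bp R) (\<lambda>x. partial \<alpha> (U k) x - partial \<alpha> (U l) x))
        + (case x of (k, l) \<Rightarrow> lpn p (cylinder bm bp R) (\<lambda>x. partial (add_mset (0, 1) \<alpha>) (U k) x - partial (add_mset (0, 1) \<alpha>) (U l) x)))) \<longlongrightarrow> 0) ?F" by simp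
      fix x :: "nat \<times> nat"
      obtain k l where x: "x = (k, l)" by (cases x)
      show "(case x of (k, l) \<Rightarrow> lpn p (ball 0 R) (\<lambda>x'. partial \<alpha> (U k) (x', s) - partial \<alpha> (U l) (x', s))) \<le>
        ennreal C * ((case x of (k, l) \<Rightarrow> lpn p (cylinder bm bp R) (\<lambda>x. partial \<alpha> (U k) x - partial \<alpha> (U l) x))
        + (case x of (k, l) \<Rightarrow> lpn p (cylinder bm bp R) (\<lambda>x. partial (add_mset (0, 1) \<alpha>) (U k) x - partial (add_mset (0, 1) \<alpha>) (U l) x)))"
        using C[OF smooth_fun_diff[OF sp[OF \<alpha>] sp[OF \<alpha>]], of R k l] unfolding eq x by simp
    qed
    have bmU: "(\<lambda>x'. partial \<alpha> (U k) (x', s)) \<in> borel_measurable lebesgue" for k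
      by (rule borel_imp_lebesgue[OF borel_measurable_continuous_onI[OF vertical_continuous(2)[OF sp[OF \<alpha>]]]])
    have "\<exists>t\<in>borel_measurable lebesgue. \<forall>i. (\<lambda>k. lpn p (ball 0 (real i + 1)) (\<lambda>x'. partial \<alpha> (U k) (x', s) - t x')) \<longlonglongrightarrow> 0"
    proof (rule lpn_complete[OF p0(2) _ _ bmU Cauchy])
      show "incseq (\<lambda>i. ball (0 :: real ^ 'n) (real i + 1))" by (intro incseq_SucI subset_ball) simp
    qed simp
    then obtain t where t: "t \<in> borel_measurable lebesgue"
      and tl: "\<And>i. (\<lambda>k. lpn p (ball 0 (real i + 1)) (\<lambda>x'. partial \<alpha> (U k) (x', s) - t x')) \<longlonglongrightarrow> 0" by blast
    have tR: "(\<lambda>k. lpn p (ball 0 R) (\<lambda>x'. partial \<alpha> (U k) (x', s) - t x')) \<longlonglongrightarrow> 0" for R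
    proof -
      obtain i :: nat where "R \<le> real i" using real_arch_simple by blast
      then have "ball 0 R \<subseteq> ball (0 :: real ^ 'n) (real i + 1)" by (intro subset_ball) simp
      from tendsto_zero_ennreal_le[OF tl lpn_mono_set[OF this]] show ?thesis .
    qed
    have "has_trace p bm bp s (?D \<alpha>) t"
      unfolding has_trace_def
    proof (intro conjI allI impI t sob[OF j \<alpha>] exI[of _ "\<lambda>k. partial \<alpha> (U k)"] sp[OF \<alpha>])
      fix R :: real
      have "sobolev1_norm_powr p (cylinder bm bp R) (\<lambda>x. partial \<alpha> (U k) x - ?D \<alpha> x)
        = lpn p (cylinder bm bp R) (\<lambda>x. partial \<alpha> (U k) x - ?D \<alpha> x) + (\<Sum>e\<in>Basis. lpn p (cylinder bm bp R) (\<lambda>x. partial (add_mset e \<alpha>) (U k) x - ?D (add_mset e \<alpha>) x))" for k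
      proof -
        have "partial {#e#} (partial \<alpha> (U k)) = partial (add_mset e \<alpha>) (U k)" if "e \<in> Basis" for e
          using partial_union[OF U _ MB[OF \<alpha>], of "{#e#}" k] that by simp
        then have "(\<Sum>e\<in>Basis. lpn p (cylinder bm bp R) (\<lambda>x. partial {#e#} (partial \<alpha> (U k)) x - ?D (add_mset e \<alpha>) x))
          = (\<Sum>e\<in>Basis. lpn p (cylinder bm bp R) (\<lambda>x. partial (add_mset e \<alpha>) (U k) x - ?D (add_mset e \<alpha>) x))"
          by (intro sum.cong) simp_all
        moreover have "sobolev1_norm_powr p (cylinder bm bp R) (\<lambda>x. partial \<alpha> (U k) x - ?D \<alpha> x)
          = lpn p (cylinder bm bp R) (\<lambda>x. partial \<alpha> (U k) x - ?D \<alpha> x) + (\<Sum>e\<in>Basis. lpn p (cylinder bm bp R) (\<lambda>x. partial {#e#} (partial \<alpha> (U k)) x - ?D (add_mset e \<alpha>) x))"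
          by (rule sobolev1_norm_powr_smooth_diff[OF cylinder_facts(1) cylinder_sets(2) sp[OF \<alpha>] wdc[OF j \<alpha>]])
        ultimately show ?thesis by (simp only:)
      qed
      moreover have "(\<lambda>k. lpn p (cylinder bm bp R) (\<lambda>x. partial \<alpha> (U k) x - ?D \<alpha> x) + (\<Sum>e\<in>Basis. lpn p (cylinder bm bp R) (\<lambda>x. partial (add_mset e \<alpha>) (U k) x - ?D (add_mset e \<alpha>) x)))
        \<longlonglongrightarrow> 0 + (\<Sum>e\<in>(Basis :: ((real ^ 'n) \<times> real) set). 0)"
      proof (intro tendsto_add tendsto_sum cyl[OF j'(1) \<alpha>])
        fix e :: "(real ^ 'n) \<times> real" assume "e \<in> Basis"
        then have "add_mset e \<alpha> \<in> multi_indices (Suc j)" using \<alpha> by (simp add: multi_indices_def)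
        then show "(\<lambda>k. lpn p (cylinder bm bp R) (\<lambda>x. partial (add_mset e \<alpha>) (U k) x - ?D (add_mset e \<alpha>) x)) \<longlonglongrightarrow> 0"
          by (rule cyl[OF j'(2)])
      qed
      ultimately show "(\<lambda>n. sobolev1_norm_powr p (cylinder bm bp R) (\<lambda>x. partial \<alpha> (U n) x - ?D \<alpha> x)) \<longlonglongrightarrow> 0" by simp
      show "(\<lambda>n. \<integral>\<^sup>+x'\<in>ball 0 R. ennreal (\<bar>partial \<alpha> (U n) (x', s) - t x'\<bar> powr p) \<partial>lebesgue) \<longlonglongrightarrow> 0"
        using tR[of R] unfolding lpn_def .
    qed
    then show ?thesis using t tR by blast
  qed
  have bt: "boundary_trace p bm bp s (?D \<alpha>) \<in> borel_measurable lebesgue"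
      "(\<lambda>k. lpn p (ball 0 R) (\<lambda>x'. partial \<alpha> (U k) (x', s) - boundary_trace p bm bp s (?D \<alpha>) x')) \<longlonglongrightarrow> 0"
    if s: "s \<in> {bm, bp}" and j: "j \<le> m - 1" and \<alpha>: "\<alpha> \<in> multi_indices j" for s j \<alpha> R
  proof -
    obtain t where t: "t \<in> borel_measurable lebesgue" "\<And>R. (\<lambda>k. lpn p (ball 0 R) (\<lambda>x'. partial \<alpha> (U k) (x', s) - t x')) \<longlonglongrightarrow> 0"
      and ht: "has_trace p bm bp s (?D \<alpha>) t" using tr[OF s j \<alpha>] by blast
    have hb: "has_trace p bm bp s (?D \<alpha>) (boundary_trace p bm bp s (?D \<alpha>))"
      unfolding boundary_trace_def by (rule someI[of "has_trace p bm bp s (?D \<alpha>)", OF ht])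
    then show "boundary_trace p bm bp s (?D \<alpha>) \<in> borel_measurable lebesgue" by (simp add: has_trace_def)
    have ae: "AE x in lebesgue. boundary_trace p bm bp s (?D \<alpha>) x = t x" by (rule has_trace_unique[OF b p s hb ht])
    have ae': "AE x in lebesgue_on (ball 0 R). partial \<alpha> (U k) (x, s) - boundary_trace p bm bp s (?D \<alpha>) x = partial \<alpha> (U k) (x, s) - t x" for k
    proof -
      have "AE x in lebesgue. x \<in> ball 0 R \<longrightarrow> partial \<alpha> (U k) (x, s) - boundary_trace p bm bp s (?D \<alpha>) x = partial \<alpha> (U k) (x, s) - t x"
        using ae by eventually_elim simp
      then show ?thesis by (subst AE_lebesgue_on_iff) auto
    qed
    have "(\<lambda>k. lpn p (ball 0 R) (\<lambda>x'. partial \<alpha> (U k) (x', s) - boundary_trace p bm bp s (?D \<alpha>) x')) = (\<lambda>k. lpn p (ball 0 R) (\<lambda>x'. partial \<alpha> (U k) (x', s) - t x'))"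
      by (intro ext lpn_cong_AE ae') simp
    then show "(\<lambda>k. lpn p (ball 0 R) (\<lambda>x'. partial \<alpha> (U k) (x', s) - boundary_trace p bm bp s (?D \<alpha>) x')) \<longlonglongrightarrow> 0"
      using t(2)[of R] by (simp only:)
  qed
  \<comment> \<open>For smooth functions the derivative of a slice is the slice of the derivative
    with index \<open>full_index\<close>; both converge in L^1 on compact sets.\<close>
  have tang: "AE x' in lebesgue. tangential_trace p bm bp s \<beta> j u x' = boundary_trace p bm bp s (?D (full_index \<beta> j)) x'"
    if s: "s \<in> {bm, bp}" and ij: "i + j \<le> m - 1" and \<beta>: "\<beta> \<in> multi_indices i" for s i j \<beta>
  proof -
    let ?n = "normal_index j :: ((real ^ 'n) \<times> real) multiset" and ?f = "full_index \<beta> j"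
    have j1: "j \<le> m - 1" using ij by simp
    note n = normal_index_multi_indices[of j] and f = full_index_multi_indices[OF \<beta>, of j]
    have \<beta>B: "set_mset \<beta> \<subseteq> Basis" using \<beta> by (simp add: multi_indices_def)
    have liftB: "set_mset (image_mset (\<lambda>b. (b, 0 :: real)) \<beta>) \<subseteq> Basis" using \<beta>B by (auto intro: tangential_in_Basis)
    have eq: "partial \<beta> (\<lambda>x'. partial ?n (U k) (x', s)) = (\<lambda>x'. partial ?f (U k) (x', s))" for k
      using partial_slice[OF sp[OF n] \<beta>B, of k s] partial_union[OF U liftB MB[OF n], of k]
      by (simp add: full_index_def normal_index_def)
    have loc: "locally_integrable UNIV (boundary_trace p bm bp s (?D \<gamma>))" and
      lim: "compact K \<Longrightarrow> (\<lambda>k. lpn 1 K (\<lambda>x'. partial \<gamma> (U k) (x', s) - boundary_trace p bm bp s (?D \<gamma>) x')) \<longlonglongrightarrow> 0"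
      if h: "h \<le> m - 1" and \<gamma>: "\<gamma> \<in> multi_indices h" for h \<gamma> K
    proof -
      let ?t = "boundary_trace p bm bp s (?D \<gamma>)"
      have tm: "?t \<in> borel_measurable (lebesgue_on A)" for A using bt(1)[OF s h \<gamma>] by (rule measurable_restrict_space1)
      have Um: "(\<lambda>x'. partial \<gamma> (U k) (x', s)) \<in> borel_measurable (lebesgue_on A)" for k A
        by (rule borel_imp_lebesgue_on[OF borel_measurable_continuous_onI[OF vertical_continuous(2)[OF sp[OF \<gamma>]]]])
      have limp: "(\<lambda>k. lpn p K (\<lambda>x'. partial \<gamma> (U k) (x', s) - ?t x')) \<longlonglongrightarrow> 0" if K: "compact K" for K
      proof -
        obtain r where "\<forall>x\<in>K. norm x \<le> r" using compact_imp_bounded[OF K] unfolding bounded_iff by blast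
        then have "K \<subseteq> ball 0 (r + 1)" by auto
        from tendsto_zero_ennreal_le[OF bt(2)[OF s h \<gamma>] lpn_mono_set[OF this]] show ?thesis .
      qed
      show "locally_integrable UNIV ?t"
      proof (rule lpn_finite_locally_integrable[OF p0(3) tm])
        fix K :: "(real ^ 'n) set" assume K: "compact K"
        have "\<forall>\<^sub>F k in sequentially. lpn p K (\<lambda>x'. partial \<gamma> (U k) (x', s) - ?t x') < 1"
          by (rule order_tendstoD(2)[OF limp[OF K]]) simp
        then obtain k where k: "lpn p K (\<lambda>x'. partial \<gamma> (U k) (x', s) - ?t x') < 1" by (auto simp: eventually_sequentially)
        have "lpn p K ?t = lpn p K (\<lambda>x'. partial \<gamma> (U k) (x', s) - (partial \<gamma> (U k) (x', s) - ?t x'))" by simp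
        also have "\<dots> \<le> ennreal (2 powr p) * (lpn p K (\<lambda>x'. partial \<gamma> (U k) (x', s)) + lpn p K (\<lambda>x'. partial \<gamma> (U k) (x', s) - ?t x'))"
          by (intro lpn_diff p0 compact_sets_lebesgue K borel_measurable_diff Um tm)
        also have "\<dots> < \<infinity>"
        proof -
          have "lpn p K (\<lambda>x'. partial \<gamma> (U k) (x', s)) < \<infinity>"
            by (rule lpn_continuous_bounded_finite[OF vertical_continuous(2)[OF sp[OF \<gamma>]] compact_imp_bounded[OF K] compact_sets_lebesgue(1)[OF K] p0(1)])
          then show ?thesis using k by (auto simp: ennreal_mult_less_top intro: less_trans)
        qed
        finally show "lpn p K ?t < \<infinity>" .
      qed simp
      show "(\<lambda>k. lpn 1 K (\<lambda>x'. partial \<gamma> (U k) (x', s) - ?t x')) \<longlonglongrightarrow> 0" if "compact K"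
        by (intro lpn_one_tendsto[OF p0(3) compact_sets_lebesgue[OF that] _ limp[OF that]] borel_measurable_diff Um tm)
    qed
    have "has_weak_deriv UNIV \<beta> (boundary_trace p bm bp s (?D ?n)) (boundary_trace p bm bp s (?D ?f))"
    proof (rule has_weak_deriv_limit[OF open_UNIV \<beta>B])
      show "has_weak_deriv UNIV \<beta> (\<lambda>x'. partial ?n (U k) (x', s)) (\<lambda>x'. partial ?f (U k) (x', s))" for k
        unfolding eq[symmetric] by (rule smooth_has_weak_deriv[OF smooth_fun_slice[OF sp[OF n]] open_UNIV \<beta>B])
    qed (rule loc[OF j1 n] loc[OF ij f] lim[OF j1 n] lim[OF ij f]; assumption?)+
    from weak_deriv_AE_eq[OF open_UNIV \<beta>B this]
    show ?thesis unfolding tangential_trace_def by (simp add: AE_lebesgue_on_iff)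
  qed
  show ?thesis
  proof (intro exI[of _ U] conjI allI ballI impI)
    show "smooth_fun (U k)" for k by (rule U)
    fix \<alpha> :: "((real ^ 'n) \<times> real) multiset" assume \<alpha>: "\<alpha> \<in> multi_indices m"
    show "?D \<alpha> \<in> borel_measurable (lebesgue_on ?O)" by (rule Dm[OF order.refl \<alpha> subset_refl])
    show "(\<lambda>k. lpn p ?O (\<lambda>x. partial \<alpha> (U k) x - ?D \<alpha> x)) \<longlonglongrightarrow> 0" by (rule top[OF \<alpha>])
  qed (rule bt tang; assumption)+
qed

section \<open>The estimate for the Taylor polynomials\<close>

text \<open>In each summand, differentiating the power of c - t gives a term that cancels the one
  obtained from the preceding summand by differentiating its F; only the last term survives.\<close>

lemma taylor_sum_derivative:
  fixes F :: "nat \<Rightarrow> real \<Rightarrow> real"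
  assumes F: "\<And>k t. k \<le> N \<Longrightarrow> (F k has_real_derivative F (Suc k) t) (at t)"
  shows "((\<lambda>t. \<Sum>k = 0..N. (c - t) ^ k / fact k * F k t) has_real_derivative (c - t) ^ N / fact N * F (Suc N) t) (at t)"
  using F
proof (induction N)
  case 0
  then show ?case by simp
next
  case (Suc N)
  have IH: "((\<lambda>t. \<Sum>k = 0..N. (c - t) ^ k / fact k * F k t) has_real_derivative (c - t) ^ N / fact N * F (Suc N) t) (at t)"
    by (rule Suc.IH) (use Suc.prems in auto)
  have d: "((\<lambda>t. (c - t) ^ Suc N) has_real_derivative - (real (Suc N) * (c - t) ^ N)) (at t)"
  proof -
    have "((\<lambda>t. c - t) has_real_derivative - 1) (at t)" by (auto intro!: derivative_eq_intros)
    from DERIV_power[OF this, of "Suc N"] show ?thesis by simp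
  qed
  have "((\<lambda>t. (c - t) ^ Suc N / fact (Suc N) * F (Suc N) t) has_real_derivative
     (- (real (Suc N) * (c - t) ^ N)) / fact (Suc N) * F (Suc N) t + F (Suc (Suc N)) t * ((c - t) ^ Suc N / fact (Suc N))) (at t)"
    by (intro DERIV_mult DERIV_cdivide d Suc.prems) simp
  from DERIV_add[OF IH this]
  have "((\<lambda>t. (\<Sum>k = 0..N. (c - t) ^ k / fact k * F k t) + (c - t) ^ Suc N / fact (Suc N) * F (Suc N) t) has_real_derivative
     (c - t) ^ N / fact N * F (Suc N) t + ((- (real (Suc N) * (c - t) ^ N)) / fact (Suc N) * F (Suc N) t + F (Suc (Suc N)) t * ((c - t) ^ Suc N / fact (Suc N)))) (at t)" .
  moreover have "(- (real (Suc N) * (c - t) ^ N)) / fact (Suc N) = - ((c - t) ^ N / fact N)"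
    by (simp add: field_simps del: of_nat_Suc)
  ultimately show ?case by (simp add: mult.commute)
qed

text \<open>Minkowski's inequality for integrals by duality: pairing the integrands with the vector
  \<open>a\<close> of their integrals gives, by Cauchy-Schwarz, A^2 at most A times the right side,
  and A can be cancelled.\<close>

lemma L2_set_integral_le:
  fixes f :: "'i \<Rightarrow> 'a \<Rightarrow> real"
  assumes I: "finite I" and f: "\<And>i. i \<in> I \<Longrightarrow> integrable M (f i)" and G: "integrable M (\<lambda>x. L2_set (\<lambda>i. f i x) I)"
  shows "L2_set (\<lambda>i. \<integral>x. f i x \<partial>M) I \<le> (\<integral>x. L2_set (\<lambda>i. f i x) I \<partial>M)"
proof -
  define a where "a i = (\<integral>x. f i x \<partial>M)" for i
  define A where "A = L2_set a I"
  have A0: "0 \<le> A" by (simp add: A_def)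
  have "A * A = (\<Sum>i\<in>I. a i * (\<integral>x. f i x \<partial>M))"
    unfolding A_def L2_set_def a_def by (simp add: sum_nonneg power2_eq_square)
  also have "\<dots> = (\<integral>x. (\<Sum>i\<in>I. a i * f i x) \<partial>M)"
    using f by (subst Bochner_Integration.integral_sum) auto
  also have "\<dots> \<le> (\<integral>x. A * L2_set (\<lambda>i. f i x) I \<partial>M)"
  proof (rule integral_mono)
    show "integrable M (\<lambda>x. \<Sum>i\<in>I. a i * f i x)" using f by auto
    show "integrable M (\<lambda>x. A * L2_set (\<lambda>i. f i x) I)" using G by simp
    fix x
    have "(\<Sum>i\<in>I. a i * f i x) \<le> (\<Sum>i\<in>I. \<bar>a i\<bar> * \<bar>f i x\<bar>)" by (intro sum_mono) (metis abs_ge_self abs_mult)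
    also have "\<dots> \<le> A * L2_set (\<lambda>i. f i x) I" unfolding A_def by (rule L2_set_mult_ineq)
    finally show "(\<Sum>i\<in>I. a i * f i x) \<le> A * L2_set (\<lambda>i. f i x) I" .
  qed
  also have "\<dots> = A * (\<integral>x. L2_set (\<lambda>i. f i x) I \<partial>M)" by simp
  finally have "A * A \<le> A * (\<integral>x. L2_set (\<lambda>i. f i x) I \<partial>M)" .
  moreover have "0 \<le> (\<integral>x. L2_set (\<lambda>i. f i x) I \<partial>M)" by simp
  ultimately have "A \<le> (\<integral>x. L2_set (\<lambda>i. f i x) I \<partial>M)"
    using A0 by (cases "A = 0") (auto simp: mult_le_cancel_left)
  then show ?thesis unfolding A_def a_def .
qed

lemma continuous_on_L2_set:
  fixes f :: "'i \<Rightarrow> 'a::topological_space \<Rightarrow> real"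
  assumes "\<And>i. i \<in> I \<Longrightarrow> continuous_on S (f i)"
  shows "continuous_on S (\<lambda>x. L2_set (\<lambda>i. f i x) I)"
  unfolding L2_set_def using assms by (intro continuous_intros) auto

text \<open>The two Taylor sums are the values at \<open>b\<close> and \<open>a\<close> of one function of the base point, whose derivative
  contains only \<open>F (Suc N)\<close>.\<close>

lemma taylor_midpoint_estimate:
  fixes F :: "'i \<Rightarrow> nat \<Rightarrow> real \<Rightarrow> real"
  assumes p: "1 < p" and ab: "a < b" and I: "finite I"
    and F: "\<And>i k t. i \<in> I \<Longrightarrow> k \<le> N \<Longrightarrow> (F i k has_real_derivative F i (Suc k) t) (at t)"
    and c: "\<And>i. i \<in> I \<Longrightarrow> continuous_on UNIV (F i (Suc N))"
  shows "ennreal (L2_set (\<lambda>i. \<Sum>k = 0..N. (- 1) ^ k / fact k * (F i k b + (- 1) ^ (k + 1) * F i k a) * ((b - a) / 2) ^ k) I powr p)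
    \<le> ennreal ((b - a) powr (real (Suc N) * p - 1)) * (\<integral>\<^sup>+t\<in>{a<..<b}. ennreal (L2_set (\<lambda>i. F i (Suc N) t) I powr p) \<partial>lborel)"
proof -
  \<comment> \<open>At the midpoint, \<open>m - b\<close> and \<open>m - a\<close> are opposite and
    of modulus (b - a) / 2, which yields the alternating signs and the powers in the sums.\<close>
  define m where "m = (a + b) / 2"
  define d where "d = b - a"
  have d: "0 < d" using ab by (simp add: d_def)
  define f where "f i t = (m - t) ^ N / fact N * F i (Suc N) t" for i t
  define S where "S i = (\<Sum>k = 0..N. (- 1) ^ k / fact k * (F i k b + (- 1) ^ (k + 1) * F i k a) * ((b - a) / 2) ^ k)" for i
  define L where "L t = L2_set (\<lambda>i. F i (Suc N) t) I" for t
  have Lc: "continuous_on UNIV L" unfolding L_def by (intro continuous_on_L2_set c)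
  have [measurable]: "L \<in> borel_measurable borel" by (rule borel_measurable_continuous_onI[OF Lc])
  have fc: "continuous_on UNIV (f i)" if "i \<in> I" for i unfolding f_def by (intro continuous_intros c that) auto
  have eq: "S i = (\<integral>t. indicator {a..b} t *\<^sub>R f i t \<partial>lborel)" if i: "i \<in> I" for i
  proof -
    have "(\<integral>t. f i t * indicator {a..b} t \<partial>lborel) = (\<Sum>k = 0..N. (m - b) ^ k / fact k * F i k b) - (\<Sum>k = 0..N. (m - a) ^ k / fact k * F i k a)"
      using fc[OF i] unfolding f_def
      by (intro integral_FTC_Icc_real less_imp_le[OF ab] taylor_sum_derivative F i) (auto simp: continuous_on_eq_continuous_at)
    also have "\<dots> = S i"
      unfolding S_def sum_subtractf[symmetric]
    proof (rule sum.cong[OF refl])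
      fix k
      have 1: "m - b = - ((b - a) / 2)" "m - a = (b - a) / 2" by (auto simp: m_def field_simps)
      have "(m - b) ^ k = (- 1) ^ k * ((b - a) / 2) ^ k" unfolding 1 by (rule power_minus)
      moreover have "(- 1 :: real) ^ k * (- 1) ^ (k + 1) = - 1" by (simp flip: power_mult_distrib)
      then have "(- 1) ^ k * ((- 1) ^ (k + 1) * F i k a) = - F i k a" by (metis mult.assoc mult_minus1)
      ultimately show "(m - b) ^ k / fact k * F i k b - (m - a) ^ k / fact k * F i k a = (- 1) ^ k / fact k * (F i k b + (- 1) ^ (k + 1) * F i k a) * ((b - a) / 2) ^ k"
        unfolding 1 by (simp add: algebra_simps add_divide_distrib diff_divide_distrib)
    qed
    finally show ?thesis by (simp add: mult.commute)
  qed
  have int: "integrable lborel (\<lambda>t. indicator {a..b} t *\<^sub>R g t)" if "continuous_on UNIV g" for g :: "real \<Rightarrow> real"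
    using that by (intro borel_integrable_compact) (auto intro: continuous_on_subset)
  have L2eq: "L2_set (\<lambda>i. indicator {a..b} t *\<^sub>R f i t) I = indicator {a..b} t *\<^sub>R L2_set (\<lambda>i. f i t) I" for t
    by (cases "t \<in> {a..b}") (simp_all add: L2_set_def)
  have "L2_set S I = L2_set (\<lambda>i. \<integral>t. indicator {a..b} t *\<^sub>R f i t \<partial>lborel) I"
    by (intro L2_set_cong refl eq)
  also have "\<dots> \<le> (\<integral>t. L2_set (\<lambda>i. indicator {a..b} t *\<^sub>R f i t) I \<partial>lborel)"
    by (intro L2_set_integral_le I) (unfold L2eq, (intro int continuous_on_L2_set fc; assumption)+)
  also have "\<dots> \<le> (\<integral>t. d ^ N * (indicator {a..b} t *\<^sub>R L t) \<partial>lborel)"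
    unfolding L2eq
  proof (rule integral_mono)
    show "integrable lborel (\<lambda>t. indicator {a..b} t *\<^sub>R L2_set (\<lambda>i. f i t) I)" by (intro int continuous_on_L2_set fc)
    show "integrable lborel (\<lambda>t. d ^ N * (indicator {a..b} t *\<^sub>R L t))" by (intro integrable_mult_right int Lc)
    fix t
    show "indicator {a..b} t *\<^sub>R L2_set (\<lambda>i. f i t) I \<le> d ^ N * (indicator {a..b} t *\<^sub>R L t)"
    proof (cases "t \<in> {a..b}")
      case True
      \<comment> \<open>The crude bounds |m - t| \<le> d and N! \<ge> 1 suffice: d^(N p) together
        with the factor \<open>d powr (p - 1)\<close> of Jensen's inequality gives d^((N+1) p - 1)
        with the constant 1.\<close>
      have "\<bar>m - t\<bar> \<le> d" using True by (auto simp: m_def d_def abs_le_iff field_simps)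
      then have "\<bar>m - t\<bar> ^ N \<le> d ^ N" by (intro power_mono) auto
      moreover have "\<bar>m - t\<bar> ^ N / fact N \<le> \<bar>m - t\<bar> ^ N / 1"
        by (intro divide_left_mono) (auto simp: fact_ge_1)
      ultimately have le: "\<bar>(m - t) ^ N / fact N\<bar> \<le> d ^ N" by (simp add: abs_divide power_abs)
      have "L2_set (\<lambda>i. f i t) I = \<bar>(m - t) ^ N / fact N\<bar> * L t"
      proof -
        have "(\<Sum>i\<in>I. (f i t)\<^sup>2) = ((m - t) ^ N / fact N)\<^sup>2 * (\<Sum>i\<in>I. (F i (Suc N) t)\<^sup>2)"
          unfolding f_def power_mult_distrib sum_distrib_left ..
        then show ?thesis unfolding L_def L2_set_def by (simp only: real_sqrt_mult real_sqrt_abs)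
      qed
      also have "\<dots> \<le> d ^ N * L t" by (intro mult_right_mono le) (simp add: L_def)
      finally show ?thesis using True by simp
    qed simp
  qed
  also have "\<dots> = (\<integral>t. (d ^ N * L t) * indicator {a..b} t \<partial>lborel)"
    by (intro Bochner_Integration.integral_cong) auto
  finally have le: "L2_set S I \<le> (\<integral>t. (d ^ N * L t) * indicator {a..b} t \<partial>lborel)" .
  have "(\<integral>\<^sup>+t. ennreal (indicator {a..b} t) \<partial>lborel) \<le> ennreal d" using ab by (simp add: ennreal_indicator d_def)
  from jensen_powr[OF p _ _ _ this, of "\<lambda>t. d ^ N * L t"] d
  have J: "ennreal (\<bar>\<integral>t. (d ^ N * L t) * indicator {a..b} t \<partial>lborel\<bar> powr p)
    \<le> ennreal (d powr (p - 1)) * (\<integral>\<^sup>+t. ennreal (\<bar>d ^ N * L t\<bar> powr p * indicator {a..b} t) \<partial>lborel)" by simp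
  have "ennreal (L2_set S I powr p) \<le> ennreal (\<bar>\<integral>t. (d ^ N * L t) * indicator {a..b} t \<partial>lborel\<bar> powr p)"
    using le p by (intro ennreal_leI powr_mono2) auto
  also note J
  also have "(\<integral>\<^sup>+t. ennreal (\<bar>d ^ N * L t\<bar> powr p * indicator {a..b} t) \<partial>lborel)
    = (\<integral>\<^sup>+t. ennreal (d powr (real N * p)) * (ennreal (L t powr p) * indicator {a..b} t) \<partial>lborel)"
  proof (intro nn_integral_cong)
    fix t
    have "\<bar>d ^ N * L t\<bar> powr p = (d ^ N * L t) powr p" using d by (simp add: L_def)
    also have "\<dots> = d powr (real N * p) * L t powr p"
      using d by (simp add: powr_mult powr_powr powr_realpow[symmetric])
    finally show "ennreal (\<bar>d ^ N * L t\<bar> powr p * indicator {a..b} t) = ennreal (d powr (real N * p)) * (ennreal (L t powr p) * indicator {a..b} t)"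
      by (auto simp: indicator_def ennreal_mult)
  qed
  also have "\<dots> = ennreal (d powr (real N * p)) * (\<integral>\<^sup>+t\<in>{a..b}. ennreal (L t powr p) \<partial>lborel)"
    by (rule nn_integral_cmult) measurable
  also have "ennreal (d powr (p - 1)) * (ennreal (d powr (real N * p)) * (\<integral>\<^sup>+t\<in>{a..b}. ennreal (L t powr p) \<partial>lborel))
    = ennreal (d powr (real (Suc N) * p - 1)) * (\<integral>\<^sup>+t\<in>{a<..<b}. ennreal (L t powr p) \<partial>lborel)"
    unfolding nn_integral_Icc_Ioo mult.assoc[symmetric] by (simp add: algebra_simps flip: ennreal_mult' powr_add)
  finally show ?thesis unfolding S_def L_def d_def .
qed

lemma full_index_Suc: "add_mset (0, 1) (full_index \<beta> j) = full_index \<beta> (Suc j)"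
  by (simp add: full_index_def)

text \<open>Different \<open>\<beta>\<close> give different indices of order m, so the left side is
  the norm of a selection of the components of the full gradient.\<close>

lemma L2_set_full_index_le:
  fixes g :: "('a::euclidean_space \<times> real) multiset \<Rightarrow> real"
  assumes "i \<le> m"
  shows "L2_set (\<lambda>\<beta>. g (full_index \<beta> (m - i))) (multi_indices i) \<le> L2_set g (multi_indices m)"
proof -
  have inj: "inj_on (\<lambda>\<beta> :: 'a multiset. full_index \<beta> (m - i)) (multi_indices i)"
  proof (rule inj_onI)
    fix \<beta> \<beta>' :: "'a multiset" assume "full_index \<beta> (m - i) = full_index \<beta>' (m - i)"
    then have "image_mset (\<lambda>b. (b, 0 :: real)) \<beta> = image_mset (\<lambda>b. (b, 0)) \<beta>'" by (simp add: full_index_def)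
    then have "image_mset fst (image_mset (\<lambda>b. (b, 0 :: real)) \<beta>) = image_mset fst (image_mset (\<lambda>b. (b, 0 :: real)) \<beta>')" by (simp only:)
    then show "\<beta> = \<beta>'" by (simp add: multiset.map_comp o_def)
  qed
  have sub: "(\<lambda>\<beta> :: 'a multiset. full_index \<beta> (m - i)) ` multi_indices i \<subseteq> multi_indices m"
    using full_index_multi_indices[where ?i = i and ?j = "m - i"] assms by auto
  have "(\<Sum>\<beta>\<in>multi_indices i. (g (full_index \<beta> (m - i)))\<^sup>2) = (\<Sum>\<alpha>\<in>(\<lambda>\<beta>. full_index \<beta> (m - i)) ` multi_indices i. (g \<alpha>)\<^sup>2)"
    by (subst sum.reindex[OF inj]) simp
  also have "\<dots> \<le> (\<Sum>\<alpha>\<in>multi_indices m. (g \<alpha>)\<^sup>2)"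
    by (rule sum_mono2[OF finite_multi_indices sub]) simp
  finally show ?thesis unfolding L2_set_def by (rule real_sqrt_le_mono)
qed

lemma L2_set_borel:
  assumes "\<And>i. i \<in> I \<Longrightarrow> f i \<in> borel_measurable M"
  shows "(\<lambda>x. L2_set (\<lambda>i. f i x) I) \<in> borel_measurable M"
  unfolding L2_set_def
  by (rule measurable_compose[OF _ borel_measurable_sqrt]) (intro borel_measurable_sum borel_measurable_power assms)

lemma multi_indices_Basis: "\<alpha> \<in> multi_indices j \<Longrightarrow> set_mset \<alpha> \<subseteq> Basis"
  by (simp add: multi_indices_def)

lemma gradient_energy_lpn: "gradient_energy m p \<Omega> u = lpn p \<Omega> (\<lambda>x. L2_set (\<lambda>\<alpha>. weak_deriv \<Omega> \<alpha> u x) (multi_indices m))"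
  by (simp add: gradient_energy_def lpn_def)

lemma taylor_trace_estimate:
  fixes V :: "(real ^ 'n) \<times> real \<Rightarrow> real"
  assumes p: "1 < p" and b: "bm < bp" and V: "smooth_fun V" and il: "i + l \<le> m - 1" and m: "1 \<le> m"
  shows "(\<integral>\<^sup>+x'. ennreal (L2_set (\<lambda>\<beta>. \<Sum>k = 0..m - l - i - 1. (- 1) ^ k / fact k *
        (partial (full_index \<beta> (k + l)) V (x', bp) + (- 1) ^ (k + 1) * partial (full_index \<beta> (k + l)) V (x', bm)) * ((bp - bm) / 2) ^ k)
        (multi_indices i) powr p) \<partial>lebesgue)
    \<le> ennreal ((bp - bm) powr (real (m - i - l) * p - 1)) * lpn p (strip bm bp) (\<lambda>x. L2_set (\<lambda>\<alpha>. partial \<alpha> V x) (multi_indices m))"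
proof -
  \<comment> \<open>The largest k in the sum. The remainder then involves i tangential and
    \<open>Suc N + l\<close> = m - i normal derivatives, that is, derivatives of order m.\<close>
  define N where "N = m - l - i - 1"
  have N: "Suc N = m - i - l" "Suc N + l = m - i" using il m by (auto simp: N_def)
  have s: "smooth_fun (partial (full_index \<beta> j) V)" if "\<beta> \<in> multi_indices i" for \<beta> :: "(real ^ 'n) multiset" and j
    by (rule smooth_fun_partial[OF V multi_indices_Basis[OF full_index_multi_indices[OF that]]])
  define G where "G x = L2_set (\<lambda>\<alpha>. partial \<alpha> V x) (multi_indices m)" for x
  have Gm: "G \<in> borel_measurable borel"
    unfolding G_def by (intro L2_set_borel smooth_partial_borel V multi_indices_Basis)
  have pt: "ennreal (L2_set (\<lambda>\<beta>. \<Sum>k = 0..N. (- 1) ^ k / fact k *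
        (partial (full_index \<beta> (k + l)) V (x', bp) + (- 1) ^ (k + 1) * partial (full_index \<beta> (k + l)) V (x', bm)) * ((bp - bm) / 2) ^ k)
        (multi_indices i) powr p) \<le> ennreal ((bp - bm) powr (real (Suc N) * p - 1)) * (\<integral>\<^sup>+t\<in>{bm<..<bp}. ennreal (\<bar>G (x', t)\<bar> powr p) \<partial>lborel)" for x'
  proof -
    have "ennreal (L2_set (\<lambda>\<beta>. \<Sum>k = 0..N. (- 1) ^ k / fact k *
        (partial (full_index \<beta> (k + l)) V (x', bp) + (- 1) ^ (k + 1) * partial (full_index \<beta> (k + l)) V (x', bm)) * ((bp - bm) / 2) ^ k)
        (multi_indices i) powr p) \<le> ennreal ((bp - bm) powr (real (Suc N) * p - 1)) *
        (\<integral>\<^sup>+t\<in>{bm<..<bp}. ennreal (L2_set (\<lambda>\<beta>. partial (full_index \<beta> (Suc N + l)) V (x', t)) (multi_indices i) powr p) \<partial>lborel)"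
    proof (rule taylor_midpoint_estimate[where F = "\<lambda>\<beta> k t. partial (full_index \<beta> (k + l)) V (x', t)", OF p b finite_multi_indices])
      fix \<beta> :: "(real ^ 'n) multiset" and k t assume \<beta>: "\<beta> \<in> multi_indices i"
      have "partial {#(0, 1)#} (partial (full_index \<beta> (k + l)) V) = partial (full_index \<beta> (Suc k + l)) V"
        using partial_union[OF V _ multi_indices_Basis[OF full_index_multi_indices[OF \<beta>]], of "{#(0, 1)#}" "k + l"]
        by (simp add: normal_in_Basis full_index_Suc)
      then show "((\<lambda>t. partial (full_index \<beta> (k + l)) V (x', t)) has_real_derivative partial (full_index \<beta> (Suc k + l)) V (x', t)) (at t)"
        using vertical_derivative[OF s[OF \<beta>]] by metis
    next
      fix \<beta> :: "(real ^ 'n) multiset" assume \<beta>: "\<beta> \<in> multi_indices i"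
      show "continuous_on UNIV (\<lambda>t. partial (full_index \<beta> (Suc N + l)) V (x', t))" by (rule vertical_continuous(1)[OF s[OF \<beta>]])
    qed
    also have "\<dots> \<le> ennreal ((bp - bm) powr (real (Suc N) * p - 1)) * (\<integral>\<^sup>+t\<in>{bm<..<bp}. ennreal (\<bar>G (x', t)\<bar> powr p) \<partial>lborel)"
    proof (intro mult_left_mono nn_integral_mono mult_right_mono ennreal_leI powr_mono2)
      fix t
      have "i \<le> m" using il m by simp
      from L2_set_full_index_le[OF this, of "\<lambda>\<alpha>. partial \<alpha> V (x', t)"]
      show "L2_set (\<lambda>\<beta>. partial (full_index \<beta> (Suc N + l)) V (x', t)) (multi_indices i) \<le> \<bar>G (x', t)\<bar>"
        unfolding N(2) G_def by simp
    qed (use p in auto)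
    finally show ?thesis .
  qed
  have sl: "(\<lambda>x'. partial (full_index \<beta> j) V (x', s)) \<in> borel_measurable borel" if "\<beta> \<in> multi_indices i" for \<beta> :: "(real ^ 'n) multiset" and j s
    by (rule borel_measurable_continuous_onI[OF vertical_continuous(2)[OF s[OF that]]])
  define h where "h x' = ennreal (L2_set (\<lambda>\<beta>. \<Sum>k = 0..N. (- 1) ^ k / fact k *
        (partial (full_index \<beta> (k + l)) V (x', bp) + (- 1) ^ (k + 1) * partial (full_index \<beta> (k + l)) V (x', bm)) * ((bp - bm) / 2) ^ k)
        (multi_indices i) powr p)" for x'
  have Gx: "(\<lambda>(x, t). G (x, t)) \<in> borel_measurable (borel \<Otimes>\<^sub>M borel)" unfolding borel_prod using Gm by simp
  note [measurable] = Gx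
  have "(\<integral>\<^sup>+x'. h x' \<partial>lebesgue) = (\<integral>\<^sup>+x'. h x' \<partial>lborel)"
    by (rule nn_integral_completion)
  also have "\<dots> \<le> (\<integral>\<^sup>+x'. ennreal ((bp - bm) powr (real (Suc N) * p - 1)) * (\<integral>\<^sup>+t\<in>{bm<..<bp}. ennreal (\<bar>G (x', t)\<bar> powr p) \<partial>lborel) \<partial>lborel)"
    unfolding h_def by (intro nn_integral_mono pt)
  also have "\<dots> = ennreal ((bp - bm) powr (real (Suc N) * p - 1)) * (\<integral>\<^sup>+x'. (\<integral>\<^sup>+t\<in>{bm<..<bp}. ennreal (\<bar>G (x', t)\<bar> powr p) \<partial>lborel) \<partial>lborel)"
    by (rule nn_integral_cmult) measurable
  also have "(\<integral>\<^sup>+x'. (\<integral>\<^sup>+t\<in>{bm<..<bp}. ennreal (\<bar>G (x', t)\<bar> powr p) \<partial>lborel) \<partial>lborel) = lpn p (strip bm bp) G"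
    unfolding strip_def by (subst lpn_Times[OF Gm]) simp_all
  finally show ?thesis unfolding h_def G_def N(1) unfolding N_def .
qed

section \<open>The estimate for the differences of the traces\<close>

text \<open>Polar coordinates for radial integrands. Both sides are integrals of G for measures on
  the real line, which agree as soon as they agree on all rays \<open>{x<..}\<close>: there the
  image of Lebesgue measure under the norm is a difference of volumes of balls, and the density has
  the antiderivative K r^n.\<close>

lemma nn_integral_norm_ball:
  fixes G :: "real \<Rightarrow> ennreal"
  assumes G[measurable]: "G \<in> borel_measurable borel" and d: "0 < d"
  shows "(\<integral>\<^sup>+h\<in>ball (0 :: 'a::euclidean_space) d. G (norm h) \<partial>lborel) =
    (\<integral>\<^sup>+r\<in>{0<..<d}. ennreal (unit_ball_vol (real DIM('a)) * real DIM('a) * r ^ (DIM('a) - 1)) * G r \<partial>lborel)"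
proof -
  define n where "n = DIM('a)"
  have n: "0 < n" by (simp add: n_def)
  define K where "K = unit_ball_vol (real n)"
  have K: "0 \<le> K" by (simp add: K_def)
  define M where "M = distr (density lborel (indicator (ball (0 :: 'a) d))) borel norm"
  define D where "D = density lborel (\<lambda>r. ennreal (K * real n * r ^ (n - 1)) * indicator {0<..<d} r)"
  have bm[measurable]: "ball (0 :: 'a) d \<in> sets borel" by simp
  have fin: "emeasure lborel (ball (0 :: 'a) r) < \<infinity>" for r by (rule emeasure_bounded_finite[OF bounded_ball])
  have eM: "emeasure M {x<..} = emeasure lborel (ball (0 :: 'a) d \<inter> {h. x < norm h})" for x
  proof -
    have m[measurable]: "{h :: 'a. x < norm h} \<in> sets borel" by measurable
    have "emeasure M {x<..} = emeasure (density lborel (indicator (ball (0 :: 'a) d))) {h. x < norm h}"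
      unfolding M_def by (subst emeasure_distr) (auto simp: vimage_def)
    also have "\<dots> = emeasure lborel (ball (0 :: 'a) d \<inter> {h. x < norm h})"
      by (subst emeasure_density) (auto simp: indicator_inter_arith[symmetric] nn_integral_indicator[symmetric] simp del: nn_integral_indicator)
    finally show ?thesis .
  qed
  have eD: "emeasure D {x<..} = (\<integral>\<^sup>+r. ennreal (K * real n * r ^ (n - 1)) * indicator {0<..<d} r * indicator {x<..} r \<partial>lborel)" for x
    unfolding D_def by (subst emeasure_density) auto
  have ftc: "(\<integral>\<^sup>+r. ennreal (K * real n * r ^ (n - 1)) * indicator {y..d} r \<partial>lborel) = ennreal (K * d ^ n - K * y ^ n)" if "0 \<le> y" "y \<le> d" for y
  proof (rule nn_integral_FTC_Icc)
    fix r
    show "((\<lambda>r. K * r ^ n) has_real_derivative K * real n * r ^ (n - 1)) (at r)"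
      by (auto intro!: derivative_eq_intros)
    show "0 \<le> K * real n * r ^ (n - 1)" if "r \<in> {y..d}" using K that \<open>0 \<le> y\<close> by auto
  qed (use that in auto)
  have eq: "emeasure M {x<..} = emeasure D {x<..}" for x
  proof -
    consider "d \<le> x" | "0 \<le> x" "x < d" | "x < 0" by linarith
    then show ?thesis
    proof cases
      case 1
      then have e: "ball (0 :: 'a) d \<inter> {h. x < norm h} = {}" by auto
      have "(\<integral>\<^sup>+r. ennreal (K * real n * r ^ (n - 1)) * indicator {0<..<d} r * indicator {x<..} r \<partial>lborel) = (\<integral>\<^sup>+r. 0 \<partial>(lborel :: real measure))"
        using 1 by (intro nn_integral_cong) (auto simp: indicator_def)
      then show ?thesis unfolding eM eD e by simp
    next
      case 2
      have s: "ball (0 :: 'a) d \<inter> {h. x < norm h} = ball 0 d - cball 0 x" by auto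
      have "emeasure lborel (ball (0 :: 'a) d - cball 0 x) = emeasure lborel (ball (0 :: 'a) d) - emeasure lborel (cball (0 :: 'a) x)"
        using 2 by (intro emeasure_Diff) (auto simp: emeasure_cball)
      also have "\<dots> = ennreal (K * d ^ n) - ennreal (K * x ^ n)"
        using 2 d by (simp add: emeasure_ball emeasure_cball K_def n_def)
      also have "\<dots> = ennreal (K * d ^ n - K * x ^ n)" using 2 K by (intro ennreal_minus) simp
      also have "\<dots> = (\<integral>\<^sup>+r. ennreal (K * real n * r ^ (n - 1)) * indicator {x..d} r \<partial>lborel)"
        using 2 by (intro ftc[symmetric]) auto
      also have "\<dots> = (\<integral>\<^sup>+r. ennreal (K * real n * r ^ (n - 1)) * indicator {x<..<d} r \<partial>lborel)"
        by (rule nn_integral_Icc_Ioo)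
      also have "\<dots> = (\<integral>\<^sup>+r. ennreal (K * real n * r ^ (n - 1)) * indicator {0<..<d} r * indicator {x<..} r \<partial>lborel)"
        using 2 by (intro nn_integral_cong) (auto simp: indicator_def)
      finally show ?thesis unfolding eM eD s .
    next
      case 3
      have s: "ball (0 :: 'a) d \<inter> {h. x < norm h} = ball 0 d" using 3 by (auto intro: less_le_trans)
      have "emeasure lborel (ball (0 :: 'a) d) = ennreal (K * d ^ n - K * 0 ^ n)"
        using d n by (simp add: emeasure_ball K_def n_def)
      also have "\<dots> = (\<integral>\<^sup>+r. ennreal (K * real n * r ^ (n - 1)) * indicator {0..d} r \<partial>lborel)"
        using d by (intro ftc[symmetric]) auto
      also have "\<dots> = (\<integral>\<^sup>+r. ennreal (K * real n * r ^ (n - 1)) * indicator {0<..<d} r \<partial>lborel)"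
        by (rule nn_integral_Icc_Ioo)
      also have "\<dots> = (\<integral>\<^sup>+r. ennreal (K * real n * r ^ (n - 1)) * indicator {0<..<d} r * indicator {x<..} r \<partial>lborel)"
        using 3 by (intro nn_integral_cong) (auto simp: indicator_def)
      finally show ?thesis unfolding eM eD s .
    qed
  qed
  have MD: "M = D"
  proof (rule measure_eqI_lessThan)
    show "sets M = sets borel" "sets D = sets borel" by (simp_all add: M_def D_def)
    fix x
    have "emeasure M {x<..} \<le> emeasure lborel (ball (0 :: 'a) d)"
      unfolding eM by (intro emeasure_mono) auto
    then show "emeasure M {x<..} < \<infinity>" using fin[of d] by (rule le_less_trans)
    show "emeasure M {x<..} = emeasure D {x<..}" by (rule eq)
  qed
  have "(\<integral>\<^sup>+h\<in>ball (0 :: 'a) d. G (norm h) \<partial>lborel) = (\<integral>\<^sup>+r. G r \<partial>M)"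
    unfolding M_def by (subst nn_integral_distr, simp, simp, subst nn_integral_density) (auto simp: mult.commute)
  also have "\<dots> = (\<integral>\<^sup>+r. ennreal (K * real n * r ^ (n - 1)) * indicator {0<..<d} r * G r \<partial>lborel)"
    unfolding MD D_def by (subst nn_integral_density) auto
  also have "\<dots> = (\<integral>\<^sup>+r\<in>{0<..<d}. ennreal (K * real n * r ^ (n - 1)) * G r \<partial>lborel)"
    by (intro nn_integral_cong) (auto simp: mult_ac)
  finally show ?thesis unfolding K_def n_def .
qed

text \<open>Apply Jensen's inequality with the weight \<open>t powr (-1/2)\<close> to \<open>F r - F 0\<close>.\<close>

lemma hardy:
  fixes F f :: "real \<Rightarrow> real"
  assumes p: "1 < p" and d: "0 < d" and F: "\<And>t. (F has_real_derivative f t) (at t)" and f: "continuous_on UNIV f"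
  shows "(\<integral>\<^sup>+r\<in>{0<..<d}. ennreal (\<bar>F r - F 0\<bar> powr p / r powr p) \<partial>lborel)
    \<le> ennreal (2 powr p / (p - 1)) * (\<integral>\<^sup>+t\<in>{0<..<d}. ennreal (\<bar>f t\<bar> powr p) \<partial>lborel)"
proof -
  have [measurable]: "f \<in> borel_measurable borel" using f by (rule borel_measurable_continuous_onI)
  \<comment> \<open>The total weight 2 r^(1/2) in Jensen's inequality produces r^q outside, and
    splitting f into f t^(1/2) and t^(-1/2) produces t^q inside. Together with r^(-p) the outer
    power becomes r^(-q-1), which is integrable at infinity.\<close>
  define q where "q = (p - 1) / 2"
  have q: "0 < q" using p by (simp add: q_def)
  have inner: "ennreal (\<bar>F r - F 0\<bar> powr p / r powr p) \<le>
      ennreal (2 powr (p - 1)) * (\<integral>\<^sup>+t\<in>{0<..<r}. ennreal (r powr (- q - 1)) * ennreal (\<bar>f t\<bar> powr p * t powr q) \<partial>lborel)" if r: "0 < r" for r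
  proof -
    define w where "w t = t powr (- 1 / 2) * indicator {0<..<r} t" for t :: real
    have wm[measurable]: "w \<in> borel_measurable borel" unfolding w_def by measurable
    have w0: "0 \<le> w t" for t by (simp add: w_def)
    have "((\<lambda>x. x powr (- 1 / 2)) has_integral (r powr (- 1 / 2 + 1) / (- 1 / 2 + 1))) {0..r}"
      by (rule has_integral_powr_from_0) (use r in auto)
    then have hi: "((\<lambda>x. x powr (- 1 / 2)) has_integral (2 * r powr (1 / 2))) {0..r}" by (simp add: mult.commute)
    have "(\<integral>\<^sup>+t. ennreal (w t) \<partial>lborel) \<le> (\<integral>\<^sup>+t. ennreal (t powr (- 1 / 2)) * indicator {0..r} t \<partial>lborel)"
      by (intro nn_integral_mono) (auto simp: w_def indicator_def)
    also have "\<dots> = ennreal (2 * r powr (1 / 2))"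
      by (rule nn_integral_has_integral_lebesgue'[OF _ hi]) simp
    finally have W: "(\<integral>\<^sup>+t. ennreal (w t) \<partial>lborel) \<le> ennreal (2 * r powr (1 / 2))" .
    define g where "g t = f t * t powr (1 / 2)" for t
    have gm[measurable]: "g \<in> borel_measurable borel" unfolding g_def by measurable
    have "F r - F 0 = (\<integral>t. f t * indicator {0..r} t \<partial>lborel)"
      by (rule integral_FTC_Icc_real[symmetric]) (use F f r in \<open>auto simp: continuous_on_eq_continuous_at\<close>)
    also have "\<dots> = (\<integral>t. g t * w t \<partial>lborel)"
    proof (rule integral_cong_AE)
      have "AE t in lborel. t \<noteq> 0" "AE t in lborel. t \<noteq> r" by (rule AE_lborel_singleton)+
      then show "AE t in lborel. f t * indicator {0..r} t = g t * w t"
      proof eventually_elim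
        case (elim t)
        show ?case
        proof (cases "t \<in> {0<..<r}")
          case True
          then have "t powr (1 / 2) * t powr (- 1 / 2) = 1" by (simp flip: powr_add)
          then show ?thesis using True by (simp add: g_def w_def)
        next
          case False
          then have "t \<notin> {0..r}" using elim by auto
          then show ?thesis using False by (simp add: w_def)
        qed
      qed
    qed measurable
    finally have eq: "F r - F 0 = (\<integral>t. g t * w t \<partial>lborel)" .
    have "ennreal (\<bar>F r - F 0\<bar> powr p) \<le> ennreal ((2 * r powr (1 / 2)) powr (p - 1)) * (\<integral>\<^sup>+t. ennreal (\<bar>g t\<bar> powr p * w t) \<partial>lborel)"
      unfolding eq by (rule jensen_powr[OF p _ _ _ W]) (auto simp: w0)
    also have "(2 * r powr (1 / 2)) powr (p - 1) = 2 powr (p - 1) * r powr q"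
      by (simp add: powr_mult powr_powr q_def)
    also have "(\<integral>\<^sup>+t. ennreal (\<bar>g t\<bar> powr p * w t) \<partial>lborel) = (\<integral>\<^sup>+t\<in>{0<..<r}. ennreal (\<bar>f t\<bar> powr p * t powr q) \<partial>lborel)"
    proof (intro nn_integral_cong)
      fix t
      show "ennreal (\<bar>g t\<bar> powr p * w t) = ennreal (\<bar>f t\<bar> powr p * t powr q) * indicator {0<..<r} t"
      proof (cases "t \<in> {0<..<r}")
        case True
        have "\<bar>g t\<bar> powr p * w t = \<bar>f t\<bar> powr p * (t powr (p / 2) * t powr (- 1 / 2))"
          using True by (simp add: g_def w_def abs_mult powr_mult powr_powr)
        also have "t powr (p / 2) * t powr (- 1 / 2) = t powr q"
          using True by (simp add: q_def diff_divide_distrib flip: powr_add)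
        finally show ?thesis using True by simp
      qed (simp add: w_def)
    qed
    finally have le: "ennreal (\<bar>F r - F 0\<bar> powr p) \<le> ennreal (2 powr (p - 1) * r powr q) * (\<integral>\<^sup>+t\<in>{0<..<r}. ennreal (\<bar>f t\<bar> powr p * t powr q) \<partial>lborel)" .
    have "ennreal (\<bar>F r - F 0\<bar> powr p / r powr p) = ennreal (r powr (- p)) * ennreal (\<bar>F r - F 0\<bar> powr p)"
      using r by (simp add: powr_minus divide_inverse mult.commute flip: ennreal_mult')
    also have "\<dots> \<le> ennreal (r powr (- p)) * (ennreal (2 powr (p - 1) * r powr q) * (\<integral>\<^sup>+t\<in>{0<..<r}. ennreal (\<bar>f t\<bar> powr p * t powr q) \<partial>lborel))"
      by (intro mult_left_mono le) simp
    also have "\<dots> = ennreal (2 powr (p - 1)) * (ennreal (r powr (- q - 1)) * (\<integral>\<^sup>+t\<in>{0<..<r}. ennreal (\<bar>f t\<bar> powr p * t powr q) \<partial>lborel))"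
    proof -
      have "r powr (- p) * (2 powr (p - 1) * r powr q) = 2 powr (p - 1) * (r powr (- p) * r powr q)" by simp
      also have "r powr (- p) * r powr q = r powr (- p + q)" by (rule powr_add[symmetric])
      also have "- p + q = - q - 1" by (simp add: q_def field_simps)
      finally have "r powr (- p) * (2 powr (p - 1) * r powr q) = 2 powr (p - 1) * r powr (- q - 1)" .
      then have "ennreal (r powr (- p)) * ennreal (2 powr (p - 1) * r powr q) = ennreal (2 powr (p - 1)) * ennreal (r powr (- q - 1))"
        by (simp flip: ennreal_mult')
      then show ?thesis by (simp only: mult.assoc[symmetric])
    qed
    also have "ennreal (r powr (- q - 1)) * (\<integral>\<^sup>+t\<in>{0<..<r}. ennreal (\<bar>f t\<bar> powr p * t powr q) \<partial>lborel)
      = (\<integral>\<^sup>+t\<in>{0<..<r}. ennreal (r powr (- q - 1)) * ennreal (\<bar>f t\<bar> powr p * t powr q) \<partial>lborel)"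
      unfolding mult.assoc by (rule nn_integral_cmult[symmetric]) measurable
    finally show ?thesis .
  qed
  \<comment> \<open>The integrand on the triangle 0 < t < r < d, prepared for exchanging the order
    of integration.\<close>
  define H where "H r t = indicator {0<..<d} r * indicator {0<..<r} t * (ennreal (r powr (- q - 1)) * ennreal (\<bar>f t\<bar> powr p * t powr q))" for r t :: real
  have Hi: "H r t = (if 0 < t \<and> t < r \<and> r < d then ennreal (r powr (- q - 1)) * ennreal (\<bar>f t\<bar> powr p * t powr q) else 0)" for r t
    by (auto simp: H_def indicator_def)
  have Hm[measurable]: "(\<lambda>(r, t). H r t) \<in> borel_measurable (lborel \<Otimes>\<^sub>M lborel)" unfolding Hi by measurable
  have "(\<integral>\<^sup>+r\<in>{0<..<d}. ennreal (\<bar>F r - F 0\<bar> powr p / r powr p) \<partial>lborel) \<le> (\<integral>\<^sup>+r. ennreal (2 powr (p - 1)) * (\<integral>\<^sup>+t. H r t \<partial>lborel) \<partial>lborel)"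
  proof (intro nn_integral_mono)
    fix r
    show "ennreal (\<bar>F r - F 0\<bar> powr p / r powr p) * indicator {0<..<d} r \<le> ennreal (2 powr (p - 1)) * (\<integral>\<^sup>+t. H r t \<partial>lborel)"
    proof (cases "r \<in> {0<..<d}")
      case True
      then have "(\<integral>\<^sup>+t. H r t \<partial>lborel) = (\<integral>\<^sup>+t\<in>{0<..<r}. ennreal (r powr (- q - 1)) * ennreal (\<bar>f t\<bar> powr p * t powr q) \<partial>lborel)"
        by (intro nn_integral_cong) (auto simp: H_def indicator_def)
      then show ?thesis using inner[of r] True by simp
    qed simp
  qed
  also have "\<dots> = ennreal (2 powr (p - 1)) * (\<integral>\<^sup>+r. \<integral>\<^sup>+t. H r t \<partial>lborel \<partial>lborel)"
    by (rule nn_integral_cmult) measurable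
  also have "(\<integral>\<^sup>+r. \<integral>\<^sup>+t. H r t \<partial>lborel \<partial>lborel) = (\<integral>\<^sup>+t. \<integral>\<^sup>+r. H r t \<partial>lborel \<partial>lborel)"
    by (rule lborel_pair.Fubini'[OF Hm, symmetric])
  also have "\<dots> \<le> (\<integral>\<^sup>+t. ennreal (1 / q) * (ennreal (\<bar>f t\<bar> powr p) * indicator {0<..<d} t) \<partial>lborel)"
  proof (intro nn_integral_mono)
    fix t
    show "(\<integral>\<^sup>+r. H r t \<partial>lborel) \<le> ennreal (1 / q) * (ennreal (\<bar>f t\<bar> powr p) * indicator {0<..<d} t)"
    proof (cases "t \<in> {0<..<d}")
      case True
      then have t: "0 < t" by simp
      \<comment> \<open>The inner integral is extended from r < d to infinity. It then equals t^(-q)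
        / q, which cancels t^q, and the constant becomes free of d.\<close>
      have hi: "((\<lambda>x. x powr (- q - 1)) has_integral - (t powr (- q - 1 + 1)) / (- q - 1 + 1)) {t..}"
        by (rule has_integral_powr_to_inf) (use q t in auto)
      have "(\<integral>\<^sup>+r. H r t \<partial>lborel) \<le> (\<integral>\<^sup>+r. (ennreal (r powr (- q - 1)) * indicator {t..} r) * ennreal (\<bar>f t\<bar> powr p * t powr q) \<partial>lborel)"
        by (intro nn_integral_mono) (auto simp: Hi)
      also have "\<dots> = (\<integral>\<^sup>+r. ennreal (r powr (- q - 1)) * indicator {t..} r \<partial>lborel) * ennreal (\<bar>f t\<bar> powr p * t powr q)"
        by (rule nn_integral_multc) measurable
      also have "(\<integral>\<^sup>+r. ennreal (r powr (- q - 1)) * indicator {t..} r \<partial>lborel) = ennreal (- (t powr (- q - 1 + 1)) / (- q - 1 + 1))"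
        by (rule nn_integral_has_integral_lebesgue'[OF _ hi]) simp
      also have "- (t powr (- q - 1 + 1)) / (- q - 1 + 1) = 1 / q * t powr (- q)" by simp
      also have "ennreal (1 / q * t powr (- q)) * ennreal (\<bar>f t\<bar> powr p * t powr q) = ennreal (1 / q) * ennreal (\<bar>f t\<bar> powr p)"
      proof -
        have "t powr (- q) * t powr q = 1" using t by (simp flip: powr_add)
        moreover have "1 / q * t powr (- q) * (\<bar>f t\<bar> powr p * t powr q) = 1 / q * \<bar>f t\<bar> powr p * (t powr (- q) * t powr q)"
          by (simp only: mult_ac)
        ultimately have "1 / q * t powr (- q) * (\<bar>f t\<bar> powr p * t powr q) = 1 / q * \<bar>f t\<bar> powr p" by simp
        then show ?thesis using q by (simp flip: ennreal_mult')
      qed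
      finally show ?thesis using True by simp
    next
      case False
      then have "H r t = 0" for r by (auto simp: Hi)
      then show ?thesis by simp
    qed
  qed
  also have "\<dots> = ennreal (1 / q) * (\<integral>\<^sup>+t\<in>{0<..<d}. ennreal (\<bar>f t\<bar> powr p) \<partial>lborel)"
    by (rule nn_integral_cmult) measurable
  also have "ennreal (2 powr (p - 1)) * (ennreal (1 / q) * (\<integral>\<^sup>+t\<in>{0<..<d}. ennreal (\<bar>f t\<bar> powr p) \<partial>lborel))
    = ennreal (2 powr p / (p - 1)) * (\<integral>\<^sup>+t\<in>{0<..<d}. ennreal (\<bar>f t\<bar> powr p) \<partial>lborel)"
  proof -
    have "2 powr (p - 1) * (1 / q) = 2 powr p / (p - 1)" by (simp add: q_def powr_diff)
    then show ?thesis using q unfolding mult.assoc[symmetric] by (simp flip: ennreal_mult')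
  qed
  finally show ?thesis by (simp add: mult_left_mono)
qed

section \<open>Integrals over pairs of points, and the two boundary planes\<close>

lemma nn_integral_Fubini_ball:
  fixes \<Phi> :: "'a::euclidean_space \<Rightarrow> 'a \<Rightarrow> ennreal"
  assumes "(\<lambda>z. \<Phi> (fst z) (snd z)) \<in> borel_measurable borel"
  shows "(\<integral>\<^sup>+x. (\<integral>\<^sup>+h\<in>ball 0 d. \<Phi> x h \<partial>lborel) \<partial>lborel) = (\<integral>\<^sup>+h\<in>ball 0 d. (\<integral>\<^sup>+x. \<Phi> x h \<partial>lborel) \<partial>lborel)"
proof -
  have P: "(\<lambda>z. \<Phi> (fst z) (snd z)) \<in> borel_measurable (borel \<Otimes>\<^sub>M borel)" using assms unfolding borel_prod .
  then have [measurable]: "(\<lambda>(x, h). \<Phi> x h) \<in> borel_measurable (borel \<Otimes>\<^sub>M borel)" by (simp add: case_prod_beta')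
  have [measurable]: "ball (0 :: 'a) d \<in> sets borel" by simp
  have m: "(\<lambda>(x, h). \<Phi> x h * indicator (ball 0 d) h) \<in> borel_measurable (lborel \<Otimes>\<^sub>M lborel)" by measurable
  have mh: "(\<lambda>x. \<Phi> x h) \<in> borel_measurable lborel" for h by measurable
  have "(\<integral>\<^sup>+x. (\<integral>\<^sup>+h\<in>ball 0 d. \<Phi> x h \<partial>lborel) \<partial>lborel) = (\<integral>\<^sup>+h. (\<integral>\<^sup>+x. \<Phi> x h * indicator (ball 0 d) h \<partial>lborel) \<partial>lborel)"
    by (rule lborel_pair.Fubini'[OF m, symmetric])
  also have "\<dots> = (\<integral>\<^sup>+h\<in>ball 0 d. (\<integral>\<^sup>+x. \<Phi> x h \<partial>lborel) \<partial>lborel)"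
    by (intro nn_integral_cong nn_integral_multc mh)
  finally show ?thesis .
qed

text \<open>For fixed h the integral over x is invariant under translation by h. Hence the vertical
  pieces above x and above x + h contribute equally.\<close>

lemma nn_integral_shift_ball:
  fixes \<Phi> :: "'a::euclidean_space \<Rightarrow> 'a \<Rightarrow> ennreal"
  assumes P: "(\<lambda>z. \<Phi> (fst z) (snd z)) \<in> borel_measurable borel"
  shows "(\<integral>\<^sup>+x. (\<integral>\<^sup>+h\<in>ball 0 d. \<Phi> (x + h) h \<partial>lborel) \<partial>lborel) = (\<integral>\<^sup>+x. (\<integral>\<^sup>+h\<in>ball 0 d. \<Phi> x h \<partial>lborel) \<partial>lborel)"
proof -
  have "(\<lambda>z :: 'a \<times> 'a. (fst z + snd z, snd z)) \<in> borel_measurable borel"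
    by (intro borel_measurable_continuous_onI continuous_intros)
  from measurable_compose[OF this P]
  have S: "(\<lambda>z. \<Phi> (fst z + snd z) (snd z)) \<in> borel_measurable borel" by simp
  have "(\<lambda>x. (x, h)) \<in> borel_measurable borel" for h :: 'a
    by (intro borel_measurable_continuous_onI continuous_intros)
  from measurable_compose[OF this P] have h: "(\<lambda>x. \<Phi> x h) \<in> borel_measurable borel" for h by simp
  show ?thesis
    unfolding nn_integral_Fubini_ball[OF P] nn_integral_Fubini_ball[of "\<lambda>x h. \<Phi> (x + h) h", OF S]
    by (subst lborel_nn_integral_translate[OF h]) simp
qed

text \<open>Here \<open>\<sigma>\<close> is the inward direction, 1 at the lower and -1 at the upper
  boundary, and r is the distance from the boundary plane. This treats both boundary components at
  once.\<close>

lemma nn_integral_reflect_Ioo: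
  fixes k :: "real \<Rightarrow> ennreal"
  assumes [measurable]: "k \<in> borel_measurable borel" and st: "s = a \<and> \<sigma> = 1 \<or> s = b \<and> \<sigma> = - 1"
  shows "(\<integral>\<^sup>+r\<in>{0<..<b - a}. k (s + \<sigma> * r) \<partial>lborel) = (\<integral>\<^sup>+t\<in>{a<..<b}. k t \<partial>lborel)"
proof -
  have \<sigma>: "\<sigma> \<noteq> 0" "\<bar>\<sigma>\<bar> = 1" using st by auto
  have "(\<integral>\<^sup>+r\<in>{0<..<b - a}. k (s + \<sigma> * r) \<partial>lborel) = (\<integral>\<^sup>+r. (k (s + \<sigma> *\<^sub>R r) * indicator {a<..<b} (s + \<sigma> *\<^sub>R r)) \<partial>lborel)"
    using st by (intro nn_integral_cong) (auto simp: indicator_def)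
  also have "\<dots> = (\<integral>\<^sup>+t\<in>{a<..<b}. k t \<partial>lborel)"
    using \<sigma> by (subst nn_integral_affine) auto
  finally show ?thesis .
qed

lemma lpn_strip_reflect:
  fixes K :: "'a::euclidean_space \<times> real \<Rightarrow> real"
  assumes K[measurable]: "K \<in> borel_measurable borel" and st: "s = bm \<and> \<sigma> = 1 \<or> s = bp \<and> \<sigma> = - 1"
  shows "(\<integral>\<^sup>+x. (\<integral>\<^sup>+r\<in>{0<..<bp - bm}. ennreal (\<bar>K (x, s + \<sigma> * r)\<bar> powr p) \<partial>lborel) \<partial>lborel) = lpn p (UNIV \<times> {bm<..<bp}) K"
proof -
  have "(\<lambda>t. ennreal (\<bar>K (x, t)\<bar> powr p)) \<in> borel_measurable borel" for x by measurable
  from nn_integral_reflect_Ioo[OF this st] show ?thesis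
    by (subst lpn_Times[OF K]) auto
qed

text \<open>The height above x depends on h only through r = |h|. With n the dimension of h, polar
  coordinates turn the kernel into r^(n-1) r^(-p-n+1) = r^(-p), the weight of Hardy's inequality on
  the vertical line.\<close>

lemma vertical_gagliardo:
  fixes V :: "'a::euclidean_space \<times> real \<Rightarrow> real"
  assumes p: "1 < p" and b: "bm < bp" and V: "smooth_fun V" and st: "s = bm \<and> \<sigma> = 1 \<or> s = bp \<and> \<sigma> = - 1"
  shows "(\<integral>\<^sup>+x. (\<integral>\<^sup>+h\<in>ball (0 :: 'a) (bp - bm). ennreal (\<bar>V (x, s + \<sigma> * norm h) - V (x, s)\<bar> powr p / norm h powr (p + real DIM('a) - 1)) \<partial>lborel) \<partial>lborel)
    \<le> ennreal (unit_ball_vol (real DIM('a)) * real DIM('a) * (2 powr p / (p - 1))) * lpn p (UNIV \<times> {bm<..<bp}) (partial {#(0, 1)#} V)"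
proof -
  define n where "n = DIM('a)"
  have n: "0 < n" by (simp add: n_def)
  define K where "K = unit_ball_vol (real n) * real n"
  have K: "0 \<le> K" by (simp add: K_def)
  define d where "d = bp - bm"
  have d: "0 < d" using b by (simp add: d_def)
  define D where "D = partial {#(0, 1)#} V"
  have sD: "smooth_fun D" unfolding D_def by (rule smooth_fun_partial[OF V]) (simp add: normal_in_Basis)
  have Dm[measurable]: "D \<in> borel_measurable borel" by (rule smooth_fun_borel[OF sD])
  have Vm[measurable]: "V \<in> borel_measurable borel" by (rule smooth_fun_borel[OF V])
  have \<sigma>: "\<bar>\<sigma>\<bar> = 1" using st by auto
  have pt: "(\<integral>\<^sup>+h\<in>ball (0 :: 'a) d. ennreal (\<bar>V (x, s + \<sigma> * norm h) - V (x, s)\<bar> powr p / norm h powr (p + real n - 1)) \<partial>lborel)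
     \<le> ennreal (K * (2 powr p / (p - 1))) * (\<integral>\<^sup>+r\<in>{0<..<d}. ennreal (\<bar>D (x, s + \<sigma> * r)\<bar> powr p) \<partial>lborel)" for x
  proof -
    define F where "F r = V (x, s + \<sigma> * r)" for r
    define f where "f r = \<sigma> * D (x, s + \<sigma> * r)" for r
    have dF: "(F has_real_derivative f r) (at r)" for r
    proof -
      have "((\<lambda>r. s + \<sigma> * r) has_real_derivative \<sigma>) (at r)" by (auto intro!: derivative_eq_intros)
      from DERIV_chain2[OF vertical_derivative[OF V] this] show ?thesis
        unfolding F_def f_def D_def by (simp add: mult.commute)
    qed
    have cf: "continuous_on UNIV f" unfolding f_def
      by (intro continuous_intros continuous_on_compose2[OF vertical_continuous(1)[OF sD, of UNIV]]) auto
    have [measurable]: "F \<in> borel_measurable borel" unfolding F_def by measurable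
    have "(\<integral>\<^sup>+h\<in>ball (0 :: 'a) d. ennreal (\<bar>F (norm h) - F 0\<bar> powr p / norm h powr (p + real n - 1)) \<partial>lborel)
       = (\<integral>\<^sup>+r\<in>{0<..<d}. ennreal (K * r ^ (n - 1)) * ennreal (\<bar>F r - F 0\<bar> powr p / r powr (p + real n - 1)) \<partial>lborel)"
      unfolding K_def n_def by (subst nn_integral_norm_ball[OF _ d, where ?'a = 'a]) simp_all
    also have "\<dots> = (\<integral>\<^sup>+r. ennreal K * (ennreal (\<bar>F r - F 0\<bar> powr p / r powr p) * indicator {0<..<d} r) \<partial>lborel)"
    proof (intro nn_integral_cong)
      fix r
      show "ennreal (K * r ^ (n - 1)) * ennreal (\<bar>F r - F 0\<bar> powr p / r powr (p + real n - 1)) * indicator {0<..<d} r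
         = ennreal K * (ennreal (\<bar>F r - F 0\<bar> powr p / r powr p) * indicator {0<..<d} r)"
      proof (cases "r \<in> {0<..<d}")
        case True
        then have r: "0 < r" by simp
        have "r powr (p + real n - 1) = r powr (p + real (n - 1))" using n by (simp add: of_nat_diff algebra_simps)
        also have "\<dots> = r powr p * r ^ (n - 1)" using r by (simp add: powr_add powr_realpow)
        finally have e: "r powr (p + real n - 1) = r powr p * r ^ (n - 1)" .
        have "K * r ^ (n - 1) * (\<bar>F r - F 0\<bar> powr p / r powr (p + real n - 1)) = K * (\<bar>F r - F 0\<bar> powr p / r powr p)"
          unfolding e using r by (simp add: field_simps)
        then show ?thesis using True K r by (simp flip: ennreal_mult')
      qed simp
    qed
    also have "\<dots> = ennreal K * (\<integral>\<^sup>+r\<in>{0<..<d}. ennreal (\<bar>F r - F 0\<bar> powr p / r powr p) \<partial>lborel)"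
      by (rule nn_integral_cmult) measurable
    also have "\<dots> \<le> ennreal K * (ennreal (2 powr p / (p - 1)) * (\<integral>\<^sup>+t\<in>{0<..<d}. ennreal (\<bar>f t\<bar> powr p) \<partial>lborel))"
      by (intro mult_left_mono hardy[OF p d dF cf]) simp
    also have "\<dots> = ennreal (K * (2 powr p / (p - 1))) * (\<integral>\<^sup>+t\<in>{0<..<d}. ennreal (\<bar>f t\<bar> powr p) \<partial>lborel)"
      using K unfolding mult.assoc[symmetric] by (simp flip: ennreal_mult')
    also have "(\<integral>\<^sup>+t\<in>{0<..<d}. ennreal (\<bar>f t\<bar> powr p) \<partial>lborel) = (\<integral>\<^sup>+r\<in>{0<..<d}. ennreal (\<bar>D (x, s + \<sigma> * r)\<bar> powr p) \<partial>lborel)"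
      by (simp add: f_def abs_mult \<sigma>)
    finally show ?thesis unfolding F_def by simp
  qed
  have "(\<integral>\<^sup>+x. (\<integral>\<^sup>+h\<in>ball (0 :: 'a) d. ennreal (\<bar>V (x, s + \<sigma> * norm h) - V (x, s)\<bar> powr p / norm h powr (p + real n - 1)) \<partial>lborel) \<partial>lborel)
     \<le> (\<integral>\<^sup>+x. ennreal (K * (2 powr p / (p - 1))) * (\<integral>\<^sup>+r\<in>{0<..<d}. ennreal (\<bar>D (x, s + \<sigma> * r)\<bar> powr p) \<partial>lborel) \<partial>lborel)"
    by (intro nn_integral_mono pt)
  also have "\<dots> = ennreal (K * (2 powr p / (p - 1))) * (\<integral>\<^sup>+x. (\<integral>\<^sup>+r\<in>{0<..<d}. ennreal (\<bar>D (x, s + \<sigma> * r)\<bar> powr p) \<partial>lborel) \<partial>lborel)"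
    by (rule nn_integral_cmult) measurable
  also have "(\<integral>\<^sup>+x. (\<integral>\<^sup>+r\<in>{0<..<d}. ennreal (\<bar>D (x, s + \<sigma> * r)\<bar> powr p) \<partial>lborel) \<partial>lborel) = lpn p (UNIV \<times> {bm<..<bp}) D"
    unfolding d_def by (rule lpn_strip_reflect[OF Dm st])
  finally show ?thesis unfolding D_def d_def K_def n_def .
qed

text \<open>\<open>segment_bound\<close> on the segment from x to x + h; after Fubini's theorem
  every t contributes the same amount, by translation invariance.\<close>

lemma tangential_difference:
  fixes W :: "'a::euclidean_space \<Rightarrow> real"
  assumes p: "1 < p" and W: "smooth_fun W"
  shows "(\<integral>\<^sup>+x. ennreal (\<bar>W (x + h) - W x\<bar> powr p) \<partial>lborel)
    \<le> ennreal (norm h powr p) * (\<integral>\<^sup>+x. ennreal ((\<Sum>b\<in>Basis. \<bar>partial {#b#} W x\<bar>) powr p) \<partial>lborel)"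
proof -
  define H where "H z = ennreal ((\<Sum>b\<in>Basis. \<bar>partial {#b#} W z\<bar>) powr p)" for z
  have b: "partial {#b#} W \<in> borel_measurable borel" if "b \<in> Basis" for b
    by (rule smooth_partial_borel[OF W]) (use that in simp)
  have [measurable]: "(\<lambda>z. \<Sum>b\<in>Basis. \<bar>partial {#b#} W z\<bar>) \<in> borel_measurable borel"
    by (intro borel_measurable_sum borel_measurable_abs b)
  have Hm[measurable]: "H \<in> borel_measurable borel" unfolding H_def by measurable
  have "(\<integral>\<^sup>+x. ennreal (\<bar>W (x + h) - W x\<bar> powr p) \<partial>lborel) \<le> (\<integral>\<^sup>+x. ennreal (norm h powr p) * (\<integral>\<^sup>+t\<in>{0..1::real}. H (x + t *\<^sub>R h) \<partial>lborel) \<partial>lborel)"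
  proof (intro nn_integral_mono)
    fix x
    show "ennreal (\<bar>W (x + h) - W x\<bar> powr p) \<le> ennreal (norm h powr p) * (\<integral>\<^sup>+t\<in>{0..1::real}. H (x + t *\<^sub>R h) \<partial>lborel)"
      using segment_bound[OF p W, of "x + h" x] by (simp add: H_def)
  qed
  also have "\<dots> = ennreal (norm h powr p) * (\<integral>\<^sup>+x. (\<integral>\<^sup>+t\<in>{0..1::real}. H (x + t *\<^sub>R h) \<partial>lborel) \<partial>lborel)"
    by (rule nn_integral_cmult) measurable
  also have "(\<integral>\<^sup>+x. (\<integral>\<^sup>+t\<in>{0..1::real}. H (x + t *\<^sub>R h) \<partial>lborel) \<partial>lborel) = (\<integral>\<^sup>+t. (\<integral>\<^sup>+x. H (x + t *\<^sub>R h) * indicator {0..1::real} t \<partial>lborel) \<partial>lborel)"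
    by (rule lborel_pair.Fubini'[symmetric]) measurable
  also have "\<dots> = (\<integral>\<^sup>+t. (\<integral>\<^sup>+x. H x \<partial>lborel) * indicator {0..1::real} t \<partial>lborel)"
    by (intro nn_integral_cong, subst nn_integral_multc) (simp_all add: lborel_nn_integral_translate)
  also have "\<dots> = (\<integral>\<^sup>+x. H x \<partial>lborel)" by (subst nn_integral_cmult) auto
  finally show ?thesis unfolding H_def .
qed

text \<open>At a fixed height the tangential difference gains |h|^p, and the remaining |h|^(1-n) is
  cancelled by the Jacobian of polar coordinates. What is left is an integral over all distances r
  from the boundary, that is, over the strip. This is the reason for crossing at the distance
  |h|.\<close>

lemma tangential_gagliardo:
  fixes V :: "'a::euclidean_space \<times> real \<Rightarrow> real"
  assumes p: "1 < p" and b: "bm < bp" and V: "smooth_fun V" and st: "s = bm \<and> \<sigma> = 1 \<or> s = bp \<and> \<sigma> = - 1"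
  shows "(\<integral>\<^sup>+x. (\<integral>\<^sup>+h\<in>ball 0 (bp - bm). ennreal (\<bar>V (x + h, s + \<sigma> * norm h) - V (x, s + \<sigma> * norm h)\<bar> powr p / norm h powr (p + real DIM('a) - 1)) \<partial>lborel) \<partial>lborel)
    \<le> ennreal (unit_ball_vol (real DIM('a)) * real DIM('a)) * lpn p (UNIV \<times> {bm<..<bp}) (\<lambda>z. \<Sum>b\<in>Basis. \<bar>partial {#(b, 0)#} V z\<bar>)"
proof -
  define n where "n = DIM('a)"
  have n: "0 < n" by (simp add: n_def)
  define K where "K = unit_ball_vol (real n) * real n"
  have K: "0 \<le> K" by (simp add: K_def)
  define d where "d = bp - bm"
  have d: "0 < d" using b by (simp add: d_def)
  define q where "q = p + real n - 1"
  have Vm[measurable]: "V \<in> borel_measurable borel" by (rule smooth_fun_borel[OF V])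
  define S where "S z = (\<Sum>b\<in>Basis. \<bar>partial {#(b, 0)#} V z\<bar>)" for z
  have Sm[measurable]: "S \<in> borel_measurable borel" unfolding S_def
    by (intro borel_measurable_sum borel_measurable_abs smooth_partial_borel V) (simp add: tangential_in_Basis)
  have S0: "0 \<le> S z" for z unfolding S_def by (intro sum_nonneg) simp
  define T where "T y = (\<integral>\<^sup>+x. ennreal (S (x, y) powr p) \<partial>lborel)" for y
  have Tm[measurable]: "T \<in> borel_measurable borel" unfolding T_def by measurable
  have slice: "(\<integral>\<^sup>+x. ennreal (\<bar>V (x + h, y) - V (x, y)\<bar> powr p) \<partial>lborel) \<le> ennreal (norm h powr p) * T y" for h y
  proof -
    have "partial {#b#} (\<lambda>x. V (x, y)) x = partial {#(b, 0)#} V (x, y)" if "b \<in> Basis" for b x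
      using partial_slice[OF V, of "{#b#}" y] that by simp
    then show ?thesis using tangential_difference[OF p smooth_fun_slice[OF V, of y], where h = h]
      unfolding T_def S_def by simp
  qed
  have m: "(\<lambda>z. ennreal (\<bar>V (fst z + snd z, s + \<sigma> * norm (snd z)) - V (fst z, s + \<sigma> * norm (snd z))\<bar> powr p / norm (snd z) powr q)) \<in> borel_measurable (borel :: ('a \<times> 'a) measure)"
    unfolding borel_prod[symmetric] by measurable
  have "(\<integral>\<^sup>+x. (\<integral>\<^sup>+h\<in>ball 0 d. ennreal (\<bar>V (x + h, s + \<sigma> * norm h) - V (x, s + \<sigma> * norm h)\<bar> powr p / norm h powr q) \<partial>lborel) \<partial>lborel)
    = (\<integral>\<^sup>+h\<in>ball 0 d. (\<integral>\<^sup>+x. ennreal (\<bar>V (x + h, s + \<sigma> * norm h) - V (x, s + \<sigma> * norm h)\<bar> powr p / norm h powr q) \<partial>lborel) \<partial>lborel)"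
    by (rule nn_integral_Fubini_ball[OF m])
  also have "\<dots> \<le> (\<integral>\<^sup>+h\<in>ball (0 :: 'a) d. ennreal (norm h powr (p - q)) * T (s + \<sigma> * norm h) \<partial>lborel)"
  proof (intro nn_integral_mono mult_right_mono)
    fix h :: 'a
    have e: "ennreal (a / norm h powr q) = ennreal (1 / norm h powr q) * ennreal a" if "0 \<le> a" for a
      using that by (simp flip: ennreal_mult')
    have "(\<integral>\<^sup>+x. ennreal (\<bar>V (x + h, s + \<sigma> * norm h) - V (x, s + \<sigma> * norm h)\<bar> powr p / norm h powr q) \<partial>lborel)
       = (\<integral>\<^sup>+x. ennreal (1 / norm h powr q) * ennreal (\<bar>V (x + h, s + \<sigma> * norm h) - V (x, s + \<sigma> * norm h)\<bar> powr p) \<partial>lborel)"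
      by (intro nn_integral_cong e) simp
    also have "\<dots> = ennreal (1 / norm h powr q) * (\<integral>\<^sup>+x. ennreal (\<bar>V (x + h, s + \<sigma> * norm h) - V (x, s + \<sigma> * norm h)\<bar> powr p) \<partial>lborel)"
      by (rule nn_integral_cmult) measurable
    also have "\<dots> \<le> ennreal (1 / norm h powr q) * (ennreal (norm h powr p) * T (s + \<sigma> * norm h))"
      by (intro mult_left_mono slice) simp
    also have "\<dots> = ennreal (norm h powr (p - q)) * T (s + \<sigma> * norm h)"
      unfolding mult.assoc[symmetric] by (simp add: powr_diff flip: ennreal_mult')
    finally show "(\<integral>\<^sup>+x. ennreal (\<bar>V (x + h, s + \<sigma> * norm h) - V (x, s + \<sigma> * norm h)\<bar> powr p / norm h powr q) \<partial>lborel)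
       \<le> ennreal (norm h powr (p - q)) * T (s + \<sigma> * norm h)" .
  qed simp
  also have "\<dots> = (\<integral>\<^sup>+r\<in>{0<..<d}. ennreal (K * r ^ (n - 1)) * (ennreal (r powr (p - q)) * T (s + \<sigma> * r)) \<partial>lborel)"
    unfolding K_def n_def by (rule nn_integral_norm_ball[OF _ d]) measurable
  also have "\<dots> = (\<integral>\<^sup>+r. ennreal K * (T (s + \<sigma> * r) * indicator {0<..<d} r) \<partial>lborel)"
  proof (intro nn_integral_cong)
    fix r
    show "ennreal (K * r ^ (n - 1)) * (ennreal (r powr (p - q)) * T (s + \<sigma> * r)) * indicator {0<..<d} r
       = ennreal K * (T (s + \<sigma> * r) * indicator {0<..<d} r)"
    proof (cases "r \<in> {0<..<d}")
      case True
      then have r: "0 < r" by simp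
      have "p - q = - real (n - 1)" using n by (simp add: q_def of_nat_diff)
      then have "r ^ (n - 1) * r powr (p - q) = 1" using r by (simp add: powr_minus powr_realpow)
      then have "K * r ^ (n - 1) * r powr (p - q) = K" by (simp add: mult.assoc)
      moreover have "ennreal (K * r ^ (n - 1)) * ennreal (r powr (p - q)) = ennreal (K * r ^ (n - 1) * r powr (p - q))"
        by (rule ennreal_mult''[symmetric]) simp
      ultimately have "ennreal (K * r ^ (n - 1)) * ennreal (r powr (p - q)) = ennreal K" by (simp only:)
      then show ?thesis using True by (simp flip: mult.assoc)
    qed simp
  qed
  also have "\<dots> = ennreal K * (\<integral>\<^sup>+r\<in>{0<..<d}. T (s + \<sigma> * r) \<partial>lborel)"
    by (rule nn_integral_cmult) measurable
  also have "(\<integral>\<^sup>+r\<in>{0<..<d}. T (s + \<sigma> * r) \<partial>lborel) = (\<integral>\<^sup>+r. (\<integral>\<^sup>+x. ennreal (S (x, s + \<sigma> * r) powr p) * indicator {0<..<d} r \<partial>lborel) \<partial>lborel)"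
    unfolding T_def by (intro nn_integral_cong nn_integral_multc[symmetric]) measurable
  also have "\<dots> = (\<integral>\<^sup>+x. (\<integral>\<^sup>+r\<in>{0<..<d}. ennreal (S (x, s + \<sigma> * r) powr p) \<partial>lborel) \<partial>lborel)"
    by (rule lborel_pair.Fubini') measurable
  also have "\<dots> = lpn p (UNIV \<times> {bm<..<bp}) S"
    using lpn_strip_reflect[OF Sm st, of p] unfolding d_def by (simp add: S0)
  finally show ?thesis unfolding S_def d_def K_def n_def q_def .
qed

text \<open>The factor 3^p splits the path into three pieces. Two of them are vertical, with the
  constants of polar coordinates and of Hardy's inequality; the third is tangential, with n^p for
  separating the n partial derivatives. The width of the strip does not enter.\<close>

definition gagliardo_const :: "real \<Rightarrow> nat \<Rightarrow> real" where
  "gagliardo_const p n = 3 powr p * (2 * (unit_ball_vol (real n) * real n * (2 powr p / (p - 1))) + unit_ball_vol (real n) * real n * real n powr p)"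

lemma gagliardo_const_nonneg: "1 < p \<Longrightarrow> 0 \<le> gagliardo_const p n"
  unfolding gagliardo_const_def by (intro mult_nonneg_nonneg add_nonneg_nonneg divide_nonneg_nonneg) auto

text \<open>The difference of the boundary values at \<open>x\<close> and \<open>x + h\<close> is split along the path through the two points at
  distance \<open>norm h\<close> from the boundary.\<close>

lemma gagliardo_smooth:
  fixes V :: "'a::euclidean_space \<times> real \<Rightarrow> real"
  assumes p: "1 < p" and b: "bm < bp" and V: "smooth_fun V" and s: "s \<in> {bm, bp}"
  shows "(\<integral>\<^sup>+x. (\<integral>\<^sup>+h\<in>ball 0 (bp - bm). ennreal (\<bar>V (x + h, s) - V (x, s)\<bar> powr p / norm h powr (p + real DIM('a) - 1)) \<partial>lborel) \<partial>lborel)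
    \<le> ennreal (gagliardo_const p DIM('a)) * (\<Sum>e\<in>Basis. lpn p (UNIV \<times> {bm<..<bp}) (partial {#e#} V))"
proof -
  obtain \<sigma> :: real where st: "s = bm \<and> \<sigma> = 1 \<or> s = bp \<and> \<sigma> = - 1" using s by auto
  define n where "n = DIM('a)"
  define q where "q = p + real n - 1"
  define K where "K = unit_ball_vol (real n) * real n"
  define K' where "K' = K * (2 powr p / (p - 1))"
  have K: "0 \<le> K" by (simp add: K_def)
  have K': "0 \<le> K'" using p K by (simp add: K'_def)
  define B where "B = ball (0 :: 'a) (bp - bm)"
  have Bm[measurable]: "B \<in> sets borel" by (simp add: B_def)
  let ?O = "UNIV \<times> {bm<..<bp} :: ('a \<times> real) set"
  have O: "?O \<in> sets lebesgue" by (rule sets_completionI_sets) (simp add: borel_open open_Times)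
  define S where "S = (\<Sum>e\<in>Basis. lpn p ?O (partial {#e#} V))"
  have Vm[measurable]: "V \<in> borel_measurable borel" by (rule smooth_fun_borel[OF V])
  define A where "A x h = ennreal (\<bar>V (x, s + \<sigma> * norm h) - V (x, s)\<bar> powr p / norm h powr q)" for x h :: 'a
  define E where "E x h = ennreal (\<bar>V (x + h, s + \<sigma> * norm h) - V (x, s + \<sigma> * norm h)\<bar> powr p / norm h powr q)" for x h :: 'a
  have Am: "(\<lambda>z. A (fst z) (snd z)) \<in> borel_measurable borel"
    unfolding A_def borel_prod[symmetric] by measurable
  have [measurable]: "(\<lambda>(x, h). A x h) \<in> borel_measurable (borel \<Otimes>\<^sub>M borel)" "(\<lambda>(x, h). E x h) \<in> borel_measurable (borel \<Otimes>\<^sub>M borel)"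
    unfolding A_def E_def by measurable
  have pt: "ennreal (\<bar>V (x + h, s) - V (x, s)\<bar> powr p / norm h powr q) \<le> ennreal (3 powr p) * (A (x + h) h + (E x h + A x h))" for x h
  proof -
    define y where "y = s + \<sigma> * norm h"
    define a where "a = (\<lambda>i :: nat. if i = 0 then V (x + h, s) - V (x + h, y) else if i = 1 then V (x + h, y) - V (x, y) else V (x, y) - V (x, s))"
    have "V (x + h, s) - V (x, s) = (\<Sum>i\<in>{0, 1, 2}. a i)" by (simp add: a_def)
    also have "\<bar>\<dots>\<bar> powr p \<le> real (card {0, 1, 2 :: nat}) powr p * (\<Sum>i\<in>{0, 1, 2}. \<bar>a i\<bar> powr p)"
      by (rule powr_sum_le) (use p in auto)
    also have "\<dots> = 3 powr p * (\<bar>V (x + h, y) - V (x + h, s)\<bar> powr p + (\<bar>V (x + h, y) - V (x, y)\<bar> powr p + \<bar>V (x, y) - V (x, s)\<bar> powr p))"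
      by (simp add: a_def abs_minus_commute)
    finally have "\<bar>V (x + h, s) - V (x, s)\<bar> powr p / norm h powr q \<le> 3 powr p * (\<bar>V (x + h, y) - V (x + h, s)\<bar> powr p + (\<bar>V (x + h, y) - V (x, y)\<bar> powr p + \<bar>V (x, y) - V (x, s)\<bar> powr p)) / norm h powr q"
      by (rule divide_right_mono) simp
    also have "\<dots> = 3 powr p * (\<bar>V (x + h, y) - V (x + h, s)\<bar> powr p / norm h powr q + (\<bar>V (x + h, y) - V (x, y)\<bar> powr p / norm h powr q + \<bar>V (x, y) - V (x, s)\<bar> powr p / norm h powr q))"
      by (simp only: add_divide_distrib times_divide_eq_right[symmetric])
    finally have "ennreal (\<bar>V (x + h, s) - V (x, s)\<bar> powr p / norm h powr q) \<le> ennreal (3 powr p * (\<bar>V (x + h, y) - V (x + h, s)\<bar> powr p / norm h powr q + (\<bar>V (x + h, y) - V (x, y)\<bar> powr p / norm h powr q + \<bar>V (x, y) - V (x, s)\<bar> powr p / norm h powr q)))"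
      by (rule ennreal_leI)
    also have "\<dots> = ennreal (3 powr p) * (A (x + h) h + (E x h + A x h))"
      unfolding A_def E_def y_def[symmetric] by (simp add: ennreal_mult' ennreal_plus[symmetric] del: ennreal_plus)
    finally show ?thesis .
  qed
  have "(\<integral>\<^sup>+x. (\<integral>\<^sup>+h\<in>B. ennreal (\<bar>V (x + h, s) - V (x, s)\<bar> powr p / norm h powr q) \<partial>lborel) \<partial>lborel)
     \<le> (\<integral>\<^sup>+x. (\<integral>\<^sup>+h. ennreal (3 powr p) * (A (x + h) h * indicator B h + (E x h * indicator B h + A x h * indicator B h)) \<partial>lborel) \<partial>lborel)"
    using pt by (intro nn_integral_mono) (auto simp: indicator_def)
  also have "\<dots> = ennreal (3 powr p) * ((\<integral>\<^sup>+x. (\<integral>\<^sup>+h\<in>B. A (x + h) h \<partial>lborel) \<partial>lborel) +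
      ((\<integral>\<^sup>+x. (\<integral>\<^sup>+h\<in>B. E x h \<partial>lborel) \<partial>lborel) + (\<integral>\<^sup>+x. (\<integral>\<^sup>+h\<in>B. A x h \<partial>lborel) \<partial>lborel)))"
    by (simp add: nn_integral_cmult nn_integral_add)
  also have "(\<integral>\<^sup>+x. (\<integral>\<^sup>+h\<in>B. A (x + h) h \<partial>lborel) \<partial>lborel) = (\<integral>\<^sup>+x. (\<integral>\<^sup>+h\<in>B. A x h \<partial>lborel) \<partial>lborel)"
    unfolding B_def by (rule nn_integral_shift_ball[OF Am])
  finally have 1: "(\<integral>\<^sup>+x. (\<integral>\<^sup>+h\<in>B. ennreal (\<bar>V (x + h, s) - V (x, s)\<bar> powr p / norm h powr q) \<partial>lborel) \<partial>lborel)
     \<le> ennreal (3 powr p) * ((\<integral>\<^sup>+x. (\<integral>\<^sup>+h\<in>B. A x h \<partial>lborel) \<partial>lborel) +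
      ((\<integral>\<^sup>+x. (\<integral>\<^sup>+h\<in>B. E x h \<partial>lborel) \<partial>lborel) + (\<integral>\<^sup>+x. (\<integral>\<^sup>+h\<in>B. A x h \<partial>lborel) \<partial>lborel)))" .
  have "(\<integral>\<^sup>+x. (\<integral>\<^sup>+h\<in>B. A x h \<partial>lborel) \<partial>lborel) \<le> ennreal K' * lpn p ?O (partial {#(0, 1)#} V)"
    using vertical_gagliardo[OF p b V st] unfolding A_def B_def K'_def K_def n_def q_def .
  also have "\<dots> \<le> ennreal K' * S"
    unfolding S_def by (intro mult_left_mono member_le_sum) (auto simp: normal_in_Basis)
  finally have 2: "(\<integral>\<^sup>+x. (\<integral>\<^sup>+h\<in>B. A x h \<partial>lborel) \<partial>lborel) \<le> ennreal K' * S" .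
  have "(\<integral>\<^sup>+x. (\<integral>\<^sup>+h\<in>B. E x h \<partial>lborel) \<partial>lborel) \<le> ennreal K * lpn p ?O (\<lambda>z. \<Sum>b\<in>Basis. \<bar>partial {#(b, 0)#} V z\<bar>)"
    using tangential_gagliardo[OF p b V st] unfolding E_def B_def K_def n_def q_def .
  also have "\<dots> \<le> ennreal K * (ennreal (real n powr p) * S)"
  proof (rule mult_left_mono)
    have "lpn p ?O (\<lambda>z. \<Sum>b\<in>Basis. \<bar>partial {#(b :: 'a, 0)#} V z\<bar>) \<le> ennreal (real n powr p) * (\<Sum>b\<in>Basis. lpn p ?O (\<lambda>z. \<bar>partial {#(b :: 'a, 0)#} V z\<bar>))"
      unfolding n_def
      by (rule lpn_sum[OF finite_Basis _ O])
        (use p in \<open>auto intro!: borel_imp_lebesgue_on borel_measurable_abs smooth_partial_borel V simp: tangential_in_Basis\<close>)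
    also have "(\<Sum>b\<in>Basis. lpn p ?O (\<lambda>z. \<bar>partial {#(b :: 'a, 0)#} V z\<bar>)) = (\<Sum>e\<in>(\<lambda>b. (b :: 'a, 0 :: real)) ` Basis. lpn p ?O (partial {#e#} V))"
      by (subst sum.reindex) (auto simp: inj_on_def lpn_def)
    also have "\<dots> \<le> S" unfolding S_def
      by (rule sum_mono2) (auto intro: tangential_in_Basis)
    finally show "lpn p ?O (\<lambda>z. \<Sum>b\<in>Basis. \<bar>partial {#(b :: 'a, 0)#} V z\<bar>) \<le> ennreal (real n powr p) * S"
      by (simp add: mult_left_mono)
  qed simp
  finally have 3: "(\<integral>\<^sup>+x. (\<integral>\<^sup>+h\<in>B. E x h \<partial>lborel) \<partial>lborel) \<le> ennreal K * (ennreal (real n powr p) * S)" .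
  have "(\<integral>\<^sup>+x. (\<integral>\<^sup>+h\<in>B. ennreal (\<bar>V (x + h, s) - V (x, s)\<bar> powr p / norm h powr q) \<partial>lborel) \<partial>lborel)
     \<le> ennreal (3 powr p) * (ennreal K' * S + (ennreal K * (ennreal (real n powr p) * S) + ennreal K' * S))"
    by (rule order_trans[OF 1]) (intro mult_left_mono add_mono 2 3 zero_le)
  also have "\<dots> = ennreal (3 powr p) * (ennreal K' + (ennreal K * ennreal (real n powr p) + ennreal K')) * S"
    by (simp only: distrib_right distrib_left mult.assoc)
  also have "ennreal (3 powr p) * (ennreal K' + (ennreal K * ennreal (real n powr p) + ennreal K')) = ennreal (gagliardo_const p n)"
  proof -
    have "ennreal (3 powr p) * (ennreal K' + (ennreal K * ennreal (real n powr p) + ennreal K')) = ennreal (3 powr p * (K' + (K * real n powr p + K')))"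
      using K K' by (simp only: ennreal_mult' ennreal_plus powr_ge_zero mult_nonneg_nonneg add_nonneg_nonneg)
    also have "3 powr p * (K' + (K * real n powr p + K')) = gagliardo_const p n"
      unfolding gagliardo_const_def K'_def K_def by (simp add: algebra_simps)
    finally show ?thesis .
  qed
  finally show ?thesis unfolding B_def S_def q_def n_def .
qed

lemma add_mset_multi_indices: "e \<in> Basis \<Longrightarrow> \<alpha> \<in> multi_indices k \<Longrightarrow> add_mset e \<alpha> \<in> multi_indices (Suc k)"
  by (simp add: multi_indices_def)

lemma L2_set_powr_le:
  assumes I: "finite I" and p: "0 \<le> p"
  shows "L2_set f I powr p \<le> real (card I) powr p * (\<Sum>i\<in>I. \<bar>f i\<bar> powr p)"
proof -
  have "L2_set f I powr p \<le> (\<Sum>i\<in>I. \<bar>f i\<bar>) powr p" by (intro powr_mono2 p L2_set_le_sum_abs) simp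
  also have "\<dots> \<le> real (card I) powr p * (\<Sum>i\<in>I. \<bar>f i\<bar> powr p)"
    using powr_sum_le[OF I p, of "\<lambda>i. \<bar>f i\<bar>"] by (simp add: sum_nonneg)
  finally show ?thesis .
qed

text \<open>\<open>gagliardo_smooth\<close> for each derivative of order k. The constant counts the
  losses: the p-th power of the cardinality for passing from the Euclidean norm to components, the
  cardinality for their number, and one more than the dimension of x for the first-order derivatives
  of each, which are components of the gradient of order k + 1.\<close>

lemma gagliardo_derivatives:
  fixes U :: "'a::euclidean_space \<times> real \<Rightarrow> real"
  assumes p: "1 < p" and b: "bm < bp" and U: "smooth_fun U" and s: "s \<in> {bm, bp}"
  shows "(\<integral>\<^sup>+x. (\<integral>\<^sup>+h\<in>ball 0 (bp - bm). ennreal (L2_set (\<lambda>\<alpha>. partial \<alpha> U (x + h, s) - partial \<alpha> U (x, s)) (multi_indices k) powr p / norm h powr (p + real DIM('a) - 1)) \<partial>lborel) \<partial>lborel)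
    \<le> ennreal (real (card (multi_indices k :: ('a \<times> real) multiset set)) powr p * (gagliardo_const p DIM('a) * (real (card (multi_indices k :: ('a \<times> real) multiset set)) * real (Suc DIM('a))))) *
      lpn p (UNIV \<times> {bm<..<bp}) (\<lambda>z. L2_set (\<lambda>\<alpha>. partial \<alpha> U z) (multi_indices (Suc k)))"
proof -
  define I where "I = (multi_indices k :: ('a \<times> real) multiset set)"
  have I: "finite I" by (simp add: I_def finite_multi_indices)
  have Ib: "set_mset \<alpha> \<subseteq> Basis" if "\<alpha> \<in> I" for \<alpha> using that unfolding I_def by (rule multi_indices_Basis)
  define q where "q = p + real DIM('a) - 1"
  define C where "C = gagliardo_const p DIM('a)"
  have C: "0 \<le> C" unfolding C_def by (rule gagliardo_const_nonneg[OF p])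
  define B where "B = ball (0 :: 'a) (bp - bm)"
  have Bm[measurable]: "B \<in> sets borel" by (simp add: B_def)
  let ?O = "UNIV \<times> {bm<..<bp} :: ('a \<times> real) set"
  define L where "L = lpn p ?O (\<lambda>z. L2_set (\<lambda>\<alpha>. partial \<alpha> U z) (multi_indices (Suc k)))"
  define A where "A \<alpha> x h = ennreal (\<bar>partial \<alpha> U (x + h, s) - partial \<alpha> U (x, s)\<bar> powr p / norm h powr q)" for \<alpha> and x h :: 'a
  have Am: "(\<lambda>(x, h). A \<alpha> x h) \<in> borel_measurable (borel \<Otimes>\<^sub>M borel)" if "\<alpha> \<in> I" for \<alpha>
  proof -
    have [measurable]: "partial \<alpha> U \<in> borel_measurable borel" by (rule smooth_partial_borel[OF U Ib[OF that]])
    show ?thesis unfolding A_def by measurable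
  qed
  have Ax: "(\<lambda>h. A \<alpha> x h * indicator B h) \<in> borel_measurable borel" if "\<alpha> \<in> I" for \<alpha> x
  proof -
    note [measurable] = Am[OF that]
    show ?thesis by measurable
  qed
  have Ai: "(\<lambda>x. \<integral>\<^sup>+h\<in>B. A \<alpha> x h \<partial>lborel) \<in> borel_measurable borel" if "\<alpha> \<in> I" for \<alpha>
  proof -
    note [measurable] = Am[OF that]
    show ?thesis by measurable
  qed
  have comp: "(\<integral>\<^sup>+x. (\<integral>\<^sup>+h\<in>B. A \<alpha> x h \<partial>lborel) \<partial>lborel) \<le> ennreal (C * real (Suc DIM('a))) * L" if \<alpha>: "\<alpha> \<in> I" for \<alpha>
  proof -
    have "(\<integral>\<^sup>+x. (\<integral>\<^sup>+h\<in>B. A \<alpha> x h \<partial>lborel) \<partial>lborel) \<le> ennreal C * (\<Sum>e\<in>Basis. lpn p ?O (partial {#e#} (partial \<alpha> U)))"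
      using gagliardo_smooth[OF p b smooth_fun_partial[OF U Ib[OF \<alpha>]] s] unfolding A_def B_def C_def q_def .
    also have "\<dots> \<le> ennreal C * (\<Sum>e\<in>(Basis :: ('a \<times> real) set). L)"
    proof (intro mult_left_mono sum_mono)
      fix e :: "'a \<times> real" assume e: "e \<in> Basis"
      have eq: "partial {#e#} (partial \<alpha> U) = partial (add_mset e \<alpha>) U"
        using partial_union[OF U _ Ib[OF \<alpha>], of "{#e#}"] e by simp
      show "lpn p ?O (partial {#e#} (partial \<alpha> U)) \<le> L"
        unfolding eq L_def
      proof (rule lpn_mono)
        fix z :: "'a \<times> real"
        have "\<bar>partial (add_mset e \<alpha>) U z\<bar> \<le> L2_set (\<lambda>\<alpha>. \<bar>partial \<alpha> U z\<bar>) (multi_indices (Suc k))"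
          by (rule member_le_L2_set[OF finite_multi_indices add_mset_multi_indices[OF e]]) (use \<alpha> in \<open>simp add: I_def\<close>)
        also have "\<dots> = L2_set (\<lambda>\<alpha>. partial \<alpha> U z) (multi_indices (Suc k))" by (simp add: L2_set_def)
        finally show "\<bar>partial (add_mset e \<alpha>) U z\<bar> \<le> \<bar>L2_set (\<lambda>\<alpha>. partial \<alpha> U z) (multi_indices (Suc k))\<bar>" by simp
      qed (use p in simp)
    qed simp
    also have "\<dots> = ennreal (C * real (Suc DIM('a))) * L"
      using C by (simp add: ennreal_mult' mult.assoc ennreal_of_nat_eq_real_of_nat del: of_nat_Suc)
    finally show ?thesis .
  qed
  have "(\<integral>\<^sup>+x. (\<integral>\<^sup>+h\<in>B. ennreal (L2_set (\<lambda>\<alpha>. partial \<alpha> U (x + h, s) - partial \<alpha> U (x, s)) I powr p / norm h powr q) \<partial>lborel) \<partial>lborel)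
     \<le> (\<integral>\<^sup>+x. (\<integral>\<^sup>+h. ennreal (real (card I) powr p) * (\<Sum>\<alpha>\<in>I. A \<alpha> x h * indicator B h) \<partial>lborel) \<partial>lborel)"
  proof (intro nn_integral_mono)
    fix x h :: 'a
    have "L2_set (\<lambda>\<alpha>. partial \<alpha> U (x + h, s) - partial \<alpha> U (x, s)) I powr p / norm h powr q
       \<le> real (card I) powr p * (\<Sum>\<alpha>\<in>I. \<bar>partial \<alpha> U (x + h, s) - partial \<alpha> U (x, s)\<bar> powr p) / norm h powr q"
      using p by (intro divide_right_mono L2_set_powr_le I) auto
    also have "\<dots> = real (card I) powr p * (\<Sum>\<alpha>\<in>I. \<bar>partial \<alpha> U (x + h, s) - partial \<alpha> U (x, s)\<bar> powr p / norm h powr q)"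
      by (simp only: sum_divide_distrib times_divide_eq_right[symmetric])
    finally have "ennreal (L2_set (\<lambda>\<alpha>. partial \<alpha> U (x + h, s) - partial \<alpha> U (x, s)) I powr p / norm h powr q)
       \<le> ennreal (real (card I) powr p * (\<Sum>\<alpha>\<in>I. \<bar>partial \<alpha> U (x + h, s) - partial \<alpha> U (x, s)\<bar> powr p / norm h powr q))"
      by (rule ennreal_leI)
    also have "\<dots> = ennreal (real (card I) powr p) * (\<Sum>\<alpha>\<in>I. A \<alpha> x h)"
      unfolding A_def by (simp add: ennreal_mult' sum_ennreal)
    finally have "ennreal (L2_set (\<lambda>\<alpha>. partial \<alpha> U (x + h, s) - partial \<alpha> U (x, s)) I powr p / norm h powr q) \<le> ennreal (real (card I) powr p) * (\<Sum>\<alpha>\<in>I. A \<alpha> x h)" .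
    then show "ennreal (L2_set (\<lambda>\<alpha>. partial \<alpha> U (x + h, s) - partial \<alpha> U (x, s)) I powr p / norm h powr q) * indicator B h
       \<le> ennreal (real (card I) powr p) * (\<Sum>\<alpha>\<in>I. A \<alpha> x h * indicator B h)"
      by (cases "h \<in> B") simp_all
  qed
  also have "\<dots> = (\<integral>\<^sup>+x. ennreal (real (card I) powr p) * (\<Sum>\<alpha>\<in>I. (\<integral>\<^sup>+h\<in>B. A \<alpha> x h \<partial>lborel)) \<partial>lborel)"
    using Ax by (intro nn_integral_cong) (simp add: nn_integral_cmult nn_integral_sum)
  also have "\<dots> = ennreal (real (card I) powr p) * (\<Sum>\<alpha>\<in>I. (\<integral>\<^sup>+x. (\<integral>\<^sup>+h\<in>B. A \<alpha> x h \<partial>lborel) \<partial>lborel))"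
    using Ai by (simp add: nn_integral_cmult nn_integral_sum)
  also have "\<dots> \<le> ennreal (real (card I) powr p) * (\<Sum>\<alpha>\<in>I. ennreal (C * real (Suc DIM('a))) * L)"
    by (intro mult_left_mono sum_mono comp zero_le)
  also have "\<dots> = ennreal (real (card I) powr p) * (ennreal (real (card I)) * (ennreal (C * real (Suc DIM('a))) * L))"
    by (simp add: ennreal_of_nat_eq_real_of_nat del: of_nat_Suc)
  also have "\<dots> = ennreal (real (card I) powr p * (C * (real (card I) * real (Suc DIM('a))))) * L"
  proof -
    have "real (card I) powr p * (C * (real (card I) * real (Suc DIM('a)))) = real (card I) powr p * (real (card I) * (C * real (Suc DIM('a))))"
      by (simp only: mult_ac)
    then show ?thesis using C by (simp only: ennreal_mult'[OF powr_ge_zero] ennreal_mult'[OF of_nat_0_le_iff] mult.assoc)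
  qed
  finally show ?thesis unfolding I_def[symmetric] B_def L_def q_def C_def .
qed

section \<open>Passage to the limit\<close>

text \<open>Fatou's lemma together with a bound along the sequence; only the lower limit of the
  energies \<open>E\<close> enters. Measurability is asked of the approximations alone, while G,
  which will contain integrals of chosen traces, is only compared with their lower limit.\<close>

lemma nn_integral_liminf_le:
  fixes F :: "nat \<Rightarrow> 'a \<Rightarrow> ennreal"
  assumes F: "\<And>k. F k \<in> borel_measurable M" and G: "AE x in M. G x \<le> liminf (\<lambda>k. F k x)"
    and le: "\<And>k. (\<integral>\<^sup>+x. F k x \<partial>M) \<le> ennreal c * E k" and E: "liminf E \<le> e"
  shows "(\<integral>\<^sup>+x. G x \<partial>M) \<le> ennreal c * e"
proof -
  have "(\<integral>\<^sup>+x. G x \<partial>M) \<le> (\<integral>\<^sup>+x. liminf (\<lambda>k. F k x) \<partial>M)" by (rule nn_integral_mono_AE[OF G])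
  also have "\<dots> \<le> liminf (\<lambda>k. \<integral>\<^sup>+x. F k x \<partial>M)" by (rule nn_integral_liminf[OF F])
  also have "\<dots> \<le> liminf (\<lambda>k. ennreal c * E k)" by (intro Liminf_mono always_eventually allI le)
  also have "\<dots> = ennreal c * liminf E"
    by (rule Liminf_compose_continuous_mono)
      (auto intro!: monoI mult_left_mono ennreal_continuous_on_cmult continuous_on_id simp: less_top)
  also have "\<dots> \<le> ennreal c * e" by (intro mult_left_mono E) simp
  finally show ?thesis .
qed

text \<open>With x fixed, this gives the convergence of the boundary values at x + h for almost
  every h.\<close>

lemma AE_lebesgue_translate:
  fixes P :: "'a::euclidean_space \<Rightarrow> bool"
  assumes "AE x in lebesgue. P x"
  shows "AE h in lebesgue. P (x + h)"
proof -
  obtain N where N: "{x. \<not> P x} \<subseteq> N" "N \<in> null_sets lebesgue" using assms by (auto elim: AE_E simp: null_sets_def)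
  then have "negligible ((\<lambda>y. - x + y) ` N)" by (intro negligible_translation) (simp add: negligible_iff_null_sets)
  then have nl: "(\<lambda>y. - x + y) ` N \<in> null_sets lebesgue" by (simp add: negligible_iff_null_sets)
  have "{h \<in> space lebesgue. \<not> P (x + h)} \<subseteq> (\<lambda>y. - x + y) ` N"
  proof
    fix h assume "h \<in> {h \<in> space lebesgue. \<not> P (x + h)}"
    then have "x + h \<in> N" using N(1) by auto
    moreover have "h = - x + (x + h)" by simp
    ultimately show "h \<in> (\<lambda>y. - x + y) ` N" by blast
  qed
  with nl show ?thesis by (rule AE_I')
qed

lemma L2_set_powr_tendsto:
  fixes f :: "'b \<Rightarrow> 'i \<Rightarrow> real"
  assumes "\<And>i. i \<in> I \<Longrightarrow> ((\<lambda>k. f k i) \<longlongrightarrow> g i) F" and p: "0 < p"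
  shows "((\<lambda>k. L2_set (f k) I powr p) \<longlongrightarrow> L2_set g I powr p) F"
proof (rule tendsto_powr')
  show "((\<lambda>k. L2_set (f k) I) \<longlongrightarrow> L2_set g I) F"
    unfolding L2_set_def by (intro tendsto_intros assms)
qed (use p in auto)

lemma L2_set_diff_le:
  assumes I: "finite I"
  shows "\<bar>L2_set f I - L2_set g I\<bar> \<le> (\<Sum>i\<in>I. \<bar>f i - g i\<bar>)"
proof -
  have *: "L2_set f I - L2_set g I \<le> (\<Sum>i\<in>I. \<bar>f i - g i\<bar>)" for f g
  proof -
    have "L2_set f I \<le> L2_set (\<lambda>i. f i - g i) I + L2_set g I"
      using L2_set_triangle_ineq[of "\<lambda>i. f i - g i" g I] by simp
    moreover have "L2_set (\<lambda>i. f i - g i) I \<le> (\<Sum>i\<in>I. \<bar>f i - g i\<bar>)" by (rule L2_set_le_sum_abs)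
    ultimately show ?thesis by simp
  qed
  show ?thesis using *[of f g] *[of g f] by (simp add: abs_minus_commute abs_le_iff)
qed

lemma lpn_sum_abs_tendsto_0:
  fixes f :: "nat \<Rightarrow> 'i \<Rightarrow> 'a::euclidean_space \<Rightarrow> real"
  assumes I: "finite I" and p: "0 \<le> p" and A: "A \<in> sets lebesgue"
    and m: "\<And>k i. i \<in> I \<Longrightarrow> f k i \<in> borel_measurable (lebesgue_on A)"
    and lim: "\<And>i. i \<in> I \<Longrightarrow> (\<lambda>k. lpn p A (f k i)) \<longlonglongrightarrow> 0"
  shows "(\<lambda>k. lpn p A (\<lambda>x. \<Sum>i\<in>I. \<bar>f k i x\<bar>)) \<longlonglongrightarrow> 0"
proof (rule tendsto_zero_ennreal_le)
  have "(\<lambda>k. \<Sum>i\<in>I. lpn p A (f k i)) \<longlonglongrightarrow> (\<Sum>i\<in>I. 0)" by (intro tendsto_sum lim)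
  then have "(\<lambda>k. ennreal (real (card I) powr p) * (\<Sum>i\<in>I. lpn p A (f k i))) \<longlonglongrightarrow> ennreal (real (card I) powr p) * (\<Sum>i\<in>I. 0)"
    by (intro ennreal_tendsto_cmult) auto
  then show "(\<lambda>k. ennreal (real (card I) powr p) * (\<Sum>i\<in>I. lpn p A (f k i))) \<longlonglongrightarrow> 0" by simp
next
  fix k
  have "lpn p A (\<lambda>x. \<Sum>i\<in>I. \<bar>f k i x\<bar>) \<le> ennreal (real (card I) powr p) * (\<Sum>i\<in>I. lpn p A (\<lambda>x. \<bar>f k i x\<bar>))"
    by (rule lpn_sum[OF I p A]) (intro borel_measurable_abs m)
  also have "\<dots> = ennreal (real (card I) powr p) * (\<Sum>i\<in>I. lpn p A (f k i))" by (simp add: lpn_def)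
  finally show "lpn p A (\<lambda>x. \<Sum>i\<in>I. \<bar>f k i x\<bar>) \<le> ennreal (real (card I) powr p) * (\<Sum>i\<in>I. lpn p A (f k i))" .
qed

text \<open>There are finitely many pairs of a boundary plane and a multi-index of order below m. So
  the sum \<open>h\<close> of all their errors still tends to 0 locally in L^p, and one subsequence
  serves them all. The energies are compared without loss by \<open>lpn_liminf_le\<close>.\<close>

lemma trace_approximation_AE:
  fixes u :: "(real ^ 'n) \<times> real \<Rightarrow> real"
  assumes b: "bm < bp" and p: "1 < p" and u: "u \<in> homogeneous_sobolev m p (strip bm bp)" and m: "1 \<le> m"
  shows "\<exists>U. (\<forall>k. smooth_fun (U k)) \<and>
    liminf (\<lambda>k. lpn p (strip bm bp) (\<lambda>x. L2_set (\<lambda>\<alpha>. partial \<alpha> (U k) x) (multi_indices m))) \<le> gradient_energy m p (strip bm bp) u \<and>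
    (\<forall>s\<in>{bm, bp}. \<forall>j\<le>m - 1. \<forall>\<alpha>\<in>multi_indices j.
       AE x' in lebesgue. (\<lambda>k. partial \<alpha> (U k) (x', s)) \<longlonglongrightarrow> boundary_trace p bm bp s (weak_deriv (strip bm bp) \<alpha> u) x') \<and>
    (\<forall>s\<in>{bm, bp}. \<forall>i j. i + j \<le> m - 1 \<longrightarrow> (\<forall>\<beta>\<in>multi_indices i.
       AE x' in lebesgue. tangential_trace p bm bp s \<beta> j u x' = boundary_trace p bm bp s (weak_deriv (strip bm bp) (full_index \<beta> j) u) x'))"
proof -
  let ?O = "strip bm bp :: ((real ^ 'n) \<times> real) set"
  let ?D = "\<lambda>\<alpha>. weak_deriv ?O \<alpha> u"
  let ?t = "\<lambda>s \<alpha>. boundary_trace p bm bp s (?D \<alpha>)"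
  obtain U where U: "\<And>k. smooth_fun (U k)"
    and D: "\<And>\<alpha>. \<alpha> \<in> multi_indices m \<Longrightarrow> ?D \<alpha> \<in> borel_measurable (lebesgue_on ?O)"
      "\<And>\<alpha>. \<alpha> \<in> multi_indices m \<Longrightarrow> (\<lambda>k. lpn p ?O (\<lambda>x. partial \<alpha> (U k) x - ?D \<alpha> x)) \<longlonglongrightarrow> 0"
    and t: "\<And>s j \<alpha>. s \<in> {bm, bp} \<Longrightarrow> j \<le> m - 1 \<Longrightarrow> \<alpha> \<in> multi_indices j \<Longrightarrow> ?t s \<alpha> \<in> borel_measurable lebesgue"
      "\<And>s j \<alpha> R. s \<in> {bm, bp} \<Longrightarrow> j \<le> m - 1 \<Longrightarrow> \<alpha> \<in> multi_indices j \<Longrightarrow> 0 < R \<Longrightarrow>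
        (\<lambda>k. lpn p (ball 0 R) (\<lambda>x'. partial \<alpha> (U k) (x', s) - ?t s \<alpha> x')) \<longlonglongrightarrow> 0"
    and tt: "\<forall>s\<in>{bm, bp}. \<forall>i j. i + j \<le> m - 1 \<longrightarrow> (\<forall>\<beta>\<in>multi_indices i.
       AE x' in lebesgue. tangential_trace p bm bp s \<beta> j u x' = ?t s (full_index \<beta> j) x')"
    using trace_approximation[OF b p u m] by blast
  define P where "P = {bm, bp} \<times> (\<Union>j\<in>{..m - 1}. multi_indices j :: ((real ^ 'n) \<times> real) multiset set)"
  have P: "finite P" unfolding P_def by (intro finite_cartesian_product finite_UN_I finite_multi_indices) auto
  define f where "f k i x' = partial (snd i) (U k) (x', fst i) - ?t (fst i) (snd i) x'" for k i x'
  have fm: "f k i \<in> borel_measurable lebesgue" if i: "i \<in> P" for k i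
  proof -
    obtain j where j: "fst i \<in> {bm, bp}" "j \<le> m - 1" "snd i \<in> multi_indices j" using i by (auto simp: P_def)
    have "(\<lambda>x'. partial (snd i) (U k) (x', fst i)) \<in> borel_measurable borel"
      by (intro borel_measurable_continuous_onI vertical_continuous(2) smooth_fun_partial U multi_indices_Basis[OF j(3)])
    then have "(\<lambda>x'. partial (snd i) (U k) (x', fst i)) \<in> borel_measurable lebesgue" by (intro measurable_completion) simp
    then show ?thesis unfolding f_def by (intro borel_measurable_diff t(1)[OF j])
  qed
  define h where "h k x' = (\<Sum>i\<in>P. \<bar>f k i x'\<bar>)" for k x'
  have "\<exists>r :: nat \<Rightarrow> nat. strict_mono r \<and> (AE x in lebesgue. x \<in> (\<Union>j. ball 0 (real j + 1)) \<longrightarrow> (\<lambda>k. h (r k) x) \<longlonglongrightarrow> 0)"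
  proof (rule lpn_AE_subseq[where p = p])
    show "0 < p" using p by simp
    show "incseq (\<lambda>j. ball (0 :: real ^ 'n) (real j + 1))" by (auto simp: incseq_def)
    show "h k \<in> borel_measurable lebesgue" for k
      unfolding h_def by (intro borel_measurable_sum borel_measurable_abs fm)
    show bl: "ball (0 :: real ^ 'n) (real j + 1) \<in> sets lebesgue" for j by (rule sets_completionI_sets) simp
    show "(\<lambda>k. lpn p (ball 0 (real j + 1)) (h k)) \<longlonglongrightarrow> 0" for j
      unfolding h_def
    proof (rule lpn_sum_abs_tendsto_0[OF P _ bl])
      fix i assume i: "i \<in> P"
      show "f k i \<in> borel_measurable (lebesgue_on (ball 0 (real j + 1)))" for k
        by (intro measurable_restrict_space1 fm i)
      obtain j' where j': "fst i \<in> {bm, bp}" "j' \<le> m - 1" "snd i \<in> multi_indices j'" using i by (auto simp: P_def)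
      show "(\<lambda>k. lpn p (ball 0 (real j + 1)) (f k i)) \<longlonglongrightarrow> 0"
        unfolding f_def by (rule t(2)[OF j']) simp
    qed (use p in simp)
  qed
  then obtain r :: "nat \<Rightarrow> nat" where r: "strict_mono r"
    and ae: "AE x in lebesgue. x \<in> (\<Union>j. ball 0 (real j + 1)) \<longrightarrow> (\<lambda>k. h (r k) x) \<longlonglongrightarrow> 0" by blast
  have all: "x \<in> (\<Union>j. ball 0 (real j + 1))" for x :: "real ^ 'n"
  proof -
    obtain j :: nat where "norm x < real j" using reals_Archimedean2 by blast
    then have "x \<in> ball 0 (real j + 1)" by simp
    then show ?thesis by blast
  qed
  have conv: "AE x' in lebesgue. (\<lambda>k. partial \<alpha> (U (r k)) (x', s)) \<longlonglongrightarrow> ?t s \<alpha> x'"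
    if s: "s \<in> {bm, bp}" and j: "j \<le> m - 1" and \<alpha>: "\<alpha> \<in> multi_indices j" for s j \<alpha>
    using ae
  proof eventually_elim
    case (elim x')
    have i: "(s, \<alpha>) \<in> P" using s j \<alpha> by (auto simp: P_def)
    have "(\<lambda>k. h (r k) x') \<longlonglongrightarrow> 0" using elim all by blast
    then have "(\<lambda>k. f (r k) (s, \<alpha>) x') \<longlonglongrightarrow> 0"
    proof (rule Lim_null_comparison[rotated])
      show "\<forall>\<^sub>F k in sequentially. norm (f (r k) (s, \<alpha>) x') \<le> h (r k) x'"
        unfolding h_def real_norm_def by (intro always_eventually allI member_le_sum i P) auto
    qed
    then show ?case unfolding f_def by (simp add: LIM_zero_iff)
  qed
  have en: "liminf (\<lambda>k. lpn p ?O (\<lambda>x. L2_set (\<lambda>\<alpha>. partial \<alpha> (U (r k)) x) (multi_indices m))) \<le> gradient_energy m p ?O u"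
    unfolding gradient_energy_lpn
  proof (rule lpn_liminf_le)
    have Um: "partial \<alpha> (U k) \<in> borel_measurable (lebesgue_on ?O)" if "\<alpha> \<in> multi_indices m" for \<alpha> k
      by (intro borel_imp_lebesgue_on smooth_partial_borel U multi_indices_Basis[OF that])
    show "(\<lambda>x. L2_set (\<lambda>\<alpha>. partial \<alpha> (U (r k)) x) (multi_indices m)) \<in> borel_measurable (lebesgue_on ?O)" for k
      by (intro L2_set_borel Um)
    show "(\<lambda>x. L2_set (\<lambda>\<alpha>. ?D \<alpha> x) (multi_indices m)) \<in> borel_measurable (lebesgue_on ?O)"
      by (intro L2_set_borel D(1))
    show "(\<lambda>k. lpn p ?O (\<lambda>x. L2_set (\<lambda>\<alpha>. partial \<alpha> (U (r k)) x) (multi_indices m) - L2_set (\<lambda>\<alpha>. ?D \<alpha> x) (multi_indices m))) \<longlonglongrightarrow> 0"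
    proof (rule tendsto_zero_ennreal_le)
      show "(\<lambda>k. lpn p ?O (\<lambda>x. \<Sum>\<alpha>\<in>multi_indices m. \<bar>partial \<alpha> (U (r k)) x - ?D \<alpha> x\<bar>)) \<longlonglongrightarrow> 0"
      proof (rule lpn_sum_abs_tendsto_0[OF finite_multi_indices])
        fix \<alpha> assume \<alpha>: "\<alpha> \<in> (multi_indices m :: ((real ^ 'n) \<times> real) multiset set)"
        show "(\<lambda>x. partial \<alpha> (U (r k)) x - ?D \<alpha> x) \<in> borel_measurable (lebesgue_on ?O)" for k
          by (intro borel_measurable_diff Um D(1) \<alpha>)
        show "(\<lambda>k. lpn p ?O (\<lambda>x. partial \<alpha> (U (r k)) x - ?D \<alpha> x)) \<longlonglongrightarrow> 0"
          using LIMSEQ_subseq_LIMSEQ[OF D(2)[OF \<alpha>] r] by (simp add: o_def)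
      qed (use p in \<open>auto intro: strip_sets\<close>)
      fix k
      show "lpn p ?O (\<lambda>x. L2_set (\<lambda>\<alpha>. partial \<alpha> (U (r k)) x) (multi_indices m) - L2_set (\<lambda>\<alpha>. ?D \<alpha> x) (multi_indices m))
         \<le> lpn p ?O (\<lambda>x. \<Sum>\<alpha>\<in>multi_indices m. \<bar>partial \<alpha> (U (r k)) x - ?D \<alpha> x\<bar>)"
        using p by (intro lpn_mono) (auto intro!: order_trans[OF L2_set_diff_le[OF finite_multi_indices]])
    qed
  qed (use p in \<open>auto intro: strip_sets\<close>)
  show ?thesis
    by (rule exI[of _ "\<lambda>k. U (r k)"]) (intro conjI allI U en tt ballI impI conv)
qed

lemma taylor_trace_bound:
  fixes u :: "(real ^ 'n) \<times> real \<Rightarrow> real"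
  assumes b: "bm < bp" and p: "1 < p" and u: "u \<in> homogeneous_sobolev m p (strip bm bp)" and m: "1 \<le> m"
    and il: "i + l \<le> m - 1"
  shows "(\<integral>\<^sup>+x'. ennreal (L2_set (\<lambda>\<beta>. \<Sum>k = 0..m - l - i - 1.
            (- 1) ^ k / fact k *
            (tangential_trace p bm bp bp \<beta> (k + l) u x' +
             (- 1) ^ (k + 1) * tangential_trace p bm bp bm \<beta> (k + l) u x') *
            ((bp - bm) / 2) ^ k) (multi_indices i) powr p) \<partial>lebesgue)
      \<le> ennreal ((bp - bm) powr (real (m - i - l) * p - 1)) * gradient_energy m p (strip bm bp) u"
proof -
  let ?t = "\<lambda>s \<alpha>. boundary_trace p bm bp s (weak_deriv (strip bm bp) \<alpha> u)"
  obtain U where U: "\<And>k. smooth_fun (U k)"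
    and en: "liminf (\<lambda>k. lpn p (strip bm bp) (\<lambda>x. L2_set (\<lambda>\<alpha>. partial \<alpha> (U k) x) (multi_indices m))) \<le> gradient_energy m p (strip bm bp) u"
    and conv: "\<And>s j \<alpha>. s \<in> {bm, bp} \<Longrightarrow> j \<le> m - 1 \<Longrightarrow> \<alpha> \<in> multi_indices j \<Longrightarrow> AE x' in lebesgue. (\<lambda>k. partial \<alpha> (U k) (x', s)) \<longlonglongrightarrow> ?t s \<alpha> x'"
    and tt: "\<And>s i j \<beta>. s \<in> {bm, bp} \<Longrightarrow> i + j \<le> m - 1 \<Longrightarrow> \<beta> \<in> multi_indices i \<Longrightarrow>
       AE x' in lebesgue. tangential_trace p bm bp s \<beta> j u x' = ?t s (full_index \<beta> j) x'"
    using trace_approximation_AE[OF b p u m] by blast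
  define I where "I = (multi_indices i :: (real ^ 'n) multiset set)"
  \<comment> \<open>The alternating sum as a function of an array of boundary values, so that the
    smooth approximations and the traces are inserted into the same expression.\<close>
  define T where "T a \<beta> = (\<Sum>k = 0..m - l - i - 1. (- 1) ^ k / fact k *
            (a bp \<beta> (k + l) + (- 1) ^ (k + 1) * a bm \<beta> (k + l)) * ((bp - bm) / 2) ^ k)"
    for a :: "real \<Rightarrow> (real ^ 'n) multiset \<Rightarrow> nat \<Rightarrow> real" and \<beta>
  define F where "F n x' = ennreal (L2_set (T (\<lambda>s \<beta> j. partial (full_index \<beta> j) (U n) (x', s))) I powr p)" for n x'
  have ae: "AE x' in lebesgue. \<forall>s\<in>{bm, bp}. \<forall>\<beta>\<in>I. \<forall>k\<in>{0..m - l - i - 1}.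
      (\<lambda>n. partial (full_index \<beta> (k + l)) (U n) (x', s)) \<longlonglongrightarrow> tangential_trace p bm bp s \<beta> (k + l) u x'"
  proof (intro AE_finite_allI)
    fix s \<beta> k assume s: "s \<in> {bm, bp}" and \<beta>: "\<beta> \<in> I" and k: "k \<in> {0..m - l - i - 1}"
    have ik: "i + (k + l) \<le> m - 1" using k il by auto
    have mi: "full_index \<beta> (k + l) \<in> multi_indices (i + (k + l))" using \<beta> unfolding I_def by (rule full_index_multi_indices)
    have \<beta>': "\<beta> \<in> multi_indices i" using \<beta> by (simp add: I_def)
    show "AE x' in lebesgue. (\<lambda>n. partial (full_index \<beta> (k + l)) (U n) (x', s)) \<longlonglongrightarrow> tangential_trace p bm bp s \<beta> (k + l) u x'"
      using conv[OF s ik mi] tt[OF s ik \<beta>'] by eventually_elim simp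
  qed (auto simp: I_def finite_multi_indices)
  have "(\<integral>\<^sup>+x'. ennreal (L2_set (T (\<lambda>s \<beta> j. tangential_trace p bm bp s \<beta> j u x')) I powr p) \<partial>lebesgue)
     \<le> ennreal ((bp - bm) powr (real (m - i - l) * p - 1)) * gradient_energy m p (strip bm bp) u"
  proof (rule nn_integral_liminf_le[OF _ _ _ en])
    fix n
    have "(\<lambda>x'. partial (full_index \<beta> j) (U n) (x', s)) \<in> borel_measurable borel" if "\<beta> \<in> I" for \<beta> j s
      using that unfolding I_def
      by (intro borel_measurable_continuous_onI vertical_continuous(2) smooth_fun_partial U multi_indices_Basis[OF full_index_multi_indices])
    then have [measurable]: "(\<lambda>x'. L2_set (T (\<lambda>s \<beta> j. partial (full_index \<beta> j) (U n) (x', s))) I) \<in> borel_measurable borel"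
      unfolding T_def
      by (intro L2_set_borel borel_measurable_const borel_measurable_sum borel_measurable_times borel_measurable_add)
    have "F n \<in> borel_measurable borel" unfolding F_def by measurable
    then show "F n \<in> borel_measurable lebesgue" by (intro measurable_completion) simp
    show "(\<integral>\<^sup>+x'. F n x' \<partial>lebesgue) \<le> ennreal ((bp - bm) powr (real (m - i - l) * p - 1)) * lpn p (strip bm bp) (\<lambda>x. L2_set (\<lambda>\<alpha>. partial \<alpha> (U n) x) (multi_indices m))"
      using taylor_trace_estimate[OF p b U il m] unfolding F_def T_def I_def .
  next
    show "AE x' in lebesgue. ennreal (L2_set (T (\<lambda>s \<beta> j. tangential_trace p bm bp s \<beta> j u x')) I powr p) \<le> liminf (\<lambda>n. F n x')"
      using ae
    proof eventually_elim
      case (elim x')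
      have "(\<lambda>n. F n x') \<longlonglongrightarrow> ennreal (L2_set (T (\<lambda>s \<beta> j. tangential_trace p bm bp s \<beta> j u x')) I powr p)"
        unfolding F_def
      proof (intro tendsto_ennrealI L2_set_powr_tendsto)
        fix \<beta> assume \<beta>: "\<beta> \<in> I"
        show "(\<lambda>n. T (\<lambda>s \<beta> j. partial (full_index \<beta> j) (U n) (x', s)) \<beta>) \<longlonglongrightarrow> T (\<lambda>s \<beta> j. tangential_trace p bm bp s \<beta> j u x') \<beta>"
          unfolding T_def using elim \<beta> by (intro tendsto_sum tendsto_mult tendsto_add tendsto_const) auto
      qed (use p in simp)
      then show ?case by (simp add: lim_imp_Liminf)
    qed
  qed
  then show ?thesis unfolding T_def I_def .
qed

text \<open>Fatou's lemma is applied twice: in h' for almost every fixed x', and then in x'. For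
  such x' the approximations converge at x' and, by \<open>AE_lebesgue_translate\<close>, at x' + h'
  for almost every h'.\<close>

lemma gagliardo_trace_bound:
  fixes u :: "(real ^ 'n) \<times> real \<Rightarrow> real"
  assumes b: "bm < bp" and p: "1 < p" and u: "u \<in> homogeneous_sobolev m p (strip bm bp)" and m: "1 \<le> m" and s: "s \<in> {bm, bp}"
  defines "M \<equiv> real (card (multi_indices (m - 1) :: ((real ^ 'n) \<times> real) multiset set))"
  shows "(\<integral>\<^sup>+x'. (\<integral>\<^sup>+h'\<in>ball 0 (bp - bm). ennreal (
            L2_set (\<lambda>\<alpha>. boundary_trace p bm bp s (weak_deriv (strip bm bp) \<alpha> u) (x' + h') -
                         boundary_trace p bm bp s (weak_deriv (strip bm bp) \<alpha> u) x')
              (multi_indices (m - 1)) powr p /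
            norm h' powr (p + real (CARD('n) + 1) - 2)) \<partial>lebesgue) \<partial>lebesgue)
      \<le> ennreal (M powr p * (gagliardo_const p CARD('n) * (M * real (Suc CARD('n))))) * gradient_energy m p (strip bm bp) u"
proof -
  let ?t = "\<lambda>\<alpha>. boundary_trace p bm bp s (weak_deriv (strip bm bp) \<alpha> u)"
  obtain U where U: "\<And>k. smooth_fun (U k)"
    and en: "liminf (\<lambda>k. lpn p (strip bm bp) (\<lambda>x. L2_set (\<lambda>\<alpha>. partial \<alpha> (U k) x) (multi_indices m))) \<le> gradient_energy m p (strip bm bp) u"
    and conv: "\<And>j \<alpha>. j \<le> m - 1 \<Longrightarrow> \<alpha> \<in> multi_indices j \<Longrightarrow> AE x' in lebesgue. (\<lambda>k. partial \<alpha> (U k) (x', s)) \<longlonglongrightarrow> ?t \<alpha> x'"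
    using trace_approximation_AE[OF b p u m] s by blast
  define I where "I = (multi_indices (m - 1) :: ((real ^ 'n) \<times> real) multiset set)"
  define B where "B = ball (0 :: real ^ 'n) (bp - bm)"
  have Bm[measurable]: "B \<in> sets borel" by (simp add: B_def)
  define q where "q = p + real (CARD('n) + 1) - 2"
  \<comment> \<open>With n = N - 1 the exponent p + N - 2 is p + n - 1, the one in
    \<open>gagliardo_derivatives\<close>.\<close>
  have q: "q = p + real DIM(real ^ 'n) - 1" by (simp add: q_def)
  define Q where "Q n x' h' = ennreal (L2_set (\<lambda>\<alpha>. partial \<alpha> (U n) (x' + h', s) - partial \<alpha> (U n) (x', s)) I powr p / norm h' powr q)" for n and x' h' :: "real ^ 'n"
  have Qm: "(\<lambda>(x', h'). Q n x' h' * indicator B h') \<in> borel_measurable (borel \<Otimes>\<^sub>M borel)" for n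
  proof -
    have "(\<lambda>z. partial \<alpha> (U n) (fst z + snd z, s) - partial \<alpha> (U n) (fst z, s)) \<in> borel_measurable (borel \<Otimes>\<^sub>M borel)" if "\<alpha> \<in> I" for \<alpha>
    proof -
      have [measurable]: "partial \<alpha> (U n) \<in> borel_measurable borel"
        using that unfolding I_def by (intro smooth_partial_borel U multi_indices_Basis)
      show ?thesis by measurable
    qed
    then have [measurable]: "(\<lambda>z. L2_set (\<lambda>\<alpha>. partial \<alpha> (U n) (fst z + snd z, s) - partial \<alpha> (U n) (fst z, s)) I) \<in> borel_measurable (borel \<Otimes>\<^sub>M borel)"
      by (rule L2_set_borel)
    show ?thesis unfolding Q_def case_prod_beta' by measurable
  qed
  have Qh: "(\<lambda>h'. Q n x' h' * indicator B h') \<in> borel_measurable lebesgue" for n x'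
  proof -
    note [measurable] = Qm
    have "(\<lambda>h'. Q n x' h' * indicator B h') \<in> borel_measurable lborel" by measurable
    then show ?thesis by (rule measurable_completion)
  qed
  have Qi: "(\<integral>\<^sup>+h'\<in>B. Q n x' h' \<partial>lebesgue) = (\<integral>\<^sup>+h'\<in>B. Q n x' h' \<partial>lborel)" for n x'
    by (rule nn_integral_completion)
  have ae: "AE x' in lebesgue. \<forall>\<alpha>\<in>I. (\<lambda>n. partial \<alpha> (U n) (x', s)) \<longlonglongrightarrow> ?t \<alpha> x'"
    by (intro AE_finite_allI) (auto simp: I_def finite_multi_indices intro: conv)
  have "(\<integral>\<^sup>+x'. (\<integral>\<^sup>+h'\<in>B. ennreal (L2_set (\<lambda>\<alpha>. ?t \<alpha> (x' + h') - ?t \<alpha> x') I powr p / norm h' powr q) \<partial>lebesgue) \<partial>lebesgue)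
     \<le> ennreal (M powr p * (gagliardo_const p CARD('n) * (M * real (Suc CARD('n))))) * gradient_energy m p (strip bm bp) u"
  proof (rule nn_integral_liminf_le[OF _ _ _ en])
    fix n
    note [measurable] = Qm
    have "(\<lambda>x'. \<integral>\<^sup>+h'\<in>B. Q n x' h' \<partial>lborel) \<in> borel_measurable lborel" by measurable
    then show "(\<lambda>x'. \<integral>\<^sup>+h'\<in>B. Q n x' h' \<partial>lebesgue) \<in> borel_measurable lebesgue" unfolding Qi by (rule measurable_completion)
    have "(\<integral>\<^sup>+x'. (\<integral>\<^sup>+h'\<in>B. Q n x' h' \<partial>lebesgue) \<partial>lebesgue) = (\<integral>\<^sup>+x'. (\<integral>\<^sup>+h'\<in>B. Q n x' h' \<partial>lborel) \<partial>lborel)"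
      unfolding Qi by (rule nn_integral_completion)
    also have "\<dots> \<le> ennreal (M powr p * (gagliardo_const p CARD('n) * (M * real (Suc CARD('n))))) * lpn p (strip bm bp) (\<lambda>x. L2_set (\<lambda>\<alpha>. partial \<alpha> (U n) x) (multi_indices m))"
      using gagliardo_derivatives[OF p b U s, of n "m - 1"] m unfolding Q_def B_def I_def q M_def strip_def by simp
    finally show "(\<integral>\<^sup>+x'. (\<integral>\<^sup>+h'\<in>B. Q n x' h' \<partial>lebesgue) \<partial>lebesgue) \<le> \<dots>" .
  next
    show "AE x' in lebesgue. (\<integral>\<^sup>+h'\<in>B. ennreal (L2_set (\<lambda>\<alpha>. ?t \<alpha> (x' + h') - ?t \<alpha> x') I powr p / norm h' powr q) \<partial>lebesgue)
       \<le> liminf (\<lambda>n. \<integral>\<^sup>+h'\<in>B. Q n x' h' \<partial>lebesgue)"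
      using ae
    proof eventually_elim
      case (elim x')
      have "AE h' in lebesgue. ennreal (L2_set (\<lambda>\<alpha>. ?t \<alpha> (x' + h') - ?t \<alpha> x') I powr p / norm h' powr q) * indicator B h'
         \<le> liminf (\<lambda>n. Q n x' h' * indicator B h')"
        using AE_lebesgue_translate[OF ae, of x']
      proof eventually_elim
        case (elim h')
        have "(\<lambda>n. L2_set (\<lambda>\<alpha>. partial \<alpha> (U n) (x' + h', s) - partial \<alpha> (U n) (x', s)) I powr p) \<longlonglongrightarrow> L2_set (\<lambda>\<alpha>. ?t \<alpha> (x' + h') - ?t \<alpha> x') I powr p"
          using elim \<open>\<forall>\<alpha>\<in>I. (\<lambda>n. partial \<alpha> (U n) (x', s)) \<longlonglongrightarrow> ?t \<alpha> x'\<close> p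
          by (intro L2_set_powr_tendsto tendsto_diff) auto
        then have "(\<lambda>n. Q n x' h') \<longlonglongrightarrow> ennreal (L2_set (\<lambda>\<alpha>. ?t \<alpha> (x' + h') - ?t \<alpha> x') I powr p / norm h' powr q)"
          unfolding Q_def divide_inverse by (intro tendsto_ennrealI tendsto_mult tendsto_const)
        from lim_imp_Liminf[OF _ this] show ?case by (cases "h' \<in> B") simp_all
      qed
      then have "(\<integral>\<^sup>+h'\<in>B. ennreal (L2_set (\<lambda>\<alpha>. ?t \<alpha> (x' + h') - ?t \<alpha> x') I powr p / norm h' powr q) \<partial>lebesgue)
         \<le> (\<integral>\<^sup>+h'. liminf (\<lambda>n. Q n x' h' * indicator B h') \<partial>lebesgue)" by (rule nn_integral_mono_AE)
      also have "\<dots> \<le> liminf (\<lambda>n. \<integral>\<^sup>+h'\<in>B. Q n x' h' \<partial>lebesgue)" by (rule nn_integral_liminf[OF Qh])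
      finally show ?case .
    qed
  qed
  then show ?thesis unfolding B_def I_def q_def .
qed

theorem theorem4p2:
  fixes m :: nat and p :: real
  assumes "m \<ge> 2" and "1 < p"
  shows "\<exists>c>0. \<forall>bm bp :: real. \<forall>u :: (real ^ 'n) \<times> real \<Rightarrow> real.
    bm < bp \<longrightarrow> u \<in> homogeneous_sobolev m p (strip bm bp) \<longrightarrow>
    (\<forall>i l :: nat. i + l \<le> m - 1 \<longrightarrow>
      (\<integral>\<^sup>+x'. ennreal (L2_set (\<lambda>\<beta>. \<Sum>k = 0..m - l - i - 1.
            (- 1) ^ k / fact k *
            (tangential_trace p bm bp bp \<beta> (k + l) u x' +
             (- 1) ^ (k + 1) * tangential_trace p bm bp bm \<beta> (k + l) u x') *
            ((bp - bm) / 2) ^ k) (multi_indices i) powr p) \<partial>lebesgue)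
      \<le> ennreal ((bp - bm) powr (real (m - i - l) * p - 1)) *
         gradient_energy m p (strip bm bp) u) \<and>
    (\<forall>s\<in>{bm, bp}.
      (\<integral>\<^sup>+x'. (\<integral>\<^sup>+h'\<in>ball 0 (bp - bm). ennreal (
            L2_set (\<lambda>\<alpha>. boundary_trace p bm bp s (weak_deriv (strip bm bp) \<alpha> u) (x' + h') -
                         boundary_trace p bm bp s (weak_deriv (strip bm bp) \<alpha> u) x')
              (multi_indices (m - 1)) powr p /
            norm h' powr (p + real (CARD('n) + 1) - 2)) \<partial>lebesgue) \<partial>lebesgue)
      \<le> ennreal c * gradient_energy m p (strip bm bp) u)"
proof -
  have m: "1 \<le> m" using \<open>m \<ge> 2\<close> by simp
  define M where "M = real (card (multi_indices (m - 1) :: ((real ^ 'n) \<times> real) multiset set))"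
  define c where "c = M powr p * (gagliardo_const p CARD('n) * (M * real (Suc CARD('n))))"
  have c: "0 \<le> c" using gagliardo_const_nonneg[OF \<open>1 < p\<close>] by (simp add: c_def M_def)
  show ?thesis
  \<comment> \<open>Only \<open>0 \<le> c\<close> has been shown, whereas a positive constant is
    asked for.\<close>
  proof (intro exI[of _ "c + 1"] conjI allI impI ballI)
    show "0 < c + 1" using c by simp
  next
    fix bm bp :: real and u :: "(real ^ 'n) \<times> real \<Rightarrow> real" and i l :: nat
    assume "bm < bp" "u \<in> homogeneous_sobolev m p (strip bm bp)" "i + l \<le> m - 1"
    then show "(\<integral>\<^sup>+x'. ennreal (L2_set (\<lambda>\<beta>. \<Sum>k = 0..m - l - i - 1.
            (- 1) ^ k / fact k *
            (tangential_trace p bm bp bp \<beta> (k + l) u x' +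
             (- 1) ^ (k + 1) * tangential_trace p bm bp bm \<beta> (k + l) u x') *
            ((bp - bm) / 2) ^ k) (multi_indices i) powr p) \<partial>lebesgue)
      \<le> ennreal ((bp - bm) powr (real (m - i - l) * p - 1)) * gradient_energy m p (strip bm bp) u"
      using \<open>1 < p\<close> m by (intro taylor_trace_bound)
  next
    fix bm bp :: real and u :: "(real ^ 'n) \<times> real \<Rightarrow> real" and s :: real
    assume *: "bm < bp" "u \<in> homogeneous_sobolev m p (strip bm bp)" "s \<in> {bm, bp}"
    have "(\<integral>\<^sup>+x'. (\<integral>\<^sup>+h'\<in>ball 0 (bp - bm). ennreal (
            L2_set (\<lambda>\<alpha>. boundary_trace p bm bp s (weak_deriv (strip bm bp) \<alpha> u) (x' + h') -
                         boundary_trace p bm bp s (weak_deriv (strip bm bp) \<alpha> u) x')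
              (multi_indices (m - 1)) powr p /
            norm h' powr (p + real (CARD('n) + 1) - 2)) \<partial>lebesgue) \<partial>lebesgue)
      \<le> ennreal c * gradient_energy m p (strip bm bp) u"
      unfolding c_def M_def by (rule gagliardo_trace_bound[OF *(1) \<open>1 < p\<close> *(2) m *(3)])
    also have "\<dots> \<le> ennreal (c + 1) * gradient_energy m p (strip bm bp) u"
      by (intro mult_right_mono ennreal_leI) auto
    finally show "(\<integral>\<^sup>+x'. (\<integral>\<^sup>+h'\<in>ball 0 (bp - bm). ennreal (
            L2_set (\<lambda>\<alpha>. boundary_trace p bm bp s (weak_deriv (strip bm bp) \<alpha> u) (x' + h') -
                         boundary_trace p bm bp s (weak_deriv (strip bm bp) \<alpha> u) x')
              (multi_indices (m - 1)) powr p /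
            norm h' powr (p + real (CARD('n) + 1) - 2)) \<partial>lebesgue) \<partial>lebesgue)
      \<le> ennreal (c + 1) * gradient_energy m p (strip bm bp) u" .
  qed
qed

end
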